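(* Let $\Omega$, $\Phi$, $q$, $\mathcal{S}$, and the $\sigma$-dimensional weighted $\Phi$-Hausdorff measure $\lambda^\sigma_\Phi$ be as in the context. Let $\sigma > 0$. Then: 1. If $\sigma > n/q$, then $\lambda^\sigma_\Phi(\Omega) = 0$, and there are no Borel measures $\mu$ on $\Omega$ satisfying $\mathcal{S}(E) \geq c\,[\mu(E)]^s$ (for all Borel $E \subset \Omega$) nontrivially when $s = 1/\sigma$. 2. If $\sigma \leq n/q$, then there is a Borel measure $\mu$ on $\Omega$ satisfying $\mathcal{S}(E) \geq c\,[\mu(E)]^{s}$ (for all Borel $E \subset \Omega$) nontrivially with $s = 1/\sigma$ if and only if $\lambda^\sigma_\Phi(\Omega) > 0$. 3. If $\sigma = n/q$, then $\lambda^\sigma_\Phi$ is absolutely continuous with respect to Lebesgue measure, and for almost every $x \in \Omega$ its Radon-Nikodym derivative satisfies $$C^{-1} D(x) \leq \frac{d\lambda^{n/q}_\Phi}{dx}(x) \leq C\, D(x), \qquad D(x) := \inf_{T \in \mathrm{GL}(n,\mathbb{R})} \ \max_{|\alpha_1| + \cdots + |\alpha_k| = q} \frac{\left| (T^*\partial)_1^{\alpha_1} \cdots (T^*\partial)_k^{\alpha_k} \Phi(x,\ldots,x) \right|^{n/q}}{|\det T|}.$$ Moreover $$\mathcal{S}(E) \geq C^{-1} \left[ \lambda^{n/q}_\Phi(E) \right]^{q/n} \quad \text{and} \quad \left[ \lambda^{n/q}_\Phi(E) \right]^{q/n} \geq C^{-1} \|\mathcal{S}\|_{\mu,q/n} \left[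 \mu(E) \right]^{q/n}$$ for any Borel set $E \subset \Omega$ and any nonnegative Borel measure $\mu$ on $\Omega$ satisfying $\mathcal{S}(E') \geq c\,[\mu(E')]^{q/n}$ for all Borel $E' \subset \Omega$. (In other words, the measure $\lambda^{n/q}_\Phi$ itself satisfies such an inequality and is, up to a multiplicative constant, the largest such measure.) Here the constants $C \in (0,\infty)$ depend only on $(n,k,q,\deg\Phi)$.
   Context: $\Omega \subset \mathbb{R}^n$ is a domain (in particular an open set), and $k, m \ge 1$ are integers. $\Phi : \Omega^k \to \mathbb{R}^m$ is a polynomial in $(x_1,\ldots,x_k)$ which vanishes to order $q \geq 1$ on the diagonal $\Delta := \{(x_1,\ldots,x_k) \in \Omega^k : x_1 = \cdots = x_k\}$, meaning that all partial derivatives of $\Phi$ of order less than $q$ vanish identically on $\Delta$ and some partial derivative of order $q$ is nonzero at some point of $\Delta$. $|\cdot|$ denotes some fixed but arbitrary norm on $\mathbb{R}^m$. For $E \subset \Omega$, $\mathcal{S}(E) := \sup_{(x_1,\ldots,x_k) \in E^k} |\Phi(x_1,\ldots,x_k)|$. For $E \subset \Omega$ and $\sigma > 0$, $$\lambda^\sigma_\Phi(E) := \lim_{\delta \to 0^+} \inf \left\{ \sum_{i=1}^\infty c_i [\mathcal{S}(E_i)]^\sigma \ : \ \chi_E \leq \sum_{i=1}^\infty c_i \chi_{E_i}, \ c_i \geq 0 \text{ and } \mathrm{diam}(E_i) \leq \delta \text{ for all } i \right\},$$ the $E_i$ being subsets of $\Omega$; this is a metric outer measure, hence a measure on Borel sets.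 A nonnegative Borel measure $\mu$ on $\Omega$ satisfies $\mathcal{S}(E) \geq c\,[\mu(E)]^s$ nontrivially if $\mu$ is not the zero measure and the inequality holds for all Borel $E \subset \Omega$ with some constant $c > 0$ independent of $E$. $\|\mathcal{S}\|_{\mu,s}$ denotes the supremum of all $c \geq 0$ such that $\mathcal{S}(E) \geq c\,[\mu(E)]^s$ for all Borel $E \subset \Omega$. For $T \in \mathrm{GL}(n,\mathbb{R})$, $T^*\partial$ is the $n$-tuple of constant-coefficient differential operators $\left( \sum_{j=1}^n T_{j1} \partial_j, \ldots, \sum_{j=1}^n T_{jn}\partial_j \right)$, where $\partial_1,\ldots,\partial_n$ are the standard coordinate partial derivatives on $\mathbb{R}^n$; $\alpha_1,\ldots,\alpha_k$ are multiindices in $n$ variables, and the subscript $j$ in $(T^*\partial)_j^{\alpha}$ indicates that the derivatives are applied to the argument $x_j$ of $\Phi(x_1,\ldots,x_k)$; the result is then evaluated at $(x,\ldots,x)$. *)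

theory Defs
  imports "HOL-Analysis.Analysis"
begin

text \<open>The space of values \<open>\<real>\<^sup>m\<close> is \<open>topspace (Euclidean_space m)\<close>, that is, the functions
  \<open>nat \<Rightarrow> real\<close> vanishing from index \<open>m\<close> on. Its dimension is a number and not a type, so that it can be
  quantified inside a formula. Points of \<open>(\<real>\<^sup>n)\<^sup>k\<close> have type \<open>real ^ 'n ^ 'k\<close>, where \<open>x $ j\<close>
  is the \<open>j\<close>-th argument.\<close>

definition norm_on :: "nat \<Rightarrow> ((nat \<Rightarrow> real) \<Rightarrow> real) \<Rightarrow> bool" where
  "norm_on m N \<longleftrightarrow>
    (\<forall>v\<in>topspace (Euclidean_space m).
      0 \<le> N v \<and> (N v = 0 \<longleftrightarrow> v = (\<lambda>_. 0)) \<and>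
      (\<forall>a. N (\<lambda>i. a * v i) = \<bar>a\<bar> * N v) \<and>
      (\<forall>w\<in>topspace (Euclidean_space m). N (\<lambda>i. v i + w i) \<le> N v + N w))"

subsection \<open>Multiindices, polynomials and their degree\<close>

definition mi_order :: "('k::finite \<Rightarrow> 'n::finite \<Rightarrow> nat) \<Rightarrow> nat" where
  "mi_order \<alpha> = (\<Sum>j\<in>UNIV. \<Sum>l\<in>UNIV. \<alpha> j l)"

definition monomial :: "('k::finite \<Rightarrow> 'n::finite \<Rightarrow> nat) \<Rightarrow> real ^ 'n ^ 'k \<Rightarrow> real" where
  "monomial \<alpha> x = (\<Prod>j\<in>UNIV. \<Prod>l\<in>UNIV. (x $ j $ l) ^ \<alpha> j l)"

definition polynomial_map :: "nat \<Rightarrow> (real ^ 'n::finite ^ 'k::finite \<Rightarrow> nat \<Rightarrow> real) \<Rightarrow> bool" where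
  "polynomial_map m \<Phi> \<longleftrightarrow>
    range \<Phi> \<subseteq> topspace (Euclidean_space m) \<and> (\<forall>i<m. real_polynomial_function (\<lambda>x. \<Phi> x i))"

text \<open>The total degree in all coordinates jointly, the maximum over the components of \<open>\<Phi>\<close>.\<close>

definition map_degree :: "nat \<Rightarrow> (real ^ 'n::finite ^ 'k::finite \<Rightarrow> nat \<Rightarrow> real) \<Rightarrow> nat" where
  "map_degree m \<Phi> = (LEAST d. \<forall>i<m. \<exists>c. \<forall>x. \<Phi> x i = (\<Sum>\<alpha> | mi_order \<alpha> \<le> d. c \<alpha> * monomial \<alpha> x))"

lemma finite_mi_order_le: "finite {\<alpha> :: 'k::finite \<Rightarrow> 'n::finite \<Rightarrow> nat. mi_order \<alpha> \<le> d}"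
proof -
  have "\<alpha> j l \<le> d" if "mi_order \<alpha> \<le> d" for \<alpha> :: "'k \<Rightarrow> 'n \<Rightarrow> nat" and j l
  proof -
    have "\<alpha> j l \<le> (\<Sum>l\<in>UNIV. \<alpha> j l)"
      by (rule member_le_sum) auto
    also have "\<dots> \<le> mi_order \<alpha>"
      unfolding mi_order_def by (rule member_le_sum) auto
    finally show ?thesis
      using that by simp
  qed
  then have "{\<alpha> :: 'k \<Rightarrow> 'n \<Rightarrow> nat. mi_order \<alpha> \<le> d} \<subseteq> UNIV \<rightarrow>\<^sub>E (UNIV \<rightarrow>\<^sub>E {..d})"
    by (auto simp: PiE_def Pi_def)
  moreover have "finite ((UNIV :: 'k set) \<rightarrow>\<^sub>E ((UNIV :: 'n set) \<rightarrow>\<^sub>E {..d}))"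
    by (intro finite_PiE) simp_all
  ultimately show ?thesis
    by (rule finite_subset)
qed

subsection \<open>Partial derivatives\<close>

text \<open>The operators \<open>\<partial>\<^sub>l\<close> and \<open>(T\<^sup>*\<partial>)\<^sub>l\<close> acting on the argument \<open>x\<^sub>j\<close>.\<close>

definition pderiv_arg ::
  "'k \<Rightarrow> 'n \<Rightarrow> (real ^ 'n::finite ^ 'k::finite \<Rightarrow> nat \<Rightarrow> real) \<Rightarrow> real ^ 'n ^ 'k \<Rightarrow> nat \<Rightarrow> real" where
  "pderiv_arg j l F = (\<lambda>x i. deriv (\<lambda>t. F (x + t *\<^sub>R axis j (axis l 1)) i) 0)"

definition pullback_pderiv_arg ::
  "real ^ 'n ^ 'n \<Rightarrow> 'k \<Rightarrow> 'n \<Rightarrow> (real ^ 'n::finite ^ 'k::finite \<Rightarrow> nat \<Rightarrow> real)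
    \<Rightarrow> real ^ 'n ^ 'k \<Rightarrow> nat \<Rightarrow> real" where
  "pullback_pderiv_arg T j l F = (\<lambda>x i. \<Sum>p\<in>UNIV. T $ p $ l * pderiv_arg j p F x i)"

text \<open>The composition of all \<open>D j l ^^ \<alpha> j l\<close>. The operators are composed along an arbitrary enumeration
  of the pairs \<open>(j, l)\<close>; the order is irrelevant for polynomials, on which the operators
  above commute.\<close>

definition mixed_deriv ::
  "('k::finite \<Rightarrow> 'n::finite \<Rightarrow> 'f \<Rightarrow> 'f) \<Rightarrow> ('k \<Rightarrow> 'n \<Rightarrow> nat) \<Rightarrow> 'f \<Rightarrow> 'f" where
  "mixed_deriv D \<alpha> = foldr (\<lambda>(j, l). D j l ^^ \<alpha> j l) (SOME xs. distinct xs \<and> set xs = UNIV)"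

definition vanishes_to_order ::
  "nat \<Rightarrow> (real ^ 'n::finite ^ 'k::finite \<Rightarrow> nat \<Rightarrow> real) \<Rightarrow> (real ^ 'n) set \<Rightarrow> bool" where
  "vanishes_to_order q \<Phi> \<Omega> \<longleftrightarrow>
    (\<forall>\<alpha>. mi_order \<alpha> < q \<longrightarrow> (\<forall>x\<in>\<Omega>. mixed_deriv pderiv_arg \<alpha> \<Phi> (\<chi> j. x) = (\<lambda>_. 0))) \<and>
    (\<exists>\<alpha>. mi_order \<alpha> = q \<and> (\<exists>x\<in>\<Omega>. mixed_deriv pderiv_arg \<alpha> \<Phi> (\<chi> j. x) \<noteq> (\<lambda>_. 0)))"

subsection \<open>The set function and the weighted Hausdorff measure\<close>

text \<open>Real powers of extended nonnegative numbers, for exponents \<open>s > 0\<close> only.\<close>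

definition epowr :: "ennreal \<Rightarrow> real \<Rightarrow> ennreal" where
  "epowr x s = (if x = top then top else ennreal (enn2real x powr s))"

definition sup_on ::
  "((nat \<Rightarrow> real) \<Rightarrow> real) \<Rightarrow> (real ^ 'n::finite ^ 'k::finite \<Rightarrow> nat \<Rightarrow> real) \<Rightarrow> (real ^ 'n) set \<Rightarrow> ennreal"
  where "sup_on N \<Phi> E = (SUP x\<in>{x. \<forall>j. x $ j \<in> E}. ennreal (N (\<Phi> x)))"

text \<open>Boundedness is required separately because \<^const>\<open>diameter\<close> is unspecified on unbounded sets.\<close>

definition weighted_covers ::
  "(real ^ 'n::finite) set \<Rightarrow> real \<Rightarrow> (real ^ 'n) set \<Rightarrow> ((nat \<Rightarrow> real) \<times> (nat \<Rightarrow> (real ^ 'n) set)) set" where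
  "weighted_covers \<Omega> \<delta> A =
    {(c, E). (\<forall>i. 0 \<le> c i \<and> E i \<subseteq> \<Omega> \<and> bounded (E i) \<and> diameter (E i) \<le> \<delta>) \<and>
      (\<forall>x\<in>\<Omega>. indicator A x \<le> (\<Sum>i. ennreal (c i) * indicator (E i) x))}"

definition weighted_content ::
  "((nat \<Rightarrow> real) \<Rightarrow> real) \<Rightarrow> (real ^ 'n::finite ^ 'k::finite \<Rightarrow> nat \<Rightarrow> real) \<Rightarrow> (real ^ 'n) set \<Rightarrow> real
    \<Rightarrow> real \<Rightarrow> (real ^ 'n) set \<Rightarrow> ennreal" where
  "weighted_content N \<Phi> \<Omega> \<sigma> \<delta> A =
    (INF (c, E)\<in>weighted_covers \<Omega> \<delta> A. \<Sum>i. ennreal (c i) * epowr (sup_on N \<Phi> (E i)) \<sigma>)"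

definition weighted_Hausdorff ::
  "((nat \<Rightarrow> real) \<Rightarrow> real) \<Rightarrow> (real ^ 'n::finite ^ 'k::finite \<Rightarrow> nat \<Rightarrow> real) \<Rightarrow> (real ^ 'n) set \<Rightarrow> real
    \<Rightarrow> (real ^ 'n) set \<Rightarrow> ennreal" where
  "weighted_Hausdorff N \<Phi> \<Omega> \<sigma> A = Lim (at_right 0) (\<lambda>\<delta>. weighted_content N \<Phi> \<Omega> \<sigma> \<delta> A)"

lemma weighted_content_antimono:
  assumes "\<delta> \<le> \<delta>'"
  shows "weighted_content N \<Phi> \<Omega> \<sigma> \<delta>' A \<le> weighted_content N \<Phi> \<Omega> \<sigma> \<delta> A"
proof -
  have "weighted_covers \<Omega> \<delta> A \<subseteq> weighted_covers \<Omega> \<delta>' A"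
    unfolding weighted_covers_def using assms by (auto intro: order_trans)
  then show ?thesis
    unfolding weighted_content_def by (rule INF_superset_mono) simp
qed

lemma weighted_content_tendsto:
  "((\<lambda>\<delta>. weighted_content N \<Phi> \<Omega> \<sigma> \<delta> A) \<longlongrightarrow> weighted_Hausdorff N \<Phi> \<Omega> \<sigma> A) (at_right 0)"
  and weighted_Hausdorff_eq_SUP:
  "weighted_Hausdorff N \<Phi> \<Omega> \<sigma> A = (SUP \<delta>\<in>{0<..}. weighted_content N \<Phi> \<Omega> \<sigma> \<delta> A)"
proof -
  let ?f = "\<lambda>\<delta>. weighted_content N \<Phi> \<Omega> \<sigma> \<delta> A"
  have *: "(?f \<longlongrightarrow> (SUP \<delta>\<in>{0<..}. ?f \<delta>)) (at_right 0)"
  proof (rule order_tendstoI)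
    fix a assume "a < (SUP \<delta>\<in>{0<..}. ?f \<delta>)"
    then obtain d where d: "0 < d" "a < ?f d"
      by (auto simp: less_SUP_iff)
    have "a < ?f \<delta>" if "\<delta> < d" for \<delta>
      using d(2) weighted_content_antimono[of \<delta> d N \<Phi> \<Omega> \<sigma> A] that by (auto intro: less_le_trans)
    then show "\<forall>\<^sub>F \<delta> in at_right 0. a < ?f \<delta>"
      using d(1) by (auto simp: eventually_at_right)
  next
    fix a assume a: "(SUP \<delta>\<in>{0<..}. ?f \<delta>) < a"
    have "?f \<delta> < a" if "0 < \<delta>" for \<delta>
      using a that by (intro le_less_trans[OF SUP_upper a]) auto
    then show "\<forall>\<^sub>F \<delta> in at_right 0. ?f \<delta> < a"
      by (auto simp: eventually_at_filter)
  qed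
  show eq: "weighted_Hausdorff N \<Phi> \<Omega> \<sigma> A = (SUP \<delta>\<in>{0<..}. ?f \<delta>)"
    unfolding weighted_Hausdorff_def by (rule tendsto_Lim[OF _ *]) simp
  show "(?f \<longlongrightarrow> weighted_Hausdorff N \<Phi> \<Omega> \<sigma> A) (at_right 0)"
    using * unfolding eq .
qed

text \<open>Since \<^const>\<open>measure_of\<close> yields the zero measure when the given set function is not countably
  additive, this is meaningful only together with
  \<open>measure_space \<Omega> (sets (restrict_space borel \<Omega>)) (weighted_Hausdorff N \<Phi> \<Omega> \<sigma>)\<close>.\<close>

definition weighted_Hausdorff_measure ::
  "((nat \<Rightarrow> real) \<Rightarrow> real) \<Rightarrow> (real ^ 'n::finite ^ 'k::finite \<Rightarrow> nat \<Rightarrow> real) \<Rightarrow> (real ^ 'n) set \<Rightarrow> real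
    \<Rightarrow> (real ^ 'n) measure" where
  "weighted_Hausdorff_measure N \<Phi> \<Omega> \<sigma> =
    measure_of \<Omega> (sets (restrict_space borel \<Omega>)) (weighted_Hausdorff N \<Phi> \<Omega> \<sigma>)"

subsection \<open>The inequality for Borel measures\<close>

definition borel_measure_on :: "'a::topological_space set \<Rightarrow> 'a measure \<Rightarrow> bool" where
  "borel_measure_on \<Omega> \<mu> \<longleftrightarrow> sets \<mu> = sets (restrict_space borel \<Omega>)"

definition dominates ::
  "((real ^ 'n::finite) set \<Rightarrow> ennreal) \<Rightarrow> (real ^ 'n) set \<Rightarrow> (real ^ 'n) measure \<Rightarrow> real \<Rightarrow> real \<Rightarrow> bool" where
  "dominates S \<Omega> \<mu> s c \<longleftrightarrow>
    (\<forall>E\<in>sets (restrict_space borel \<Omega>). ennreal c * epowr (emeasure \<mu> E) s \<le> S E)"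

definition dominates_nontrivially ::
  "((real ^ 'n::finite) set \<Rightarrow> ennreal) \<Rightarrow> (real ^ 'n) set \<Rightarrow> (real ^ 'n) measure \<Rightarrow> real \<Rightarrow> bool" where
  "dominates_nontrivially S \<Omega> \<mu> s \<longleftrightarrow> emeasure \<mu> \<Omega> \<noteq> 0 \<and> (\<exists>c>0. dominates S \<Omega> \<mu> s c)"

definition best_constant ::
  "((real ^ 'n::finite) set \<Rightarrow> ennreal) \<Rightarrow> (real ^ 'n) set \<Rightarrow> (real ^ 'n) measure \<Rightarrow> real \<Rightarrow> ennreal" where
  "best_constant S \<Omega> \<mu> s = (SUP c\<in>{c. 0 \<le> c \<and> dominates S \<Omega> \<mu> s c}. ennreal c)"

subsection \<open>The density\<close>

definition density_bound ::
  "((nat \<Rightarrow> real) \<Rightarrow> real) \<Rightarrow> (real ^ 'n::finite ^ 'k::finite \<Rightarrow> nat \<Rightarrow> real) \<Rightarrow> nat \<Rightarrow> real ^ 'n \<Rightarrow> real" where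
  "density_bound N \<Phi> q x =
    (INF T\<in>{T :: real ^ 'n ^ 'n. invertible T}.
      Max ((\<lambda>\<alpha>. N (mixed_deriv (pullback_pderiv_arg T) \<alpha> \<Phi> (\<chi> j. x)) powr (real CARD('n) / real q)
                 / \<bar>det T\<bar>) ` {\<alpha>. mi_order \<alpha> = q}))"

end

theory Submission
  imports Defs
begin

text \<open>The critical exponent is \<open>n / q\<close> because \<open>\<Phi>\<close> vanishes to order \<open>q\<close> on the diagonal: on a small
parallelepiped with edge matrix \<open>s T\<close> the set function is at most a constant times \<open>s ^ q\<close>, by Taylor's
formula (\<open>taylor_bound\<close>), while the volume is \<open>s ^ n\<close> times \<open>\<bar>det T\<bar>\<close>. Covering by such parallelepipeds
shows that the Hausdorff measure vanishes above the critical exponent, and that at the critical exponent it is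
at most a constant times the density \<open>D\<close> integrated against Lebesgue measure (\<open>Hausdorff_le_of_cubes\<close>,
\<open>Hausdorff_zero_above_critical\<close>, \<open>Hausdorff_le_density\<close>); the infimum over \<open>T\<close> in the definition of \<open>D\<close> is the choice of the best
shape at each point.

Two facts link the Hausdorff measure to other measures. Any measure dominated by the set function lies below it
(\<open>dominates_le_Hausdorff\<close>, the mass distribution principle). Conversely, where the Hausdorff measure is positive there is a
nonzero dominated measure (\<open>Frostman_measure\<close>): the weighted covering number is a sublinear functional, which by
Hahn-Banach has a linear minorant of the same value at the function 1; this minorant is a finitely additive
content, and an outer measure constructed from it is the measure sought.

What remains is the lower bound at the critical exponent. By the mass distribution principle it suffices that the
measure with density \<open>D\<close> is dominated by the set function, that is,
\<open>\<integral>\<^sub>E D \<le> C S(E) ^ (n / q)\<close> with a constant that depends only on \<open>n\<close>, \<open>k\<close>, \<open>q\<close> and the degree (\<open>density_integral\<close>).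
The proof interpolates \<open>\<Phi>\<close> at finitely many points of \<open>E\<close>, with basis polynomials bounded on \<open>E\<close> by a constant
that depends only on the degree (\<open>interpolation_basis\<close>). Starting from these
polynomials it adjoins, \<open>q\<close> times, derivatives along the fields dual to the gradients of an \<open>n\<close>-tuple from the
family. If at each stage the tuple has maximal Jacobian at \<open>x\<close>, all new functions are bounded at \<open>x\<close> by 1,
and this controls every derivative of order \<open>q\<close> of \<open>\<Phi>\<close> on the diagonal in the
frame dual to the last tuple \<open>\<tau>\<close> (\<open>good_step\<close>, \<open>slots_replace_lower\<close>). Hence \<open>D(x)\<close> is at most a constant times
\<open>S(E) ^ (n / q) \<bar>J\<^sub>\<tau>(x)\<bar>\<close> (\<open>density_at_point\<close>). Only boundedly many tuples occur, each consists of rational functions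
of bounded degree with values in a bounded interval, and such a tuple takes almost every value a bounded
number of times, so that the integral of \<open>\<bar>J\<^sub>\<tau>\<bar>\<close> is bounded (\<open>rational_Jacobian_integral\<close>).\<close>

section \<open>The weighted Hausdorff measure is a Borel measure\<close>

lemma ennreal_less_add_pos: "x < top ==> 0 < e ==> x < x + ennreal e"
  by (cases x) (auto simp: ennreal_plus[symmetric] ennreal_less_iff simp del: ennreal_plus)

text \<open>Caratheodory's argument: the points of \<open>A\<close> outside \<open>C\<close> at distance at least \<open>1 / n\<close> from \<open>C\<close> exhaust
  \<open>A - C\<close>, and the mass of the layers between consecutive such sets is summable, because layers of equal parity are
  separated from each other.\<close>

lemma metric_outer_measure_split_closed:
  fixes f :: "'a::metric_space set => ennreal"
  assumes empty: "f {} = 0"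
    and mono: "!!A B. A \<subseteq> B ==> B \<subseteq> \<Omega> ==> f A \<le> f B"
    and csub: "!!A :: nat => 'a set. (!!i. A i \<subseteq> \<Omega>) ==> f (\<Union>i. A i) \<le> (\<Sum>i. f (A i))"
    and metric: "!!A B e. 0 < e ==> A \<subseteq> \<Omega> ==> B \<subseteq> \<Omega> ==> (!!x y. x \<in> A ==> y \<in> B ==> e \<le> dist x y)
        ==> f A + f B \<le> f (A \<union> B)"
    and "closed C" and A: "A \<subseteq> \<Omega>"
  shows "f (A \<inter> C) + f (A - C) \<le> f A"
proof (cases "C = {}")
  case True
  then show ?thesis by (simp add: empty)
next
  case ne: False
  have sub2: "f (X \<union> Y) \<le> f X + f Y" if "X \<subseteq> \<Omega>" "Y \<subseteq> \<Omega>" for X Y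
  proof -
    have "f (\<Union>i::nat. (%i. if i = 0 then X else if i = 1 then Y else {}) i)
      \<le> (\<Sum>i. f (if i = 0 then X else if i = 1 then Y else {}))"
      using that by (intro csub) auto
    moreover have "(\<Union>i::nat. (%i. if i = 0 then X else if i = 1 then Y else {}) i) = X \<union> Y"
      by (auto split: if_splits)
    moreover have "(\<Sum>i. f (if i = 0 then X else if i = 1 then Y else {}))
       = (\<Sum>i\<in>{0,1::nat}. f (if i = 0 then X else if i = 1 then Y else {}))"
      by (rule suminf_finite) (auto simp: empty)
    ultimately show ?thesis by simp
  qed
  define d where "d x = infdist x C" for x
  define R where "R m = {x \<in> A. inverse (real (m + 2)) \<le> d x \<and> d x < inverse (real (m + 1))}" for m
  define G where "G n = {x \<in> A. inverse (real (n + 1)) \<le> d x}" for n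
  have RA: "R m \<subseteq> A" "G m \<subseteq> A" for m by (auto simp: R_def G_def)
  have RO: "x \<in> R m ==> x \<in> \<Omega>" "x \<in> G m ==> x \<in> \<Omega>" for x m using RA A by blast+
  have dtri: "d x \<le> d y + dist x y" for x y
    unfolding d_def by (rule infdist_triangle)
  have odd: "(\<Sum>i<k. f (R (2 * i + c))) \<le> f (\<Union>i<k. R (2 * i + c))" for k c
  proof (induction k)
    case 0 then show ?case by (simp add: empty)
  next
    case (Suc k)
    have "f (\<Union>i<k. R (2 * i + c)) + f (R (2 * k + c)) \<le> f ((\<Union>i<k. R (2 * i + c)) \<union> R (2 * k + c))"
    proof (rule metric)
      show "0 < (if k > 0 then inverse (real (2 * k + c)) - inverse (real (2 * k + c + 1)) else 1)"
        by (simp add: less_imp_inverse_less)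
    next
      fix x y assume x: "x \<in> (\<Union>i<k. R (2 * i + c))" and y: "y \<in> R (2 * k + c)"
      from x obtain i where i: "i < k" "inverse (real (2 * i + c + 2)) \<le> d x" by (auto simp: R_def)
      have "inverse (real (2 * k + c)) \<le> inverse (real (2 * i + c + 2))"
        using i by (intro le_imp_inverse_le) auto
      moreover have "d y < inverse (real (2 * k + c + 1))" using y by (simp add: R_def)
      ultimately have "inverse (real (2 * k + c)) - inverse (real (2 * k + c + 1)) \<le> dist x y"
        using i(2) dtri[of x y] by linarith
      then show "(if k > 0 then inverse (real (2 * k + c)) - inverse (real (2 * k + c + 1)) else 1) \<le> dist x y"
        using i by auto
    qed (use RA(1) A in blast)+
    moreover have "(\<Union>i<Suc k. R (2 * i + c)) = (\<Union>i<k. R (2 * i + c)) \<union> R (2 * k + c)"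
      by (auto simp: less_Suc_eq)
    ultimately show ?case using Suc by (auto intro: order_trans[OF add_right_mono])
  qed
  have fin: "(\<Sum>m<n. f (R m)) \<le> f A + f A" for n
  proof -
    have "(\<Sum>m<n. f (R m)) \<le> (\<Sum>m<2*n. f (R m))"
      by (rule sum_mono2) auto
    also have "\<dots> = (\<Sum>i<n. f (R (2*i+0))) + (\<Sum>i<n. f (R (2*i+1)))"
      by (induction n) (auto simp: ac_simps)
    also have "\<dots> \<le> f A + f A"
      using A RA by (intro add_mono order_trans[OF odd] mono) auto
    finally show ?thesis .
  qed
  show ?thesis
  proof (rule ennreal_le_epsilon)
    fix e :: real assume top: "f A < top" and e: "0 < e"
    let ?S = "\<Sum>m. f (R m)"
    have "?S \<le> f A + f A"
      using fin by (intro suminf_le_const) auto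
    then have Sfin: "?S < top" using top by (auto intro: le_less_trans)
    have "(%n. (\<Sum>m<n. f (R m)) + ennreal e) \<longlonglongrightarrow> ?S + ennreal e"
      by (intro tendsto_add summable_LIMSEQ) auto
    moreover have "?S < ?S + ennreal e"
      by (rule ennreal_less_add_pos[OF Sfin e])
    ultimately have "\<forall>\<^sub>F n in sequentially. ?S < (\<Sum>m<n. f (R m)) + ennreal e"
      by (rule order_tendstoD)
    then obtain n where n: "?S < (\<Sum>m<n. f (R m)) + ennreal e"
      by (auto simp: eventually_sequentially)
    have S: "?S = (\<Sum>m. f (R (m + n))) + (\<Sum>m<n. f (R m))"
      by (rule suminf_offset) auto
    with n have tail: "(\<Sum>m. f (R (m + n))) \<le> ennreal e"
    proof -
      have "(\<Sum>m<n. f (R m)) < top" using top by (intro le_less_trans[OF fin]) simp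
      then show ?thesis
        using n unfolding S add.commute[of _ "\<Sum>m<n. f (R m)"]
        by (auto simp: ennreal_add_left_cancel_less)
    qed
    have "A - C \<subseteq> G n \<union> (\<Union>m. R (m + n))"
    proof
      fix x assume x: "x \<in> A - C"
      then have "0 < d x" using \<open>closed C\<close> ne by (auto simp: d_def infdist_pos_not_in_closed)
      show "x \<in> G n \<union> (\<Union>m. R (m + n))"
      proof (rule ccontr)
        assume "x \<notin> G n \<union> (\<Union>m. R (m + n))"
        then have 1: "d x < inverse (real (n + 1))" and
          2: "!!m. inverse (real (m + n + 2)) \<le> d x ==> \<not> d x < inverse (real (m + n + 1))"
          using x by (auto simp: G_def R_def)
        have small: "d x < inverse (real (m + n + 1))" for m
        proof (induction m)
          case (Suc m)
          then have "\<not> inverse (real (m + n + 2)) \<le> d x" using 2 by blast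
          then show ?case by simp
        qed (use 1 in simp)
        obtain m where "inverse (real (Suc m)) < d x"
          using reals_Archimedean[OF \<open>0 < d x\<close>] by auto
        moreover have "inverse (real (m + n + 1)) \<le> inverse (real (Suc m))"
          by (rule le_imp_inverse_le) auto
        ultimately show False using small[of m] by linarith
      qed
    qed
    then have "f (A - C) \<le> f (G n \<union> (\<Union>m. R (m + n)))"
      by (intro mono) (auto dest: RO)
    also have "\<dots> \<le> f (G n) + f (\<Union>m. R (m + n))"
      by (intro sub2) (auto dest: RO)
    also have "\<dots> \<le> f (G n) + ennreal e"
      using tail by (intro add_left_mono order_trans[OF csub]) (auto dest: RO)
    finally have "f (A \<inter> C) + f (A - C) \<le> f (A \<inter> C) + f (G n) + ennreal e"
      by (simp add: add.assoc add_left_mono)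
    also have "f (A \<inter> C) + f (G n) \<le> f (A \<inter> C \<union> G n)"
    proof (rule metric)
      show "inverse (real (n + 1)) \<le> dist x y" if "x \<in> A \<inter> C" "y \<in> G n" for x y
        using that dtri[of y x] by (auto simp: G_def d_def dist_commute)
    qed (use A RO in auto)
    also have "\<dots> \<le> f A" using RA A by (intro mono) auto
    finally show "f (A \<inter> C) + f (A - C) \<le> f A + ennreal e"
      by (simp add: add_right_mono)
  qed
qed

theorem metric_outer_measure_borel:
  fixes f :: "'a::metric_space set => ennreal"
  assumes empty: "f {} = 0"
    and mono: "!!A B. A \<subseteq> B ==> B \<subseteq> \<Omega> ==> f A \<le> f B"
    and csub: "!!A :: nat => 'a set. (!!i. A i \<subseteq> \<Omega>) ==> f (\<Union>i. A i) \<le> (\<Sum>i. f (A i))"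
    and metric: "!!A B e. 0 < e ==> A \<subseteq> \<Omega> ==> B \<subseteq> \<Omega> ==> (!!x y. x \<in> A ==> y \<in> B ==> e \<le> dist x y)
        ==> f A + f B \<le> f (A \<union> B)"
  shows "measure_space \<Omega> (sets (restrict_space borel \<Omega>)) f"
proof -
  interpret P: sigma_algebra \<Omega> "Pow \<Omega>" by (rule sigma_algebra_Pow)
  define L where "L = lambda_system \<Omega> (Pow \<Omega>) f"
  have oms: "outer_measure_space (Pow \<Omega>) f"
    unfolding outer_measure_space_def positive_def increasing_def countably_subadditive_def
    using empty mono csub by (auto simp: subset_eq)
  have ms: "measure_space \<Omega> L f"
    unfolding L_def by (rule P.caratheodory_lemma[OF oms])
  then interpret L: sigma_algebra \<Omega> L by (simp add: measure_space_def)
  have sub2: "f (X \<union> Y) \<le> f X + f Y" if "X \<subseteq> \<Omega>" "Y \<subseteq> \<Omega>" "X \<inter> Y = {}" for X Y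
    using P.countably_subadditive_subadditive[of f] oms that
    by (auto simp: outer_measure_space_def subadditive_def)
  have closed: "\<Omega> \<inter> C \<in> L" if "closed C" for C
    unfolding L_def P.lambda_system_eq
  proof (intro CollectI conjI ballI)
    fix x assume x: "x \<in> Pow \<Omega>"
    have *: "x \<inter> (\<Omega> \<inter> C) = x \<inter> C" "x - \<Omega> \<inter> C = x - C" using x by auto
    show "f (x \<inter> (\<Omega> \<inter> C)) + f (x - \<Omega> \<inter> C) = f x"
      unfolding *
    proof (rule antisym)
      show "f (x \<inter> C) + f (x - C) \<le> f x"
        by (rule metric_outer_measure_split_closed[where \<Omega> = \<Omega>]; (fact empty mono csub metric that)?)
          (use x in auto)
      have "f x = f (x \<inter> C \<union> (x - C))" by (simp add: Int_Diff_Un)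
      also have "\<dots> \<le> f (x \<inter> C) + f (x - C)" using x by (intro sub2) auto
      finally show "f x \<le> f (x \<inter> C) + f (x - C)" .
    qed
  qed auto
  have "\<Omega> \<inter> B \<in> L" if "B \<in> sets borel" for B
  proof -
    have "B \<in> sigma_sets UNIV (Collect closed)"
      using that by (simp add: borel_eq_closed)
    then show ?thesis
    proof induction
      case (Compl a)
      have "\<Omega> \<inter> (UNIV - a) = \<Omega> - \<Omega> \<inter> a" by auto
      then show ?case using Compl by (simp add: L.compl_sets)
    next
      case (Union a)
      have *: "\<Omega> \<inter> (\<Union>i. a i) = (\<Union>i. \<Omega> \<inter> a i)" by auto
      then show ?case unfolding * using Union by (intro L.countable_UN) auto
    qed (use closed in auto)
  qed
  then have sub: "sets (restrict_space borel \<Omega>) \<subseteq> L"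
    by (auto simp: sets_restrict_space)
  have "sigma_algebra \<Omega> (sets (restrict_space borel \<Omega>))"
    using sets.sigma_algebra_axioms[of "restrict_space borel \<Omega>"] by (simp add: space_restrict_space)
  then show ?thesis
    using ms sub unfolding measure_space_def positive_def countably_additive_def
    by (auto simp: subset_eq)
qed


lemma sup_on_empty [simp]: "sup_on N \<Phi> {} = 0"
  by (simp add: sup_on_def bot_ennreal)

lemma sup_on_mono: "A \<subseteq> B ==> sup_on N \<Phi> A \<le> sup_on N \<Phi> B"
  unfolding sup_on_def by (rule SUP_subset_mono) auto

lemma epowr_0 [simp]: "epowr 0 s = 0"
  by (simp add: epowr_def)

lemma epowr_top [simp]: "epowr top s = top"
  by (simp add: epowr_def)

lemma epowr_ennreal: "0 \<le> x ==> epowr (ennreal x) s = ennreal (x powr s)"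
  by (simp add: epowr_def)

lemma epowr_mono:
  assumes "x \<le> y" "0 \<le> s" shows "epowr x s \<le> epowr y s"
proof (cases "y = top")
  case False
  then have "x < top" "y < top" using assms by (auto simp: less_top top_unique)
  then show ?thesis
    using assms by (auto simp: epowr_def intro!: ennreal_leI powr_mono2 enn2real_mono)
qed simp

lemma epowr_epowr:
  assumes "s \<noteq> 0" shows "epowr (epowr x s) t = (epowr x (s * t))"
  by (cases x) (auto simp: epowr_ennreal powr_powr)

lemma epowr_1 [simp]: "epowr x 1 = x"
  by (cases x) (auto simp: epowr_ennreal)

lemma epowr_mult:
  assumes "0 \<le> a" "0 < s" shows "epowr (ennreal a * x) s = ennreal (a powr s) * epowr x s"
proof (cases x)
  case (real r)
  then show ?thesis using assms
    by (simp add: epowr_ennreal ennreal_mult'[symmetric] powr_mult)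
next
  case top
  then show ?thesis using assms by (cases "a = 0") (auto simp: ennreal_mult_top)
qed

lemma weighted_content_le:
  assumes "(c, E) \<in> weighted_covers \<Omega> \<delta> A"
  shows "weighted_content N \<Phi> \<Omega> \<sigma> \<delta> A \<le> (\<Sum>i. ennreal (c i) * epowr (sup_on N \<Phi> (E i)) \<sigma>)"
  unfolding weighted_content_def by (rule INF_lower2[OF assms]) simp

lemma weighted_content_empty:
  assumes "0 \<le> \<delta>" shows "weighted_content N \<Phi> \<Omega> \<sigma> \<delta> {} = 0"
proof -
  have "(%_. 0, %_. {}) \<in> weighted_covers \<Omega> \<delta> {}"
    using assms by (auto simp: weighted_covers_def)
  from weighted_content_le[OF this, of N \<Phi> \<sigma>] show ?thesis by simp
qed

lemma weighted_content_mono: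
  assumes "A \<subseteq> B"
  shows "weighted_content N \<Phi> \<Omega> \<sigma> \<delta> A \<le> weighted_content N \<Phi> \<Omega> \<sigma> \<delta> B"
  unfolding weighted_content_def
proof (rule INF_superset_mono)
  have "indicator A x \<le> (indicator B x :: ennreal)" for x
    using assms by (auto simp: indicator_def)
  then show "weighted_covers \<Omega> \<delta> B \<subseteq> weighted_covers \<Omega> \<delta> A"
    unfolding weighted_covers_def by (blast intro: order_trans)
qed simp

text \<open>Nearly optimal covers of the pieces are merged into one sequence by enumerating pairs of indices.\<close>

lemma weighted_content_countably_subadditive:
  "weighted_content N \<Phi> \<Omega> \<sigma> \<delta> (\<Union>n::nat. A n) \<le> (\<Sum>n. weighted_content N \<Phi> \<Omega> \<sigma> \<delta> (A n))"
proof (rule ennreal_le_epsilon)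
  fix e :: real
  assume top: "(\<Sum>n. weighted_content N \<Phi> \<Omega> \<sigma> \<delta> (A n)) < top" and e: "0 < e"
  have fin: "weighted_content N \<Phi> \<Omega> \<sigma> \<delta> (A n) < top" for n
    using top ennreal_suminf_lessD by blast
  have "\<forall>n. \<exists>p. p \<in> weighted_covers \<Omega> \<delta> (A n) \<and> (\<Sum>i. ennreal (fst p i) * epowr (sup_on N \<Phi> (snd p i)) \<sigma>)
      \<le> weighted_content N \<Phi> \<Omega> \<sigma> \<delta> (A n) + ennreal (e * (1/2) ^ Suc n)"
  proof
    fix n
    have "weighted_content N \<Phi> \<Omega> \<sigma> \<delta> (A n)
        < weighted_content N \<Phi> \<Omega> \<sigma> \<delta> (A n) + ennreal (e * (1/2) ^ Suc n)"
      using fin[of n] e by (intro ennreal_less_add_pos) auto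
    then obtain p where "p \<in> weighted_covers \<Omega> \<delta> (A n)"
      "(case p of (c, E) => \<Sum>i. ennreal (c i) * epowr (sup_on N \<Phi> (E i)) \<sigma>)
        < weighted_content N \<Phi> \<Omega> \<sigma> \<delta> (A n) + ennreal (e * (1/2) ^ Suc n)"
      by (subst (asm) (1) weighted_content_def) (auto simp only: INF_less_iff)
    then show "\<exists>p. p \<in> weighted_covers \<Omega> \<delta> (A n) \<and> (\<Sum>i. ennreal (fst p i) * epowr (sup_on N \<Phi> (snd p i)) \<sigma>)
      \<le> weighted_content N \<Phi> \<Omega> \<sigma> \<delta> (A n) + ennreal (e * (1/2) ^ Suc n)"
      by (intro exI[of _ p]) (auto intro: less_imp_le simp: case_prod_beta')
  qed
  from choice[OF this] obtain p where p: "!!n. p n \<in> weighted_covers \<Omega> \<delta> (A n)"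
    and le': "!!n. (\<Sum>i. ennreal (fst (p n) i) * epowr (sup_on N \<Phi> (snd (p n) i)) \<sigma>)
      \<le> weighted_content N \<Phi> \<Omega> \<sigma> \<delta> (A n) + ennreal (e * (1/2) ^ Suc n)"
    by blast
  define c where "c n = fst (p n)" for n
  define E where "E n = snd (p n)" for n
  have cE: "(c n, E n) \<in> weighted_covers \<Omega> \<delta> (A n)" for n
    using p[of n] by (simp add: c_def E_def)
  note le = le'[folded c_def E_def]
  define c' where "c' i = case_prod c (prod_decode i)" for i
  define E' where "E' i = case_prod E (prod_decode i)" for i
  have sums: "(\<Sum>i. ennreal (c' i) * g (E' i)) = (\<Sum>n. \<Sum>i. ennreal (c n i) * g (E n i))" for g :: "_ => ennreal"
    using suminf_ennreal_2dimen[of "%n. \<Sum>i. ennreal (c n i) * g (E n i)" "%(n, i). ennreal (c n i) * g (E n i)", OF prod.case[symmetric, THEN suminf_cong]]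
    unfolding c'_def E'_def comp_def case_prod_beta' by simp
  have "(c', E') \<in> weighted_covers \<Omega> \<delta> (\<Union>n. A n)"
    unfolding weighted_covers_def
  proof (clarsimp, intro conjI allI ballI)
    fix i
    have "(c n, E n) \<in> weighted_covers \<Omega> \<delta> (A n)" for n by (rule cE)
    then show "0 \<le> c' i" "E' i \<subseteq> \<Omega>" "bounded (E' i)" "diameter (E' i) \<le> \<delta>"
      by (auto simp: weighted_covers_def c'_def E'_def case_prod_beta')
  next
    fix x assume "x \<in> \<Omega>"
    have "indicator (\<Union>n. A n) x \<le> (\<Sum>n. \<Sum>i. ennreal (c n i) * indicator (E n i) x)"
    proof (cases "x \<in> (\<Union>n. A n)")
      case True
      then obtain n where "x \<in> A n" by auto
      then have "1 \<le> (\<Sum>i. ennreal (c n i) * indicator (E n i) x)"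
        using cE[of n] \<open>x \<in> \<Omega>\<close> by (auto simp: weighted_covers_def)
      also have "\<dots> = (\<Sum>n\<in>{n}. \<Sum>i. ennreal (c n i) * indicator (E n i) x)" by simp
      also have "\<dots> \<le> (\<Sum>n. \<Sum>i. ennreal (c n i) * indicator (E n i) x)"
        by (rule sum_le_suminf) auto
      finally show ?thesis using True by simp
    qed simp
    then show "indicator (\<Union>n. A n) x \<le> (\<Sum>i. ennreal (c' i) * indicator (E' i) x)"
      using sums[of "%E. indicator E x"] by simp
  qed
  from weighted_content_le[OF this, of N \<Phi> \<sigma>]
  have "weighted_content N \<Phi> \<Omega> \<sigma> \<delta> (\<Union>n. A n) \<le> (\<Sum>n. \<Sum>i. ennreal (c n i) * epowr (sup_on N \<Phi> (E n i)) \<sigma>)"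
    using sums[of "%E. epowr (sup_on N \<Phi> E) \<sigma>"] by simp
  also have "\<dots> \<le> (\<Sum>n. weighted_content N \<Phi> \<Omega> \<sigma> \<delta> (A n) + ennreal (e * (1/2) ^ Suc n))"
    by (intro suminf_le le) auto
  also have "\<dots> = (\<Sum>n. weighted_content N \<Phi> \<Omega> \<sigma> \<delta> (A n)) + (\<Sum>n. ennreal (e * (1/2) ^ Suc n))"
    by (rule suminf_add[symmetric]) auto
  also have "(\<Sum>n. ennreal (e * (1/2) ^ Suc n)) = ennreal e"
    using sums_mult[OF power_half_series, of e] e
    by (intro suminf_ennreal_eq) auto
  finally show "weighted_content N \<Phi> \<Omega> \<sigma> \<delta> (\<Union>n. A n)
    \<le> (\<Sum>n. weighted_content N \<Phi> \<Omega> \<sigma> \<delta> (A n)) + ennreal e" .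
qed

text \<open>A set of diameter at most \<open>\<delta>\<close> meets at most one of two sets at distance more than \<open>\<delta>\<close>, so
  every cover of the union splits into covers of the two parts.\<close>

lemma weighted_content_separated:
  assumes "\<delta> < e" "0 \<le> \<delta>" and sep: "!!x y. x \<in> A ==> y \<in> B ==> e \<le> dist x y"
  shows "weighted_content N \<Phi> \<Omega> \<sigma> \<delta> A + weighted_content N \<Phi> \<Omega> \<sigma> \<delta> B
    \<le> weighted_content N \<Phi> \<Omega> \<sigma> \<delta> (A \<union> B)"
  unfolding weighted_content_def[of _ _ _ _ _ "A \<union> B"]
proof (rule INF_greatest, clarify)
  fix c and E :: "nat => (real ^ 'a) set" assume cE: "(c, E) \<in> weighted_covers \<Omega> \<delta> (A \<union> B)"
  define r where "r X i = (if E i \<inter> X = {} then {} else E i)" for X i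
  have "(c, r X) \<in> weighted_covers \<Omega> \<delta> X" if "X \<subseteq> A \<union> B" for X
    unfolding weighted_covers_def
  proof (clarsimp, intro conjI allI ballI)
    fix i show "0 \<le> c i" "r X i \<subseteq> \<Omega>" "bounded (r X i)" "diameter (r X i) \<le> \<delta>"
      using cE assms(2) by (auto simp: weighted_covers_def r_def)
  next
    fix x assume "x \<in> \<Omega>"
    show "indicator X x \<le> (\<Sum>i. ennreal (c i) * indicator (r X i) x)"
    proof (cases "x \<in> X")
      case True
      then have "indicator (r X i) x = (indicator (E i) x :: ennreal)" for i
        by (auto simp: r_def indicator_def)
      then show ?thesis using cE \<open>x \<in> \<Omega>\<close> that True by (force simp: weighted_covers_def)
    qed simp
  qed
  then have "weighted_content N \<Phi> \<Omega> \<sigma> \<delta> A + weighted_content N \<Phi> \<Omega> \<sigma> \<delta> B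
    \<le> (\<Sum>i. ennreal (c i) * epowr (sup_on N \<Phi> (r A i)) \<sigma>) + (\<Sum>i. ennreal (c i) * epowr (sup_on N \<Phi> (r B i)) \<sigma>)"
    by (intro add_mono weighted_content_le) auto
  also have "\<dots> = (\<Sum>i. ennreal (c i) * epowr (sup_on N \<Phi> (r A i)) \<sigma> + ennreal (c i) * epowr (sup_on N \<Phi> (r B i)) \<sigma>)"
    by (rule suminf_add) auto
  also have "\<dots> \<le> (\<Sum>i. ennreal (c i) * epowr (sup_on N \<Phi> (E i)) \<sigma>)"
  proof (intro suminf_le allI)
    fix i
    have "E i \<inter> A = {} \<or> E i \<inter> B = {}"
    proof (rule ccontr)
      assume "\<not> ?thesis"
      then obtain x y where xy: "x \<in> E i" "x \<in> A" "y \<in> E i" "y \<in> B" by auto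
      have "bounded (E i)" "diameter (E i) \<le> \<delta>" using cE by (auto simp: weighted_covers_def)
      then have "dist x y \<le> \<delta>" using xy diameter_bounded_bound by fastforce
      with sep[of x y] xy \<open>\<delta> < e\<close> show False by simp
    qed
    then show "ennreal (c i) * epowr (sup_on N \<Phi> (r A i)) \<sigma> + ennreal (c i) * epowr (sup_on N \<Phi> (r B i)) \<sigma>
       \<le> ennreal (c i) * epowr (sup_on N \<Phi> (E i)) \<sigma>"
      by (auto simp: r_def)
  qed auto
  finally show "weighted_content N \<Phi> \<Omega> \<sigma> \<delta> A + weighted_content N \<Phi> \<Omega> \<sigma> \<delta> B
    \<le> (\<Sum>i. ennreal (c i) * epowr (sup_on N \<Phi> (E i)) \<sigma>)" .
qed

lemma weighted_content_le_Hausdorff: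
  "0 < \<delta> ==> weighted_content N \<Phi> \<Omega> \<sigma> \<delta> A \<le> weighted_Hausdorff N \<Phi> \<Omega> \<sigma> A"
  unfolding weighted_Hausdorff_eq_SUP by (rule SUP_upper) simp

lemma weighted_Hausdorff_leI:
  "(!!\<delta>. 0 < \<delta> ==> weighted_content N \<Phi> \<Omega> \<sigma> \<delta> A \<le> b) ==> weighted_Hausdorff N \<Phi> \<Omega> \<sigma> A \<le> b"
  unfolding weighted_Hausdorff_eq_SUP by (rule SUP_least) simp

lemma weighted_Hausdorff_empty: "weighted_Hausdorff N \<Phi> \<Omega> \<sigma> {} = 0"
  by (rule antisym[OF weighted_Hausdorff_leI]) (auto simp: weighted_content_empty)

lemma weighted_Hausdorff_mono:
  "A \<subseteq> B ==> weighted_Hausdorff N \<Phi> \<Omega> \<sigma> A \<le> weighted_Hausdorff N \<Phi> \<Omega> \<sigma> B"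
  by (intro weighted_Hausdorff_leI order_trans[OF weighted_content_mono weighted_content_le_Hausdorff])

lemma weighted_Hausdorff_countably_subadditive:
  "weighted_Hausdorff N \<Phi> \<Omega> \<sigma> (\<Union>n::nat. A n) \<le> (\<Sum>n. weighted_Hausdorff N \<Phi> \<Omega> \<sigma> (A n))"
  by (intro weighted_Hausdorff_leI order_trans[OF weighted_content_countably_subadditive]
      suminf_le weighted_content_le_Hausdorff) auto

lemma weighted_Hausdorff_separated:
  assumes "0 < e" and sep: "!!x y. x \<in> A ==> y \<in> B ==> e \<le> dist x y"
  shows "weighted_Hausdorff N \<Phi> \<Omega> \<sigma> A + weighted_Hausdorff N \<Phi> \<Omega> \<sigma> B
    \<le> weighted_Hausdorff N \<Phi> \<Omega> \<sigma> (A \<union> B)"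
proof (rule tendsto_le)
  show "\<forall>\<^sub>F \<delta> in at_right 0. weighted_content N \<Phi> \<Omega> \<sigma> \<delta> A + weighted_content N \<Phi> \<Omega> \<sigma> \<delta> B
    \<le> weighted_content N \<Phi> \<Omega> \<sigma> \<delta> (A \<union> B)"
    unfolding eventually_at_right_field
    by (rule exI[of _ e]) (use assms in \<open>auto intro!: weighted_content_separated\<close>)
qed (auto intro!: tendsto_add weighted_content_tendsto)

theorem weighted_Hausdorff_measure_space:
  "measure_space \<Omega> (sets (restrict_space borel \<Omega>)) (weighted_Hausdorff N \<Phi> \<Omega> \<sigma>)"
  by (rule metric_outer_measure_borel)
    (auto simp: weighted_Hausdorff_empty intro: weighted_Hausdorff_mono
      weighted_Hausdorff_countably_subadditive weighted_Hausdorff_separated)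

lemma sets_weighted_Hausdorff_measure [simp]:
  "sets (weighted_Hausdorff_measure N \<Phi> \<Omega> \<sigma>) = sets (restrict_space borel \<Omega>)"
  and space_weighted_Hausdorff_measure [simp]: "space (weighted_Hausdorff_measure N \<Phi> \<Omega> \<sigma>) = \<Omega>"
proof -
  interpret sigma_algebra \<Omega> "sets (restrict_space borel \<Omega>)"
    using weighted_Hausdorff_measure_space unfolding measure_space_def by blast
  show "sets (weighted_Hausdorff_measure N \<Phi> \<Omega> \<sigma>) = sets (restrict_space borel \<Omega>)"
    "space (weighted_Hausdorff_measure N \<Phi> \<Omega> \<sigma>) = \<Omega>"
    unfolding weighted_Hausdorff_measure_def by (auto simp: space_measure_of_conv)
qed

lemma emeasure_weighted_Hausdorff_measure:
  assumes "A \<in> sets (restrict_space borel \<Omega>)"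
  shows "emeasure (weighted_Hausdorff_measure N \<Phi> \<Omega> \<sigma>) A = weighted_Hausdorff N \<Phi> \<Omega> \<sigma> A"
  unfolding weighted_Hausdorff_measure_def
  using weighted_Hausdorff_measure_space[of \<Omega> N \<Phi> \<sigma>] assms
  by (intro emeasure_measure_of_sigma) (auto simp: measure_space_def)

section \<open>Measures dominated by the set function lie below the Hausdorff measure\<close>

abbreviation Euc :: "nat => (nat => real) set" where "Euc m \<equiv> topspace (Euclidean_space m)"

lemma Euc_iff: "v \<in> Euc m \<longleftrightarrow> (\<forall>i\<ge>m. v i = 0)"
  by (simp add: topspace_Euclidean_space)

lemma Euc_sum: "(!!a. a \<in> A ==> v a \<in> Euc m) ==> (%i. \<Sum>a\<in>A. c a * v a i) \<in> Euc m"
  by (simp add: Euc_iff)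

lemma norm_on_nonneg: "norm_on m N ==> v \<in> Euc m ==> 0 \<le> N v"
  by (simp add: norm_on_def)

lemma norm_on_scale: "norm_on m N ==> v \<in> Euc m ==> N (%i. a * v i) = \<bar>a\<bar> * N v"
  by (simp add: norm_on_def)

lemma norm_on_triangle: "norm_on m N ==> v \<in> Euc m ==> w \<in> Euc m ==> N (%i. v i + w i) \<le> N v + N w"
  by (simp add: norm_on_def)

lemma norm_on_zero: "norm_on m N ==> N (%_. 0) = 0"
  by (force simp: norm_on_def Euc_iff)

lemma norm_on_sum:
  assumes N: "norm_on m N" and "finite A" "!!a. a \<in> A ==> v a \<in> Euc m"
  shows "N (%i. \<Sum>a\<in>A. c a * v a i) \<le> (\<Sum>a\<in>A. \<bar>c a\<bar> * N (v a))"
  using assms(2,3)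
proof (induction A)
  case empty
  then show ?case using norm_on_zero[OF N] by simp
next
  case (insert a A)
  have "N (%i. c a * v a i + (\<Sum>a\<in>A. c a * v a i)) \<le> N (%i. c a * v a i) + N (%i. \<Sum>a\<in>A. c a * v a i)"
    using insert by (intro norm_on_triangle[OF N] Euc_sum) (auto simp: Euc_iff)
  then show ?case using insert norm_on_scale[OF N, of "v a" "c a"] by simp
qed

lemma norm_on_le_components:
  assumes N: "norm_on m N" and v: "v \<in> Euc m"
  shows "N v \<le> (\<Sum>i<m. \<bar>v i\<bar> * N (%j. if j = i then 1 else 0))"
proof -
  have "v = (%j. \<Sum>i<m. v i * (if j = i then 1 else 0))"
    using v by (auto simp: Euc_iff fun_eq_iff if_distrib[of "%x. _ * x"] cong: if_cong)
  then have "N v = N (%j. \<Sum>i<m. v i * (if j = i then 1 else 0))" by simp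
  also have "\<dots> \<le> (\<Sum>i<m. \<bar>v i\<bar> * N (%j. if j = i then 1 else 0))"
    by (rule norm_on_sum[OF N]) (auto simp: Euc_iff)
  finally show ?thesis .
qed

lemma norm_on_diff:
  assumes N: "norm_on m N" and v: "v \<in> Euc m" "w \<in> Euc m"
  shows "\<bar>N v - N w\<bar> \<le> N (%i. v i - w i)"
proof -
  have d: "(%i. v i - w i) \<in> Euc m" using v by (simp add: Euc_iff)
  have "N v \<le> N (%i. v i - w i) + N w"
    using norm_on_triangle[OF N d v(2)] by simp
  moreover have "N (%i. (-1) * (v i - w i)) = N (%i. v i - w i)"
    using norm_on_scale[OF N d, of "-1"] by simp
  moreover have "(%i. (-1) * (v i - w i)) \<in> Euc m" using d by (simp add: Euc_iff)
  ultimately show ?thesis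
    using norm_on_triangle[OF N _ v(1), of "%i. (-1) * (v i - w i)"] by simp
qed

lemma continuous_on_norm_on:
  assumes N: "norm_on m N" and F: "!!x. x \<in> S ==> F x \<in> Euc m"
    and cont: "!!i. i < m ==> continuous_on S (%x. F x i)"
  shows "continuous_on S (%x. N (F x))"
  unfolding continuous_on_def
proof
  fix a assume a: "a \<in> S"
  have "((%x. N (F x) - N (F a)) \<longlongrightarrow> 0) (at a within S)"
  proof (rule Lim_null_comparison)
    show "\<forall>\<^sub>F x in at a within S. norm (N (F x) - N (F a))
        \<le> (\<Sum>i<m. \<bar>F x i - F a i\<bar> * N (%j. if j = i then 1 else 0))"
    proof (rule eventually_at_topological[THEN iffD2], intro exI[of _ UNIV] conjI ballI impI)
      fix x assume x: "x \<in> S"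
      have "\<bar>N (F x) - N (F a)\<bar> \<le> N (%i. F x i - F a i)"
        by (rule norm_on_diff[OF N F[OF x] F[OF a]])
      also have "\<dots> \<le> (\<Sum>i<m. \<bar>F x i - F a i\<bar> * N (%j. if j = i then 1 else 0))"
        using F[OF x] F[OF a] by (intro norm_on_le_components[OF N]) (auto simp: Euc_iff)
      finally show "norm (N (F x) - N (F a)) \<le> (\<Sum>i<m. \<bar>F x i - F a i\<bar> * N (%j. if j = i then 1 else 0))"
        by simp
    qed auto
    have "((%x. \<Sum>i<m. \<bar>F x i - F a i\<bar> * N (%j. if j = i then 1 else 0)) \<longlongrightarrow>
       (\<Sum>i<m. \<bar>F a i - F a i\<bar> * N (%j. if j = i then 1 else 0))) (at a within S)"
      using cont a by (intro tendsto_intros) (auto simp: continuous_on_def)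
    then show "((%x. \<Sum>i<m. \<bar>F x i - F a i\<bar> * N (%j. if j = i then 1 else 0)) \<longlongrightarrow> 0) (at a within S)"
      by simp
  qed
  then show "((%x. N (F x)) \<longlongrightarrow> N (F a)) (at a within S)"
    by (simp add: LIM_zero_iff)
qed

lemma polynomial_map_Euc: "polynomial_map m \<Phi> ==> \<Phi> x \<in> Euc m"
  by (auto simp: polynomial_map_def)

lemma polynomial_map_component:
  assumes "polynomial_map m \<Phi>" shows "real_polynomial_function (%x. \<Phi> x i)"
proof (cases "i < m")
  case False
  then have "(%x. \<Phi> x i) = (%x. 0)"
    using polynomial_map_Euc[OF assms] by (auto simp: Euc_iff)
  then show ?thesis by (simp add: real_polynomial_function.intros(2))
qed (use assms in \<open>auto simp: polynomial_map_def\<close>)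

lemma continuous_on_norm_polynomial_map:
  assumes "norm_on m N" "polynomial_map m \<Phi>" shows "continuous_on S (%x. N (\<Phi> x))"
proof (rule continuous_on_norm_on[OF assms(1) polynomial_map_Euc[OF assms(2)]])
  show "continuous_on S (%x. \<Phi> x i)" for i
    by (intro continuous_at_imp_continuous_on ballI continuous_real_polymonial_function
        polynomial_map_component[OF assms(2)])
qed

lemma closure_vec_components:
  fixes x :: "'a::metric_space ^ 'k::finite"
  assumes "!!j. x $ j \<in> closure E" shows "x \<in> closure {x. \<forall>j. x $ j \<in> E}"
proof -
  have "\<forall>j. \<exists>s. (\<forall>n. s n \<in> E) \<and> s \<longlonglongrightarrow> x $ j"
    using assms by (simp add: closure_sequential)
  then obtain s where s: "!!j n. s j n \<in> E" "!!j. s j \<longlonglongrightarrow> x $ j" by metis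
  have "(%n. \<chi> j. s j n) \<longlonglongrightarrow> x"
    by (rule vec_tendstoI) (simp add: s)
  then show ?thesis using s(1) unfolding closure_sequential
    by (intro exI[of _ "%n. \<chi> j. s j n"]) auto
qed

text \<open>Covers may be assumed to consist of closed sets, and thus of Borel sets, to which a measure can be applied.\<close>

lemma sup_on_closure:
  fixes \<Phi> :: "real ^ 'n::finite ^ 'k::finite => nat => real"
  assumes cont: "continuous_on UNIV (%x. N (\<Phi> x))"
  shows "sup_on N \<Phi> (closure E) = sup_on N \<Phi> E"
proof (rule antisym)
  show "sup_on N \<Phi> (closure E) \<le> sup_on N \<Phi> E"
  proof (cases "sup_on N \<Phi> E")
    case (real s)
    have "closed {x. N (\<Phi> x) \<le> s}"
      using cont by (intro closed_Collect_le continuous_on_const)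
    moreover have "{x. \<forall>j. x $ j \<in> E} \<subseteq> {x. N (\<Phi> x) \<le> s}"
    proof
      fix x :: "real ^ 'n ^ 'k" assume x: "x \<in> {x. \<forall>j. x $ j \<in> E}"
      have "ennreal (N (\<Phi> x)) \<le> ennreal s"
        unfolding real(2)[symmetric] sup_on_def using x by (rule SUP_upper)
      then show "x \<in> {x. N (\<Phi> x) \<le> s}" using real by simp
    qed
    ultimately have "closure {x. \<forall>j. x $ j \<in> E} \<subseteq> {x. N (\<Phi> x) \<le> s}"
      by (rule closure_minimal[rotated])
    then have "N (\<Phi> x) \<le> s" if "\<forall>j. x $ j \<in> closure E" for x :: "real ^ 'n ^ 'k"
      using closure_vec_components[of x E] that by blast
    then show ?thesis
      unfolding real(2) unfolding sup_on_def by (intro SUP_least ennreal_leI) auto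
  qed simp
qed (rule sup_on_mono[OF closure_subset])

text \<open>The mass distribution principle: integrating the covering inequality against \<open>\<mu>\<close> bounds \<open>\<mu> A\<close> by the
  weighted sum of the \<open>\<mu> (E i)\<close>, and each of these is at most a constant times a power of the set function.\<close>

theorem dominates_le_Hausdorff:
  assumes cont: "continuous_on UNIV (%x. N (\<Phi> x))" and \<mu>: "borel_measure_on \<Omega> \<mu>"
    and \<sigma>: "0 < \<sigma>" and c: "0 \<le> c" and dom: "dominates (sup_on N \<Phi>) \<Omega> \<mu> (1 / \<sigma>) c"
    and A: "A \<in> sets (restrict_space borel \<Omega>)"
  shows "ennreal (c powr \<sigma>) * emeasure \<mu> A \<le> weighted_Hausdorff N \<Phi> \<Omega> \<sigma> A"
proof -
  have sets: "sets \<mu> = sets (restrict_space borel \<Omega>)" using \<mu> by (simp add: borel_measure_on_def)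
  then have space: "space \<mu> = \<Omega>" using sets_eq_imp_space_eq[OF sets] by (simp add: space_restrict_space)
  have "ennreal (c powr \<sigma>) * emeasure \<mu> A \<le> weighted_content N \<Phi> \<Omega> \<sigma> 1 A"
    unfolding weighted_content_def
  proof (rule INF_greatest, clarify)
    fix a E assume aE: "(a, E) \<in> weighted_covers \<Omega> 1 A"
    define E' where "E' i = \<Omega> \<inter> closure (E i)" for i :: nat
    have E': "E' i \<in> sets \<mu>" for i
      unfolding sets E'_def sets_restrict_space by (intro imageI) auto
    have EE': "E i \<subseteq> E' i" for i
      using aE closure_subset unfolding E'_def weighted_covers_def by blast
    have bound: "ennreal (c powr \<sigma>) * emeasure \<mu> (E' i) \<le> epowr (sup_on N \<Phi> (E i)) \<sigma>" for i
    proof -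
      have "ennreal c * epowr (emeasure \<mu> (E' i)) (1 / \<sigma>) \<le> sup_on N \<Phi> (E' i)"
        using dom E'[of i] by (auto simp: dominates_def sets)
      also have "\<dots> \<le> sup_on N \<Phi> (closure (E i))"
        by (rule sup_on_mono) (auto simp: E'_def)
      also have "\<dots> = sup_on N \<Phi> (E i)" by (rule sup_on_closure, rule cont)
      finally have "epowr (ennreal c * epowr (emeasure \<mu> (E' i)) (1 / \<sigma>)) \<sigma> \<le> epowr (sup_on N \<Phi> (E i)) \<sigma>"
        using \<sigma> by (intro epowr_mono) auto
      then show ?thesis using \<sigma> c by (simp add: epowr_mult epowr_epowr)
    qed
    have "emeasure \<mu> A = (\<integral>\<^sup>+x. indicator A x \<partial>\<mu>)"
      using A by (simp add: sets)
    also have "\<dots> \<le> (\<integral>\<^sup>+x. (\<Sum>i. ennreal (a i) * indicator (E' i) x) \<partial>\<mu>)"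
    proof (rule nn_integral_mono)
      fix x assume "x \<in> space \<mu>"
      then have "indicator A x \<le> (\<Sum>i. ennreal (a i) * indicator (E i) x)"
        using aE by (auto simp: weighted_covers_def space)
      also have "\<dots> \<le> (\<Sum>i. ennreal (a i) * indicator (E' i) x)"
        using EE' by (intro suminf_le mult_left_mono) (auto simp: indicator_def)
      finally show "indicator A x \<le> (\<Sum>i. ennreal (a i) * indicator (E' i) x)" .
    qed
    also have "\<dots> = (\<Sum>i. ennreal (a i) * emeasure \<mu> (E' i))"
      using E' by (simp add: nn_integral_suminf nn_integral_cmult_indicator)
    finally have "ennreal (c powr \<sigma>) * emeasure \<mu> A \<le> ennreal (c powr \<sigma>) * (\<Sum>i. ennreal (a i) * emeasure \<mu> (E' i))"
      by (rule mult_left_mono) simp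
    also have "\<dots> = (\<Sum>i. ennreal (a i) * (ennreal (c powr \<sigma>) * emeasure \<mu> (E' i)))"
      by (simp add: ennreal_suminf_cmult[symmetric] mult_ac)
    also have "\<dots> \<le> (\<Sum>i. ennreal (a i) * epowr (sup_on N \<Phi> (E i)) \<sigma>)"
      by (intro suminf_le mult_left_mono bound) auto
    finally show "ennreal (c powr \<sigma>) * emeasure \<mu> A \<le> (\<Sum>i. ennreal (a i) * epowr (sup_on N \<Phi> (E i)) \<sigma>)" .
  qed
  also have "\<dots> \<le> weighted_Hausdorff N \<Phi> \<Omega> \<sigma> A" by (rule weighted_content_le_Hausdorff) simp
  finally show ?thesis .
qed

section \<open>Change of variables with multiplicity\<close>

text \<open>The change of variables formula is stated for well-ordered index types. An enumeration of a finite type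
  provides such an order; the copy carries it without imposing it on the original type.\<close>

typedef 'a wo = "UNIV :: 'a set" morphisms un_wo mk_wo by auto

lemma un_mk_wo [simp]: "un_wo (mk_wo x) = x" by (simp add: mk_wo_inverse)
lemma mk_un_wo [simp]: "mk_wo (un_wo x) = x" by (rule un_wo_inverse)
lemma un_wo_inj [simp]: "un_wo x = un_wo y \<longleftrightarrow> x = y" by (rule un_wo_inject)
lemma mk_wo_inj [simp]: "mk_wo x = mk_wo y \<longleftrightarrow> x = y" by (metis un_mk_wo)

instance wo :: (finite) finite
proof
  have "(UNIV :: 'a wo set) = mk_wo ` UNIV" by (metis mk_un_wo surjI)
  then show "finite (UNIV :: 'a wo set)" by (metis finite finite_imageI)
qed

definition wo_rank :: "'a::finite wo => nat" where
  "wo_rank = (SOME f. inj f)"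

lemma inj_wo_rank: "inj wo_rank"
proof -
  have "\<exists>f :: 'a wo => nat. inj f"
    using finite_imp_inj_to_nat_seg[of "UNIV :: 'a wo set"] by auto
  then show ?thesis unfolding wo_rank_def by (rule someI_ex)
qed

instantiation wo :: (finite) wellorder
begin
definition less_eq_wo :: "'a wo => 'a wo => bool" where "less_eq_wo a b \<longleftrightarrow> wo_rank a \<le> wo_rank b"
definition less_wo :: "'a wo => 'a wo => bool" where "less_wo a b \<longleftrightarrow> wo_rank a < wo_rank b"
instance
proof
  fix P :: "'a wo => bool" and a :: "'a wo"
  assume *: "!!x. (!!y. y < x ==> P y) ==> P x"
  show "P a"
  proof (induction a rule: measure_induct_rule[of wo_rank])
    case (less x)
    show ?case by (rule *) (rule less, simp add: less_wo_def)
  qed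
next
  fix a b :: "'a wo" assume "a \<le> b" "b \<le> a"
  then show "a = b" using inj_wo_rank by (auto simp: less_eq_wo_def inj_def)
qed (auto simp: less_eq_wo_def less_wo_def)
end

lemma swapidseq_conj:
  assumes "swapidseq n p" and f: "!!x. g (f x) = x" "!!y. f (g y) = y"
  shows "swapidseq n (f \<circ> p \<circ> g)"
  using assms(1)
proof induction
  case id
  have "f \<circ> id \<circ> g = id" using f(2) by (simp add: fun_eq_iff)
  then show ?case by (simp only: swapidseq.id)
next
  case (comp_Suc n p a b)
  have "f \<circ> (Transposition.transpose a b \<circ> p) \<circ> g = Transposition.transpose (f a) (f b) \<circ> (f \<circ> p \<circ> g)"
    by (auto simp: fun_eq_iff Transposition.transpose_def) (metis f(1))+
  moreover have "f a \<noteq> f b" using comp_Suc(2) f(1) by metis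
  ultimately show ?case using swapidseq.comp_Suc[OF comp_Suc(3)] by metis
qed

lemma sign_conj:
  assumes p: "p permutes (UNIV :: 'a::finite set)" and f: "!!x. g (f x) = x" "!!y. f (g y) = y"
  shows "sign (f \<circ> p \<circ> g) = sign p"
proof -
  have "permutation p" using p by (metis finite permutation_permutes)
  then obtain n where n: "swapidseq n p" by (auto simp: permutation_def)
  have "evenperm (f \<circ> p \<circ> g) = even n" by (rule evenperm_unique[OF swapidseq_conj[OF n f] refl])
  moreover have "evenperm p = even n" by (rule evenperm_unique[OF n refl])
  ultimately show ?thesis by (simp add: sign_def)
qed

text \<open>Reindexing rows and columns simultaneously conjugates every permutation in the Leibniz formula, and conjugation
  preserves signs.\<close>

lemma det_wo:
  fixes A :: "real ^ 'n::finite ^ 'n"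
  shows "det (\<chi> i j. A $ un_wo i $ un_wo j) = det A"
proof -
  have bij: "bij (un_wo :: 'n wo => 'n)" "bij (mk_wo :: 'n => 'n wo)"
    by (rule o_bij[of mk_wo], auto simp: fun_eq_iff) (rule o_bij[of un_wo], auto simp: fun_eq_iff)
  have perm: "mk_wo \<circ> p \<circ> un_wo permutes UNIV" if "p permutes UNIV" for p :: "'n => 'n"
    by (rule bij_imp_permutes) (auto intro!: bij_comp bij permutes_bij[OF that])
  have perm': "un_wo \<circ> p \<circ> mk_wo permutes UNIV" if "p permutes UNIV" for p :: "'n wo => 'n wo"
    by (rule bij_imp_permutes) (auto intro!: bij_comp bij permutes_bij[OF that])
  show ?thesis
    unfolding det_def
  proof (rule sum.reindex_bij_witness[of _ "%p. mk_wo \<circ> p \<circ> un_wo" "%p. un_wo \<circ> p \<circ> mk_wo"])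
    fix p :: "'n wo => 'n wo" assume p: "p \<in> {p. p permutes UNIV}"
    show "of_int (sign (un_wo \<circ> p \<circ> mk_wo)) * (\<Prod>i\<in>UNIV. A $ i $ (un_wo \<circ> p \<circ> mk_wo) i)
       = of_int (sign p) * (\<Prod>i\<in>UNIV. (\<chi> i j. A $ un_wo i $ un_wo j) $ i $ p i)"
    proof -
      have "(\<Prod>i\<in>UNIV. A $ i $ (un_wo \<circ> p \<circ> mk_wo) i) = (\<Prod>i\<in>UNIV. A $ un_wo i $ un_wo (p i))"
        by (rule prod.reindex_bij_witness[of _ un_wo mk_wo]) auto
      then show ?thesis using sign_conj[of p mk_wo un_wo] p by simp
    qed
  qed (use perm perm' in \<open>auto simp: fun_eq_iff\<close>)
qed

definition to_wo :: "real ^ 'n::finite => real ^ 'n wo" where "to_wo x = (\<chi> i. x $ un_wo i)"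
definition of_wo :: "real ^ 'n::finite wo => real ^ 'n" where "of_wo x = (\<chi> i. x $ mk_wo i)"

lemma to_of_wo [simp]: "to_wo (of_wo x) = x" by (simp add: to_wo_def of_wo_def vec_eq_iff)
lemma of_to_wo [simp]: "of_wo (to_wo x) = x" by (simp add: to_wo_def of_wo_def vec_eq_iff)

lemma linear_to_wo: "linear to_wo" by (rule linearI) (auto simp: to_wo_def vec_eq_iff)
lemma linear_of_wo: "linear of_wo" by (rule linearI) (auto simp: of_wo_def vec_eq_iff)

lemma prod_Basis_cart: "(\<Prod>b\<in>(Basis :: (real ^ 'n::finite) set). f b) = (\<Prod>i\<in>UNIV. f (axis i 1))"
proof -
  have 1: "(Basis :: (real ^ 'n) set) = range (%i. axis i 1)" by (auto simp: Basis_vec_def)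
  have 2: "inj (%i. axis i (1::real) :: real ^ 'n)" by (auto simp: inj_def axis_eq_axis)
  show ?thesis unfolding 1 by (subst prod.reindex[OF 2]) simp
qed

lemma borel_measurable_to_wo [measurable]: "to_wo \<in> borel_measurable borel"
  and borel_measurable_of_wo [measurable]: "of_wo \<in> borel_measurable borel"
  by (auto intro!: borel_measurable_continuous_onI linear_continuous_on linear_conv_bounded_linear[THEN iffD1]
      linear_to_wo linear_of_wo)

lemma distr_to_wo: "distr lborel borel (to_wo :: real ^ 'n::finite => _) = lborel"
proof (rule lborel_eqI[symmetric])
  fix l u :: "real ^ 'n wo" assume le: "!!b. b \<in> Basis ==> l \<bullet> b \<le> u \<bullet> b"
  have le': "l $ i \<le> u $ i" for i using le[of "axis i 1"] by (simp add: inner_axis)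
  have "to_wo -` box l u = box (of_wo l) (of_wo u :: real ^ 'n)"
  proof -
    have "(\<forall>i. l $ i < x $ un_wo i \<and> x $ un_wo i < u $ i) \<longleftrightarrow> (\<forall>j. l $ mk_wo j < x $ j \<and> x $ j < u $ mk_wo j)" for x :: "real ^ 'n"
      by (metis un_mk_wo mk_un_wo)
    then show ?thesis by (simp add: mem_box_cart to_wo_def of_wo_def set_eq_iff)
  qed
  then have "emeasure (distr lborel borel to_wo) (box l u) = emeasure lborel (box (of_wo l) (of_wo u :: real ^ 'n))"
    by (simp add: emeasure_distr)
  also have "\<dots> = (\<Prod>b\<in>Basis. (of_wo u - of_wo l) \<bullet> b)"
    using le' by (intro emeasure_lborel_box) (auto simp: Basis_vec_def inner_axis of_wo_def)
  also have "\<dots> = (\<Prod>b\<in>Basis. (u - l) \<bullet> b)"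
    unfolding prod_Basis_cart
    by (simp add: inner_axis of_wo_def, intro arg_cong[of _ _ ennreal] prod.reindex_bij_witness[of _ un_wo mk_wo]) auto
  finally show "emeasure (distr lborel borel to_wo) (box l u) = (\<Prod>b\<in>Basis. (u - l) \<bullet> b)" .
qed simp

lemma emeasure_vimage_to_wo: "A \<in> sets borel ==> emeasure lborel (to_wo -` A) = emeasure lborel A"
  by (subst distr_to_wo[symmetric]) (simp add: emeasure_distr)

lemma nn_integral_to_wo:
  "f \<in> borel_measurable borel ==> (\<integral>\<^sup>+x. f (to_wo x) \<partial>lborel) = (\<integral>\<^sup>+x. f x \<partial>lborel)"
  using nn_integral_distr[of to_wo lborel borel f] by (simp add: distr_to_wo)

lemma matrix_wo:
  fixes h :: "real ^ 'n::finite => real ^ 'n"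
  assumes "linear h"
  shows "det (matrix (%v. to_wo (h (of_wo v)))) = det (matrix h)"
proof -
  have ax: "of_wo (axis j 1) = (axis (un_wo j) 1 :: real ^ 'n)" for j
    by (auto simp: of_wo_def axis_def vec_eq_iff)
  have "matrix (%v. to_wo (h (of_wo v))) = (\<chi> i j. matrix h $ un_wo i $ un_wo j)"
    unfolding matrix_def to_wo_def by (simp add: ax)
  then show ?thesis by (simp add: det_wo)
qed

subsection \<open>Images and Jacobians\<close>

lemma nn_integral_det_le_image_wo:
  fixes f :: "real ^ 'n::{finite,wellorder} => real ^ 'n::_"
  assumes S: "S \<in> sets borel" and der: "!!x. x \<in> S ==> (f has_derivative f' x) (at x)"
    and inj: "inj_on f S" and bd: "bounded (f ` S)"
  shows "f ` S \<in> sets lebesgue \<and> (\<integral>\<^sup>+x. ennreal \<bar>det (matrix (f' x))\<bar> * indicator S x \<partial>lborel) = emeasure lebesgue (f ` S)"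
proof -
  have Sl: "S \<in> sets lebesgue" using S by auto
  have der': "x \<in> S ==> (f has_derivative f' x) (at x within S)" for x
    using der has_derivative_at_withinI by blast
  have img: "f ` S \<in> sets lebesgue"
  proof (rule differentiable_image_in_sets_lebesgue[OF Sl])
    show "f differentiable_on S" using der' by (auto simp: differentiable_on_def differentiable_def)
  qed simp
  then have lm: "f ` S \<in> lmeasurable" by (rule bounded_set_imp_lmeasurable[OF bd])
  then have "((%x. \<bar>det (matrix (f' x))\<bar>) has_integral measure lebesgue (f ` S)) S"
    using has_measure_differentiable_image[OF Sl der' inj] by blast
  then have "(\<integral>\<^sup>+x. ennreal \<bar>det (matrix (f' x))\<bar> * indicator S x \<partial>lborel) = ennreal (measure lebesgue (f ` S))"
    by (intro nn_integral_has_integral_lebesgue') auto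
  also have "\<dots> = emeasure lebesgue (f ` S)"
    using lm by (simp add: emeasure_eq_measure2)
  finally show ?thesis using img by simp
qed


lemma nn_integral_det_injective:
  fixes f :: "real ^ 'n::finite => real ^ 'n"
  assumes S: "S \<in> sets borel" and der: "!!x. x \<in> S ==> (f has_derivative (*v) (J x)) (at x)"
    and inj: "inj_on f S" and bd: "bounded (f ` S)"
    and meas: "(%x. ennreal \<bar>det (J x)\<bar> * indicator S x) \<in> borel_measurable borel"
  shows "\<exists>B\<in>sets borel. B \<subseteq> f ` S \<and> (\<integral>\<^sup>+x. ennreal \<bar>det (J x)\<bar> * indicator S x \<partial>lborel) = emeasure lborel B"
proof -
  define F where "F y = to_wo (f (of_wo y))" for y
  define S' where "S' = of_wo -` S"
  define F' where "F' y = (%v. to_wo (J (of_wo y) *v of_wo v))" for y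
  have S': "S' \<in> sets borel"
    unfolding S'_def using measurable_sets[OF borel_measurable_of_wo S] by simp
  have bl: "bounded_linear (to_wo :: real ^ 'n => _)" "bounded_linear (of_wo :: _ => real ^ 'n)"
    using linear_to_wo linear_of_wo by (auto simp: linear_conv_bounded_linear)
  have der': "(F has_derivative F' y) (at y)" if "y \<in> S'" for y
  proof -
    have "(f has_derivative (*v) (J (of_wo y))) (at (of_wo y))" using der that by (simp add: S'_def)
    from has_derivative_compose[OF bounded_linear_imp_has_derivative[OF bl(2)] this]
    have "((%y. f (of_wo y)) has_derivative (%v. J (of_wo y) *v of_wo v)) (at y)" .
    from bounded_linear.has_derivative[OF bl(1) this] show ?thesis
      unfolding F_def F'_def .
  qed
  have inj': "inj_on F S'"
  proof (rule inj_onI)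
    fix x y assume xy: "x \<in> S'" "y \<in> S'" "F x = F y"
    then have "f (of_wo x) = f (of_wo y)" unfolding F_def by (metis of_to_wo)
    then have "of_wo x = of_wo y" using inj xy by (auto simp: S'_def inj_on_def)
    then show "x = y" by (metis to_of_wo)
  qed
  have FS: "F ` S' = to_wo ` f ` S"
  proof -
    have "of_wo ` S' = S" unfolding S'_def by (rule surj_image_vimage_eq) (rule surjI, rule of_to_wo)
    then show ?thesis by (simp add: F_def image_image[symmetric, of to_wo f] image_image[of "%x. to_wo (f x)" of_wo, symmetric])
  qed
  have "bounded (F ` S')" unfolding FS by (rule bounded_linear_image[OF bd bl(1)])
  from nn_integral_det_le_image_wo[OF S' der' inj' this]
  have img: "F ` S' \<in> sets lebesgue"
    and eq: "(\<integral>\<^sup>+x. ennreal \<bar>det (matrix (F' x))\<bar> * indicator S' x \<partial>lborel) = emeasure lebesgue (F ` S')"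
    by auto
  define B where "B = to_wo -` main_part lborel (F ` S')"
  have mp: "main_part lborel (F ` S') \<in> sets borel" "main_part lborel (F ` S') \<subseteq> F ` S'"
    using main_part_sets[OF img] main_part_null_part_Un[OF img] by (simp, blast)
  have "B \<in> sets borel"
    unfolding B_def using measurable_sets[OF borel_measurable_to_wo mp(1)] by simp
  moreover have "B \<subseteq> f ` S"
    using mp(2) unfolding B_def FS by (auto simp: image_iff subset_iff) (metis of_to_wo)
  moreover have "(\<integral>\<^sup>+x. ennreal \<bar>det (J x)\<bar> * indicator S x \<partial>lborel) = emeasure lborel B"
  proof -
    let ?g = "%y. ennreal \<bar>det (J (of_wo y))\<bar> * indicator S (of_wo y)"
    have gm: "?g \<in> borel_measurable borel"
      using measurable_compose[OF borel_measurable_of_wo meas] by simp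
    have "(\<integral>\<^sup>+x. ennreal \<bar>det (J x)\<bar> * indicator S x \<partial>lborel) = (\<integral>\<^sup>+x. ?g (to_wo x) \<partial>lborel)" by simp
    also have "\<dots> = (\<integral>\<^sup>+y. ?g y \<partial>lborel)" by (rule nn_integral_to_wo[OF gm])
    also have "\<dots> = (\<integral>\<^sup>+x. ennreal \<bar>det (matrix (F' x))\<bar> * indicator S' x \<partial>lborel)"
    proof (rule nn_integral_cong)
      fix y
      have "det (matrix (F' y)) = det (matrix ((*v) (J (of_wo y))))"
        unfolding F'_def by (rule matrix_wo) simp
      then show "?g y = ennreal \<bar>det (matrix (F' y))\<bar> * indicator S' y"
        by (simp add: S'_def indicator_def)
    qed
    also have "\<dots> = emeasure lborel (main_part lborel (F ` S'))"
      unfolding eq by (rule emeasure_completion[OF img])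
    also have "\<dots> = emeasure lborel B" unfolding B_def using emeasure_vimage_to_wo[OF mp(1)] by simp
    finally show ?thesis .
  qed
  ultimately show ?thesis by blast
qed

text \<open>The domain is cut into countably many pieces on which \<open>f\<close> is injective, by the inverse function
  theorem; on each piece the integral is the measure of the image, and almost no point lies in more than \<open>M\<close> images.\<close>

theorem nn_integral_det_le_multiplicity:
  fixes f :: "real ^ 'n::finite => real ^ 'n"
  assumes "open U" and S: "S \<in> sets borel" "S \<subseteq> U"
    and der: "!!x. x \<in> U ==> (f has_derivative (*v) (J x)) (at x)" and contJ: "continuous_on U J"
    and Z: "Z \<in> null_sets lborel"
    and mult: "!!y F. y \<notin> Z ==> finite F ==> F \<subseteq> {x \<in> S. f x = y} ==> card F \<le> M"
    and Q: "Q \<in> sets borel" "bounded Q" "f ` S \<subseteq> Q"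
  shows "(\<integral>\<^sup>+x. ennreal \<bar>det (J x)\<bar> * indicator S x \<partial>lborel) \<le> of_nat M * emeasure lborel Q"
proof -
  have cdet: "continuous_on U (%x. det (J x))"
    using contJ unfolding det_def by (intro continuous_intros) auto
  define V where "V = {x \<in> U. det (J x) \<noteq> 0}"
  have openV: "open V"
  proof -
    have "V = U \<inter> (%x. det (J x)) -` (- {0})" by (auto simp: V_def)
    then show ?thesis using continuous_open_preimage[OF cdet \<open>open U\<close>, of "- {0}"] by auto
  qed
  have local_inj: "\<exists>r>0. ball a r \<subseteq> V \<and> inj_on f (ball a r)" if a: "a \<in> V" for a
  proof -
    have "invertible (J a)" using a by (simp add: V_def invertible_det_nz)
    then obtain I where I: "I ** J a = mat 1" by (auto simp: invertible_def)
    have "\<exists>d>0. \<forall>x. dist a x < d --> onorm (%v. J x *v v - J a *v v) < e" if e: "e > 0" for e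
    proof -
      let ?n = "real CARD('n)"
      have "continuous (at a) J"
        using contJ a \<open>open U\<close> by (simp add: V_def continuous_on_eq_continuous_at)
      then obtain d where d: "0 < d" "!!x. dist x a < d ==> dist (J x) (J a) < e / (2 * ?n * ?n)"
        using e unfolding continuous_at_eps_delta by (metis (no_types) divide_pos_pos mult_pos_pos of_nat_0_less_iff zero_less_card_finite zero_less_numeral)
      show ?thesis
      proof (intro exI conjI allI impI)
        fix x assume "dist a x < d"
        then have "dist x a < d" by (simp add: dist_commute)
        then have dJ: "dist (J x) (J a) < e / (2 * ?n * ?n)" by (rule d(2))
        have comp: "\<bar>(J x - J a) $ i $ j\<bar> \<le> e / (2 * ?n * ?n)" for i j
        proof -
          have "\<bar>(J x - J a) $ i $ j\<bar> \<le> norm ((J x - J a) $ i)" by (rule component_le_norm_cart)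
          also have "\<dots> \<le> norm (J x - J a)" by (rule Finite_Cartesian_Product.norm_nth_le)
          finally show ?thesis using dJ by (simp add: dist_norm)
        qed
        have "onorm ((*v) (J x - J a)) \<le> (\<Sum>i\<in>UNIV. \<Sum>j\<in>UNIV. \<bar>(J x - J a) $ i $ j\<bar>)"
          by (rule onorm_le_matrix_component_sum)
        also have "\<dots> \<le> (\<Sum>i\<in>(UNIV::'n set). \<Sum>j\<in>(UNIV::'n set). e / (2 * ?n * ?n))"
          by (intro sum_mono comp)
        also have "\<dots> = e / 2" by simp
        also have "\<dots> < e" using e by simp
        finally have "onorm ((*v) (J x - J a)) < e" .
        moreover have "(%v. J x *v v - J a *v v) = (*v) (J x - J a)"
          by (rule ext) (simp add: matrix_vector_mult_diff_rdistrib)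
        ultimately show "onorm (%v. J x *v v - J a *v v) < e" by simp
      qed (rule d(1))
    qed
    moreover have "(*v) I \<circ> (*v) (J a) = id"
      using I by (auto simp: fun_eq_iff matrix_vector_mul_assoc)
    ultimately obtain r where "r > 0" "ball a r \<subseteq> V" "inj_on f (ball a r)"
      using has_derivative_locally_injective[of a V "(*v) I" "%x. (*v) (J x)" f] a openV der
      by (auto simp: V_def)
    then show ?thesis by blast
  qed
  then obtain r where r: "!!a. a \<in> V ==> 0 < r a" "!!a. a \<in> V ==> ball a (r a) \<subseteq> V" "!!a. a \<in> V ==> inj_on f (ball a (r a))"
    by metis
  obtain \<B> where \<B>: "\<B> \<subseteq> (%a. ball a (r a)) ` V" "countable \<B>" "\<Union>\<B> = (\<Union>a\<in>V. ball a (r a))"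
    using Lindelof[of "(%a. ball a (r a)) ` V"] by auto
  have UB: "\<Union>\<B> = V" unfolding \<B>(3) using r centre_in_ball by fastforce
  define D where "D = disjointed (%i. if \<B> = {} then {} else from_nat_into \<B> i)"
  have D_sub: "D i \<subseteq> (if \<B> = {} then {} else from_nat_into \<B> i)" for i
    unfolding D_def by (rule disjointed_subset)
  have Din: "\<B> \<noteq> {} ==> from_nat_into \<B> i \<in> \<B>" for i by (rule from_nat_into)
  have D_inj: "inj_on f (D i)" for i
  proof (cases "\<B> = {}")
    case True
    then show ?thesis using D_sub[of i] by simp
  next
    case False
    then obtain a where "a \<in> V" "from_nat_into \<B> i = ball a (r a)" using Din[of i] \<B>(1) by blast
    then show ?thesis using D_sub[of i] r(3)[of a] False by (auto intro: inj_on_subset)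
  qed
  have D_U: "(\<Union>i. D i) = V"
    unfolding D_def UN_disjointed_eq using UB \<B>(2) by (auto simp: UN_from_nat_into)
  have D_disj: "disjoint_family D" unfolding D_def by (rule disjoint_family_disjointed)
  have D_borel: "D i \<in> sets borel" for i
  proof -
    have "range (%i. if \<B> = {} then {} else from_nat_into \<B> i) \<subseteq> sets borel"
    proof (rule image_subsetI)
      fix i
      show "(if \<B> = {} then {} else from_nat_into \<B> i) \<in> sets borel"
      proof (cases "\<B> = {}")
        case False
        then obtain a where "from_nat_into \<B> i = ball a (r a)" using Din[of i] \<B>(1) by blast
        then show ?thesis using False by simp
      qed simp
    qed
    from sets.range_disjointed_sets[OF this] show ?thesis unfolding D_def by auto
  qed
  have SD: "S \<inter> D i \<in> sets borel" for i using S D_borel by auto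
  have measdet: "(%x. ennreal \<bar>det (J x)\<bar> * indicator X x) \<in> borel_measurable borel"
    if X: "X \<in> sets borel" "X \<subseteq> U" for X
  proof -
    have "(%x. indicator U x *\<^sub>R det (J x)) \<in> borel_measurable borel"
      using \<open>open U\<close> by (intro borel_measurable_continuous_on_indicator cdet) auto
    then have "(%x. ennreal \<bar>indicator U x *\<^sub>R det (J x)\<bar> * indicator X x) \<in> borel_measurable borel"
      using X by (intro borel_measurable_times_ennreal) auto
    also have "(%x. ennreal \<bar>indicator U x *\<^sub>R det (J x)\<bar> * indicator X x) = (%x. ennreal \<bar>det (J x)\<bar> * indicator X x)"
      using X by (auto simp: indicator_def fun_eq_iff)
    finally show ?thesis .
  qed
  have SDU: "S \<inter> D i \<subseteq> U" for i using S by auto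
  have "\<exists>B\<in>sets borel. B \<subseteq> f ` (S \<inter> D i) \<and>
      (\<integral>\<^sup>+x. ennreal \<bar>det (J x)\<bar> * indicator (S \<inter> D i) x \<partial>lborel) = emeasure lborel B" for i
  proof (rule nn_integral_det_injective[OF SD])
    show "x \<in> S \<inter> D i ==> (f has_derivative (*v) (J x)) (at x)" for x using der S by auto
    show "inj_on f (S \<inter> D i)" using D_inj by (rule inj_on_subset) auto
    show "bounded (f ` (S \<inter> D i))" using Q by (auto intro: bounded_subset)
  qed (rule measdet[OF SD SDU])
  then obtain B where B: "!!i. B i \<in> sets borel" "!!i. B i \<subseteq> f ` (S \<inter> D i)"
    "!!i. (\<integral>\<^sup>+x. ennreal \<bar>det (J x)\<bar> * indicator (S \<inter> D i) x \<partial>lborel) = emeasure lborel (B i)"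
    by metis
  have "(\<integral>\<^sup>+x. ennreal \<bar>det (J x)\<bar> * indicator S x \<partial>lborel)
      = (\<integral>\<^sup>+x. (\<Sum>i. ennreal \<bar>det (J x)\<bar> * indicator (S \<inter> D i) x) \<partial>lborel)"
  proof (rule nn_integral_cong)
    fix x
    show "ennreal \<bar>det (J x)\<bar> * indicator S x = (\<Sum>i. ennreal \<bar>det (J x)\<bar> * indicator (S \<inter> D i) x)"
    proof (cases "x \<in> S \<inter> V")
      case True
      then obtain i where i: "x \<in> D i" using D_U by auto
      have "(\<Sum>i. indicator (S \<inter> D i) x) = (indicator (\<Union>i. S \<inter> D i) x :: ennreal)"
        using D_disj by (intro suminf_indicator) (auto simp: disjoint_family_on_def)
      also have "\<dots> = indicator S x" using i True by (auto simp: indicator_def)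
      finally show ?thesis by simp
    next
      case False
      then have "x \<in> S ==> det (J x) = 0" using S by (auto simp: V_def)
      moreover have "x \<notin> S \<inter> D i" for i using False D_U by auto
      ultimately show ?thesis by (cases "x \<in> S") auto
    qed
  qed
  also have "\<dots> = (\<Sum>i. emeasure lborel (B i))"
    unfolding B(3)[symmetric] using measdet[OF SD SDU] by (intro nn_integral_suminf) simp
  also have "\<dots> = (\<integral>\<^sup>+y. (\<Sum>i. indicator (B i) y) \<partial>lborel)"
    using B(1) by (simp add: nn_integral_suminf)
  also have "\<dots> \<le> (\<integral>\<^sup>+y. of_nat M * indicator Q y \<partial>lborel)"
  proof (rule nn_integral_mono_AE, rule AE_I'[OF Z], rule subsetI, rule ccontr)
    fix y assume "y \<in> {y \<in> space lborel. \<not> (\<Sum>i. indicator (B i) y) \<le> of_nat M * (indicator Q y :: ennreal)}" and "y \<notin> Z"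
    then have y: "\<not> (\<Sum>i. indicator (B i) y) \<le> of_nat M * (indicator Q y :: ennreal)" by simp
    have *: "(\<Sum>i<k. indicator (B i) y) \<le> (of_nat M * indicator Q y :: ennreal)" for k
    proof -
      define I where "I = {i. i < k \<and> y \<in> B i}"
      have "\<forall>i\<in>I. \<exists>x. x \<in> S \<inter> D i \<and> f x = y" using B(2) by (fastforce simp: I_def)
      then obtain x where x: "!!i. i \<in> I ==> x i \<in> S \<inter> D i" "!!i. i \<in> I ==> f (x i) = y" by metis
      have "inj_on x I"
      proof (rule inj_onI, rule ccontr)
        fix i j assume "i \<in> I" "j \<in> I" "x i = x j" "i \<noteq> j"
        then show False using x(1)[of i] x(1)[of j] D_disj by (auto simp: disjoint_family_on_def)
      qed
      have fI: "finite I" by (simp add: I_def)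
      have "card I = card (x ` I)" using \<open>inj_on x I\<close> by (simp add: card_image)
      also have "\<dots> \<le> M" using x fI by (intro mult[OF \<open>y \<notin> Z\<close>]) auto
      finally have cI: "card I \<le> M" .
      have "(\<Sum>i<k. indicator (B i) y) = (\<Sum>i\<in>I. 1 :: ennreal)"
        by (rule sum.mono_neutral_cong_right) (auto simp: I_def indicator_def)
      also have "\<dots> = of_nat (card I)" by simp
      also have "\<dots> \<le> of_nat M * indicator Q y"
      proof (cases "I = {}")
        case False
        then obtain i where "i \<in> I" by auto
        then have "y \<in> Q" using x[of i] Q(3) by auto
        then show ?thesis using cI by simp
      qed simp
      finally show ?thesis .
    qed
    have "(\<Sum>i. indicator (B i) y) \<le> (of_nat M * indicator Q y :: ennreal)"
      by (rule suminf_le_const) (auto intro: *)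
    with y show False by simp
  qed
  also have "\<dots> = of_nat M * emeasure lborel Q"
    using Q(1) by (simp add: nn_integral_cmult_indicator)
  finally show ?thesis .
qed

corollary null_set_preimage_Jacobian:
  fixes f :: "real ^ 'n::finite => real ^ 'n"
  assumes "open U" and S: "S \<in> sets borel" "S \<subseteq> U"
    and der: "!!x. x \<in> U ==> (f has_derivative (*v) (J x)) (at x)" and contJ: "continuous_on U J"
    and Z: "Z \<in> null_sets lborel" "f ` S \<subseteq> Z" "bounded Z" and ne: "!!x. x \<in> S ==> det (J x) \<noteq> 0"
  shows "S \<in> null_sets lborel"
proof -
  have m: "card F \<le> 0" if "y \<notin> Z" "finite F" "F \<subseteq> {x \<in> S. f x = y}" for y and F :: "(real ^ 'n) set"
    using that Z(2) by (cases "F = {}") auto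
  have "Z \<in> sets borel" using Z(1) by auto
  then have "(\<integral>\<^sup>+x. ennreal \<bar>det (J x)\<bar> * indicator S x \<partial>lborel) \<le> of_nat 0 * emeasure lborel Z"
    using nn_integral_det_le_multiplicity[where U = U and J = J and f = f and Z = Z and M = 0 and Q = Z and S = S] assms m
    by blast
  then have 0: "(\<integral>\<^sup>+x. ennreal \<bar>det (J x)\<bar> * indicator S x \<partial>lborel) = 0" by simp
  have cdet: "continuous_on U (%x. det (J x))"
    using contJ unfolding det_def by (intro continuous_intros) auto
  have "(%x. indicator U x *\<^sub>R det (J x)) \<in> borel_measurable borel"
    using \<open>open U\<close> by (intro borel_measurable_continuous_on_indicator cdet) auto
  then have "(%x. ennreal \<bar>indicator U x *\<^sub>R det (J x)\<bar> * indicator S x) \<in> borel_measurable borel"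
    using S by (intro borel_measurable_times_ennreal) auto
  also have "(%x. ennreal \<bar>indicator U x *\<^sub>R det (J x)\<bar> * indicator S x) = (%x. ennreal \<bar>det (J x)\<bar> * indicator S x)"
    using S by (auto simp: indicator_def fun_eq_iff)
  finally have "AE x in lborel. ennreal \<bar>det (J x)\<bar> * indicator S x = 0"
    using 0 by (subst (asm) nn_integral_0_iff_AE) auto
  then have "AE x in lborel. x \<notin> S"
    by eventually_elim (use ne in \<open>auto simp: indicator_def split: if_splits\<close>)
  then show ?thesis using S(1) by (simp add: AE_iff_null_sets)
qed

lemma emeasure_linear_image:
  fixes T :: "real ^ 'n::finite ^ 'n"
  assumes A: "A \<in> sets borel" "bounded A" and T: "invertible T"
  shows "(*v) T ` A \<in> sets borel" "emeasure lborel ((*v) T ` A) = ennreal \<bar>det T\<bar> * emeasure lborel A"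
proof -
  obtain T' where TT: "T' ** T = mat 1" "T ** T' = mat 1" using T by (auto simp: invertible_def)
  have vim: "(*v) M ` X = (*v) M' -` X" if "M' ** M = mat 1" "M ** M' = mat 1" for M M' :: "real ^ 'n ^ 'n" and X
    using that by (auto simp: matrix_vector_mul_assoc image_iff)
      (metis matrix_vector_mul_assoc matrix_vector_mul_lid)
  have meas: "(*v) M \<in> borel_measurable borel" for M :: "real ^ 'n ^ 'n"
    by (intro borel_measurable_continuous_onI linear_continuous_on) simp
  have img: "(*v) M ` X \<in> sets borel" if "M' ** M = mat 1" "M ** M' = mat 1" "X \<in> sets borel" for M M' :: "real ^ 'n ^ 'n" and X
    unfolding vim[OF that(1,2)] using measurable_sets[OF meas that(3)] by simp
  have le: "ennreal \<bar>det M\<bar> * emeasure lborel X \<le> emeasure lborel ((*v) M ` X)"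
    if M: "M' ** M = mat 1" "M ** M' = mat 1" and X: "X \<in> sets borel" "bounded X" for M M' :: "real ^ 'n ^ 'n" and X
  proof -
    have inj: "inj_on ((*v) M) Y" for Y
      using M(1) by (intro inj_on_inverseI[of _ "(*v) M'"]) (simp add: matrix_vector_mul_assoc)
    have "(\<integral>\<^sup>+x. ennreal \<bar>det M\<bar> * indicator X x \<partial>lborel) \<le> of_nat 1 * emeasure lborel ((*v) M ` X)"
    proof (rule nn_integral_det_le_multiplicity[where U = UNIV and Z = "{}" and J = "%_. M"])
      fix y F assume F: "finite F" "F \<subseteq> {x \<in> X. M *v x = y}"
      show "card F \<le> 1"
        using F inj[of UNIV] by (intro card_le_Suc0_iff_eq[THEN iffD2, unfolded One_nat_def[symmetric]]) (auto simp: inj_def)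
    qed (use X img[OF M X(1)] in \<open>auto intro!: bounded_linear_image bounded_linear_imp_has_derivative\<close>)
    then show ?thesis using X by (simp add: nn_integral_cmult_indicator)
  qed
  show TA: "(*v) T ` A \<in> sets borel" by (rule img[OF TT A(1)])
  have bT: "bounded ((*v) T ` A)" by (intro bounded_linear_image A) simp
  have bk: "(*v) T' ` (*v) T ` A = A"
    using TT by (auto simp: image_image matrix_vector_mul_assoc)
  have dd: "\<bar>det T\<bar> * \<bar>det T'\<bar> = 1"
    using TT(2) by (metis abs_mult abs_one det_I det_mul)
  have "emeasure lborel ((*v) T ` A) = ennreal (\<bar>det T\<bar> * \<bar>det T'\<bar>) * emeasure lborel ((*v) T ` A)" by (simp add: dd)
  also have "\<dots> = ennreal \<bar>det T\<bar> * (ennreal \<bar>det T'\<bar> * emeasure lborel ((*v) T ` A))"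
    by (simp add: ennreal_mult' mult.assoc)
  also have "\<dots> \<le> ennreal \<bar>det T\<bar> * emeasure lborel A"
    using le[OF TT(2,1) TA bT] by (intro mult_left_mono) (auto simp: bk)
  finally show "emeasure lborel ((*v) T ` A) = ennreal \<bar>det T\<bar> * emeasure lborel A"
    using le[OF TT A] by (intro antisym) auto
qed

section \<open>Monomials\<close>

lemma finite_deg_le: "finite {\<gamma> :: 'i::finite => nat. (\<Sum>i\<in>UNIV. \<gamma> i) \<le> t}"
  and card_deg_le: "card {\<gamma> :: 'i::finite => nat. (\<Sum>i\<in>UNIV. \<gamma> i) \<le> t} \<le> (t + 1) ^ CARD('i)"
proof -
  have sub: "{\<gamma> :: 'i => nat. (\<Sum>i\<in>UNIV. \<gamma> i) \<le> t} \<subseteq> (UNIV :: 'i set) \<rightarrow>\<^sub>E {..t}"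
    by (auto simp: PiE_def Pi_def) (meson UNIV_I finite member_le_sum order_trans zero_le)
  have fin: "finite ((UNIV :: 'i set) \<rightarrow>\<^sub>E {..t})" by (intro finite_PiE) auto
  show "finite {\<gamma> :: 'i => nat. (\<Sum>i\<in>UNIV. \<gamma> i) \<le> t}" by (rule finite_subset[OF sub fin])
  have "card {\<gamma> :: 'i => nat. (\<Sum>i\<in>UNIV. \<gamma> i) \<le> t} \<le> card ((UNIV :: 'i set) \<rightarrow>\<^sub>E {..t})"
    by (rule card_mono[OF fin sub])
  then show "card {\<gamma> :: 'i => nat. (\<Sum>i\<in>UNIV. \<gamma> i) \<le> t} \<le> (t + 1) ^ CARD('i)"
    by (simp add: card_PiE)
qed

text \<open>Monomials in an arbitrary finite family of functions \<open>u\<close>. The coordinates give ordinary polynomials; other families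
  are used to find algebraic relations between rational functions.\<close>

definition gmon :: "('i::finite => 'a => real) => ('i => nat) => 'a => real" where
  "gmon u \<gamma> x = (\<Prod>i\<in>UNIV. u i x ^ \<gamma> i)"

definition gpol :: "('i::finite => 'a => real) => nat => ('a => real) => bool" where
  "gpol u t f \<longleftrightarrow> (\<exists>c. \<forall>x. f x = (\<Sum>\<gamma> | (\<Sum>i\<in>UNIV. \<gamma> i) \<le> t. c \<gamma> * gmon u \<gamma> x))"

lemma gmon_add: "gmon u (%i. \<gamma> i + \<delta> i) x = gmon u \<gamma> x * gmon u \<delta> x"
  by (simp add: gmon_def power_add prod.distrib)

lemma gmon_0 [simp]: "gmon u (%_. 0) x = 1"
  by (simp add: gmon_def)

lemma gmon_single: "gmon u (%j. if j = i then n else 0) x = u i x ^ n"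
proof -
  have "gmon u (%j. if j = i then n else 0) x = (\<Prod>j\<in>UNIV. if j = i then u j x ^ n else 1)"
    unfolding gmon_def by (rule prod.cong) auto
  then show ?thesis by simp
qed

lemma gpol_cong: "gpol u t f ==> (!!x. f x = g x) ==> gpol u t g"
  by (simp add: gpol_def)

lemma gpol_gmon: "(\<Sum>i\<in>UNIV. \<gamma> i) \<le> t ==> gpol u t (gmon u \<gamma>)"
  unfolding gpol_def
  by (intro exI[of _ "%\<delta>. if \<delta> = \<gamma> then 1 else 0"])
    (simp add: finite_deg_le if_distrib[of "%x. x * _"] sum.delta cong: if_cong)

lemma gpol_add:
  assumes "gpol u t f" "gpol u t g" shows "gpol u t (%x. f x + g x)"
proof -
  obtain c d where "\<forall>x. f x = (\<Sum>\<gamma> | (\<Sum>i\<in>UNIV. \<gamma> i) \<le> t. c \<gamma> * gmon u \<gamma> x)"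
    "\<forall>x. g x = (\<Sum>\<gamma> | (\<Sum>i\<in>UNIV. \<gamma> i) \<le> t. d \<gamma> * gmon u \<gamma> x)"
    using assms by (auto simp: gpol_def)
  then show ?thesis unfolding gpol_def
    by (intro exI[of _ "%\<gamma>. c \<gamma> + d \<gamma>"]) (simp add: sum.distrib algebra_simps)
qed

lemma gpol_cmult:
  assumes "gpol u t f" shows "gpol u t (%x. a * f x)"
proof -
  obtain c where "\<forall>x. f x = (\<Sum>\<gamma> | (\<Sum>i\<in>UNIV. \<gamma> i) \<le> t. c \<gamma> * gmon u \<gamma> x)"
    using assms by (auto simp: gpol_def)
  then show ?thesis unfolding gpol_def
    by (intro exI[of _ "%\<gamma>. a * c \<gamma>"]) (simp add: sum_distrib_left algebra_simps)
qed

lemma gpol_const: "gpol u t (%_. a)"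
  using gpol_cmult[OF gpol_gmon[of "%_. 0" t u], of a] by simp

lemma gpol_sum: "(!!i. i \<in> I ==> gpol u t (f i)) ==> gpol u t (%x. \<Sum>i\<in>I. f i x)"
  by (induction I rule: infinite_finite_induct) (auto intro: gpol_const gpol_add)

lemma gpol_mult:
  assumes "gpol u s f" "gpol u t g" shows "gpol u (s + t) (%x. f x * g x)"
proof -
  obtain c d where c: "\<forall>x. f x = (\<Sum>\<gamma> | (\<Sum>i\<in>UNIV. \<gamma> i) \<le> s. c \<gamma> * gmon u \<gamma> x)"
    and d: "\<forall>x. g x = (\<Sum>\<gamma> | (\<Sum>i\<in>UNIV. \<gamma> i) \<le> t. d \<gamma> * gmon u \<gamma> x)"
    using assms by (auto simp: gpol_def)
  have "gpol u (s + t) (%x. \<Sum>\<gamma> | (\<Sum>i\<in>UNIV. \<gamma> i) \<le> s. \<Sum>\<delta> | (\<Sum>i\<in>UNIV. \<delta> i) \<le> t.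
      (c \<gamma> * d \<delta>) * gmon u (%i. \<gamma> i + \<delta> i) x)"
    by (intro gpol_sum gpol_cmult gpol_gmon) (auto simp: sum.distrib)
  then show ?thesis
    by (rule gpol_cong) (simp add: c d sum_product gmon_add algebra_simps)
qed

lemma gpol_mono:
  assumes "gpol u s f" "s \<le> t" shows "gpol u t f"
proof -
  obtain c where c: "\<forall>x. f x = (\<Sum>\<gamma> | (\<Sum>i\<in>UNIV. \<gamma> i) \<le> s. c \<gamma> * gmon u \<gamma> x)"
    using assms by (auto simp: gpol_def)
  have "gpol u t (%x. \<Sum>\<gamma> | (\<Sum>i\<in>UNIV. \<gamma> i) \<le> s. c \<gamma> * gmon u \<gamma> x)"
    using assms(2) by (intro gpol_sum gpol_cmult gpol_gmon) auto
  then show ?thesis by (rule gpol_cong) (simp add: c)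
qed

lemma gpol_coord: "1 \<le> t ==> gpol u t (u i)"
  by (rule gpol_cong[OF gpol_gmon[of "%j. if j = i then 1 else 0"]]) (auto simp: gmon_single)

lemma gpol_power: "gpol u t f ==> gpol u (n * t) (%x. f x ^ n)"
  by (induction n) (auto intro: gpol_const dest: gpol_mult)

lemma gpol_prod: "finite I ==> (!!i. i \<in> I ==> gpol u t (f i)) ==> gpol u (card I * t) (%x. \<Prod>i\<in>I. f i x)"
  by (induction I rule: finite_induct) (auto intro: gpol_const dest: gpol_mult)

lemma real_polynomial_function_gpol:
  assumes lin: "!!f. bounded_linear f ==> gpol u 1 f"
  shows "real_polynomial_function f ==> \<exists>t. gpol u t f"
proof (induction rule: real_polynomial_function.induct)
  case (add f g)
  then obtain s t where "gpol u s f" "gpol u t g" by auto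
  then have "gpol u (max s t) (%x. f x + g x)" by (intro gpol_add) (auto elim: gpol_mono)
  then show ?case by blast
qed (use lin gpol_const gpol_mult in blast)+

section \<open>Directional derivatives\<close>

definition dv :: "'a::real_normed_vector => ('a => real) => 'a => real" where
  "dv v f x = deriv (%t. f (x + t *\<^sub>R v)) 0"

lemma DERIV_line:
  assumes "(f has_derivative f') (at x)"
  shows "((%t. f (x + t *\<^sub>R v)) has_field_derivative f' v) (at 0)"
proof -
  have lin: "linear f'" using assms has_derivative_linear by blast
  have "((%t. x + t *\<^sub>R v) has_derivative (%t. t *\<^sub>R v)) (at (0::real))"
    by (auto intro!: derivative_eq_intros)
  moreover have "(f has_derivative f') (at (x + 0 *\<^sub>R v))" using assms by simp
  ultimately have "((%t. f (x + t *\<^sub>R v)) has_derivative (%t. f' (t *\<^sub>R v))) (at 0)"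
    by (rule has_derivative_compose)
  moreover have "(%t. f' (t *\<^sub>R v)) = (*) (f' v)"
    using lin by (auto simp: linear_cmul fun_eq_iff)
  ultimately show ?thesis
    by (simp add: has_field_derivative_def)
qed

lemma has_derivative_dv: "(f has_derivative f') (at x) ==> dv v f x = f' v"
  unfolding dv_def by (rule DERIV_imp_deriv) (rule DERIV_line)

lemma dv_frechet: "f differentiable (at x) ==> dv v f x = frechet_derivative f (at x) v"
  by (rule has_derivative_dv) (simp add: frechet_derivative_works)

lemma dv_add: "f differentiable (at x) ==> g differentiable (at x) ==> dv v (%x. f x + g x) x = dv v f x + dv v g x"
  by (subst has_derivative_dv[OF has_derivative_add[OF frechet_derivative_works[THEN iffD1] frechet_derivative_works[THEN iffD1]]])
    (auto simp: dv_frechet)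

lemma dv_mult: "f differentiable (at x) ==> g differentiable (at x) ==>
    dv v (%x. f x * g x) x = f x * dv v g x + dv v f x * g x"
  by (subst has_derivative_dv[OF has_derivative_mult[OF frechet_derivative_works[THEN iffD1] frechet_derivative_works[THEN iffD1]]])
    (auto simp: dv_frechet)

lemma dv_const [simp]: "dv v (%_. c) x = 0"
  by (subst has_derivative_dv[OF has_derivative_const]) simp

lemma dv_cmult: "f differentiable (at x) ==> dv v (%x. c * f x) x = c * dv v f x"
  using dv_mult[of "%_. c" x f v] by simp

lemma dv_sum:
  assumes "!!i. i \<in> I ==> f i differentiable (at x)"
  shows "dv v (%x. \<Sum>i\<in>I. f i x) x = (\<Sum>i\<in>I. dv v (f i) x)"
  using assms
proof (induction I rule: infinite_finite_induct)
  case (insert i I)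
  then have "(%x. \<Sum>i\<in>I. f i x) differentiable (at x)" by (intro differentiable_sum) auto
  then show ?case using insert dv_add[of "f i" x "%x. \<Sum>i\<in>I. f i x" v] by simp
qed auto

lemma dv_divide:
  assumes "f differentiable (at x)" "g differentiable (at x)" "g x \<noteq> 0"
  shows "dv v (%x. f x / g x) x = (dv v f x * g x - f x * dv v g x) / (g x * g x)"
  using has_derivative_dv[OF has_derivative_divide'[OF assms(1,2)[unfolded frechet_derivative_works] assms(3)], of v]
  by (simp add: dv_frechet assms)

lemma dv_transform:
  assumes "open U" "x \<in> U" "!!y. y \<in> U ==> f y = g y" shows "dv v f x = dv v g x"
  unfolding dv_def
proof (rule deriv_cong_ev[OF _ refl])
  have "((%t. x + t *\<^sub>R v) \<longlongrightarrow> x + 0 *\<^sub>R v) (nhds 0)"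
    by (intro tendsto_intros filterlim_ident)
  then have "\<forall>\<^sub>F t in nhds 0. x + t *\<^sub>R v \<in> U"
    using assms(1,2) by (auto intro: topological_tendstoD)
  then show "\<forall>\<^sub>F t in nhds 0. f (x + t *\<^sub>R v) = g (x + t *\<^sub>R v)"
    by eventually_elim (rule assms(3))
qed

lemma dv_axis_expand:
  fixes f :: "real ^ 'n::finite => real"
  assumes "f differentiable (at x)"
  shows "dv v f x = (\<Sum>s\<in>UNIV. v $ s * dv (axis s 1) f x)"
proof -
  let ?f' = "frechet_derivative f (at x)"
  have lin: "linear ?f'" using assms by (rule linear_frechet_derivative)
  have "v = (\<Sum>s\<in>UNIV. v $ s *\<^sub>R axis s 1)"
    by (simp add: vec_eq_iff axis_def if_distrib[of "%x. _ * x"] cong: if_cong)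
  then have "?f' v = ?f' (\<Sum>s\<in>UNIV. v $ s *\<^sub>R axis s 1)" by simp
  also have "\<dots> = (\<Sum>s\<in>UNIV. v $ s * ?f' (axis s 1))"
    using lin by (simp add: linear_sum linear_cmul)
  finally show ?thesis by (simp add: dv_frechet assms)
qed

section \<open>Polynomials and rational functions of one vector variable\<close>

abbreviation mon :: "('n::finite => nat) => real ^ 'n => real" where "mon \<equiv> gmon (%l x. x $ l)"
abbreviation pol :: "nat => (real ^ 'n::finite => real) => bool" where "pol \<equiv> gpol (%l x. x $ l)"

lemma real_polynomial_function_coord: "real_polynomial_function (%x :: real ^ 'n::finite. x $ l)"
  by (rule real_polynomial_function.intros(1)) (rule bounded_linear_vec_nth)

lemma real_polynomial_function_mon: "real_polynomial_function (mon \<gamma>)"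
  unfolding gmon_def[abs_def]
  by (intro real_polynomial_function_prod real_polynomial_function_power real_polynomial_function_coord) auto

lemma pol_imp_real_polynomial_function:
  assumes "pol t f" shows "real_polynomial_function f"
proof -
  obtain c where "f = (%x. \<Sum>\<gamma> | (\<Sum>i\<in>UNIV. \<gamma> i) \<le> t. c \<gamma> * mon \<gamma> x)"
    using assms by (auto simp: gpol_def fun_eq_iff)
  then show ?thesis
    by (auto intro!: real_polynomial_function_sum real_polynomial_function.intros(2,4) real_polynomial_function_mon finite_deg_le)
qed

lemma pol_differentiable: "pol t f ==> f differentiable (at x)"
  by (intro differentiable_at_real_polynomial_function pol_imp_real_polynomial_function)

lemma real_polynomial_function_imp_pol:
  fixes f :: "real ^ 'n::finite => real"
  assumes "real_polynomial_function f" shows "\<exists>t. pol t f"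
proof (rule real_polynomial_function_gpol[OF _ assms])
  fix f :: "real ^ 'n => real" assume "bounded_linear f"
  then have lin: "linear f" by (rule bounded_linear.linear)
  have eq: "f x = (\<Sum>s\<in>UNIV. f (axis s 1) * x $ s)" for x
  proof -
    have "x = (\<Sum>s\<in>UNIV. x $ s *\<^sub>R axis s 1)"
      by (simp add: vec_eq_iff axis_def if_distrib[of "%x. _ * x"] cong: if_cong)
    then have "f x = f (\<Sum>s\<in>UNIV. x $ s *\<^sub>R axis s 1)" by simp
    also have "\<dots> = (\<Sum>s\<in>UNIV. x $ s * f (axis s 1))"
      using lin by (simp add: linear_sum linear_cmul)
    finally show ?thesis by (simp add: mult.commute)
  qed
  have "pol 1 (%x. \<Sum>s\<in>UNIV. f (axis s 1) * x $ s)"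
    by (intro gpol_sum gpol_cmult gpol_coord) auto
  then show "pol 1 f" by (rule gpol_cong) (rule eq[symmetric])
qed

lemma dv_mon: "dv (axis l 1) (mon \<gamma>) x = real (\<gamma> l) * mon (\<gamma>(l := \<gamma> l - 1)) x"
proof -
  let ?R = "\<Prod>j\<in>UNIV - {l}. (x $ j) ^ \<gamma> j"
  have split: "mon \<delta> y = (y $ l) ^ \<delta> l * (\<Prod>j\<in>UNIV - {l}. (y $ j) ^ \<delta> j)" for \<delta> y
    unfolding gmon_def by (subst prod.remove[of _ l]) auto
  have eq: "mon \<gamma> (x + t *\<^sub>R axis l 1) = (x $ l + t) ^ \<gamma> l * ?R" for t
    unfolding split by (auto intro!: prod.cong simp: axis_def)
  have "((%t. (x $ l + t) ^ \<gamma> l * ?R) has_field_derivative real (\<gamma> l) * (x $ l + 0) ^ (\<gamma> l - 1) * ?R) (at 0)"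
    by (auto intro!: derivative_eq_intros)
  then have "dv (axis l 1) (mon \<gamma>) x = real (\<gamma> l) * (x $ l) ^ (\<gamma> l - 1) * ?R"
    unfolding dv_def eq by (auto dest: DERIV_imp_deriv)
  then show ?thesis unfolding split[of "\<gamma>(l := \<gamma> l - 1)"] by simp
qed

lemma mon_differentiable: "mon \<gamma> differentiable (at x)"
  by (intro differentiable_at_real_polynomial_function real_polynomial_function_mon)

lemma sum_fun_upd_le: "(\<Sum>i\<in>UNIV. (\<gamma>(l := \<gamma> l - 1)) i) \<le> (\<Sum>i\<in>UNIV. \<gamma> i :: nat)" for \<gamma> :: "'i::finite => nat"
  by (rule sum_mono) auto

lemma pol_dv:
  assumes "pol t f" shows "pol t (dv (axis l 1) f)"
proof -
  obtain c where c: "f = (%x. \<Sum>\<gamma> | (\<Sum>i\<in>UNIV. \<gamma> i) \<le> t. c \<gamma> * mon \<gamma> x)"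
    using assms by (auto simp: gpol_def fun_eq_iff)
  have "pol t (%x. \<Sum>\<gamma> | (\<Sum>i\<in>UNIV. \<gamma> i) \<le> t. c \<gamma> * (real (\<gamma> l) * mon (\<gamma>(l := \<gamma> l - 1)) x))"
    by (intro gpol_sum gpol_cmult gpol_gmon, rule order_trans[OF sum_fun_upd_le]) simp
  then show ?thesis
    by (rule gpol_cong)
      (simp add: c dv_sum dv_cmult mon_differentiable dv_mon)
qed

lemma real_polynomial_function_dv:
  assumes "real_polynomial_function f" shows "real_polynomial_function (dv v f)"
  using assms
proof (induction rule: real_polynomial_function.induct)
  case (linear f)
  then have "dv v f = (%_. f v)"
    by (intro ext has_derivative_dv bounded_linear_imp_has_derivative)
  then show ?case by (simp add: real_polynomial_function.intros(2))
next
  case (const c)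
  have "dv v (%x. c) = (%_. 0)" by (intro ext dv_const)
  then show ?case by (simp add: real_polynomial_function.intros(2))
next
  case (add f g)
  have "dv v (%x. f x + g x) = (%x. dv v f x + dv v g x)"
    by (intro ext dv_add differentiable_at_real_polynomial_function add)
  then show ?case using add by (simp add: real_polynomial_function.intros(3))
next
  case (mult f g)
  have "dv v (%x. f x * g x) = (%x. f x * dv v g x + dv v f x * g x)"
    by (intro ext dv_mult differentiable_at_real_polynomial_function mult)
  then show ?case using mult by (simp add: real_polynomial_function.intros(3,4))
qed

lemma continuous_on_pol: "pol t f ==> continuous_on S f"
  by (intro continuous_at_imp_continuous_on ballI continuous_real_polymonial_function pol_imp_real_polynomial_function)

text \<open>The degree \<open>t\<close> bounds numerator and denominator, and the denominator has no zero on \<open>U\<close>.\<close>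

definition rat :: "(real ^ 'n::finite) set => nat => (real ^ 'n => real) => bool" where
  "rat U t f \<longleftrightarrow> (\<exists>A B. pol t A \<and> pol t B \<and> (\<forall>x\<in>U. B x \<noteq> 0 \<and> f x = A x / B x))"

lemma rat_mono: "rat U s f ==> V \<subseteq> U ==> s \<le> t ==> rat V t f"
  unfolding rat_def by (meson gpol_mono subsetD)

lemma rat_cong: "rat U t f ==> (!!x. x \<in> U ==> f x = g x) ==> rat U t g"
  by (simp add: rat_def)

lemma rat_pol: "pol t f ==> rat U t f"
  unfolding rat_def by (intro exI[of _ f] exI[of _ "%_. 1"]) (auto intro: gpol_const)

lemma rat_const: "rat U t (%_. a)"
  by (intro rat_pol gpol_const)

lemma rat_add:
  assumes "rat U s f" "rat U t g" shows "rat U (s + t) (%x. f x + g x)"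
proof -
  obtain A B A' B' where *: "pol s A" "pol s B" "\<forall>x\<in>U. B x \<noteq> 0 \<and> f x = A x / B x"
    "pol t A'" "pol t B'" "\<forall>x\<in>U. B' x \<noteq> 0 \<and> g x = A' x / B' x"
    using assms by (auto simp: rat_def)
  have "pol (s + t) (%x. A x * B' x + B x * A' x)" "pol (s + t) (%x. B x * B' x)"
    using * by (auto intro!: gpol_add gpol_mult)
  then show ?thesis unfolding rat_def
    by (intro exI[of _ "%x. A x * B' x + B x * A' x"] exI[of _ "%x. B x * B' x"])
      (use * in \<open>auto simp: field_simps\<close>)
qed

lemma rat_mult:
  assumes "rat U s f" "rat U t g" shows "rat U (s + t) (%x. f x * g x)"
proof -
  obtain A B A' B' where *: "pol s A" "pol s B" "\<forall>x\<in>U. B x \<noteq> 0 \<and> f x = A x / B x"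
    "pol t A'" "pol t B'" "\<forall>x\<in>U. B' x \<noteq> 0 \<and> g x = A' x / B' x"
    using assms by (auto simp: rat_def)
  have "pol (s + t) (%x. A x * A' x)" "pol (s + t) (%x. B x * B' x)"
    using * by (auto intro!: gpol_mult)
  then show ?thesis unfolding rat_def
    by (intro exI[of _ "%x. A x * A' x"] exI[of _ "%x. B x * B' x"]) (use * in auto)
qed

lemma rat_cmult: "rat U t f ==> rat U t (%x. a * f x)"
  using rat_mult[OF rat_const[of U 0 a], of t f] by simp

lemma rat_divide:
  assumes "rat U s f" "rat U t g" "!!x. x \<in> U ==> g x \<noteq> 0" shows "rat U (s + t) (%x. f x / g x)"
proof -
  obtain A B A' B' where *: "pol s A" "pol s B" "\<forall>x\<in>U. B x \<noteq> 0 \<and> f x = A x / B x"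
    "pol t A'" "pol t B'" "\<forall>x\<in>U. B' x \<noteq> 0 \<and> g x = A' x / B' x"
    using assms by (auto simp: rat_def)
  have "pol (s + t) (%x. A x * B' x)" "pol (s + t) (%x. B x * A' x)"
    using * by (auto intro!: gpol_mult)
  then show ?thesis unfolding rat_def
    by (intro exI[of _ "%x. A x * B' x"] exI[of _ "%x. B x * A' x"]) (use * assms(3) in auto)
qed

lemma rat_sum: "finite I ==> (!!i. i \<in> I ==> rat U t (f i)) ==> rat U (card I * t) (%x. \<Sum>i\<in>I. f i x)"
  by (induction I rule: finite_induct) (auto intro: rat_const dest: rat_add)

lemma rat_prod: "finite I ==> (!!i. i \<in> I ==> rat U t (f i)) ==> rat U (card I * t) (%x. \<Prod>i\<in>I. f i x)"
  by (induction I rule: finite_induct) (auto intro: rat_const dest: rat_mult)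

lemma rat_det:
  fixes a :: "real ^ 'n::finite => 'm::finite => 'm => real"
  assumes "!!i j. rat U t (%x. a x i j)"
  shows "rat U (card {p. p permutes (UNIV::'m set)} * (CARD('m) * t)) (%x. det (\<chi> i j. a x i j))"
  unfolding det_def using assms by (auto intro!: rat_sum rat_cmult rat_prod finite_permutations)

lemma rat_differentiable:
  assumes "rat U t f" "open U" "x \<in> U" shows "f differentiable (at x)"
proof -
  obtain A B where *: "pol t A" "pol t B" "\<forall>x\<in>U. B x \<noteq> 0 \<and> f x = A x / B x"
    using assms by (auto simp: rat_def)
  have "(%x. A x / B x) differentiable (at x)"
    using * assms by (intro differentiable_divide pol_differentiable) auto
  then obtain D where "((%x. A x / B x) has_derivative D) (at x)" by (auto simp: differentiable_def)
  then have "(f has_derivative D) (at x)"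
    by (rule has_derivative_transform_within_open[OF _ assms(2,3)]) (use * in auto)
  then show ?thesis by (auto simp: differentiable_def)
qed

lemma rat_dv_axis:
  assumes "rat U t f" "open U" shows "rat U (2 * t) (dv (axis l 1) f)"
proof -
  obtain A B where *: "pol t A" "pol t B" "\<forall>x\<in>U. B x \<noteq> 0 \<and> f x = A x / B x"
    using assms by (auto simp: rat_def)
  define A' where "A' x = dv (axis l 1) A x * B x + (- 1) * (A x * dv (axis l 1) B x)" for x
  have "pol (t + t) A'"
    unfolding A'_def[abs_def] by (intro gpol_add gpol_cmult gpol_mult pol_dv *)
  moreover have "pol (t + t) (%x. B x * B x)" by (intro gpol_mult *)
  moreover have "B x * B x \<noteq> 0 \<and> dv (axis l 1) f x = A' x / (B x * B x)" if "x \<in> U" for x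
  proof -
    have "dv (axis l 1) f x = dv (axis l 1) (%x. A x / B x) x"
      by (rule dv_transform[OF assms(2) that]) (use * in auto)
    then show ?thesis using *(3) that by (simp add: A'_def dv_divide pol_differentiable[OF *(1)] pol_differentiable[OF *(2)])
  qed
  ultimately show ?thesis unfolding rat_def mult_2 by blast
qed

lemma rat_continuous_on: "rat U t f ==> open U ==> continuous_on U f"
  by (meson continuous_at_imp_continuous_on differentiable_imp_continuous_within rat_differentiable)

section \<open>Zero sets\<close>

definition jac :: "('n => real ^ 'n::finite => real) => real ^ 'n => real ^ 'n ^ 'n" where
  "jac f x = (\<chi> i s. dv (axis s 1) (f i) x)"

lemma has_derivative_jac:
  assumes "!!i. f i differentiable (at x)"
  shows "((%x. \<chi> i. f i x) has_derivative (*v) (jac f x)) (at x)"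
proof (subst has_derivative_componentwise_within, rule ballI)
  fix b :: "real ^ 'a" assume "b \<in> Basis"
  then obtain i where b: "b = axis i 1" by (auto simp: Basis_vec_def)
  have "(f i has_derivative frechet_derivative (f i) (at x)) (at x)"
    using assms by (simp add: frechet_derivative_works)
  moreover have "frechet_derivative (f i) (at x) = (%v. (jac f x *v v) \<bullet> b)"
  proof
    fix v
    have "frechet_derivative (f i) (at x) v = dv v (f i) x" by (rule dv_frechet[OF assms, symmetric])
    also have "\<dots> = (\<Sum>s\<in>UNIV. v $ s * dv (axis s 1) (f i) x)" by (rule dv_axis_expand[OF assms])
    also have "\<dots> = (jac f x *v v) \<bullet> b"
      by (simp add: b inner_axis jac_def matrix_vector_mult_def mult.commute)
    finally show "frechet_derivative (f i) (at x) v = (jac f x *v v) \<bullet> b" .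
  qed
  ultimately show "((%x. (\<chi> i. f i x) \<bullet> b) has_derivative (%v. (jac f x *v v) \<bullet> b)) (at x)"
    by (simp add: b inner_axis)
qed

lemma continuous_on_jac:
  assumes "!!i. rat U t (f i)" "open U" shows "continuous_on U (jac f)"
  unfolding jac_def[abs_def]
  by (intro continuous_on_vec_lambda rat_continuous_on[OF rat_dv_axis[OF assms] assms(2)])

lemma det_identity_row:
  fixes v :: "real ^ 'n::finite"
  shows "det (\<chi> i. if i = l then v else axis i 1) = v $ l"
proof -
  have 1: "(\<Sum>i\<in>UNIV. v $ i *s row i (mat 1 :: real ^ 'n ^ 'n)) = v"
    by (simp add: row_def mat_def vec_eq_iff if_distrib[of "%x. _ * x"] cong: if_cong)
  have 2: "row i (mat 1 :: real ^ 'n ^ 'n) = axis i 1" for i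
    by (auto simp: row_def mat_def axis_def vec_eq_iff)
  show ?thesis using cramer_lemma_transpose[of l v "mat 1", unfolded 1, unfolded 2] by simp
qed

text \<open>Where a partial derivative of \<open>P\<close> does not vanish, replacing the corresponding coordinate by \<open>P\<close> gives a
  map with nonzero Jacobian, and the zero set is the preimage of a hyperplane.\<close>

lemma null_zero_set_smooth:
  fixes P :: "real ^ 'n::finite => real"
  assumes P: "pol t P"
  shows "{x. P x = 0 \<and> dv (axis l 1) P x \<noteq> 0} \<in> null_sets lborel"
proof -
  let ?S = "%m. {x. P x = 0 \<and> dv (axis l 1) P x \<noteq> 0} \<inter> cball 0 (real m)"
  define f where "f i = (if i = l then P else (%x. x $ i))" for i
  have coord: "pol 1 (%x :: real ^ 'n. x $ i)" for i by (rule gpol_coord) simp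
  have polf: "pol (max t 1) (f i)" for i
    using gpol_mono[OF P, of "max t 1"] gpol_mono[OF coord, of "max t 1"] by (simp add: f_def)
  have dcoord: "dv (axis s 1) (%x. x $ i) x = (axis i 1 :: real ^ 'n) $ s" for i s and x :: "real ^ 'n"
    using has_derivative_dv[OF bounded_linear_imp_has_derivative[OF bounded_linear_vec_nth], of "axis s 1" i x]
    by (simp add: axis_def)
  have jac: "det (jac f x) = dv (axis l 1) P x" for x
  proof -
    have "jac f x = (\<chi> i. if i = l then (\<chi> s. dv (axis s 1) P x) else axis i 1)"
      by (auto simp: jac_def f_def dcoord vec_eq_iff)
    then show ?thesis by (simp add: det_identity_row)
  qed
  have Pc: "closed {x. P x = 0}"
    using continuous_on_pol[OF P] by (intro closed_Collect_eq continuous_on_const) auto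
  have Dc: "open {x. dv (axis l 1) P x \<noteq> 0}"
    using continuous_on_pol[OF pol_dv[OF P]] by (intro open_Collect_neq continuous_on_const) auto
  have borel: "?S m \<in> sets borel" for m
  proof -
    have "?S m = {x. P x = 0} \<inter> {x. dv (axis l 1) P x \<noteq> 0} \<inter> cball 0 (real m)" by auto
    then show ?thesis using Pc Dc by auto
  qed
  have "?S m \<in> null_sets lborel" for m
  proof (rule null_set_preimage_Jacobian[where U = UNIV and f = "%x. \<chi> i. f i x" and J = "jac f"
        and Z = "{y. y $ l = 0} \<inter> cbox (\<chi> i. - real m) (\<chi> i. real m)"])
    show "((%x. \<chi> i. f i x) has_derivative (*v) (jac f x)) (at x)" for x
      by (rule has_derivative_jac) (rule pol_differentiable[OF polf])
    show "continuous_on UNIV (jac f)"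
      by (rule continuous_on_jac[OF rat_pol[OF polf]]) simp
    have "negligible {y :: real ^ 'n. axis l 1 \<bullet> y = 0}"
      by (rule negligible_hyperplane) (simp add: axis_eq_0_iff)
    then have "{y :: real ^ 'n. y $ l = 0} \<in> null_sets lebesgue"
      by (simp add: negligible_iff_null_sets inner_axis' )
    moreover have "{y :: real ^ 'n. y $ l = 0} \<in> sets borel"
      by (intro borel_closed closed_Collect_eq continuous_intros)
    ultimately have "{y :: real ^ 'n. y $ l = 0} \<in> null_sets lborel"
      by (simp add: null_sets_completion_iff)
    then show "{y. y $ l = 0} \<inter> cbox (\<chi> i. - real m) (\<chi> i. real m) \<in> null_sets lborel"
      by (rule null_set_Int2) simp
    show "(%x. \<chi> i. f i x) ` ?S m \<subseteq> {y. y $ l = 0} \<inter> cbox (\<chi> i. - real m) (\<chi> i. real m)"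
    proof safe
      fix x assume x: "x \<in> cball 0 (real m)" and P0: "P x = 0"
      show "(\<chi> i. f i x) $ l = 0" using P0 by (simp add: f_def)
      have "\<bar>f i x\<bar> \<le> real m" for i
        using x component_le_norm_cart[of x i] P0 by (auto simp: f_def)
      then show "(\<chi> i. f i x) \<in> cbox (\<chi> i. - real m) (\<chi> i. real m)"
        by (auto simp: mem_box_cart abs_le_iff minus_le_iff)
    qed
  qed (auto simp: jac borel)
  then have "(\<Union>m. ?S m) \<in> null_sets lborel" by (rule null_sets_UN)
  moreover have "(\<Union>m. ?S m) = {x. P x = 0 \<and> dv (axis l 1) P x \<noteq> 0}"
    by (auto simp: real_arch_simple)
  ultimately show ?thesis by simp
qed

text \<open>By induction on the degree: at a zero, either some partial derivative is nonzero, which is the smooth case, or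
  all of them vanish, and one of these is a nonzero polynomial of lower degree.\<close>

theorem null_zero_set:
  fixes c :: "('n::finite => nat) => real"
  assumes "(\<Sum>i\<in>UNIV. \<gamma> i) \<le> t" "c \<gamma> \<noteq> 0"
  shows "{x. (\<Sum>\<gamma> | (\<Sum>i\<in>UNIV. \<gamma> i) \<le> t. c \<gamma> * mon \<gamma> x) = 0} \<in> null_sets lborel"
  using assms
proof (induction t arbitrary: c \<gamma>)
  case 0
  then have "\<gamma> = (%_. 0)" by auto
  moreover have "{\<gamma> :: 'n => nat. (\<Sum>i\<in>UNIV. \<gamma> i) \<le> 0} = {%_. 0}" by auto
  ultimately show ?case using 0 by simp
next
  case (Suc t)
  let ?G = "%t. {\<gamma> :: 'n => nat. (\<Sum>i\<in>UNIV. \<gamma> i) \<le> t}"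
  define P where "P x = (\<Sum>\<gamma>\<in>?G (Suc t). c \<gamma> * mon \<gamma> x)" for x
  have P: "pol (Suc t) P" unfolding P_def[abs_def] by (intro gpol_sum gpol_cmult gpol_gmon) auto
  show ?case
  proof (cases "\<exists>\<gamma>\<in>?G (Suc t). c \<gamma> \<noteq> 0 \<and> \<gamma> \<noteq> (%_. 0)")
    case False
    then have "c \<delta> = 0" if "\<delta> \<in> ?G (Suc t)" "\<delta> \<noteq> (%_. 0)" for \<delta> using that by auto
    then have "P x = (\<Sum>\<gamma>\<in>{%_. 0}. c \<gamma> * mon \<gamma> x)" for x
      unfolding P_def by (intro sum.mono_neutral_right finite_deg_le) auto
    moreover have "\<gamma> = (%_. 0)" using False Suc.prems by auto
    ultimately have "{x. P x = 0} = {}" using Suc.prems by auto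
    then show ?thesis unfolding P_def by simp
  next
    case True
    then obtain \<delta> l where \<delta>: "\<delta> \<in> ?G (Suc t)" "c \<delta> \<noteq> 0" "0 < \<delta> l" by (auto simp: fun_eq_iff)
    define c' where "c' \<gamma> = real (\<gamma> l + 1) * c (\<gamma>(l := \<gamma> l + 1))" for \<gamma>
    have sum_upd: "(\<Sum>i\<in>UNIV. (\<gamma>(l := a)) i) = a + (\<Sum>i\<in>UNIV - {l}. \<gamma> i)" for \<gamma> :: "'n => nat" and a
      by (subst sum.remove[of _ l]) auto
    have sum_l: "(\<Sum>i\<in>UNIV. \<gamma> i) = \<gamma> l + (\<Sum>i\<in>UNIV - {l}. \<gamma> i)" for \<gamma> :: "'n => nat"
      by (subst sum.remove[of _ l]) auto
    have DP: "dv (axis l 1) P x = (\<Sum>\<gamma>\<in>?G t. c' \<gamma> * mon \<gamma> x)" for x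
    proof -
      have "dv (axis l 1) P x = (\<Sum>\<gamma>\<in>?G (Suc t). c \<gamma> * (real (\<gamma> l) * mon (\<gamma>(l := \<gamma> l - 1)) x))"
        unfolding P_def[abs_def] by (simp add: dv_sum dv_cmult mon_differentiable dv_mon)
      also have "\<dots> = (\<Sum>\<gamma>\<in>{\<gamma>\<in>?G (Suc t). 0 < \<gamma> l}. c \<gamma> * (real (\<gamma> l) * mon (\<gamma>(l := \<gamma> l - 1)) x))"
        by (intro sum.mono_neutral_right finite_deg_le) auto
      also have "\<dots> = (\<Sum>\<gamma>\<in>?G t. c' \<gamma> * mon \<gamma> x)"
        by (rule sum.reindex_bij_witness[of _ "%\<gamma>. \<gamma>(l := \<gamma> l + 1)" "%\<gamma>. \<gamma>(l := \<gamma> l - 1)"])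
          (auto simp: c'_def sum_upd sum_l)
      finally show ?thesis .
    qed
    have "c' (\<delta>(l := \<delta> l - 1)) \<noteq> 0" using \<delta> by (simp add: c'_def)
    moreover have "(\<Sum>i\<in>UNIV. (\<delta>(l := \<delta> l - 1)) i) \<le> t" unfolding sum_upd using \<delta> sum_l[of \<delta>] by simp
    ultimately have "{x. dv (axis l 1) P x = 0} \<in> null_sets lborel"
      unfolding DP using Suc.IH by blast
    then have "{x. dv (axis l 1) P x = 0} \<union> {x. P x = 0 \<and> dv (axis l 1) P x \<noteq> 0} \<in> null_sets lborel"
      using null_zero_set_smooth[OF P] by (rule null_sets.Un)
    moreover have "{x. P x = 0} \<in> sets lborel"
      using continuous_on_pol[OF P] by (intro borel_closed[THEN sets_lborel[THEN equalityD2, THEN subsetD]] closed_Collect_eq continuous_on_const) auto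
    ultimately have "{x. P x = 0} \<in> null_sets lborel"
      by (rule null_sets_subset) auto
    then show ?thesis unfolding P_def .
  qed
qed

corollary null_zero_set_pol:
  assumes "pol t P" "P x \<noteq> 0" shows "{x. P x = 0} \<in> null_sets lborel"
proof -
  obtain c where c: "\<forall>x. P x = (\<Sum>\<gamma> | (\<Sum>i\<in>UNIV. \<gamma> i) \<le> t. c \<gamma> * mon \<gamma> x)"
    using assms by (auto simp: gpol_def)
  have "\<exists>\<gamma>. (\<Sum>i\<in>UNIV. \<gamma> i) \<le> t \<and> c \<gamma> \<noteq> 0"
  proof (rule ccontr)
    assume "\<not> ?thesis"
    then have "P x = 0" unfolding c[rule_format] by (intro sum.neutral) auto
    then show False using assms by simp
  qed
  then show ?thesis using null_zero_set[of _ t c] c by auto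
qed

section \<open>Multiplicity of rational maps\<close>

text \<open>A homogeneous linear system with more unknowns than equations has a nontrivial solution.\<close>

lemma homogeneous_system:
  fixes a :: "'i => 'g => real"
  assumes "finite G" "finite I" "card G < card I"
  shows "\<exists>c. (\<exists>i\<in>I. c i \<noteq> 0) \<and> (\<forall>g\<in>G. (\<Sum>i\<in>I. c i * a i g) = 0)"
  using assms
proof (induction G arbitrary: I a rule: finite_induct)
  case empty
  then have "I \<noteq> {}" by auto
  then show ?case by (intro exI[of _ "%_. 1"]) auto
next
  case (insert g G)
  show ?case
  proof (cases "\<forall>i\<in>I. a i g = 0")
    case True
    have "card G < card I" using insert by simp
    then obtain c where "\<exists>i\<in>I. c i \<noteq> 0" "\<forall>g\<in>G. (\<Sum>i\<in>I. c i * a i g) = 0"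
      using insert.IH[OF insert.prems(1)] by blast
    then show ?thesis using True by (intro exI[of _ c]) auto
  next
    case False
    then obtain k where k: "k \<in> I" "a k g \<noteq> 0" by auto
    define a' where "a' i h = a i h - (a i g / a k g) * a k h" for i h
    have "card G < card (I - {k})" using insert k by simp
    then obtain c where c: "\<exists>i\<in>I - {k}. c i \<noteq> 0" "\<forall>h\<in>G. (\<Sum>i\<in>I - {k}. c i * a' i h) = 0"
      using insert.IH[of "I - {k}" a'] insert.prems(1) by blast
    define c' where "c' i = (if i = k then - (\<Sum>i\<in>I - {k}. c i * (a i g / a k g)) else c i)" for i
    have sum: "(\<Sum>i\<in>I. c' i * a i h) = (\<Sum>i\<in>I - {k}. c i * a' i h)" for h
    proof -
      have "(\<Sum>i\<in>I. c' i * a i h) = c' k * a k h + (\<Sum>i\<in>I - {k}. c' i * a i h)"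
        using insert.prems(1) k(1) by (rule sum.remove)
      also have "(\<Sum>i\<in>I - {k}. c' i * a i h) = (\<Sum>i\<in>I - {k}. c i * a i h)"
        by (rule sum.cong) (auto simp: c'_def)
      also have "c' k * a k h = - (\<Sum>i\<in>I - {k}. c i * (a i g / a k g) * a k h)"
        by (simp add: c'_def sum_distrib_right)
      finally show ?thesis by (simp add: a'_def algebra_simps sum_subtractf sum.distrib)
    qed
    have "(\<Sum>i\<in>I. c' i * a i g) = 0" unfolding sum using k by (simp add: a'_def)
    moreover have "\<exists>i\<in>I. c' i \<noteq> 0" using c(1) by (auto simp: c'_def)
    ultimately show ?thesis using c(2) sum by (intro exI[of _ c']) auto
  qed
qed


text \<open>The products \<open>f ^ \<beta> * x_l ^ s\<close> with exponents up to \<open>D\<close> are rational with a common denominator, and there are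
  more of them than there are coefficients of the numerators.\<close>

lemma rational_algebraic_dependence:
  fixes f :: "'n::finite => real ^ 'n => real"
  assumes f: "!!i. rat U t (f i)"
  defines "D \<equiv> (CARD('n) * t + 1) ^ CARD('n)"
  shows "\<exists>c. (\<exists>\<beta> s. (\<forall>i. \<beta> i \<le> D) \<and> s \<le> D \<and> c \<beta> s \<noteq> 0) \<and>
    (\<forall>x\<in>U. (\<Sum>s\<le>D. (\<Sum>\<beta> | \<forall>i. \<beta> i \<le> D. c \<beta> s * (\<Prod>i\<in>UNIV. f i x ^ \<beta> i)) * (x $ l) ^ s) = 0)"
proof -
  let ?n = "CARD('n)"
  have "\<forall>i. \<exists>A B. pol t A \<and> pol t B \<and> (\<forall>x\<in>U. B x \<noteq> 0 \<and> f i x = A x / B x)"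
    using f by (simp add: rat_def)
  then obtain A B where AB: "!!i. pol t (A i)" "!!i. pol t (B i)"
    "!!i x. x \<in> U ==> B i x \<noteq> 0" "!!i x. x \<in> U ==> f i x = A i x / B i x"
    by metis
  define K where "K = ?n * (D * t) + D"
  define Bs where "Bs = {\<beta> :: 'n => nat. \<forall>i. \<beta> i \<le> D}"
  define I where "I = Bs \<times> {..D}"
  define G where "G = {\<gamma> :: 'n => nat. (\<Sum>i\<in>UNIV. \<gamma> i) \<le> K}"
  have BsPi: "Bs = (UNIV :: 'n set) \<rightarrow>\<^sub>E {..D}" by (auto simp: Bs_def PiE_def Pi_def)
  have fB: "finite Bs" unfolding BsPi by (intro finite_PiE) auto
  have fin: "finite I" "finite G" unfolding I_def G_def using fB by (auto intro: finite_deg_le)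
  have cI: "card I = (D + 1) ^ ?n * (D + 1)"
    unfolding I_def BsPi by (simp add: card_cartesian_product card_PiE)
  have cG: "card G \<le> (K + 1) ^ ?n" unfolding G_def by (rule card_deg_le)
  have "K + 1 \<le> (?n * t + 1) * (D + 1)" by (simp add: K_def algebra_simps)
  then have "(K + 1) ^ ?n \<le> ((?n * t + 1) * (D + 1)) ^ ?n" by (rule power_mono) simp
  also have "\<dots> = (?n * t + 1) ^ ?n * (D + 1) ^ ?n" by (rule power_mult_distrib)
  also have "\<dots> = D * (D + 1) ^ ?n" by (simp only: D_def)
  also have "\<dots> < (D + 1) ^ ?n * (D + 1)" by simp
  finally have card: "card G < card I" using cG cI by simp
  define g where "g = (%(\<beta>, s) x. (\<Prod>i\<in>UNIV. A i x ^ \<beta> i * B i x ^ (D - \<beta> i)) * (x $ l) ^ s)"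
  have g: "pol K (g p)" if "p \<in> I" for p
  proof -
    obtain \<beta> s where p: "p = (\<beta>, s)" "!!i. \<beta> i \<le> D" "s \<le> D" using \<open>p \<in> I\<close> by (auto simp: I_def Bs_def)
    have fac: "pol (D * t) (%x. A i x ^ \<beta> i * B i x ^ (D - \<beta> i))" for i
      using gpol_mult[OF gpol_power[OF AB(1)[of i], of "\<beta> i"] gpol_power[OF AB(2)[of i], of "D - \<beta> i"]] p(2)[of i]
      by (simp flip: distrib_right)
    have 1: "pol (?n * (D * t)) (%x. \<Prod>i\<in>UNIV. A i x ^ \<beta> i * B i x ^ (D - \<beta> i))"
      by (rule gpol_prod) (auto intro: fac)
    have "pol (s * 1) (%x :: real ^ 'n. (x $ l) ^ s)" by (intro gpol_power gpol_coord) simp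
    then have "pol D (%x :: real ^ 'n. (x $ l) ^ s)" by (rule gpol_mono) (use p in simp)
    from gpol_mult[OF 1 this] show ?thesis by (simp add: g_def p(1) K_def)
  qed
  have "\<exists>a. \<forall>p\<in>I. \<forall>x. g p x = (\<Sum>\<gamma>\<in>G. a p \<gamma> * mon \<gamma> x)"
    using g unfolding gpol_def G_def by (intro bchoice) blast
  then obtain a where a: "!!p x. p \<in> I ==> g p x = (\<Sum>\<gamma>\<in>G. a p \<gamma> * mon \<gamma> x)" by blast
  obtain c where c: "\<exists>p\<in>I. c p \<noteq> 0" "\<forall>\<gamma>\<in>G. (\<Sum>p\<in>I. c p * a p \<gamma>) = 0"
    using homogeneous_system[OF fin(2,1) card] by blast
  have zero: "(\<Sum>p\<in>I. c p * g p x) = 0" for x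
  proof -
    have "(\<Sum>p\<in>I. c p * g p x) = (\<Sum>p\<in>I. \<Sum>\<gamma>\<in>G. c p * a p \<gamma> * mon \<gamma> x)"
      by (intro sum.cong refl) (simp add: a sum_distrib_left mult.assoc)
    also have "\<dots> = (\<Sum>\<gamma>\<in>G. (\<Sum>p\<in>I. c p * a p \<gamma>) * mon \<gamma> x)"
      by (subst sum.swap) (simp add: sum_distrib_right)
    finally show ?thesis using c(2) by simp
  qed
  show ?thesis
  proof (intro exI[of _ "%\<beta> s. c (\<beta>, s)"] conjI ballI)
    show "\<exists>\<beta> s. (\<forall>i. \<beta> i \<le> D) \<and> s \<le> D \<and> c (\<beta>, s) \<noteq> 0"
      using c(1) by (auto simp: I_def Bs_def)
    fix x assume x: "x \<in> U"
    define q where "q = (\<Prod>i\<in>UNIV. B i x ^ D)"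
    have q: "q \<noteq> 0" using AB(3)[OF x] by (auto simp: q_def)
    have gf: "g (\<beta>, s) x = q * ((\<Prod>i\<in>UNIV. f i x ^ \<beta> i) * (x $ l) ^ s)" if "\<beta> \<in> Bs" for \<beta> s
    proof -
      have eq: "A i x ^ \<beta> i * B i x ^ (D - \<beta> i) = B i x ^ D * f i x ^ \<beta> i" for i
      proof -
        have "B i x ^ D = B i x ^ \<beta> i * B i x ^ (D - \<beta> i)"
          using that by (simp add: Bs_def flip: power_add)
        then show ?thesis using AB(3)[OF x, of i] by (simp add: AB(4)[OF x] power_divide)
      qed
      have "(\<Prod>i\<in>UNIV. A i x ^ \<beta> i * B i x ^ (D - \<beta> i)) = q * (\<Prod>i\<in>UNIV. f i x ^ \<beta> i)"
        unfolding eq q_def by (rule prod.distrib)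
      then show ?thesis by (simp only: g_def prod.case mult.assoc)
    qed
    have "0 = (\<Sum>p\<in>I. c p * g p x)" by (simp add: zero)
    also have "\<dots> = (\<Sum>\<beta>\<in>Bs. \<Sum>s\<le>D. c (\<beta>, s) * g (\<beta>, s) x)"
      unfolding I_def by (simp add: sum.cartesian_product)
    also have "\<dots> = (\<Sum>\<beta>\<in>Bs. \<Sum>s\<le>D. q * (c (\<beta>, s) * (\<Prod>i\<in>UNIV. f i x ^ \<beta> i) * (x $ l) ^ s))"
      by (intro sum.cong refl) (simp add: gf mult_ac)
    also have "\<dots> = q * (\<Sum>s\<le>D. (\<Sum>\<beta>\<in>Bs. c (\<beta>, s) * (\<Prod>i\<in>UNIV. f i x ^ \<beta> i)) * (x $ l) ^ s)"
      by (subst sum.swap) (simp add: sum_distrib_left sum_distrib_right)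
    finally show "(\<Sum>s\<le>D. (\<Sum>\<beta> | \<forall>i. \<beta> i \<le> D. c (\<beta>, s) * (\<Prod>i\<in>UNIV. f i x ^ \<beta> i)) * (x $ l) ^ s) = 0"
      using q by (simp add: Bs_def)
  qed
qed

text \<open>A point \<open>x\<close> with \<open>f x = y\<close> satisfies, for each coordinate, an equation of degree at most \<open>D\<close> with
  coefficients polynomial in \<open>y\<close>. For almost every \<open>y\<close> none of these equations is trivial, which leaves at most \<open>D\<close> values
  for each coordinate.\<close>

theorem rational_map_multiplicity:
  fixes f :: "'n::finite => real ^ 'n => real"
  assumes f: "!!i. rat U t (f i)"
  defines "D \<equiv> (CARD('n) * t + 1) ^ CARD('n)"
  shows "\<exists>Z\<in>null_sets lborel. \<forall>y F. y \<notin> Z --> finite F --> F \<subseteq> {x \<in> U. (\<chi> i. f i x) = y} --> card F \<le> D ^ CARD('n)"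
proof -
  let ?Bs = "{\<beta> :: 'n => nat. \<forall>i. \<beta> i \<le> D}"
  have "\<forall>l. \<exists>c. (\<exists>\<beta> s. (\<forall>i. \<beta> i \<le> D) \<and> s \<le> D \<and> c \<beta> s \<noteq> 0) \<and>
    (\<forall>x\<in>U. (\<Sum>s\<le>D. (\<Sum>\<beta>\<in>?Bs. c \<beta> s * (\<Prod>i\<in>UNIV. f i x ^ \<beta> i)) * (x $ l) ^ s) = 0)"
    unfolding D_def by (intro allI rational_algebraic_dependence[of U t f] f)
  from choice[OF this] obtain c where c: "\<forall>l. (\<exists>\<beta> s. (\<forall>i. \<beta> i \<le> D) \<and> s \<le> D \<and> c l \<beta> s \<noteq> 0) \<and>
    (\<forall>x\<in>U. (\<Sum>s\<le>D. (\<Sum>\<beta>\<in>?Bs. c l \<beta> s * (\<Prod>i\<in>UNIV. f i x ^ \<beta> i)) * (x $ l) ^ s) = 0)"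
    by (rule exE)
  have c1: "\<exists>\<beta> s. (\<forall>i. \<beta> i \<le> D) \<and> s \<le> D \<and> c l \<beta> s \<noteq> 0" for l
    using c by (rule allE) (erule conjunct1)
  have c2: "(\<Sum>s\<le>D. (\<Sum>\<beta>\<in>?Bs. c l \<beta> s * (\<Prod>i\<in>UNIV. f i x ^ \<beta> i)) * (x $ l) ^ s) = 0" if "x \<in> U" for l x
    using c[rule_format, THEN conjunct2, rule_format, OF that] .
  define R where "R l s y = (\<Sum>\<beta>\<in>?Bs. c l \<beta> s * mon \<beta> y)" for l s and y :: "real ^ 'n"
  have BsPi: "?Bs = (UNIV :: 'n set) \<rightarrow>\<^sub>E {..D}" by (auto simp: PiE_def Pi_def)
  have fB: "finite ?Bs" unfolding BsPi by (intro finite_PiE) auto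
  have "\<exists>s\<le>D. {y. R l s y = 0} \<in> null_sets lborel" for l
  proof -
    obtain \<beta> s where \<beta>: "\<forall>i. \<beta> i \<le> D" "s \<le> D" "c l \<beta> s \<noteq> 0" using c1 by blast
    let ?t = "CARD('n) * D"
    have deg: "(\<Sum>i\<in>UNIV. \<beta> i) \<le> ?t" if "\<forall>i. \<beta> i \<le> D" for \<beta> :: "'n => nat"
      using sum_mono[of UNIV \<beta> "%_. D"] that by simp
    define c' where "c' \<gamma> = (if \<gamma> \<in> ?Bs then c l \<gamma> s else 0)" for \<gamma>
    have "R l s y = (\<Sum>\<gamma> | (\<Sum>i\<in>UNIV. \<gamma> i) \<le> ?t. c' \<gamma> * mon \<gamma> y)" for y
      unfolding R_def by (rule sum.mono_neutral_cong_left) (auto simp: finite_deg_le deg c'_def)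
    moreover have "c' \<beta> \<noteq> 0" using \<beta> by (simp add: c'_def)
    ultimately have "{y. R l s y = 0} \<in> null_sets lborel"
      using null_zero_set[of \<beta> ?t c'] deg[OF \<beta>(1)] by simp
    then show ?thesis using \<beta>(2) by blast
  qed
  then obtain s where s: "!!l. s l \<le> D" "!!l. {y. R l (s l) y = 0} \<in> null_sets lborel" by metis
  show ?thesis
  proof (intro bexI[of _ "\<Union>l\<in>UNIV. {y. R l (s l) y = 0}"] allI impI)
    show "(\<Union>l\<in>UNIV. {y. R l (s l) y = 0}) \<in> null_sets lborel"
      using s(2) by (intro null_sets_UN') auto
    fix y F assume y: "y \<notin> (\<Union>l\<in>UNIV. {y. R l (s l) y = 0})" and F: "finite F" "F \<subseteq> {x \<in> U. (\<chi> i. f i x) = y}"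
    define Q where "Q l = {z :: real. (\<Sum>i\<le>D. R l i y * z ^ i) = 0}" for l
    have Q: "finite (Q l)" "card (Q l) \<le> D" for l
      using polyfun_rootbound[of D "%i. R l i y"] s(1)[of l] y unfolding Q_def by auto
    have FQ: "x $ l \<in> Q l" if "x \<in> F" for x l
    proof -
      have x: "x \<in> U" "y = (\<chi> i. f i x)" using F that by auto
      have "R l i y = (\<Sum>\<beta>\<in>?Bs. c l \<beta> i * (\<Prod>i\<in>UNIV. f i x ^ \<beta> i))" for i
        unfolding R_def gmon_def x(2) by simp
      then show ?thesis using c2[OF x(1), of l] by (simp add: Q_def)
    qed
    have "card F \<le> card (PiE (UNIV :: 'n set) Q)"
    proof (rule card_inj_on_le[of "%x. ($) x"])
      show "inj_on (%x. ($) x) F" by (auto simp: inj_on_def vec_eq_iff)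
      show "(%x. ($) x) ` F \<subseteq> PiE UNIV Q" using FQ by auto
      show "finite (PiE (UNIV :: 'n set) Q)" using Q by (intro finite_PiE) auto
    qed
    also have "\<dots> = (\<Prod>l\<in>UNIV. card (Q l))" by (simp add: card_PiE)
    also have "\<dots> \<le> (\<Prod>l\<in>(UNIV :: 'n set). D)" by (intro prod_mono) (use Q in auto)
    finally show "card F \<le> D ^ CARD('n)" by simp
  qed
qed

text \<open>The image of \<open>E\<close> lies in a cube of side \<open>2 b\<close>, and almost every point of the cube is attained a bounded number of
  times.\<close>

theorem rational_Jacobian_integral:
  fixes f :: "'n::finite => real ^ 'n => real"
  assumes f: "!!i. rat U t (f i)" and "open U" and E: "E \<in> sets borel" "E \<subseteq> U"
    and b: "0 \<le> b" "!!i x. x \<in> E ==> \<bar>f i x\<bar> \<le> b"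
  shows "(\<integral>\<^sup>+x. ennreal \<bar>det (jac f x)\<bar> * indicator E x \<partial>lborel)
    \<le> ennreal (real (((CARD('n) * t + 1) ^ CARD('n)) ^ CARD('n)) * (2 * b) ^ CARD('n))"
proof -
  let ?M = "((CARD('n) * t + 1) ^ CARD('n)) ^ CARD('n)"
  let ?Q = "cbox (\<chi> i. - b) (\<chi> i. b) :: (real ^ 'n) set"
  obtain Z where Z: "Z \<in> null_sets lborel"
    "!!y F. y \<notin> Z ==> finite F ==> F \<subseteq> {x \<in> U. (\<chi> i. f i x) = y} ==> card F \<le> ?M"
    using rational_map_multiplicity[of U t f, OF f] by blast
  have "(\<integral>\<^sup>+x. ennreal \<bar>det (jac f x)\<bar> * indicator E x \<partial>lborel) \<le> of_nat ?M * emeasure lborel ?Q"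
  proof (rule nn_integral_det_le_multiplicity[OF \<open>open U\<close> E])
    show "((%x. \<chi> i. f i x) has_derivative (*v) (jac f x)) (at x)" if "x \<in> U" for x
      by (rule has_derivative_jac) (rule rat_differentiable[OF f \<open>open U\<close> that])
    show "continuous_on U (jac f)" by (rule continuous_on_jac[of U t f, OF f \<open>open U\<close>])
    show "card F \<le> ?M" if "y \<notin> Z" "finite F" "F \<subseteq> {x \<in> E. (\<chi> i. f i x) = y}" for y F
      by (rule Z(2)[OF that(1,2)]) (use that(3) E(2) in auto)
    show "(%x. \<chi> i. f i x) ` E \<subseteq> ?Q"
      using b(2) by (auto simp: mem_box_cart abs_le_iff minus_le_iff)
  qed (use Z in auto)
  also have "emeasure lborel ?Q = ennreal (\<Prod>e\<in>Basis. ((\<chi> i. b) - (\<chi> i. - b) :: real ^ 'n) \<bullet> e)"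
    by (rule emeasure_lborel_cbox) (use b(1) in \<open>auto simp: Basis_vec_def inner_axis\<close>)
  also have "(\<Prod>e\<in>Basis. ((\<chi> i. b) - (\<chi> i. - b) :: real ^ 'n) \<bullet> e) = (2 * b) ^ CARD('n)"
    unfolding prod_Basis_cart by (simp add: inner_axis)
  finally show ?thesis
    by (simp add: ennreal_of_nat_eq_real_of_nat ennreal_mult' del: of_nat_power)
qed

section \<open>Derivatives of maps of several vector variables\<close>

definition darg :: "'k => real ^ 'n => (real ^ 'n::finite ^ 'k::finite => nat => real) => real ^ 'n ^ 'k => nat => real" where
  "darg j v F = (%x i. dv (axis j v) (%y. F y i) x)"

abbreviation dargs :: "('k \<times> (real ^ 'n)) list => (real ^ 'n::finite ^ 'k::finite => nat => real) => real ^ 'n ^ 'k => nat => real" where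
  "dargs ws F \<equiv> foldr (%(j, v). darg j v) ws F"

definition poly_comps :: "('a::real_normed_vector => nat => real) => bool" where
  "poly_comps F \<longleftrightarrow> (\<forall>i. real_polynomial_function (%x. F x i))"

lemma pderiv_arg_darg: "pderiv_arg j l = darg j (axis l 1)"
  by (auto simp: pderiv_arg_def darg_def dv_def fun_eq_iff)

lemma poly_comps_darg: "poly_comps F ==> poly_comps (darg j v F)"
  by (auto simp: poly_comps_def darg_def intro: real_polynomial_function_dv)

lemma axis_column_expand:
  fixes v :: "real ^ 'n::finite"
  shows "axis j v = (\<Sum>p\<in>UNIV. v $ p *\<^sub>R axis j (axis p 1))"
  by (simp add: vec_eq_iff axis_def if_distrib[of "%x. x $ _"] if_distrib[of "%x. _ * x"] cong: if_cong)

lemma pullback_pderiv_arg_darg: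
  assumes "poly_comps F" shows "pullback_pderiv_arg T j l F = darg j (column l T) F"
proof (intro ext)
  fix x i
  let ?f = "%y. F y i" and ?f' = "frechet_derivative (%y. F y i) (at x)"
  have d: "?f differentiable (at x)"
    using assms by (intro differentiable_at_real_polynomial_function) (simp add: poly_comps_def)
  have lin: "linear ?f'" using d by (rule linear_frechet_derivative)
  have "darg j (column l T) F x i = ?f' (axis j (column l T))" by (simp add: darg_def dv_frechet[OF d])
  also have "\<dots> = ?f' (\<Sum>p\<in>UNIV. column l T $ p *\<^sub>R axis j (axis p 1))"
    by (subst axis_column_expand) (rule refl)
  also have "\<dots> = (\<Sum>p\<in>UNIV. T $ p $ l * ?f' (axis j (axis p 1)))"
    using lin by (simp add: linear_sum linear_cmul column_def)
  finally show "pullback_pderiv_arg T j l F x i = darg j (column l T) F x i"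
    by (simp add: pullback_pderiv_arg_def pderiv_arg_darg darg_def dv_frechet[OF d])
qed

definition mi_enum :: "('k::finite \<times> 'n::finite) list" where
  "mi_enum = (SOME xs. distinct xs \<and> set xs = UNIV)"

lemma mi_enum: "distinct (mi_enum :: ('k::finite \<times> 'n::finite) list)" "set (mi_enum :: ('k \<times> 'n) list) = UNIV"
proof -
  have "\<exists>xs :: ('k \<times> 'n) list. distinct xs \<and> set xs = UNIV"
    using finite_distinct_list[of "UNIV :: ('k \<times> 'n) set"] by auto
  from someI_ex[OF this] show "distinct (mi_enum :: ('k \<times> 'n) list)" "set (mi_enum :: ('k \<times> 'n) list) = UNIV"
    unfolding mi_enum_def by auto
qed

lemma mixed_deriv_enum: "mixed_deriv D \<alpha> = foldr (%(j, l). D j l ^^ \<alpha> j l) mi_enum"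
  unfolding mixed_deriv_def mi_enum_def ..

text \<open>A multiindex as a word of directional derivatives, in the order in which \<^const>\<open>mixed_deriv\<close> composes them.\<close>

definition mi_word :: "('n => real ^ 'n) => ('k::finite => 'n::finite => nat) => ('k \<times> (real ^ 'n)) list" where
  "mi_word V \<alpha> = concat (map (%(j, l). replicate (\<alpha> j l) (j, V l)) mi_enum)"

lemma sum_mi_enum: "(\<Sum>(j, l)\<leftarrow>mi_enum. h j l) = (\<Sum>j\<in>UNIV. \<Sum>l\<in>UNIV. h j l)"
  for h :: "'k::finite => 'n::finite => nat"
  using sum_list_distinct_conv_sum_set[OF mi_enum(1), of "%(j, l). h j l"]
  by (simp add: mi_enum(2) sum.cartesian_product)

lemma length_mi_word: "length (mi_word V \<alpha>) = mi_order \<alpha>"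
proof -
  have "length (mi_word V \<alpha>) = (\<Sum>(j, l)\<leftarrow>mi_enum. \<alpha> j l)"
    unfolding mi_word_def length_concat map_map by (intro arg_cong[of _ _ sum_list] map_cong) auto
  then show ?thesis unfolding sum_mi_enum by (simp add: mi_order_def)
qed

lemma set_mi_word: "set (mi_word V \<alpha>) \<subseteq> UNIV \<times> range V"
  by (auto simp: mi_word_def)

lemma mixed_deriv_dargs:
  assumes D: "!!j l G. poly_comps G ==> D j l G = darg j (V l) G" and F: "poly_comps F"
  shows "mixed_deriv D \<alpha> F = dargs (mi_word V \<alpha>) F"
proof -
  have rep: "(D j l ^^ n) G = dargs (replicate n (j, V l)) G \<and> poly_comps ((D j l ^^ n) G)" if "poly_comps G" for n j l G
    using that by (induction n) (auto simp: D poly_comps_darg)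
  have "foldr (%(j, l). D j l ^^ \<alpha> j l) xs F = dargs (concat (map (%(j, l). replicate (\<alpha> j l) (j, V l)) xs)) F \<and>
      poly_comps (foldr (%(j, l). D j l ^^ \<alpha> j l) xs F)" for xs
  proof (induction xs)
    case (Cons p xs)
    obtain j l where p: "p = (j, l)" by (cases p)
    let ?G = "foldr (%(j, l). D j l ^^ \<alpha> j l) xs F"
    have G: "?G = dargs (concat (map (%(j, l). replicate (\<alpha> j l) (j, V l)) xs)) F" "poly_comps ?G"
      using Cons by auto
    have "(D j l ^^ \<alpha> j l) ?G = dargs (replicate (\<alpha> j l) (j, V l)) ?G" "poly_comps ((D j l ^^ \<alpha> j l) ?G)"
      using rep[OF G(2), of "\<alpha> j l" j l] by blast+
    then show ?case using G(1) by (simp add: p)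
  qed (simp add: F)
  then show ?thesis unfolding mixed_deriv_enum mi_word_def by blast
qed

subsection \<open>Sums of products\<close>

text \<open>Sums of products of functions of one argument each; differentiation in the argument \<open>j\<close> acts on the \<open>j\<close>-th factor
  only.\<close>

definition tens :: "'i set => ('i => nat => real) => ('i => 'k => real ^ 'n => real) => real ^ 'n::finite ^ 'k::finite => nat => real" where
  "tens A a g = (%x i. \<Sum>I\<in>A. a I i * (\<Prod>j\<in>UNIV. g I j (x $ j)))"

lemma differentiable_component_fun:
  fixes f :: "real ^ 'n::finite => real"
  assumes "f differentiable (at (x $ j))"
  shows "(%x :: real ^ 'n ^ 'k::finite. f (x $ j)) differentiable (at x)"
proof -
  obtain D where "(f has_derivative D) (at (x $ j))" using assms by (auto simp: differentiable_def)
  from has_derivative_compose[OF bounded_linear_imp_has_derivative[OF bounded_linear_vec_nth] this]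
  show ?thesis by (auto simp: differentiable_def)
qed

lemma differentiable_prod:
  fixes f :: "'i => 'a::real_normed_vector => real"
  assumes "!!i. i \<in> I ==> f i differentiable (at x)"
  shows "(%x. \<Prod>i\<in>I. f i x) differentiable (at x)"
  using assms by (induction I rule: infinite_finite_induct) (auto intro: differentiable_mult)

lemma dv_prod_components:
  fixes g :: "'k::finite => real ^ 'n::finite => real"
  assumes "g j differentiable (at (x $ j))"
  shows "dv (axis j v) (%x. \<Prod>j'\<in>UNIV. g j' (x $ j')) x
     = (\<Prod>j'\<in>UNIV. (if j' = j then dv v (g j') else g j') (x $ j'))"
proof -
  let ?R = "\<Prod>j'\<in>UNIV - {j}. g j' (x $ j')"
  have eq: "(\<Prod>j'\<in>UNIV. g j' ((x + t *\<^sub>R axis j v) $ j')) = g j (x $ j + t *\<^sub>R v) * ?R" for t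
    by (subst prod.remove[of _ j]) (auto intro!: prod.cong simp: axis_def)
  have "dv (axis j v) (%x. \<Prod>j'\<in>UNIV. g j' (x $ j')) x = deriv (%t. g j (x $ j + t *\<^sub>R v) * ?R) 0"
    unfolding dv_def eq ..
  also have "\<dots> = dv v (g j) (x $ j) * ?R"
  proof (rule DERIV_imp_deriv, rule DERIV_cmult_right)
    show "((%t. g j (x $ j + t *\<^sub>R v)) has_field_derivative dv v (g j) (x $ j)) (at 0)"
      using DERIV_line[OF assms[unfolded frechet_derivative_works], of v] by (simp add: dv_frechet[OF assms])
  qed
  also have "\<dots> = (\<Prod>j'\<in>UNIV. (if j' = j then dv v (g j') else g j') (x $ j'))"
    by (subst prod.remove[of _ j]) (auto intro!: prod.cong)
  finally show ?thesis .
qed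

lemma darg_tens:
  fixes g :: "'i => 'k::finite => real ^ 'n::finite => real"
  assumes "finite A" and g: "!!I j. I \<in> A ==> real_polynomial_function (g I j)"
  shows "darg j v (tens A a g) = tens A a (%I j'. if j' = j then dv v (g I j') else g I j')"
proof (intro ext)
  fix x :: "real ^ 'n ^ 'k" and i
  have diff: "(%x :: real ^ 'n ^ 'k. \<Prod>j\<in>UNIV. g I j (x $ j)) differentiable (at x)" if "I \<in> A" for I
    by (intro differentiable_prod differentiable_component_fun differentiable_at_real_polynomial_function g that)
  have "darg j v (tens A a g) x i = (\<Sum>I\<in>A. dv (axis j v) (%x. a I i * (\<Prod>j\<in>UNIV. g I j (x $ j))) x)"
    unfolding darg_def tens_def using diff by (intro dv_sum differentiable_mult) auto
  also have "\<dots> = (\<Sum>I\<in>A. a I i * dv (axis j v) (%x. \<Prod>j\<in>UNIV. g I j (x $ j)) x)"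
    using diff by (intro sum.cong refl dv_cmult)
  finally show "darg j v (tens A a g) x i = tens A a (%I j'. if j' = j then dv v (g I j') else g I j') x i"
    using g by (simp add: tens_def dv_prod_components differentiable_at_real_polynomial_function)
qed

lemma real_polynomial_function_dvs: "real_polynomial_function f ==> real_polynomial_function (foldr dv vs f)"
  by (induction vs) (auto intro: real_polynomial_function_dv)

lemma dargs_tens:
  assumes "finite A" and g: "!!I j. I \<in> A ==> real_polynomial_function (g I j)"
  shows "dargs ws (tens A a g) = tens A a (%I j. foldr dv (map snd (filter (%p. fst p = j) ws)) (g I j))"
proof (induction ws)
  case (Cons p ws)
  obtain j v where p: "p = (j, v)" by (cases p)
  have "dargs (p # ws) (tens A a g)
    = darg j v (tens A a (%I j. foldr dv (map snd (filter (%p. fst p = j) ws)) (g I j)))"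
    by (simp add: p Cons)
  also have "\<dots> = tens A a (%I j'. if j' = j then dv v (foldr dv (map snd (filter (%p. fst p = j') ws)) (g I j'))
      else foldr dv (map snd (filter (%p. fst p = j') ws)) (g I j'))"
    by (rule darg_tens) (auto intro: assms real_polynomial_function_dvs)
  also have "(%I j'. if j' = j then dv v (foldr dv (map snd (filter (%p. fst p = j') ws)) (g I j'))
      else foldr dv (map snd (filter (%p. fst p = j') ws)) (g I j'))
    = (%I j'. foldr dv (map snd (filter (%q. fst q = j') (p # ws))) (g I j'))"
    by (auto simp: p fun_eq_iff)
  finally show ?case .
qed simp

subsection \<open>Monomial expansions\<close>

lemma monomial_prod_mon: "monomial \<alpha> x = (\<Prod>j\<in>UNIV. mon (\<alpha> j) (x $ j))"
  by (simp add: monomial_def gmon_def)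

lemma monomial_gmon: "monomial \<alpha> = gmon (%(j, l) x. x $ j $ l) (%(j, l). \<alpha> j l)"
  by (auto simp: monomial_def gmon_def prod.cartesian_product fun_eq_iff intro!: prod.cong)

lemma linear_expand_vec_vec:
  fixes f :: "real ^ 'n::finite ^ 'k::finite => real"
  assumes "linear f" shows "f x = (\<Sum>j\<in>UNIV. \<Sum>l\<in>UNIV. f (axis j (axis l 1)) * x $ j $ l)"
proof -
  have 1: "x = (\<Sum>j\<in>UNIV. axis j (x $ j))"
    by (simp add: vec_eq_iff axis_def if_distrib[of "%x. x $ _"] cong: if_cong)
  have "f x = (\<Sum>j\<in>UNIV. f (axis j (x $ j)))"
    by (subst 1) (simp add: linear_sum[OF assms])
  also have "\<dots> = (\<Sum>j\<in>UNIV. \<Sum>l\<in>UNIV. f (axis j (axis l 1)) * x $ j $ l)"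
  proof (rule sum.cong[OF refl])
    fix j
    show "f (axis j (x $ j)) = (\<Sum>l\<in>UNIV. f (axis j (axis l 1)) * x $ j $ l)"
      by (subst axis_column_expand) (simp add: linear_sum[OF assms] linear_cmul[OF assms] mult.commute)
  qed
  finally show ?thesis .
qed

lemma real_polynomial_function_monomials:
  fixes f :: "real ^ 'n::finite ^ 'k::finite => real"
  assumes "real_polynomial_function f"
  shows "\<exists>d c. \<forall>x. f x = (\<Sum>\<alpha> | mi_order \<alpha> \<le> d. c \<alpha> * monomial \<alpha> x)"
proof -
  let ?u = "%(j, l) (x :: real ^ 'n ^ 'k). x $ j $ l"
  have "\<exists>t. gpol ?u t f"
  proof (rule real_polynomial_function_gpol[OF _ assms])
    fix f :: "real ^ 'n ^ 'k => real" assume "bounded_linear f"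
    then have lin: "linear f" by (rule bounded_linear.linear)
    have c: "gpol ?u 1 (%x. x $ j $ l)" for j l
      using gpol_coord[of 1 ?u "(j, l)"] by simp
    have "gpol ?u 1 (%x. \<Sum>j\<in>UNIV. \<Sum>l\<in>UNIV. f (axis j (axis l 1)) * x $ j $ l)"
      by (intro gpol_sum gpol_cmult c)
    then show "gpol ?u 1 f" by (rule gpol_cong) (rule linear_expand_vec_vec[OF lin, symmetric])
  qed
  then obtain t c where c: "!!x. f x = (\<Sum>\<gamma> | (\<Sum>p\<in>UNIV. \<gamma> p) \<le> t. c \<gamma> * gmon ?u \<gamma> x)"
    by (auto simp: gpol_def)
  have "f x = (\<Sum>\<alpha> | mi_order \<alpha> \<le> t. c (%(j, l). \<alpha> j l) * monomial \<alpha> x)" for x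
    unfolding c
  proof (rule sum.reindex_bij_witness[of _ "%\<alpha>. %(j, l). \<alpha> j l" "%\<gamma> j l. \<gamma> (j, l)"])
    have ord: "mi_order \<alpha> = (\<Sum>p\<in>UNIV. (%(j, l). \<alpha> j l) p)" for \<alpha> :: "'k => 'n => nat"
      by (simp add: mi_order_def sum.cartesian_product)
    show "(%j l. \<gamma> (j, l)) \<in> {\<alpha>. mi_order \<alpha> \<le> t}" if "\<gamma> \<in> {\<gamma>. sum \<gamma> UNIV \<le> t}" for \<gamma> :: "'k \<times> 'n => nat"
      using that by (simp add: ord)
    show "(%(j, l). \<alpha> j l) \<in> {\<gamma>. sum \<gamma> UNIV \<le> t}" if "\<alpha> \<in> {\<alpha>. mi_order \<alpha> \<le> t}" for \<alpha> :: "'k => 'n => nat"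
      using that by (simp add: ord)
  qed (auto simp: monomial_gmon)
  then show ?thesis by (intro exI[of _ t] exI[of _ "%\<alpha>. c (%(j, l). \<alpha> j l)"] allI)
qed

definition falling :: "nat => nat => real" where "falling b m = (\<Prod>k<m. real (b - k))"

lemma falling_zero: "b < m ==> falling b m = 0"
  by (auto simp: falling_def)

lemma falling_self: "falling m m = fact m"
  by (simp add: falling_def fact_prod_rev of_nat_prod atLeast0LessThan)

lemma pderiv_arg_monomials:
  fixes e :: "'b => 'k::finite => 'n::finite => nat"
  assumes "finite B"
  shows "pderiv_arg j l (%x i. \<Sum>\<beta>\<in>B. c \<beta> i * monomial (e \<beta>) x)
    = (%x i. \<Sum>\<beta>\<in>B. (c \<beta> i * real (e \<beta> j l)) * monomial ((e \<beta>)(j := (e \<beta> j)(l := e \<beta> j l - 1))) x)"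
proof -
  have "(%x i. \<Sum>\<beta>\<in>B. c \<beta> i * monomial (e \<beta>) x) = tens B c (%\<beta> j. mon (e \<beta> j))"
    by (simp add: tens_def monomial_prod_mon)
  then have "pderiv_arg j l (%x i. \<Sum>\<beta>\<in>B. c \<beta> i * monomial (e \<beta>) x)
    = tens B c (%\<beta> j'. if j' = j then dv (axis l 1) (mon (e \<beta> j')) else mon (e \<beta> j'))"
    unfolding pderiv_arg_darg using assms by (simp add: darg_tens real_polynomial_function_mon)
  also have "\<dots> = (%x i. \<Sum>\<beta>\<in>B. (c \<beta> i * real (e \<beta> j l)) * monomial ((e \<beta>)(j := (e \<beta> j)(l := e \<beta> j l - 1))) x)"
    unfolding tens_def
  proof (intro ext sum.cong refl)
    fix x :: "real ^ 'n ^ 'k" and i \<beta>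
    have "(\<Prod>j'\<in>UNIV. (if j' = j then dv (axis l 1) (mon (e \<beta> j')) else mon (e \<beta> j')) (x $ j'))
      = dv (axis l 1) (mon (e \<beta> j)) (x $ j) * (\<Prod>j'\<in>UNIV - {j}. mon (e \<beta> j') (x $ j'))"
      by (subst prod.remove[of _ j]) (auto intro!: prod.cong)
    also have "\<dots> = real (e \<beta> j l) * monomial ((e \<beta>)(j := (e \<beta> j)(l := e \<beta> j l - 1))) x"
      unfolding monomial_prod_mon by (subst (2) prod.remove[of _ j]) (auto simp: dv_mon intro!: prod.cong)
    finally show "c \<beta> i * (\<Prod>j'\<in>UNIV. (if j' = j then dv (axis l 1) (mon (e \<beta> j')) else mon (e \<beta> j')) (x $ j'))
      = (c \<beta> i * real (e \<beta> j l)) * monomial ((e \<beta>)(j := (e \<beta> j)(l := e \<beta> j l - 1))) x" by simp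
  qed
  finally show ?thesis .
qed

lemma pderiv_arg_pow_monomials:
  fixes e :: "'b => 'k::finite => 'n::finite => nat"
  assumes "finite B"
  shows "(pderiv_arg j l ^^ m) (%x i. \<Sum>\<beta>\<in>B. c \<beta> i * monomial (e \<beta>) x)
    = (%x i. \<Sum>\<beta>\<in>B. (c \<beta> i * falling (e \<beta> j l) m) * monomial ((e \<beta>)(j := (e \<beta> j)(l := e \<beta> j l - m))) x)"
proof (induction m)
  case 0
  then show ?case by (simp add: falling_def)
next
  case (Suc m)
  let ?e = "%\<beta>. (e \<beta>)(j := (e \<beta> j)(l := e \<beta> j l - m))"
  have "(pderiv_arg j l ^^ Suc m) (%x i. \<Sum>\<beta>\<in>B. c \<beta> i * monomial (e \<beta>) x)
     = pderiv_arg j l (%x i. \<Sum>\<beta>\<in>B. (c \<beta> i * falling (e \<beta> j l) m) * monomial (?e \<beta>) x)"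
    by (simp only: funpow.simps o_apply Suc)
  also have "\<dots> = (%x i. \<Sum>\<beta>\<in>B. ((c \<beta> i * falling (e \<beta> j l) m) * real (?e \<beta> j l)) * monomial ((?e \<beta>)(j := (?e \<beta> j)(l := ?e \<beta> j l - 1))) x)"
    by (rule pderiv_arg_monomials[OF assms])
  also have "\<dots> = (%x i. \<Sum>\<beta>\<in>B. (c \<beta> i * falling (e \<beta> j l) (Suc m)) * monomial ((e \<beta>)(j := (e \<beta> j)(l := e \<beta> j l - Suc m))) x)"
  proof -
    have 1: "(?e \<beta>)(j := (?e \<beta> j)(l := ?e \<beta> j l - 1)) = (e \<beta>)(j := (e \<beta> j)(l := e \<beta> j l - Suc m))" for \<beta>
      by (auto simp: fun_eq_iff)
    have 2: "falling (e \<beta> j l) (Suc m) = falling (e \<beta> j l) m * real (?e \<beta> j l)" for \<beta>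
      by (simp add: falling_def)
    show ?thesis unfolding 1 2 by (simp only: mult.assoc)
  qed
  finally show ?case .
qed

lemma mixed_deriv_monomials_at_0:
  fixes \<alpha> :: "'k::finite => 'n::finite => nat"
  assumes "finite B"
  shows "mixed_deriv pderiv_arg \<alpha> (%x i. \<Sum>\<beta>\<in>B. c \<beta> i * monomial \<beta> x) 0 i
    = (if \<alpha> \<in> B then c \<alpha> i * (\<Prod>j\<in>UNIV. \<Prod>l\<in>UNIV. fact (\<alpha> j l)) else 0)"
proof -
  let ?P = "%xs \<beta>. \<Prod>(j, l)\<in>set xs. falling (\<beta> j l) (\<alpha> j l)"
  let ?e = "%xs \<beta> j l. if (j, l) \<in> set xs then \<beta> j l - \<alpha> j l else \<beta> j l"
  have fold: "foldr (%(j, l). pderiv_arg j l ^^ \<alpha> j l) xs (%x i. \<Sum>\<beta>\<in>B. c \<beta> i * monomial \<beta> x)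
    = (%x i. \<Sum>\<beta>\<in>B. (c \<beta> i * ?P xs \<beta>) * monomial (?e xs \<beta>) x)" if "distinct xs" for xs :: "('k \<times> 'n) list"
    using that
  proof (induction xs)
    case (Cons p xs)
    obtain j l where p: "p = (j, l)" by (cases p)
    have n: "(j, l) \<notin> set xs" using Cons.prems p by simp
    have "foldr (%(j, l). pderiv_arg j l ^^ \<alpha> j l) (p # xs) (%x i. \<Sum>\<beta>\<in>B. c \<beta> i * monomial \<beta> x)
      = (pderiv_arg j l ^^ \<alpha> j l) (%x i. \<Sum>\<beta>\<in>B. (c \<beta> i * ?P xs \<beta>) * monomial (?e xs \<beta>) x)"
      using Cons by (simp add: p)
    also have "\<dots> = (%x i. \<Sum>\<beta>\<in>B. ((c \<beta> i * ?P xs \<beta>) * falling (?e xs \<beta> j l) (\<alpha> j l))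
        * monomial ((?e xs \<beta>)(j := (?e xs \<beta> j)(l := ?e xs \<beta> j l - \<alpha> j l))) x)"
      by (rule pderiv_arg_pow_monomials[OF assms])
    also have "\<dots> = (%x i. \<Sum>\<beta>\<in>B. (c \<beta> i * ?P (p # xs) \<beta>) * monomial (?e (p # xs) \<beta>) x)"
    proof -
      have "(?e xs \<beta>)(j := (?e xs \<beta> j)(l := ?e xs \<beta> j l - \<alpha> j l)) = ?e (p # xs) \<beta>" for \<beta>
        using n by (auto simp: p fun_eq_iff)
      moreover have "?P (p # xs) \<beta> = falling (\<beta> j l) (\<alpha> j l) * ?P xs \<beta>" for \<beta>
        using n by (simp add: p)
      ultimately show ?thesis using n by (simp add: mult_ac)
    qed
    finally show ?case .
  qed simp
  have "mixed_deriv pderiv_arg \<alpha> (%x i. \<Sum>\<beta>\<in>B. c \<beta> i * monomial \<beta> x) 0 i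
    = (\<Sum>\<beta>\<in>B. (c \<beta> i * ?P mi_enum \<beta>) * monomial (?e mi_enum \<beta>) 0)"
    unfolding mixed_deriv_enum fold[OF mi_enum(1)] ..
  also have "\<dots> = (\<Sum>\<beta>\<in>B. if \<beta> = \<alpha> then c \<alpha> i * (\<Prod>j\<in>UNIV. \<Prod>l\<in>UNIV. fact (\<alpha> j l)) else 0)"
  proof (intro sum.cong refl)
    fix \<beta>
    show "(c \<beta> i * ?P mi_enum \<beta>) * monomial (?e mi_enum \<beta>) 0 = (if \<beta> = \<alpha> then c \<alpha> i * (\<Prod>j\<in>UNIV. \<Prod>l\<in>UNIV. fact (\<alpha> j l)) else 0)"
    proof (cases "\<beta> = \<alpha>")
      case True
      then show ?thesis by (simp add: mi_enum(2) falling_self monomial_def prod.cartesian_product)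
    next
      case False
      then obtain j l where "\<beta> j l \<noteq> \<alpha> j l" by (auto simp: fun_eq_iff)
      then consider "\<beta> j l < \<alpha> j l" | "\<alpha> j l < \<beta> j l" by linarith
      then have "?P mi_enum \<beta> * monomial (?e mi_enum \<beta>) 0 = 0"
      proof cases
        case 1
        have "?P mi_enum \<beta> = 0"
          using falling_zero[OF 1] by (intro prod_zero) (auto simp: mi_enum(2) intro!: bexI[of _ "(j, l)"])
        then show ?thesis by simp
      next
        case 2
        then have "monomial (?e mi_enum \<beta>) 0 = 0"
          unfolding monomial_def by (intro prod_zero bexI[of _ j]) (auto simp: mi_enum(2) intro!: prod_zero bexI[of _ l])
        then show ?thesis by simp
      qed
      then show ?thesis using False by simp
    qed
  qed
  finally show ?thesis using assms by (simp add: sum.delta)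
qed

subsection \<open>Order of vanishing\<close>

text \<open>The polynomials without terms of degree less than \<open>r\<close>.\<close>

inductive vord :: "nat => (real ^ 'n::finite ^ 'k::finite => real) => bool" for r where
  zero: "vord r (%_. 0)"
| step: "vord r f ==> r \<le> mi_order \<alpha> ==> vord r (%h. c * monomial \<alpha> h + f h)"

lemma vord_poly: "vord r f ==> real_polynomial_function f"
  for f :: "real ^ 'n::finite ^ 'k::finite => real"
proof (induction rule: vord.induct)
  case zero
  then show ?case by (rule real_polynomial_function.intros(2))
next
  case (step f \<alpha> c)
  have "real_polynomial_function (%x :: real ^ 'n ^ 'k. x $ j $ l)" for j l
    using bounded_linear_compose[OF bounded_linear_vec_nth[of l] bounded_linear_vec_nth[of j]]
    by (rule real_polynomial_function.intros(1))
  then have "real_polynomial_function (monomial \<alpha>)"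
    unfolding monomial_def[abs_def] by (intro real_polynomial_function_prod real_polynomial_function_power) auto
  then show ?case using step by (intro real_polynomial_function.intros(2,3,4))
qed

lemma vord_add: "vord r f ==> vord r g ==> vord r (%h. f h + g h)"
proof (induction rule: vord.induct)
  case (step f \<alpha> c)
  then have "vord r (%h. c * monomial \<alpha> h + (f h + g h))" by (intro vord.step) auto
  then show ?case by (simp add: add.assoc)
qed simp

lemma vord_cmult: "vord r f ==> vord r (%h. a * f h)"
proof (induction rule: vord.induct)
  case (step f \<alpha> c)
  then have "vord r (%h. (a * c) * monomial \<alpha> h + a * f h)" by (intro vord.step) auto
  then show ?case by (simp add: algebra_simps)
qed (simp add: vord.zero)

lemma vord_monomial: "r \<le> mi_order \<alpha> ==> vord r (monomial \<alpha>)"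
  using vord.step[OF vord.zero, of r \<alpha> 1] by simp

lemma vord_sum: "(!!i. i \<in> I ==> vord r (f i)) ==> vord r (%h. \<Sum>i\<in>I. f i h)"
  by (induction I rule: infinite_finite_induct) (auto intro: vord.zero vord_add)

lemma mi_order_dec:
  fixes \<alpha> :: "'k::finite => 'n::finite => nat"
  shows "mi_order \<alpha> \<le> Suc (mi_order (\<alpha>(j := (\<alpha> j)(l := \<alpha> j l - 1))))"
proof -
  let ?\<alpha>' = "\<alpha>(j := (\<alpha> j)(l := \<alpha> j l - 1))"
  have 1: "(\<Sum>l'\<in>UNIV. \<alpha> j l') \<le> Suc (\<Sum>l'\<in>UNIV. ?\<alpha>' j l')"
    by (subst (1 2) sum.remove[of _ l]) auto
  have 2: "mi_order \<beta> = (\<Sum>l'\<in>UNIV. \<beta> j l') + (\<Sum>j'\<in>UNIV - {j}. \<Sum>l'\<in>UNIV. \<beta> j' l')" for \<beta> :: "'k => 'n => nat"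
    unfolding mi_order_def by (subst sum.remove[of _ j]) auto
  have "(\<Sum>j'\<in>UNIV - {j}. \<Sum>l'\<in>UNIV. ?\<alpha>' j' l') = (\<Sum>j'\<in>UNIV - {j}. \<Sum>l'\<in>UNIV. \<alpha> j' l')"
    by (rule sum.cong) auto
  then show ?thesis using 1 unfolding 2[of \<alpha>] 2[of ?\<alpha>'] by simp
qed

lemma vord_dv_axis:
  fixes f :: "real ^ 'n::finite ^ 'k::finite => real"
  assumes "vord (Suc r) f" shows "vord r (dv (axis j (axis l 1)) f)"
  using assms
proof (induction rule: vord.induct)
  case zero
  have "dv (axis j (axis l 1)) (%_ :: real ^ 'n ^ 'k. 0) = (%_. 0)" by (intro ext dv_const)
  then show ?case by (simp add: vord.zero)
next
  case (step f \<alpha> c)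
  have mono: "dv (axis j (axis l 1)) (monomial \<alpha>) = (%x. real (\<alpha> j l) * monomial (\<alpha>(j := (\<alpha> j)(l := \<alpha> j l - 1))) x)"
    using pderiv_arg_monomials[of "{()}" j l "%_ _. 1" "%_. \<alpha>"]
    by (simp add: pderiv_arg_darg darg_def fun_eq_iff)
  have d: "monomial \<alpha> differentiable (at x)" "f differentiable (at x)" for x
    using vord_poly[OF vord_monomial[of 0 \<alpha>]] vord_poly[OF step(1)]
    by (auto intro: differentiable_at_real_polynomial_function)
  have "dv (axis j (axis l 1)) (%h. c * monomial \<alpha> h + f h)
    = (%x. c * (real (\<alpha> j l) * monomial (\<alpha>(j := (\<alpha> j)(l := \<alpha> j l - 1))) x) + dv (axis j (axis l 1)) f x)"
    using d by (intro ext) (simp add: dv_add dv_cmult mono)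
  moreover have "r \<le> mi_order (\<alpha>(j := (\<alpha> j)(l := \<alpha> j l - 1)))"
    using step(2) mi_order_dec[of \<alpha> j l] by simp
  ultimately show ?case using step by (auto intro!: vord_add vord_cmult vord_monomial)
qed

lemma vord_dv:
  fixes f :: "real ^ 'n::finite ^ 'k::finite => real"
  assumes "vord (Suc r) f" shows "vord r (dv (axis j v) f)"
proof -
  have d: "f differentiable (at x)" for x
    by (intro differentiable_at_real_polynomial_function vord_poly[OF assms])
  have "dv (axis j v) f = (%x. \<Sum>l\<in>UNIV. v $ l * dv (axis j (axis l 1)) f x)"
  proof
    fix x
    have lin: "linear (frechet_derivative f (at x))" using d by (rule linear_frechet_derivative)
    have "dv (axis j v) f x = frechet_derivative f (at x) (\<Sum>p\<in>UNIV. v $ p *\<^sub>R axis j (axis p 1))"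
      by (subst axis_column_expand[symmetric]) (rule dv_frechet[OF d])
    then show "dv (axis j v) f x = (\<Sum>l\<in>UNIV. v $ l * dv (axis j (axis l 1)) f x)"
      using lin by (simp add: linear_sum linear_cmul dv_frechet[OF d])
  qed
  then show ?thesis using assms by (simp add: vord_sum vord_cmult vord_dv_axis)
qed

lemma vord_at_0: "vord r f ==> 0 < r ==> f 0 = 0"
  for f :: "real ^ 'n::finite ^ 'k::finite => real"
proof (induction rule: vord.induct)
  case (step f \<alpha> c)
  have "monomial \<alpha> (0 :: real ^ 'n ^ 'k) = 0"
  proof -
    have "\<exists>j l. \<alpha> j l \<noteq> 0"
    proof (rule ccontr)
      assume "\<not> ?thesis"
      then have "mi_order \<alpha> = 0" by (simp add: mi_order_def)
      then show False using step by simp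
    qed
    then obtain j l where "\<alpha> j l \<noteq> 0" by blast
    then show ?thesis
      unfolding monomial_def by (intro prod_zero bexI[of _ j]) (auto intro!: prod_zero bexI[of _ l])
  qed
  then show ?case using step by simp
qed simp

lemma dv_translate: "dv v (%h. f (z + h)) h = dv v f (z + h)"
  by (simp add: dv_def add.assoc)

lemma dargs_vord:
  fixes F :: "real ^ 'n::finite ^ 'k::finite => nat => real"
  assumes "!!i. vord q (%h. F (z + h) i)" "length ws \<le> q"
  shows "vord (q - length ws) (%h. dargs ws F (z + h) i)"
  using assms(2)
proof (induction ws arbitrary: i)
  case (Cons p ws)
  obtain j v where p: "p = (j, v)" by (cases p)
  have "q - length ws = Suc (q - length (p # ws))" using Cons.prems by simp
  with Cons have "vord (Suc (q - length (p # ws))) (%h. dargs ws F (z + h) i)" by simp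
  from vord_dv[OF this, of j v]
  have "vord (q - length (p # ws)) (%h. dv (axis j v) (%h. dargs ws F (z + h) i) h)" .
  moreover have "dv (axis j v) (%h. dargs ws F (z + h) i) h = dargs (p # ws) F (z + h) i" for h
    unfolding dv_translate[of "axis j v" "%y. dargs ws F y i" z h] by (simp add: p darg_def)
  ultimately show ?case by simp
qed (use assms in simp)

lemma dargs_vanish:
  fixes F :: "real ^ 'n::finite ^ 'k::finite => nat => real"
  assumes "!!i. vord q (%h. F (z + h) i)" "length ws < q" shows "dargs ws F z i = 0"
  using vord_at_0[OF dargs_vord[where F = F and z = z and q = q and ws = ws and i = i]] assms by simp

lemma dv_affine:
  fixes L :: "'a::real_normed_vector => 'b::real_normed_vector"
  assumes "linear L" shows "dv v (%u. f (a + L u)) u = dv (L v) f (a + L u)"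
  unfolding dv_def by (simp add: linear_add[OF assms] linear_cmul[OF assms] add.assoc)

lemma mixed_deriv_pullback:
  fixes T :: "real ^ 'n::finite ^ 'n" and F :: "real ^ 'n ^ 'k::finite => nat => real"
  assumes F: "poly_comps F"
  shows "mixed_deriv pderiv_arg \<alpha> (%u. F (z + (\<chi> j. T *v (u $ j)))) u
    = mixed_deriv (pullback_pderiv_arg T) \<alpha> F (z + (\<chi> j. T *v (u $ j)))"
proof -
  define L where "L u = (\<chi> j. T *v (u $ j))" for u :: "real ^ 'n ^ 'k"
  have lin: "linear L" unfolding L_def
    by (rule linearI) (auto simp: vec_eq_iff matrix_vector_right_distrib matrix_vector_mult_scaleR)
  have L_axis: "L (axis j (axis l 1)) = axis j (column l T)" for j l
    by (auto simp: L_def vec_eq_iff axis_def column_def matrix_vector_mult_def if_distrib[of "%x. x $ _"] if_distrib[of "%x. _ * x"] cong: if_cong)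
  have one: "pderiv_arg j l (%u. G (z + L u)) = (%u. pullback_pderiv_arg T j l G (z + L u))" if "poly_comps G" for G j l
  proof (intro ext)
    fix u i
    show "pderiv_arg j l (%u. G (z + L u)) u i = pullback_pderiv_arg T j l G (z + L u) i"
      using dv_affine[OF lin, of "axis j (axis l 1)" "%y. G y i" z u]
      by (simp add: pullback_pderiv_arg_darg[OF that] pderiv_arg_darg darg_def L_axis)
  qed
  have pc: "poly_comps (pullback_pderiv_arg T j l G)" if "poly_comps G" for G j l
    unfolding pullback_pderiv_arg_darg[OF that] by (rule poly_comps_darg[OF that])
  have pow: "(pderiv_arg j l ^^ m) (%u. G (z + L u)) = (%u. (pullback_pderiv_arg T j l ^^ m) G (z + L u))
      \<and> poly_comps ((pullback_pderiv_arg T j l ^^ m) G)" if "poly_comps G" for G j l m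
    using that by (induction m) (auto simp: one pc)
  have "foldr (%(j, l). pderiv_arg j l ^^ \<alpha> j l) xs (%u. F (z + L u))
      = (%u. foldr (%(j, l). pullback_pderiv_arg T j l ^^ \<alpha> j l) xs F (z + L u))
      \<and> poly_comps (foldr (%(j, l). pullback_pderiv_arg T j l ^^ \<alpha> j l) xs F)" for xs
  proof (induction xs)
    case (Cons p xs)
    obtain j l where p: "p = (j, l)" by (cases p)
    show ?case
      using Cons pow[of "foldr (%(j, l). pullback_pderiv_arg T j l ^^ \<alpha> j l) xs F" "\<alpha> j l" j l] by (simp add: p)
  qed (simp add: F)
  then show ?thesis unfolding mixed_deriv_enum L_def[symmetric] by simp
qed

lemma poly_comps_translate:
  fixes T :: "real ^ 'n::finite ^ 'n" and F :: "real ^ 'n ^ 'k::finite => nat => real"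
  assumes "poly_comps F" shows "real_polynomial_function (%u. F (z + (\<chi> j. T *v (u $ j))) i)"
proof -
  have lin: "linear (%u :: real ^ 'n ^ 'k. \<chi> j. T *v (u $ j))"
    by (rule linearI) (auto simp: vec_eq_iff matrix_vector_right_distrib matrix_vector_mult_scaleR)
  have "polynomial_function (%u. z + (\<chi> j. T *v (u $ j)))"
    by (intro polynomial_function_add polynomial_function_const polynomial_function_bounded_linear
        linear_conv_bounded_linear[THEN iffD1] lin)
  from real_polynomial_function_compose[OF this, of "%x. F x i"] show ?thesis
    using assms by (simp add: poly_comps_def o_def)
qed

lemma taylor_coefficients:
  fixes T :: "real ^ 'n::finite ^ 'n" and F :: "real ^ 'n ^ 'k::finite => nat => real"
  assumes F: "poly_comps F" and m: "!!x i. m \<le> i ==> F x i = 0"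
  obtains d c where "!!u i. F (z + (\<chi> j. T *v (u $ j))) i = (\<Sum>\<alpha> | mi_order \<alpha> \<le> d. c \<alpha> i * monomial \<alpha> u)"
    "!!\<alpha> i. mi_order \<alpha> \<le> d ==> mixed_deriv (pullback_pderiv_arg T) \<alpha> F z i = c \<alpha> i * (\<Prod>j\<in>UNIV. \<Prod>l\<in>UNIV. fact (\<alpha> j l))"
    "!!\<alpha> i. m \<le> i ==> c \<alpha> i = 0"
proof -
  let ?G = "%u. F (z + (\<chi> j. T *v (u $ j)))"
  have "\<forall>i. \<exists>d c. \<forall>u. ?G u i = (\<Sum>\<alpha> | mi_order \<alpha> \<le> d. c \<alpha> * monomial \<alpha> u)"
    by (intro allI real_polynomial_function_monomials poly_comps_translate F)
  from choice[OF this] obtain d where "\<forall>i. \<exists>c. \<forall>u. ?G u i = (\<Sum>\<alpha> | mi_order \<alpha> \<le> d i. c \<alpha> * monomial \<alpha> u)" ..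
  from choice[OF this] obtain c where "\<forall>i u. ?G u i = (\<Sum>\<alpha> | mi_order \<alpha> \<le> d i. c i \<alpha> * monomial \<alpha> u)" ..
  then have dc: "?G u i = (\<Sum>\<alpha> | mi_order \<alpha> \<le> d i. c i \<alpha> * monomial \<alpha> u)" for u i by blast
  define d' where "d' = Max (d ` {..m})"
  define c' where "c' \<alpha> i = (if i < m \<and> mi_order \<alpha> \<le> d i then c i \<alpha> else 0)" for \<alpha> i
  have G: "?G u i = (\<Sum>\<alpha> | mi_order \<alpha> \<le> d'. c' \<alpha> i * monomial \<alpha> u)" for u i
  proof (cases "i < m")
    case True
    then have "d i \<le> d'" unfolding d'_def by (intro Max_ge) auto
    then show ?thesis unfolding dc
      by (intro sum.mono_neutral_cong_left finite_mi_order_le) (auto simp: c'_def True)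
  next
    case False
    then show ?thesis using m[of i] by (simp add: c'_def)
  qed
  show thesis
  proof (rule that[of c' d'])
    fix \<alpha> :: "'k => 'n => nat" and i assume \<alpha>: "mi_order \<alpha> \<le> d'"
    have "mixed_deriv (pullback_pderiv_arg T) \<alpha> F z i = mixed_deriv pderiv_arg \<alpha> ?G 0 i"
      using mixed_deriv_pullback[OF F, of \<alpha> z T 0] by (simp add: zero_vec_def[symmetric])
    also have "?G = (%u i. \<Sum>\<alpha> | mi_order \<alpha> \<le> d'. c' \<alpha> i * monomial \<alpha> u)"
      by (intro ext G)
    also have "mixed_deriv pderiv_arg \<alpha> \<dots> 0 i = c' \<alpha> i * (\<Prod>j\<in>UNIV. \<Prod>l\<in>UNIV. fact (\<alpha> j l))"
      using \<alpha> by (subst mixed_deriv_monomials_at_0[OF finite_mi_order_le]) simp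
    finally show "mixed_deriv (pullback_pderiv_arg T) \<alpha> F z i = c' \<alpha> i * (\<Prod>j\<in>UNIV. \<Prod>l\<in>UNIV. fact (\<alpha> j l))" .
  qed (auto simp: G c'_def)
qed

lemma pullback_identity: "pullback_pderiv_arg (mat 1) = pderiv_arg"
  by (intro ext) (simp add: pullback_pderiv_arg_def mat_def if_distrib[of "%x. x * _"] cong: if_cong)

text \<open>The Taylor coefficients of order less than \<open>q\<close> are multiples of the mixed derivatives.\<close>

lemma vanishing_vord:
  fixes F :: "real ^ 'n::finite ^ 'k::finite => nat => real"
  assumes F: "poly_comps F" and m: "!!x i. m \<le> i ==> F x i = 0"
    and van: "!!\<alpha>. mi_order \<alpha> < q ==> mixed_deriv pderiv_arg \<alpha> F z = (%_. 0)"
  shows "vord q (%h. F (z + h) i)"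
proof -
  obtain d c where dc: "!!u i. F (z + (\<chi> j. mat 1 *v (u $ j))) i = (\<Sum>\<alpha> | mi_order \<alpha> \<le> d. c \<alpha> i * monomial \<alpha> u)"
    "!!\<alpha> i. mi_order \<alpha> \<le> d ==> mixed_deriv (pullback_pderiv_arg (mat 1)) \<alpha> F z i = c \<alpha> i * (\<Prod>j\<in>UNIV. \<Prod>l\<in>UNIV. fact (\<alpha> j l))"
    by (rule taylor_coefficients[where T = "mat 1" and z = z and m = m, OF F m]) (blast, rule that)
  have c0: "c \<alpha> i = 0" if "mi_order \<alpha> \<le> d" "mi_order \<alpha> < q" for \<alpha>
  proof -
    have "c \<alpha> i * (\<Prod>j\<in>UNIV. \<Prod>l\<in>UNIV. fact (\<alpha> j l)) = 0"
      using dc(2)[OF that(1), of i] van[OF that(2)] by (simp add: pullback_identity)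
    then show ?thesis by simp
  qed
  have "vord q (%h. \<Sum>\<alpha> | mi_order \<alpha> \<le> d. c \<alpha> i * monomial \<alpha> h)"
  proof (rule vord_sum)
    fix \<alpha> :: "'k => 'n => nat" assume "\<alpha> \<in> {\<alpha>. mi_order \<alpha> \<le> d}"
    then show "vord q (%h. c \<alpha> i * monomial \<alpha> h)"
    proof (cases "mi_order \<alpha> < q")
      case False
      then show ?thesis by (intro vord_cmult vord_monomial) simp
    qed (use c0[of \<alpha>] in \<open>simp add: vord.zero\<close>)
  qed
  moreover have "F (z + h) i = (\<Sum>\<alpha> | mi_order \<alpha> \<le> d. c \<alpha> i * monomial \<alpha> h)" for h
    using dc(1)[of h i] by simp
  ultimately show ?thesis by simp
qed

text \<open>In the coordinates given by \<open>T\<close> the terms of order \<open>q\<close> are controlled by the derivatives of order \<open>q\<close> along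
  the columns of \<open>T\<close>; the factor \<open>C\<close> of the higher terms depends on the point and on \<open>\<Phi>\<close>.\<close>

theorem taylor_bound:
  fixes T :: "real ^ 'n::finite ^ 'n" and \<Phi> :: "real ^ 'n ^ 'k::finite => nat => real"
  assumes N: "norm_on m N" and \<Phi>: "polynomial_map m \<Phi>"
    and van: "!!\<alpha>. mi_order \<alpha> < q ==> mixed_deriv pderiv_arg \<alpha> \<Phi> z = (%_. 0)"
    and M: "!!\<alpha>. mi_order \<alpha> = q ==> N (mixed_deriv (pullback_pderiv_arg T) \<alpha> \<Phi> z) \<le> M"
  shows "\<exists>C\<ge>0. \<forall>u s. 0 \<le> s \<and> s \<le> 1 \<and> (\<forall>j l. \<bar>u $ j $ l\<bar> \<le> s) -->
    N (\<Phi> (z + (\<chi> j. T *v (u $ j)))) \<le> s ^ q * (real (card {\<alpha> :: 'k => 'n => nat. mi_order \<alpha> = q}) * M) + C * s ^ (q + 1)"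
proof -
  have F: "poly_comps \<Phi>" using polynomial_map_component[OF \<Phi>] by (simp add: poly_comps_def)
  have m0: "\<Phi> x i = 0" if "m \<le> i" for x i using polynomial_map_Euc[OF \<Phi>, of x] that by (simp add: Euc_iff)
  obtain d c where dc: "!!u i. \<Phi> (z + (\<chi> j. T *v (u $ j))) i = (\<Sum>\<alpha> | mi_order \<alpha> \<le> d. c \<alpha> i * monomial \<alpha> u)"
    "!!\<alpha> i. mi_order \<alpha> \<le> d ==> mixed_deriv (pullback_pderiv_arg T) \<alpha> \<Phi> z i = c \<alpha> i * (\<Prod>j\<in>UNIV. \<Prod>l\<in>UNIV. fact (\<alpha> j l))"
    "!!\<alpha> i. m \<le> i ==> c \<alpha> i = 0"
    by (rule taylor_coefficients[where T = T and z = z and m = m, OF F m0]) (blast, rule that)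
  have cE: "c \<alpha> \<in> Euc m" for \<alpha> using dc(3) by (simp add: Euc_iff)
  have Nc: "0 \<le> N (c \<alpha>)" for \<alpha> by (rule norm_on_nonneg[OF N cE])
  have fact1: "1 \<le> (\<Prod>j\<in>UNIV. \<Prod>l\<in>UNIV. fact (\<alpha> j l) :: real)" for \<alpha> :: "'k => 'n => nat"
    by (intro prod_ge_1) (auto simp: fact_ge_1)
  have low: "c \<alpha> i = 0" if "mi_order \<alpha> \<le> d" "mi_order \<alpha> < q" for \<alpha> i
  proof -
    have "mixed_deriv (pullback_pderiv_arg T) \<alpha> \<Phi> z i = dargs (mi_word (%l. column l T) \<alpha>) \<Phi> z i"
      by (subst mixed_deriv_dargs[OF pullback_pderiv_arg_darg F]) auto
    also have "\<dots> = 0"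
      by (rule dargs_vanish[OF vanishing_vord[OF F m0 van]]) (use that in \<open>auto simp: length_mi_word\<close>)
    finally show ?thesis using dc(2)[OF that(1), of i] fact1[of \<alpha>] by auto
  qed
  have top: "N (c \<alpha>) \<le> M" if "mi_order \<alpha> \<le> d" "mi_order \<alpha> = q" for \<alpha>
  proof -
    let ?f = "\<Prod>j\<in>UNIV. \<Prod>l\<in>UNIV. fact (\<alpha> j l) :: real"
    have "mixed_deriv (pullback_pderiv_arg T) \<alpha> \<Phi> z = (%i. ?f * c \<alpha> i)"
      using dc(2)[OF that(1)] by (auto simp: mult.commute)
    then have "N (mixed_deriv (pullback_pderiv_arg T) \<alpha> \<Phi> z) = ?f * N (c \<alpha>)"
      using norm_on_scale[OF N cE, of ?f \<alpha>] fact1[of \<alpha>] by simp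
    moreover have "1 * N (c \<alpha>) \<le> ?f * N (c \<alpha>)" by (intro mult_right_mono fact1 Nc)
    ultimately show ?thesis using M[OF that(2)] by simp
  qed
  have M0: "0 \<le> M" if "{\<alpha> :: 'k => 'n => nat. mi_order \<alpha> \<le> d \<and> mi_order \<alpha> = q} \<noteq> {}"
    using top Nc that by (blast intro: order_trans)
  define A where "A = {\<alpha> :: 'k => 'n => nat. mi_order \<alpha> \<le> d}"
  have fA: "finite A" unfolding A_def by (rule finite_mi_order_le)
  have fq: "finite {\<alpha> :: 'k => 'n => nat. mi_order \<alpha> = q}"
    by (rule finite_subset[OF _ finite_mi_order_le[of q]]) auto
  define C where "C = (\<Sum>\<alpha>\<in>A. N (c \<alpha>)) + real (card {\<alpha> :: 'k => 'n => nat. mi_order \<alpha> = q}) * \<bar>M\<bar>"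
  show ?thesis
  proof (cases "q \<le> d")
    case dq: True
    show ?thesis
    proof (intro exI[of _ "\<Sum>\<alpha>\<in>A. N (c \<alpha>)"] conjI allI impI)
      show "0 \<le> (\<Sum>\<alpha>\<in>A. N (c \<alpha>))" by (intro sum_nonneg Nc)
      fix u :: "real ^ 'n ^ 'k" and s :: real assume s: "0 \<le> s \<and> s \<le> 1 \<and> (\<forall>j l. \<bar>u $ j $ l\<bar> \<le> s)"
      have mono: "\<bar>monomial \<alpha> u\<bar> \<le> s ^ mi_order \<alpha>" for \<alpha>
      proof -
        have "\<bar>monomial \<alpha> u\<bar> = (\<Prod>j\<in>UNIV. \<Prod>l\<in>UNIV. \<bar>u $ j $ l\<bar> ^ \<alpha> j l)"
          by (simp add: monomial_def abs_prod power_abs)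
        also have "\<dots> \<le> (\<Prod>j\<in>UNIV. \<Prod>l\<in>UNIV. s ^ \<alpha> j l)"
          using s by (intro prod_mono conjI prod_nonneg power_mono) auto
        finally show ?thesis by (simp add: mi_order_def power_sum)
      qed
      have "\<Phi> (z + (\<chi> j. T *v (u $ j))) = (%i. \<Sum>\<alpha>\<in>A. monomial \<alpha> u * c \<alpha> i)"
        using dc(1)[of u] by (auto simp: A_def mult.commute)
      then have "N (\<Phi> (z + (\<chi> j. T *v (u $ j)))) \<le> (\<Sum>\<alpha>\<in>A. \<bar>monomial \<alpha> u\<bar> * N (c \<alpha>))"
        using norm_on_sum[OF N fA cE] by simp
      also have "\<dots> \<le> (\<Sum>\<alpha>\<in>A. (if mi_order \<alpha> = q then s ^ q * M else 0) + s ^ (q + 1) * N (c \<alpha>))"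
      proof (rule sum_mono)
        fix \<alpha> assume \<alpha>: "\<alpha> \<in> A"
        consider "mi_order \<alpha> < q" | "mi_order \<alpha> = q" | "q + 1 \<le> mi_order \<alpha>" by linarith
        then show "\<bar>monomial \<alpha> u\<bar> * N (c \<alpha>) \<le> (if mi_order \<alpha> = q then s ^ q * M else 0) + s ^ (q + 1) * N (c \<alpha>)"
        proof cases
          case 1
          then have "c \<alpha> = (%_. 0)" using low[of \<alpha>] \<alpha> by (auto simp: A_def)
          then show ?thesis using 1 s norm_on_zero[OF N] by simp
        next
          case 2
          have "\<bar>monomial \<alpha> u\<bar> * N (c \<alpha>) \<le> s ^ q * M"
            using mono[of \<alpha>] top[of \<alpha>] \<alpha> 2 s Nc by (intro mult_mono) (auto simp: A_def)
          moreover have "0 \<le> s ^ (q + 1) * N (c \<alpha>)" using s Nc by simp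
          ultimately show ?thesis using 2 by simp
        next
          case 3
          have "\<bar>monomial \<alpha> u\<bar> \<le> s ^ (q + 1)"
            using s 3 by (intro order_trans[OF mono] power_decreasing) auto
          then show ?thesis using 3 Nc by (auto intro: mult_right_mono)
        qed
      qed
      also have "\<dots> = (\<Sum>\<alpha>\<in>A. (if mi_order \<alpha> = q then s ^ q * M else 0)) + (\<Sum>\<alpha>\<in>A. N (c \<alpha>)) * s ^ (q + 1)"
        by (simp add: sum.distrib sum_distrib_left mult.commute)
      also have "(\<Sum>\<alpha>\<in>A. (if mi_order \<alpha> = q then s ^ q * M else 0)) = (\<Sum>\<alpha> | mi_order (\<alpha> :: 'k => 'n => nat) = q. s ^ q * M)"
        using dq fA by (intro sum.mono_neutral_cong_right) (auto simp: A_def)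
      finally show "N (\<Phi> (z + (\<chi> j. T *v (u $ j)))) \<le> s ^ q * (real (card {\<alpha> :: 'k => 'n => nat. mi_order \<alpha> = q}) * M)
        + (\<Sum>\<alpha>\<in>A. N (c \<alpha>)) * s ^ (q + 1)" by (simp add: mult_ac)
    qed
  next
    case False
    then have "c \<alpha> i = 0" if "\<alpha> \<in> A" for \<alpha> i using low[of \<alpha>] that by (auto simp: A_def)
    then have zero: "\<Phi> (z + (\<chi> j. T *v (u $ j))) = (%_. 0)" for u
      using dc(1)[of u] by (auto simp: A_def)
    show ?thesis
    proof (intro exI[of _ C] conjI allI impI)
      show "0 \<le> C" unfolding C_def using Nc by (intro add_nonneg_nonneg sum_nonneg) auto
      fix u :: "real ^ 'n ^ 'k" and s :: real assume s: "0 \<le> s \<and> s \<le> 1 \<and> (\<forall>j l. \<bar>u $ j $ l\<bar> \<le> s)"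
      have "0 \<le> M"
      proof (cases "{\<alpha> :: 'k => 'n => nat. mi_order \<alpha> = q} = {}")
        case ne: False
        then obtain \<alpha> :: "'k => 'n => nat" where \<alpha>: "mi_order \<alpha> = q" by auto
        have "mixed_deriv (pullback_pderiv_arg T) \<alpha> \<Phi> z = mixed_deriv pderiv_arg \<alpha> (%u. \<Phi> (z + (\<chi> j. T *v (u $ j)))) 0"
          using mixed_deriv_pullback[OF F, of \<alpha> z T 0] by (simp add: zero_vec_def[symmetric])
        also have "\<dots> = (%_. 0)"
          unfolding zero using mixed_deriv_monomials_at_0[of "{}" \<alpha>] by auto
        finally show ?thesis using M[OF \<alpha>] norm_on_zero[OF N] by simp
      next
        case True
        let ?\<alpha> = "%(j::'k) (l::'n). if (j, l) = hd mi_enum then q else 0"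
        have "mi_order ?\<alpha> = q"
        proof -
          have "mi_order ?\<alpha> = (\<Sum>p\<in>UNIV. if p = hd mi_enum then q else 0)"
            by (simp add: mi_order_def sum.cartesian_product case_prod_unfold)
          then show ?thesis by simp
        qed
        then show ?thesis using True by auto
      qed
      then show "N (\<Phi> (z + (\<chi> j. T *v (u $ j)))) \<le> s ^ q * (real (card {\<alpha> :: 'k => 'n => nat. mi_order \<alpha> = q}) * M) + C * s ^ (q + 1)"
        unfolding zero norm_on_zero[OF N] using s Nc
        by (auto simp: C_def intro!: add_nonneg_nonneg mult_nonneg_nonneg sum_nonneg)
    qed
  qed
qed

section \<open>Sublinear functionals and Frostman measures\<close>

definition bounded_funs :: "('a => real) set" where "bounded_funs = {f. bounded (range f)}"

lemma bounded_funsI: "(!!x. \<bar>f x\<bar> \<le> B) ==> f \<in> bounded_funs"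
  by (auto simp: bounded_funs_def bounded_iff)

lemma bounded_funsE:
  assumes "f \<in> bounded_funs" obtains B where "!!x. \<bar>f x\<bar> \<le> B"
  using assms by (auto simp: bounded_funs_def bounded_iff)

lemma bounded_funs_scale [intro]: "f \<in> bounded_funs ==> (%x. c * f x) \<in> bounded_funs"
proof (erule bounded_funsE)
  fix B assume "!!x. \<bar>f x\<bar> \<le> B"
  then show ?thesis
    by (intro bounded_funsI[of _ "\<bar>c\<bar> * B"]) (simp add: abs_mult mult_left_mono)
qed

lemma bounded_funs_add [intro]:
  assumes "f \<in> bounded_funs" "g \<in> bounded_funs" shows "(%x. f x + g x) \<in> bounded_funs"
proof -
  obtain A B where "!!x. \<bar>f x\<bar> \<le> A" "!!x. \<bar>g x\<bar> \<le> B"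
    using assms by (auto elim!: bounded_funsE)
  then show ?thesis by (intro bounded_funsI[of _ "A + B"]) (meson abs_triangle_ineq add_mono order_trans)
qed

lemma bounded_funs_uminus [intro]: "f \<in> bounded_funs ==> (%x. - f x) \<in> bounded_funs"
  using bounded_funs_scale[of f "-1"] by simp

lemma bounded_funs_const [intro]: "(%x. c) \<in> bounded_funs"
  by (rule bounded_funsI[of _ "\<bar>c\<bar>"]) simp

lemma bounded_funs_indicator [intro]: "indicator A \<in> bounded_funs"
  by (rule bounded_funsI[of _ 1]) (simp add: indicator_def)

definition sublinear :: "(('a => real) => real) => bool" where
  "sublinear p \<longleftrightarrow>
    (\<forall>f\<in>bounded_funs. \<forall>g\<in>bounded_funs. p (%x. f x + g x) \<le> p f + p g) \<and>
    (\<forall>f\<in>bounded_funs. \<forall>c>0. p (%x. c * f x) = c * p f)"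

lemma sublinear_add: "sublinear p ==> f \<in> bounded_funs ==> g \<in> bounded_funs ==> p (%x. f x + g x) \<le> p f + p g"
  by (simp add: sublinear_def)

lemma sublinear_scale: "sublinear p ==> f \<in> bounded_funs ==> 0 < c ==> p (%x. c * f x) = c * p f"
  by (simp add: sublinear_def)

lemma sublinear_zero:
  assumes "sublinear p" shows "p (%_. 0) = 0"
  using sublinear_scale[OF assms, of "%_. 0" 2] by (simp add: bounded_funs_const)

lemma sublinear_scale0: "sublinear p ==> f \<in> bounded_funs ==> 0 \<le> c ==> p (%x. c * f x) = c * p f"
  by (cases "c = 0") (auto simp: sublinear_zero sublinear_scale)

lemma sublinear_uminus:
  assumes p: "sublinear p" and f: "f \<in> bounded_funs" shows "- p (%x. - f x) \<le> p f"
  using sublinear_add[OF p f bounded_funs_uminus[OF f]] sublinear_zero[OF p] by simp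

text \<open>The standard modification of a sublinear functional that makes it additive in the direction \<open>y\<close>.\<close>

definition tilt :: "(('a => real) => real) => ('a => real) => ('a => real) => real" where
  "tilt p y f = (INF t\<in>{0..}. p (%x. f x + t * y x) - t * p y)"

context
  fixes p :: "('a => real) => real" and y :: "'a => real"
  assumes p: "sublinear p" and y: "y \<in> bounded_funs"
begin

lemma tilt_lower:
  assumes f: "f \<in> bounded_funs" and t: "0 \<le> t"
  shows "- p (%x. - f x) \<le> p (%x. f x + t * y x) - t * p y"
  using sublinear_add[OF p, of "%x. f x + t * y x" "%x. - f x"] sublinear_scale0[OF p y t] f y
  by (auto simp: bounded_funs_add bounded_funs_scale bounded_funs_uminus)

lemma tilt_le:
  assumes f: "f \<in> bounded_funs" and t: "0 \<le> t"
  shows "tilt p y f \<le> p (%x. f x + t * y x) - t * p y"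
  unfolding tilt_def using tilt_lower[OF f] t
  by (intro cINF_lower bdd_belowI2[of _ "- p (%x. - f x)"]) auto

lemma tilt_greatest:
  assumes "!!t. 0 \<le> t ==> b \<le> p (%x. f x + t * y x) - t * p y"
  shows "b \<le> tilt p y f"
  unfolding tilt_def using assms by (intro cINF_greatest) auto

lemma tilt_sublinear: "sublinear (tilt p y)"
  unfolding sublinear_def
proof (intro conjI ballI allI impI)
  fix f g :: "'a => real" assume f: "f \<in> bounded_funs" and g: "g \<in> bounded_funs"
  have *: "tilt p y (%x. f x + g x) \<le> (p (%x. f x + s * y x) - s * p y) + (p (%x. g x + t * y x) - t * p y)"
    if "0 \<le> s" "0 \<le> t" for s t
  proof -
    have "tilt p y (%x. f x + g x) \<le> p (%x. (f x + g x) + (s + t) * y x) - (s + t) * p y"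
      using that f g by (intro tilt_le) auto
    also have "(%x. (f x + g x) + (s + t) * y x) = (%x. (f x + s * y x) + (g x + t * y x))"
      by (auto simp: algebra_simps)
    also have "p \<dots> \<le> p (%x. f x + s * y x) + p (%x. g x + t * y x)"
      using f g y by (intro sublinear_add[OF p]) auto
    finally show ?thesis by (simp add: algebra_simps)
  qed
  have "tilt p y (%x. f x + g x) - (p (%x. g x + t * y x) - t * p y) \<le> tilt p y f" if "0 \<le> t" for t
    using *[OF _ that] by (intro tilt_greatest) (simp add: algebra_simps)
  then have "tilt p y (%x. f x + g x) - tilt p y f \<le> tilt p y g"
    by (intro tilt_greatest) (simp add: algebra_simps)
  then show "tilt p y (%x. f x + g x) \<le> tilt p y f + tilt p y g" by simp
next
  fix f :: "'a => real" and c :: real assume f: "f \<in> bounded_funs" and c: "0 < c"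
  have le: "tilt p y (%x. c * f x) \<le> c * tilt p y f" if f: "f \<in> bounded_funs" and c: "0 < c" for f c
  proof -
    have "tilt p y (%x. c * f x) / c \<le> tilt p y f"
    proof (rule tilt_greatest)
      fix t :: real assume t: "0 \<le> t"
      have "tilt p y (%x. c * f x) \<le> p (%x. c * f x + (c * t) * y x) - (c * t) * p y"
        using t c f by (intro tilt_le) auto
      also have "(%x. c * f x + (c * t) * y x) = (%x. c * (f x + t * y x))"
        by (auto simp: algebra_simps)
      also have "p \<dots> = c * p (%x. f x + t * y x)"
        using f y c by (intro sublinear_scale[OF p]) auto
      finally show "tilt p y (%x. c * f x) / c \<le> p (%x. f x + t * y x) - t * p y"
        using c by (simp add: field_simps)
    qed
    then show ?thesis using c by (simp add: field_simps)
  qed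
  have "tilt p y (%x. (1 / c) * (c * f x)) \<le> (1 / c) * tilt p y (%x. c * f x)"
    using f c by (intro le) auto
  then show "tilt p y (%x. c * f x) = c * tilt p y f"
    using le[OF f c] c by (simp add: field_simps)
qed

lemma tilt_le_self: "f \<in> bounded_funs ==> tilt p y f \<le> p f"
  using tilt_le[of f 0] by simp

end

definition minorant_set :: "(('a => real) => real) => (('a => real) => real) set" where
  "minorant_set p = {q. sublinear q \<and> (\<forall>f\<in>bounded_funs. q f \<le> p f) \<and> (\<forall>f. f \<notin> bounded_funs --> q f = 0)}"

text \<open>Zorn's lemma; the infimum of a chain of sublinear functionals is finite because each of them is at least
  \<open>- p (- f)\<close>.\<close>

lemma minimal_sublinear_exists:
  assumes p: "sublinear p"
  obtains L where "L \<in> minorant_set p"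
    "!!q. q \<in> minorant_set p ==> (!!f. q f \<le> L f) ==> q = L"
proof -
  let ?A = "minorant_set p" and ?P = "%q q'. \<forall>f. q' f \<le> q f"
  have "\<exists>m\<in>?A. \<forall>a\<in>?A. ?P m a --> a = m"
  proof (rule predicate_Zorn)
    show "partial_order_on ?A (relation_of ?P ?A)"
      by (rule partial_order_on_relation_ofI) (auto intro: order_trans intro!: ext antisym)
  next
    fix C assume C: "C \<in> Chains (relation_of ?P ?A)"
    then have CA: "C \<subseteq> ?A" by (auto simp: Chains_def relation_of_def)
    have chain: "q \<in> C ==> q' \<in> C ==> ?P q q' \<or> ?P q' q" for q q'
      using C by (auto simp: Chains_def relation_of_def)
    show "\<exists>u\<in>?A. \<forall>a\<in>C. ?P a u"
    proof (cases "C = {}")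
      case True
      have "(%f. if f \<in> bounded_funs then p f else 0) \<in> ?A"
        using p by (auto simp: minorant_set_def sublinear_def bounded_funs_add bounded_funs_scale)
      then show ?thesis using True by auto
    next
      case ne: False
      define u where "u f = (INF q\<in>C. q f)" for f
      have sub: "sublinear q" if "q \<in> C" for q using CA that by (auto simp: minorant_set_def)
      have qp: "q f \<le> p f" if "q \<in> C" "f \<in> bounded_funs" for q f using CA that by (auto simp: minorant_set_def)
      have q0: "q f = 0" if "q \<in> C" "f \<notin> bounded_funs" for q f using CA that by (auto simp: minorant_set_def)
      have bdd: "bdd_below ((%q. q f) ` C)" for f
      proof (cases "f \<in> bounded_funs")
        case True
        have "- p (%x. - f x) \<le> q f" if "q \<in> C" for q
          using sublinear_uminus[OF sub[OF that] True] qp[OF that bounded_funs_uminus[OF True]] by simp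
        then show ?thesis by (intro bdd_belowI2)
      qed (auto simp: q0 intro!: bdd_belowI2[of _ 0])
      have u_le: "u f \<le> q f" if "q \<in> C" for q f
        unfolding u_def by (rule cINF_lower[OF bdd that])
      have u_ge: "b \<le> u f" if "!!q. q \<in> C ==> b \<le> q f" for b f
        unfolding u_def using ne that by (rule cINF_greatest)
      have "sublinear u"
        unfolding sublinear_def
      proof (intro conjI ballI allI impI)
        fix f g :: "'a => real" assume f: "f \<in> bounded_funs" and g: "g \<in> bounded_funs"
        have *: "u (%x. f x + g x) \<le> q f + q' g" if qq: "q \<in> C" "q' \<in> C" for q q'
        proof -
          obtain r where r: "r \<in> C" "!!f. r f \<le> q f" "!!f. r f \<le> q' f"
            using chain[OF qq] qq by auto
          have "u (%x. f x + g x) \<le> r (%x. f x + g x)" by (rule u_le[OF r(1)])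
          also have "\<dots> \<le> r f + r g" by (rule sublinear_add[OF sub[OF r(1)] f g])
          also have "\<dots> \<le> q f + q' g" by (intro add_mono r)
          finally show ?thesis .
        qed
        have "u (%x. f x + g x) - q' g \<le> u f" if "q' \<in> C" for q'
          using *[OF _ that] by (intro u_ge) (simp add: algebra_simps)
        then have "u (%x. f x + g x) - u f \<le> u g" by (intro u_ge) (simp add: algebra_simps)
        then show "u (%x. f x + g x) \<le> u f + u g" by simp
      next
        fix f :: "'a => real" and c :: real assume f: "f \<in> bounded_funs" and c: "0 < c"
        have "u (%x. c * f x) / c \<le> u f"
        proof (rule u_ge)
          fix q assume q: "q \<in> C"
          show "u (%x. c * f x) / c \<le> q f"
            using u_le[OF q, of "%x. c * f x"] c unfolding sublinear_scale[OF sub[OF q] f c]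
            by (simp add: field_simps)
        qed
        moreover have "c * u f \<le> u (%x. c * f x)"
        proof (rule u_ge)
          fix q assume q: "q \<in> C"
          show "c * u f \<le> q (%x. c * f x)"
            unfolding sublinear_scale[OF sub[OF q] f c] using u_le[OF q] c by (simp add: mult_left_mono)
        qed
        ultimately show "u (%x. c * f x) = c * u f" using c by (simp add: field_simps)
      qed
      moreover obtain q where "q \<in> C" using ne by auto
      then have "\<forall>f\<in>bounded_funs. u f \<le> p f" using u_le qp by (meson order_trans)
      moreover have "\<forall>f. f \<notin> bounded_funs --> u f = 0"
        using ne by (auto simp: u_def q0)
      ultimately have "u \<in> ?A" by (simp add: minorant_set_def)
      then show ?thesis using u_le by blast
    qed
  qed
  then obtain m where "m \<in> ?A" "\<forall>a\<in>?A. ?P m a --> a = m" by blast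
  then show thesis by (intro that[of m]) auto
qed

text \<open>A minimal sublinear functional is unchanged by tilting in any direction, and is therefore linear.\<close>

theorem Hahn_Banach_bounded_funs:
  assumes p: "sublinear p" and u: "u \<in> bounded_funs"
  obtains L where "!!f. f \<in> bounded_funs ==> L f \<le> p f" "p u \<le> L u"
    "!!f g. f \<in> bounded_funs ==> g \<in> bounded_funs ==> L (%x. f x + g x) = L f + L g"
proof -
  obtain L where L: "L \<in> minorant_set (tilt p u)"
    and min: "!!q. q \<in> minorant_set (tilt p u) ==> (!!f. q f \<le> L f) ==> q = L"
    using minimal_sublinear_exists[OF tilt_sublinear[OF p u]] by blast
  have sub: "sublinear L" and le: "!!f. f \<in> bounded_funs ==> L f \<le> tilt p u f"
    and out: "!!f. f \<notin> bounded_funs ==> L f = 0"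
    using L by (auto simp: minorant_set_def)
  have superadd: "L f + L g \<le> L (%x. f x + g x)" if f: "f \<in> bounded_funs" and g: "g \<in> bounded_funs" for f g
  proof -
    define q where "q f = (if f \<in> bounded_funs then tilt L g f else 0)" for f
    have "q \<in> minorant_set (tilt p u)"
      unfolding minorant_set_def
      using tilt_sublinear[OF sub g] tilt_le_self[OF sub g] le
      by (auto simp: q_def sublinear_def bounded_funs_add bounded_funs_scale intro: order_trans)
    then have "q = L"
      by (rule min) (simp add: q_def out tilt_le_self[OF sub g])
    then have "L f = tilt L g f" using f by (metis q_def)
    also have "\<dots> \<le> L (%x. f x + 1 * g x) - 1 * L g" by (rule tilt_le[OF sub g f]) simp
    finally show ?thesis by simp
  qed
  have add: "L (%x. f x + g x) = L f + L g" if "f \<in> bounded_funs" "g \<in> bounded_funs" for f g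
    using superadd[OF that] sublinear_add[OF sub that] by simp
  have "L (%x. - u x) \<le> tilt p u (%x. - u x)" by (intro le bounded_funs_uminus u)
  also have "\<dots> \<le> p (%x. - u x + 1 * u x) - 1 * p u" by (rule tilt_le[OF p u]) (auto intro: u)
  finally have "L (%x. - u x) \<le> - p u" by (simp add: sublinear_zero[OF p])
  moreover have "L u + L (%x. - u x) = 0"
    using add[OF u bounded_funs_uminus[OF u]] sublinear_zero[OF sub] by simp
  ultimately have "p u \<le> L u" by simp
  moreover have "L f \<le> p f" if "f \<in> bounded_funs" for f
    using le[OF that] tilt_le_self[OF p u that] by simp
  ultimately show thesis using add that by blast
qed

subsection \<open>Finitely additive minorants of a covering content\<close>

definition list_covers :: "'a set => 'a set set => ('a => real) => (real \<times> 'a set) list set" where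
  "list_covers K \<G> f = {l. (\<forall>(c, E)\<in>set l. 0 \<le> c \<and> E \<in> \<G>) \<and> (\<forall>x\<in>K. f x \<le> (\<Sum>(c, E)\<leftarrow>l. c * indicator E x))}"

definition list_cost :: "('a set => real) => (real \<times> 'a set) list => real" where
  "list_cost \<zeta> l = (\<Sum>(c, E)\<leftarrow>l. c * \<zeta> E)"

text \<open>The least cost of a finite weighted cover of a function on \<open>K\<close> is sublinear in that function. A linear minorant
  with the same value at the function 1 yields \<open>h\<close> on indicator functions.\<close>

theorem finitely_additive_minorant:
  fixes K :: "'a set" and \<zeta> :: "'a set => real"
  assumes \<zeta>: "!!E. E \<in> \<G> ==> 0 \<le> \<zeta> E" and \<H>: "finite \<H>" "\<H> \<subseteq> \<G>" "K \<subseteq> \<Union>\<H>"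
    and b: "!!l. l \<in> list_covers K \<G> (%_. 1) ==> b \<le> list_cost \<zeta> l"
  obtains h where "!!A. 0 \<le> h A" "!!A B. A \<inter> B = {} ==> h (A \<union> B) = h A + h B"
    "!!A. A \<inter> K = {} ==> h A = 0" "!!E. E \<in> \<G> ==> h E \<le> \<zeta> E" "b \<le> h UNIV"
proof -
  define p where "p f = (INF l\<in>list_covers K \<G> f. list_cost \<zeta> l)" for f
  have cost_nonneg: "0 \<le> list_cost \<zeta> l" if "l \<in> list_covers K \<G> f" for l f
    using that \<zeta> unfolding list_cost_def list_covers_def
    by (intro sum_list_nonneg) auto
  have bdd: "bdd_below (list_cost \<zeta> ` list_covers K \<G> f)" for f
    using cost_nonneg by (intro bdd_belowI2[of _ 0]) auto
  have ne: "list_covers K \<G> f \<noteq> {}" if fb: "f \<in> bounded_funs" for f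
  proof -
    from bounded_funsE[OF fb] obtain B where B: "!!x. \<bar>f x\<bar> \<le> B" by blast
    obtain Hs where Hs: "set Hs = \<H>" using finite_list[OF \<H>(1)] by auto
    have B0: "0 \<le> B" using B[of undefined] by linarith
    have "map (Pair B) Hs \<in> list_covers K \<G> f"
      unfolding list_covers_def
    proof (intro CollectI conjI ballI)
      fix x assume "x \<in> K"
      then obtain H where H: "H \<in> set Hs" "x \<in> H" using \<H>(3) Hs by blast
      from split_list[OF H(1)] obtain as bs where Hs': "Hs = as @ H # bs" by blast
      have sl: "0 \<le> (\<Sum>E\<leftarrow>xs. B * indicator E x)" for xs :: "'a set list"
        by (rule sum_list_nonneg) (use B0 in auto)
      have "f x \<le> B * indicator H x" using B[of x] H by simp
      also have "\<dots> \<le> (\<Sum>E\<leftarrow>Hs. B * indicator E x)"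
        using sl[of as] sl[of bs] unfolding Hs' by simp
      finally show "f x \<le> (\<Sum>(c, E)\<leftarrow>map (Pair B) Hs. c * indicator E x)"
        by (simp add: comp_def)
    qed (use Hs \<H> B0 in auto)
    then show ?thesis by auto
  qed
  have p_le: "p f \<le> list_cost \<zeta> l" if "l \<in> list_covers K \<G> f" for l f
    unfolding p_def by (rule cINF_lower[OF bdd that])
  have p_ge: "r \<le> p f" if "f \<in> bounded_funs" "!!l. l \<in> list_covers K \<G> f ==> r \<le> list_cost \<zeta> l" for r f
    unfolding p_def using ne[OF that(1)] that(2) by (rule cINF_greatest)
  have sub: "sublinear p"
    unfolding sublinear_def
  proof (intro conjI ballI allI impI)
    fix f g :: "'a => real" assume f: "f \<in> bounded_funs" and g: "g \<in> bounded_funs"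
    have *: "p (%x. f x + g x) \<le> list_cost \<zeta> l + list_cost \<zeta> l'"
      if "l \<in> list_covers K \<G> f" "l' \<in> list_covers K \<G> g" for l l'
    proof -
      have "l @ l' \<in> list_covers K \<G> (%x. f x + g x)"
        using that by (auto simp: list_covers_def intro: add_mono)
      from p_le[OF this] show ?thesis by (simp add: list_cost_def)
    qed
    have "p (%x. f x + g x) - list_cost \<zeta> l' \<le> p f" if "l' \<in> list_covers K \<G> g" for l'
      using *[OF _ that] by (intro p_ge f) (simp add: algebra_simps)
    then have "p (%x. f x + g x) - p f \<le> p g" by (intro p_ge g) (simp add: algebra_simps)
    then show "p (%x. f x + g x) \<le> p f + p g" by simp
  next
    fix f :: "'a => real" and c :: real assume f: "f \<in> bounded_funs" and c: "0 < c"
    have le: "p (%x. c * f x) \<le> c * p f" if f: "f \<in> bounded_funs" and c: "0 < c" for f c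
    proof -
      have "p (%x. c * f x) / c \<le> p f"
      proof (rule p_ge[OF f])
        fix l assume l: "l \<in> list_covers K \<G> f"
        have eq: "(\<Sum>(a, E)\<leftarrow>map (%(a, E). (c * a, E)) l. a * F E) = c * (\<Sum>(a, E)\<leftarrow>l. a * F E)" for F :: "'a set => real"
          by (induction l) (auto simp: algebra_simps)
        have "map (%(a, E). (c * a, E)) l \<in> list_covers K \<G> (%x. c * f x)"
        proof -
          have "\<forall>x\<in>K. c * f x \<le> c * (\<Sum>(a, E)\<leftarrow>l. a * indicator E x)"
            using l c by (auto simp: list_covers_def intro!: mult_left_mono)
          then show ?thesis
            using l c unfolding list_covers_def mem_Collect_eq eq by auto
        qed
        from p_le[OF this] show "p (%x. c * f x) / c \<le> list_cost \<zeta> l"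
          using c unfolding list_cost_def eq by (simp add: field_simps)
      qed
      then show ?thesis using c by (simp add: field_simps)
    qed
    have "p (%x. (1 / c) * (c * f x)) \<le> (1 / c) * p (%x. c * f x)"
      using f c by (intro le) auto
    then show "p (%x. c * f x) = c * p f"
      using le[OF f c] c by (simp add: field_simps)
  qed
  obtain L where Lp: "!!f. f \<in> bounded_funs ==> L f \<le> p f" and L1: "p (%_. 1) \<le> L (%_. 1)"
    and Ladd: "!!f g. f \<in> bounded_funs ==> g \<in> bounded_funs ==> L (%x. f x + g x) = L f + L g"
    using Hahn_Banach_bounded_funs[OF sub bounded_funs_const[of 1]] by blast
  define h where "h A = L (indicator A)" for A
  have L0: "L (%_. 0) = 0" using Ladd[of "%_. 0" "%_. 0"] by (simp add: bounded_funs_const)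
  have empty_cover: "p f \<le> 0" if "!!x. x \<in> K ==> f x \<le> 0" for f
    using p_le[of "[]" f] that by (auto simp: list_covers_def list_cost_def)
  have nonneg: "0 \<le> h A" for A
  proof -
    have "L (%x. - indicator A x) \<le> p (%x. - indicator A x)"
      by (intro Lp bounded_funs_uminus bounded_funs_indicator)
    also have "\<dots> \<le> 0" by (rule empty_cover) simp
    finally show ?thesis
      using Ladd[OF bounded_funs_indicator[of A] bounded_funs_uminus[OF bounded_funs_indicator[of A]]] L0
      by (simp add: h_def)
  qed
  show thesis
  proof (rule that[of h])
    show "0 \<le> h A" for A by (rule nonneg)
    show "h (A \<union> B) = h A + h B" if "A \<inter> B = {}" for A B
    proof -
      have "indicator (A \<union> B) = (%x. indicator A x + indicator B x :: real)"
        using that by (auto simp: indicator_def fun_eq_iff)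
      then show ?thesis by (simp add: h_def Ladd bounded_funs_indicator)
    qed
    show "h A = 0" if "A \<inter> K = {}" for A
    proof (rule antisym[OF _ nonneg])
      have "h A \<le> p (indicator A)" unfolding h_def by (intro Lp bounded_funs_indicator)
      also have "\<dots> \<le> 0" using that by (intro empty_cover) (auto simp: indicator_def)
      finally show "h A \<le> 0" .
    qed
    show "h E \<le> \<zeta> E" if "E \<in> \<G>" for E
    proof -
      have "[(1, E)] \<in> list_covers K \<G> (indicator E)" using that by (auto simp: list_covers_def)
      from p_le[OF this] Lp[OF bounded_funs_indicator[of E]] show ?thesis
        by (simp add: h_def list_cost_def)
    qed
    have "indicator UNIV = (%_::'a. 1::real)" by (simp add: fun_eq_iff)
    moreover have "b \<le> p (%_. 1)" by (rule p_ge[OF bounded_funs_const b])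
    ultimately show "b \<le> h UNIV" using L1 by (simp add: h_def)
  qed
qed


lemma bounded_vec_components:
  fixes K :: "'a::real_normed_vector set"
  assumes "bounded K" shows "bounded {x :: 'a ^ 'k::finite. \<forall>j. x $ j \<in> K}"
proof -
  obtain B where B: "!!y. y \<in> K ==> norm y \<le> B" using assms by (auto simp: bounded_iff)
  have "norm x \<le> (\<Sum>j\<in>(UNIV::'k set). B)" if "\<forall>j. x $ j \<in> K" for x :: "'a ^ 'k"
  proof -
    have "norm x \<le> (\<Sum>j\<in>UNIV. norm (x $ j))"
      unfolding norm_vec_def by (rule L2_set_le_sum) simp
    also have "\<dots> \<le> (\<Sum>j\<in>(UNIV::'k set). B)" by (rule sum_mono) (use B that in auto)
    finally show ?thesis .
  qed
  then show ?thesis unfolding bounded_iff by blast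
qed

lemma sup_on_finite_compact:
  fixes \<Phi> :: "real ^ 'a::finite ^ 'b::finite => nat => real"
  assumes cont: "continuous_on UNIV (%x. N (\<Phi> x))" and K: "bounded K" "E \<subseteq> K"
  shows "sup_on N \<Phi> E < top"
proof -
  have "bounded {x :: real ^ 'a ^ 'b. \<forall>j. x $ j \<in> K}"
    by (rule bounded_vec_components[OF K(1)])
  then have "compact (closure {x :: real ^ 'a ^ 'b. \<forall>j. x $ j \<in> K})" by simp
  then have "compact ((%x. N (\<Phi> x)) ` closure {x. \<forall>j. x $ j \<in> K})"
    using cont by (intro compact_continuous_image continuous_on_subset[OF cont]) auto
  then obtain B where B: "\<forall>x\<in>closure {x :: real ^ 'a ^ 'b. \<forall>j. x $ j \<in> K}. \<bar>N (\<Phi> x)\<bar> \<le> B"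
    by (auto dest!: compact_imp_bounded simp: bounded_iff)
  have "sup_on N \<Phi> E \<le> ennreal B"
    unfolding sup_on_def
  proof (rule SUP_least)
    fix x :: "real ^ 'a ^ 'b" assume "x \<in> {x. \<forall>j. x $ j \<in> E}"
    then have "x \<in> closure {x. \<forall>j. x $ j \<in> K}" using K(2) by (intro subsetD[OF closure_subset]) auto
    from bspec[OF B this] show "ennreal (N (\<Phi> x)) \<le> ennreal B" by (intro ennreal_leI) auto
  qed
  then show ?thesis by (rule le_less_trans) simp
qed

text \<open>By uniform continuity a set may be enlarged to an open neighbourhood at an arbitrarily small cost.\<close>

lemma sup_on_nbhd_le:
  fixes \<Phi> :: "real ^ 'n::finite ^ 'k::finite => nat => real"
  assumes cont: "continuous_on UNIV (%x. N (\<Phi> x))" and K: "compact K" and r: "0 < r"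
  obtains \<epsilon> where "0 < \<epsilon>" "!!E U. E \<subseteq> K ==> U \<subseteq> K ==> (!!x. x \<in> U ==> \<exists>y\<in>E. dist x y \<le> \<epsilon>)
     ==> sup_on N \<Phi> U \<le> sup_on N \<Phi> E + ennreal r"
proof -
  let ?KK = "{x :: real ^ 'n ^ 'k. \<forall>j. x $ j \<in> K}"
  have "bounded ?KK"
    by (rule bounded_vec_components[OF compact_imp_bounded[OF K]])
  then have "compact (closure ?KK)" by simp
  then have "uniformly_continuous_on (closure ?KK) (%x. N (\<Phi> x))"
    by (intro compact_uniformly_continuous continuous_on_subset[OF cont]) auto
  then obtain d where d: "0 < d" "!!x y. x \<in> closure ?KK ==> y \<in> closure ?KK ==> dist y x < d
      ==> dist (N (\<Phi> y)) (N (\<Phi> x)) < r"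
    using r unfolding uniformly_continuous_on_def by blast
  define \<epsilon> where "\<epsilon> = d / (2 * real CARD('k))"
  show thesis
  proof (rule that[of \<epsilon>])
    show "0 < \<epsilon>" using d by (simp add: \<epsilon>_def)
    fix E U assume E: "E \<subseteq> K" and U: "U \<subseteq> K" and near: "!!x. x \<in> U ==> \<exists>y\<in>E. dist x y \<le> \<epsilon>"
    show "sup_on N \<Phi> U \<le> sup_on N \<Phi> E + ennreal r"
      unfolding sup_on_def[of N \<Phi> U]
    proof (rule SUP_least)
      fix x :: "real ^ 'n ^ 'k" assume "x \<in> {x. \<forall>j. x $ j \<in> U}"
      then have x: "!!j. x $ j \<in> U" by auto
      then have "\<forall>j. \<exists>y. y \<in> E \<and> dist (x $ j) y \<le> \<epsilon>" using near by blast
      then obtain y where y: "!!j. y j \<in> E" "!!j. dist (x $ j) (y j) \<le> \<epsilon>" by metis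
      let ?y = "\<chi> j. y j"
      have "dist x ?y \<le> (\<Sum>j\<in>(UNIV::'k set). dist (x $ j) (?y $ j))"
        unfolding dist_vec_def by (rule L2_set_le_sum) auto
      also have "\<dots> \<le> (\<Sum>j\<in>(UNIV::'k set). \<epsilon>)" using y by (intro sum_mono) auto
      also have "\<dots> < d" using d by (simp add: \<epsilon>_def)
      finally have "dist x ?y < d" .
      moreover have "x \<in> closure ?KK" "?y \<in> closure ?KK"
        using x y(1) E U by (auto intro!: subsetD[OF closure_subset])
      ultimately have "dist (N (\<Phi> x)) (N (\<Phi> ?y)) < r" using d(2)[of ?y x] by simp
      then have "N (\<Phi> x) \<le> N (\<Phi> ?y) + r" by (simp add: dist_real_def)
      then have "ennreal (N (\<Phi> x)) \<le> ennreal (N (\<Phi> ?y) + r)" by (rule ennreal_leI)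
      also have "\<dots> \<le> ennreal (N (\<Phi> ?y)) + ennreal r"
        using r by (cases "0 \<le> N (\<Phi> ?y)")
          (auto simp: ennreal_plus[symmetric] ennreal_neg intro!: ennreal_leI simp del: ennreal_plus)
      also have "\<dots> \<le> sup_on N \<Phi> E + ennreal r"
        unfolding sup_on_def using y(1) by (intro add_right_mono SUP_upper) auto
      finally show "ennreal (N (\<Phi> x)) \<le> sup_on N \<Phi> E + ennreal r" .
    qed
  qed
qed

subsection \<open>From contents to measures\<close>

text \<open>Finitely additive \<open>h\<close> need not be countably additive; covers by open sets repair this without losing mass on
  compact sets.\<close>

definition content_outer :: "('a::topological_space set => real) => 'a set => ennreal" where
  "content_outer h A = (INF U\<in>{U :: nat => 'a set. (\<forall>i. open (U i)) \<and> A \<subseteq> (\<Union>i. U i)}. \<Sum>i. ennreal (h (U i)))"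

context
  fixes h :: "'a::metric_space set => real"
  assumes nonneg: "!!A. 0 \<le> h A" and add: "!!A B. A \<inter> B = {} ==> h (A \<union> B) = h A + h B"
begin

lemma content_empty: "h {} = 0"
  using add[of "{}" "{}"] by simp

lemma content_mono: "A \<subseteq> B ==> h A \<le> h B"
  using add[of A "B - A"] nonneg[of "B - A"] by (simp add: Un_absorb1)

lemma content_subadd: "h (A \<union> B) \<le> h A + h B"
  using add[of A "B - A"] content_mono[of "B - A" B] by simp

lemma content_finite_subadd: "finite I ==> h (\<Union>i\<in>I. U i) \<le> (\<Sum>i\<in>I. h (U i))"
  by (induction I rule: finite_induct) (auto simp: content_empty intro: order_trans[OF content_subadd])

lemma content_outer_le: "(!!i. open (U i)) ==> A \<subseteq> (\<Union>i. U i) ==> content_outer h A \<le> (\<Sum>i. ennreal (h (U i)))"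
  unfolding content_outer_def by (rule INF_lower) auto

lemma content_outer_le_open:
  assumes "open U" "A \<subseteq> U" shows "content_outer h A \<le> ennreal (h U)"
proof -
  have "content_outer h A \<le> (\<Sum>i. ennreal (h (if i = (0::nat) then U else {})))"
    using assms by (intro content_outer_le) (auto split: if_splits)
  also have "\<dots> = (\<Sum>i\<in>{0::nat}. ennreal (h (if i = 0 then U else {})))"
    by (rule suminf_finite) (auto simp: content_empty)
  finally show ?thesis by simp
qed

lemma content_outer_mono: "A \<subseteq> B ==> content_outer h A \<le> content_outer h B"
  unfolding content_outer_def by (rule INF_superset_mono) auto

lemma content_outer_subadditive: "content_outer h (\<Union>n::nat. A n) \<le> (\<Sum>n. content_outer h (A n))"
proof (rule ennreal_le_epsilon)
  fix e :: real
  assume top: "(\<Sum>n. content_outer h (A n)) < top" and e: "0 < e"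
  have fin: "content_outer h (A n) < top" for n
    using top ennreal_suminf_lessD by blast
  have "\<forall>n. \<exists>U. (\<forall>i. open (U i)) \<and> A n \<subseteq> (\<Union>i::nat. U i) \<and>
     (\<Sum>i. ennreal (h (U i))) \<le> content_outer h (A n) + ennreal (e * (1/2) ^ Suc n)"
  proof
    fix n
    have "content_outer h (A n) < content_outer h (A n) + ennreal (e * (1/2) ^ Suc n)"
      using fin[of n] e by (intro ennreal_less_add_pos) auto
    then obtain U :: "nat => 'a set" where "U \<in> {U. (\<forall>i. open (U i)) \<and> A n \<subseteq> (\<Union>i. U i)}"
      "(\<Sum>i. ennreal (h (U i))) < content_outer h (A n) + ennreal (e * (1/2) ^ Suc n)"
      by (subst (asm) (1) content_outer_def) (auto simp only: INF_less_iff)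
    then show "\<exists>U. (\<forall>i. open (U i)) \<and> A n \<subseteq> (\<Union>i::nat. U i) \<and>
     (\<Sum>i. ennreal (h (U i))) \<le> content_outer h (A n) + ennreal (e * (1/2) ^ Suc n)"
      by (intro exI[of _ U]) auto
  qed
  from choice[OF this] obtain U :: "nat => nat => 'a set" where U: "!!n i. open (U n i)" "!!n. A n \<subseteq> (\<Union>i. U n i)"
     "!!n. (\<Sum>i. ennreal (h (U n i))) \<le> content_outer h (A n) + ennreal (e * (1/2) ^ Suc n)"
    by blast
  have "content_outer h (\<Union>n. A n) \<le> (\<Sum>i. ennreal (h (case_prod U (prod_decode i))))"
  proof (rule content_outer_le)
    show "(\<Union>n. A n) \<subseteq> (\<Union>i. case_prod U (prod_decode i))"
    proof safe
      fix x n assume "x \<in> A n"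
      then obtain i where "x \<in> U n i" using U(2) by blast
      then show "x \<in> (\<Union>i. case_prod U (prod_decode i))"
        by (intro UN_I[of "prod_encode (n, i)"]) auto
    qed
  qed (auto simp: case_prod_beta' U)
  also have "\<dots> = (\<Sum>n. \<Sum>i. ennreal (h (U n i)))"
    using suminf_ennreal_2dimen[of "%n. \<Sum>i. ennreal (h (U n i))" "%(n, i). ennreal (h (U n i))",
        OF prod.case[symmetric, THEN suminf_cong]]
    unfolding comp_def case_prod_beta' by simp
  also have "\<dots> \<le> (\<Sum>n. content_outer h (A n) + ennreal (e * (1/2) ^ Suc n))"
    by (intro suminf_le U) auto
  also have "\<dots> = (\<Sum>n. content_outer h (A n)) + (\<Sum>n. ennreal (e * (1/2) ^ Suc n))"
    by (rule suminf_add[symmetric]) auto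
  also have "(\<Sum>n. ennreal (e * (1/2) ^ Suc n)) = ennreal e"
    using sums_mult[OF power_half_series, of e] e
    by (intro suminf_ennreal_eq) auto
  finally show "content_outer h (\<Union>n. A n) \<le> (\<Sum>n. content_outer h (A n)) + ennreal e" .
qed

lemma content_outer_separated:
  assumes e: "0 < e" and sep: "!!x y. x \<in> A ==> y \<in> B ==> e \<le> dist x y"
  shows "content_outer h A + content_outer h B \<le> content_outer h (A \<union> B)"
  unfolding content_outer_def[of _ "A \<union> B"]
proof (rule INF_greatest, clarify)
  fix U :: "nat => 'a set" assume U: "\<forall>i. open (U i)" "A \<union> B \<subseteq> (\<Union>i. U i)"
  define G where "G X = (\<Union>x\<in>X. ball x (e / 2))" for X :: "'a set"
  have G: "open (G X)" "X \<subseteq> G X" for X using e by (auto simp: G_def)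
  have disj: "G A \<inter> G B = {}"
  proof (rule ccontr)
    assume "G A \<inter> G B \<noteq> {}"
    then obtain x y z where xyz: "x \<in> A" "y \<in> B" "dist x z < e / 2" "dist y z < e / 2" by (auto simp: G_def)
    then have "dist x y < e" using dist_triangle2[of x y z] by linarith
    then show False using sep[OF xyz(1,2)] by simp
  qed
  have "content_outer h A + content_outer h B
     \<le> (\<Sum>i. ennreal (h (U i \<inter> G A))) + (\<Sum>i. ennreal (h (U i \<inter> G B)))"
    using U G by (intro add_mono content_outer_le) auto
  also have "\<dots> = (\<Sum>i. ennreal (h (U i \<inter> G A)) + ennreal (h (U i \<inter> G B)))"
    by (rule suminf_add) auto
  also have "\<dots> \<le> (\<Sum>i. ennreal (h (U i)))"
  proof (intro suminf_le allI)
    fix i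
    have "h (U i \<inter> G A) + h (U i \<inter> G B) = h (U i \<inter> G A \<union> U i \<inter> G B)"
      using disj by (intro add[symmetric]) auto
    also have "\<dots> \<le> h (U i)" by (rule content_mono) auto
    finally show "ennreal (h (U i \<inter> G A)) + ennreal (h (U i \<inter> G B)) \<le> ennreal (h (U i))"
      using nonneg by (simp add: ennreal_plus[symmetric] ennreal_leI del: ennreal_plus)
  qed auto
  finally show "content_outer h A + content_outer h B \<le> (\<Sum>i. ennreal (h (U i)))" .
qed

text \<open>A countable open cover of a compact set has a finite subcover, to which finite subadditivity applies.\<close>

lemma content_outer_compact_ge:
  assumes K: "compact K" shows "ennreal (h K) \<le> content_outer h K"
  unfolding content_outer_def
proof (rule INF_greatest, clarify)
  fix U :: "nat => 'a set" assume U: "\<forall>i. open (U i)" "K \<subseteq> (\<Union>i. U i)"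
  obtain I where I: "finite I" "K \<subseteq> (\<Union>i\<in>I. U i)"
    by (rule compactE_image[OF K, of UNIV U]) (use U in \<open>auto intro: that\<close>)
  have "h K \<le> (\<Sum>i\<in>I. h (U i))"
    by (rule order_trans[OF content_mono[OF I(2)] content_finite_subadd[OF I(1)]])
  then have "ennreal (h K) \<le> (\<Sum>i\<in>I. ennreal (h (U i)))"
    by (simp add: nonneg sum_ennreal ennreal_leI)
  also have "\<dots> \<le> (\<Sum>i. ennreal (h (U i)))"
    by (rule sum_le_suminf) (auto simp: I)
  finally show "ennreal (h K) \<le> (\<Sum>i. ennreal (h (U i)))" .
qed

theorem content_outer_measure_space: "measure_space \<Omega> (sets (restrict_space borel \<Omega>)) (content_outer h)"
proof (rule metric_outer_measure_borel)
  show "content_outer h {} = 0" using content_outer_le_open[of "{}" "{}"] by (simp add: content_empty)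
  show "content_outer h A \<le> content_outer h B" if "A \<subseteq> B" for A B
    by (rule content_outer_mono[OF that])
  show "content_outer h (\<Union>i. A i) \<le> (\<Sum>i. content_outer h (A i))" for A :: "nat => 'a set"
    by (rule content_outer_subadditive)
  show "content_outer h A + content_outer h B \<le> content_outer h (A \<union> B)"
    if "0 < e" "!!x y. x \<in> A ==> y \<in> B ==> e \<le> dist x y" for A B e
    by (rule content_outer_separated[OF that])
qed

end


text \<open>Some compact \<open>K\<close> has positive Hausdorff measure, hence positive content at some scale \<open>\<delta>\<close>. Its content has a
  minorant \<open>h\<close> with \<open>h E\<close> at most the power of the set function for \<open>E\<close> of diameter at most \<open>\<delta>\<close>. An arbitrary set is
  first divided into boundedly many parts of small diameter.\<close>

theorem Frostman_measure:
  fixes \<Phi> :: "real ^ 'n::finite ^ 'k::finite => nat => real"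
  assumes cont: "continuous_on UNIV (%x. N (\<Phi> x))" and "open \<Omega>" and \<sigma>: "0 < \<sigma>"
    and pos: "0 < weighted_Hausdorff N \<Phi> \<Omega> \<sigma> \<Omega>"
  shows "\<exists>\<mu>. borel_measure_on \<Omega> \<mu> \<and> dominates_nontrivially (sup_on N \<Phi>) \<Omega> \<mu> (1 / \<sigma>)"
proof -
  obtain C where C: "!!n. compact (C n)" "!!n::nat. C n \<subseteq> \<Omega>" "\<Union>(range C) = \<Omega>"
    using open_Union_compact_subsets[OF \<open>open \<Omega>\<close>] by metis
  have "\<exists>n. 0 < weighted_Hausdorff N \<Phi> \<Omega> \<sigma> (C n)"
  proof (rule ccontr)
    assume "\<nexists>n. 0 < weighted_Hausdorff N \<Phi> \<Omega> \<sigma> (C n)"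
    then have "weighted_Hausdorff N \<Phi> \<Omega> \<sigma> (C n) = 0" for n by (auto simp: zero_less_iff_neq_zero)
    then show False
      using weighted_Hausdorff_countably_subadditive[of N \<Phi> \<Omega> \<sigma> C] pos C(3) by simp
  qed
  then obtain K where K: "compact K" "K \<subseteq> \<Omega>" "0 < weighted_Hausdorff N \<Phi> \<Omega> \<sigma> K" using C by metis
  obtain \<delta> where \<delta>: "0 < \<delta>" "0 < weighted_content N \<Phi> \<Omega> \<sigma> \<delta> K"
    using K(3) unfolding weighted_Hausdorff_eq_SUP less_SUP_iff by auto
  obtain b where b: "0 < b" "ennreal b \<le> weighted_content N \<Phi> \<Omega> \<sigma> \<delta> K"
  proof -
    obtain z where z: "0 < z" "z < weighted_content N \<Phi> \<Omega> \<sigma> \<delta> K" using dense[OF \<delta>(2)] by auto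
    then show thesis by (intro that[of "enn2real z"]) (cases z; auto simp: ennreal_zero_less_one less_imp_le)+
  qed
  define \<zeta> where "\<zeta> E = enn2real (epowr (sup_on N \<Phi> E) \<sigma>)" for E
  define \<G> where "\<G> = {E. E \<subseteq> K \<and> diameter E \<le> \<delta>}"
  have \<zeta>: "ennreal (\<zeta> E) = epowr (sup_on N \<Phi> E) \<sigma>" if "E \<subseteq> K" for E
    using sup_on_finite_compact[where N = N and \<Phi> = \<Phi>, OF cont compact_imp_bounded[OF K(1)] that]
    by (cases "sup_on N \<Phi> E") (auto simp: \<zeta>_def epowr_ennreal)
  have "0 < \<delta> / 4" using \<delta>(1) by simp
  then obtain X where X: "finite X" "K \<subseteq> (\<Union>x\<in>X. ball x (\<delta> / 4))"
    using K(1) unfolding compact_eq_totally_bounded by blast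
  define P where "P x = K \<inter> ball x (\<delta> / 4)" for x
  have P: "K = (\<Union>x\<in>X. P x)" "P x \<subseteq> K" for x using X by (auto simp: P_def)
  have diamP: "diameter S \<le> \<delta>" if "!!y z. y \<in> S ==> z \<in> S ==> dist y z \<le> \<delta>" for S :: "(real ^ 'n) set"
    using that \<delta>(1) by (intro diameter_le) (auto simp: dist_norm)
  have fin_cover: "finite (P ` X)" "P ` X \<subseteq> \<G>" "K \<subseteq> \<Union>(P ` X)"
  proof -
    have "dist y z \<le> \<delta>" if "y \<in> P x" "z \<in> P x" for x y z
      using that dist_triangle3[of y z x] \<delta>(1) by (auto simp: P_def)
    then show "P ` X \<subseteq> \<G>" using P by (auto simp: \<G>_def intro!: diamP)
  qed (use X P in auto)
  have list_le: "b \<le> list_cost \<zeta> l" if l: "l \<in> list_covers K \<G> (%_. 1)" for l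
  proof -
    define c where "c i = (if i < length l then fst (l ! i) else 0)" for i
    define E where "E i = (if i < length l then snd (l ! i) else {})" for i
    have li: "0 \<le> fst (l ! i) \<and> snd (l ! i) \<in> \<G>" if "i < length l" for i
      using l nth_mem[OF that] by (auto simp: list_covers_def case_prod_beta')
    have sum: "(\<Sum>(c, E)\<leftarrow>l. c * F E) = (\<Sum>i<length l. c i * F (E i))" for F :: "(real ^ 'n) set => real"
      by (simp add: sum_list_sum_nth case_prod_beta' c_def E_def atLeast0LessThan)
    have "(c, E) \<in> weighted_covers \<Omega> \<delta> K"
      unfolding weighted_covers_def
    proof (clarsimp, intro conjI allI ballI)
      fix i show "0 \<le> c i" "E i \<subseteq> \<Omega>" "bounded (E i)" "diameter (E i) \<le> \<delta>"
        using li[of i] K(2) \<delta>(1) compact_imp_bounded[OF K(1)]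
        by (auto simp: c_def E_def \<G>_def intro: bounded_subset)
    next
      fix x assume "x \<in> \<Omega>"
      show "indicator K x \<le> (\<Sum>i. ennreal (c i) * indicator (E i) x)"
      proof (cases "x \<in> K")
        case True
        then have "1 \<le> (\<Sum>i<length l. c i * indicator (E i) x)"
          using l by (simp add: list_covers_def sum)
        then have "1 \<le> ennreal (\<Sum>i<length l. c i * indicator (E i) x)"
          by (simp add: ennreal_leI flip: ennreal_1)
        also have "\<dots> = (\<Sum>i<length l. ennreal (c i * indicator (E i) x))"
          by (rule sum_ennreal[symmetric]) (use li in \<open>auto simp: c_def\<close>)
        also have "\<dots> = (\<Sum>i<length l. ennreal (c i) * indicator (E i) x)"
          by (intro sum.cong refl) (simp add: indicator_def)
        also have "\<dots> \<le> (\<Sum>i. ennreal (c i) * indicator (E i) x)"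
          by (rule sum_le_suminf) auto
        finally show ?thesis using True by simp
      qed simp
    qed
    from weighted_content_le[OF this, of N \<Phi> \<sigma>]
    have "ennreal b \<le> (\<Sum>i. ennreal (c i) * epowr (sup_on N \<Phi> (E i)) \<sigma>)" using b(2) by simp
    also have "\<dots> = (\<Sum>i<length l. ennreal (c i) * epowr (sup_on N \<Phi> (E i)) \<sigma>)"
      by (rule suminf_finite) (auto simp: c_def)
    also have "\<dots> = (\<Sum>i<length l. ennreal (c i * \<zeta> (E i)))"
    proof (rule sum.cong[OF refl])
      fix i assume "i \<in> {..<length l}"
      then have "0 \<le> c i" "E i \<subseteq> K" using li[of i] by (auto simp: c_def E_def \<G>_def)
      then show "ennreal (c i) * epowr (sup_on N \<Phi> (E i)) \<sigma> = ennreal (c i * \<zeta> (E i))"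
        unfolding \<zeta>[OF \<open>E i \<subseteq> K\<close>, symmetric] by (simp add: ennreal_mult')
    qed
    also have "\<dots> = ennreal (list_cost \<zeta> l)"
      unfolding list_cost_def sum using li by (intro sum_ennreal) (auto simp: c_def \<zeta>_def)
    finally show ?thesis
    proof (rule ennreal_le_iff[THEN iffD1, rotated])
      show "0 \<le> list_cost \<zeta> l" unfolding list_cost_def sum using li
        by (intro sum_nonneg) (auto simp: c_def \<zeta>_def)
    qed
  qed
  have \<zeta>0: "0 \<le> \<zeta> E" for E by (simp add: \<zeta>_def)
  obtain h where h: "!!A. 0 \<le> h A" "!!A B. A \<inter> B = {} ==> h (A \<union> B) = h A + h B"
    "!!A. A \<inter> K = {} ==> h A = 0" "!!E. E \<in> \<G> ==> h E \<le> \<zeta> E" "b \<le> h UNIV"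
    by (rule finitely_additive_minorant[OF \<zeta>0 fin_cover list_le], assumption) (rule that)
  have hK: "h (A \<inter> K) = h A" for A
  proof -
    have "h (A \<inter> K \<union> (A - K)) = h (A \<inter> K) + h (A - K)" by (rule h(2)) auto
    moreover have "h (A - K) = 0" by (rule h(3)) auto
    ultimately show ?thesis by (simp add: Int_Diff_Un)
  qed
  define f where "f = content_outer h"
  define \<mu> where "\<mu> = measure_of \<Omega> (sets (restrict_space borel \<Omega>)) f"
  have ms: "measure_space \<Omega> (sets (restrict_space borel \<Omega>)) f"
    unfolding f_def by (rule content_outer_measure_space[OF h(1,2)])
  then interpret sigma_algebra \<Omega> "sets (restrict_space borel \<Omega>)" by (simp add: measure_space_def)
  have sets: "sets \<mu> = sets (restrict_space borel \<Omega>)" unfolding \<mu>_def by simp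
  have em: "emeasure \<mu> A = f A" if "A \<in> sets (restrict_space borel \<Omega>)" for A
    unfolding \<mu>_def using ms that by (intro emeasure_measure_of_sigma) (auto simp: measure_space_def)
  have fsub: "f (A \<union> B) \<le> f A + f B" if "A \<in> sets (restrict_space borel \<Omega>)" "B \<in> sets (restrict_space borel \<Omega>)" for A B
    using emeasure_subadditive[of A \<mu> B] that by (simp add: sets em)
  have borelI: "A \<inter> \<Omega> \<in> sets (restrict_space borel \<Omega>)" if "A \<in> sets borel" for A
    unfolding sets_restrict_space by (subst Int_commute) (rule imageI[OF that])
  have local: "f E \<le> epowr (sup_on N \<Phi> E) \<sigma>"
    if E: "E \<subseteq> P x" for E x
  proof -
    have EK: "E \<subseteq> K" using E P by auto
    obtain s where s: "0 \<le> s" "sup_on N \<Phi> E = ennreal s"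
      using sup_on_finite_compact[where N = N and \<Phi> = \<Phi>, OF cont compact_imp_bounded[OF K(1)] EK]
      by (cases "sup_on N \<Phi> E") auto
    have step: "f E \<le> ennreal ((s + r) powr \<sigma>)" if r: "0 < r" for r
    proof -
      obtain \<epsilon> where \<epsilon>: "0 < \<epsilon>" "!!E U. E \<subseteq> K ==> U \<subseteq> K ==> (!!x. x \<in> U ==> \<exists>y\<in>E. dist x y \<le> \<epsilon>)
         ==> sup_on N \<Phi> U \<le> sup_on N \<Phi> E + ennreal r"
        using sup_on_nbhd_le[where N = N and \<Phi> = \<Phi>, OF cont K(1) r] by blast
      define e where "e = min \<epsilon> (\<delta> / 4)"
      define U where "U = (\<Union>y\<in>E. ball y e)"
      have e: "0 < e" "e \<le> \<epsilon>" "e \<le> \<delta> / 4" using \<epsilon> \<delta> by (auto simp: e_def)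
      have U: "open U" "E \<subseteq> U" using e by (auto simp: U_def)
      have "dist y z \<le> \<delta>" if yz: "y \<in> U \<inter> K" "z \<in> U \<inter> K" for y z
      proof -
        obtain y' z' where "y' \<in> E" "z' \<in> E" "dist y' y < e" "dist z' z < e" using yz by (auto simp: U_def)
        moreover then have "dist x y' < \<delta> / 4" "dist x z' < \<delta> / 4" using E by (auto simp: P_def)
        moreover have "dist y z \<le> dist y y' + dist y' x + dist x z' + dist z' z"
          using dist_triangle[of y z y'] dist_triangle[of y' z x] dist_triangle[of x z z'] by linarith
        ultimately show ?thesis using e by (simp add: dist_commute)
      qed
      then have "U \<inter> K \<in> \<G>" unfolding \<G>_def by (auto intro!: diamP)
      have "f E \<le> ennreal (h U)"
        unfolding f_def by (rule content_outer_le_open[OF h(1,2) U])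
      also have "\<dots> \<le> ennreal (\<zeta> (U \<inter> K))"
        using h(4)[OF \<open>U \<inter> K \<in> \<G>\<close>] hK[of U] by (simp add: ennreal_leI)
      also have "\<dots> = epowr (sup_on N \<Phi> (U \<inter> K)) \<sigma>" by (rule \<zeta>) auto
      also have "\<dots> \<le> epowr (sup_on N \<Phi> E + ennreal r) \<sigma>"
      proof (rule epowr_mono)
        show "sup_on N \<Phi> (U \<inter> K) \<le> sup_on N \<Phi> E + ennreal r"
        proof (rule \<epsilon>(2)[OF EK])
          fix z assume "z \<in> U \<inter> K"
          then show "\<exists>y\<in>E. dist z y \<le> \<epsilon>" using e by (force simp: U_def dist_commute)
        qed auto
      qed (use \<sigma> in simp)
      also have "\<dots> = ennreal ((s + r) powr \<sigma>)"
        using s r by (simp add: epowr_ennreal ennreal_plus[symmetric] del: ennreal_plus)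
      finally show ?thesis .
    qed
    have "((%r. ennreal ((s + r) powr \<sigma>)) \<longlongrightarrow> ennreal ((s + 0) powr \<sigma>)) (at_right 0)"
      using s \<sigma> by (intro tendsto_ennrealI tendsto_powr' tendsto_intros) (auto simp: eventually_at_right_field intro!: exI[of _ 1])
    then have "f E \<le> ennreal ((s + 0) powr \<sigma>)"
      by (rule tendsto_lowerbound) (auto simp: eventually_at_right_field step intro!: exI[of _ 1])
    then show ?thesis using s by (simp add: epowr_ennreal)
  qed
  have "f (\<Omega> - K) = 0"
  proof -
    have "f (\<Omega> - K) \<le> ennreal (h (- K))"
      unfolding f_def using compact_imp_closed[OF K(1)]
      by (intro content_outer_le_open h(1,2)) (auto simp: open_Compl)
    then show ?thesis using h(3)[of "- K"] by simp
  qed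
  have fE: "f E \<le> ennreal (real (card X)) * epowr (sup_on N \<Phi> E) \<sigma>" if E: "E \<in> sets (restrict_space borel \<Omega>)" for E
  proof -
    have meas: "E \<inter> P x \<in> sets (restrict_space borel \<Omega>)" for x
    proof -
      have "P x \<in> sets borel" unfolding P_def by (intro sets.Int borel_closed compact_imp_closed[OF K(1)] borel_open open_ball)
      then have "E \<inter> (P x \<inter> \<Omega>) \<in> sets (restrict_space borel \<Omega>)" using E borelI by blast
      moreover have "E \<inter> (P x \<inter> \<Omega>) = E \<inter> P x" using P(2) K(2) by blast
      ultimately show ?thesis by simp
    qed
    have EO: "E \<subseteq> \<Omega>" using sets.sets_into_space[OF E] by (simp add: space_restrict_space)
    have Kc: "\<Omega> - K \<in> sets (restrict_space borel \<Omega>)"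
      using borelI[OF borel_open[OF open_Compl[OF compact_imp_closed[OF K(1)]]]] by (simp add: Diff_eq Int_commute)
    have "f E \<le> f ((\<Omega> - K) \<union> (\<Union>x\<in>X. E \<inter> P x))"
      unfolding f_def using EO P(1) by (intro content_outer_mono h(1,2)) auto
    also have "\<dots> \<le> f (\<Omega> - K) + f (\<Union>x\<in>X. E \<inter> P x)"
      using X meas Kc by (intro fsub finite_UN) auto
    also have "\<dots> = emeasure \<mu> (\<Union>x\<in>X. E \<inter> P x)"
      unfolding em[OF finite_UN[OF X(1) meas]] \<open>f (\<Omega> - K) = 0\<close> by simp
    also have "\<dots> \<le> (\<Sum>x\<in>X. emeasure \<mu> (E \<inter> P x))"
      using X meas by (intro emeasure_subadditive_finite) (auto simp: sets)
    also have "\<dots> \<le> (\<Sum>x\<in>X. epowr (sup_on N \<Phi> E) \<sigma>)"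
    proof (rule sum_mono)
      fix x
      have "emeasure \<mu> (E \<inter> P x) \<le> epowr (sup_on N \<Phi> (E \<inter> P x)) \<sigma>"
        using local[of "E \<inter> P x" x] by (simp add: em[OF meas])
      also have "\<dots> \<le> epowr (sup_on N \<Phi> E) \<sigma>" using \<sigma> by (intro epowr_mono sup_on_mono) auto
      finally show "emeasure \<mu> (E \<inter> P x) \<le> epowr (sup_on N \<Phi> E) \<sigma>" .
    qed
    finally show ?thesis by (simp add: ennreal_of_nat_eq_real_of_nat)
  qed
  have KO: "K \<in> sets (restrict_space borel \<Omega>)"
    using borelI[of K] K(1,2) by (auto simp: Int_absorb2 intro: borel_closed compact_imp_closed)
  have "0 < ennreal (h K)" using hK[of UNIV] h(5) b(1) by simp
  also have "\<dots> \<le> f K" unfolding f_def by (rule content_outer_compact_ge[OF h(1,2) K(1)])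
  finally have fK: "0 < f K" .
  have "0 < f \<Omega>"
    using fK K(2) content_outer_mono[of h K \<Omega>] h(1,2) unfolding f_def by (auto intro: less_le_trans)
  moreover have "\<Omega> \<in> sets (restrict_space borel \<Omega>)" by auto
  ultimately have "emeasure \<mu> \<Omega> \<noteq> 0" by (simp add: em)
  moreover have "X \<noteq> {}" using fK P(1) h(1,2) content_outer_le_open[of h "{}" "{}"] content_empty[of h]
    by (auto simp: f_def)
  define c where "c = real (card X) powr (- (1 / \<sigma>))"
  have cardX: "0 < real (card X)" using X \<open>X \<noteq> {}\<close> by (simp add: card_gt_0_iff)
  have c: "0 < c" using cardX by (simp add: c_def)
  have "dominates (sup_on N \<Phi>) \<Omega> \<mu> (1 / \<sigma>) c"
    unfolding dominates_def
  proof
    fix E assume E: "E \<in> sets (restrict_space borel \<Omega>)"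
    have "epowr (f E) (1 / \<sigma>) \<le> epowr (ennreal (real (card X)) * epowr (sup_on N \<Phi> E) \<sigma>) (1 / \<sigma>)"
      using \<sigma> by (intro epowr_mono fE E) simp
    also have "\<dots> = ennreal (real (card X) powr (1 / \<sigma>)) * sup_on N \<Phi> E"
      using \<sigma> by (simp add: epowr_mult epowr_epowr)
    finally have "ennreal c * epowr (f E) (1 / \<sigma>) \<le> ennreal c * (ennreal (real (card X) powr (1 / \<sigma>)) * sup_on N \<Phi> E)"
      by (rule mult_left_mono) simp
    also have "\<dots> = sup_on N \<Phi> E"
      using cardX by (simp add: c_def mult.assoc[symmetric] ennreal_mult'[symmetric] powr_add[symmetric])
    finally show "ennreal c * epowr (emeasure \<mu> E) (1 / \<sigma>) \<le> sup_on N \<Phi> E" by (simp add: em[OF E])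
  qed
  ultimately have "dominates_nontrivially (sup_on N \<Phi>) \<Omega> \<mu> (1 / \<sigma>)"
    using c by (auto simp: dominates_nontrivially_def)
  then show ?thesis using sets by (auto simp: borel_measure_on_def)
qed

section \<open>Interpolation with bounded basis functions\<close>

text \<open>The supremum need not be attained; half of it suffices, and costs only a factor in the constants.\<close>

lemma almost_maximal_point:
  fixes g :: "'a => real"
  assumes "!!x. x \<in> E ==> \<bar>g x\<bar> \<le> K" "x0 \<in> E" "g x0 \<noteq> 0"
  obtains e where "e \<in> E" "g e \<noteq> 0" "!!x. x \<in> E ==> \<bar>g x\<bar> \<le> 2 * \<bar>g e\<bar>"
proof -
  let ?s = "SUP x\<in>E. \<bar>g x\<bar>"
  have bdd: "bdd_above ((%x. \<bar>g x\<bar>) ` E)" using assms(1) by (intro bdd_aboveI2)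
  have le: "\<bar>g x\<bar> \<le> ?s" if "x \<in> E" for x by (rule cSUP_upper[OF that bdd])
  have "0 < ?s" using le[OF assms(2)] assms(3) by linarith
  then have "?s / 2 < ?s" by simp
  then obtain e where e: "e \<in> E" "?s / 2 < \<bar>g e\<bar>"
    using less_cSUP_iff[OF _ bdd] assms(2) by blast
  show thesis
  proof (rule that[OF e(1)])
    show "g e \<noteq> 0" using e(2) \<open>0 < ?s\<close> by auto
    show "\<bar>g x\<bar> \<le> 2 * \<bar>g e\<bar>" if "x \<in> E" for x using le[OF that] e(2) by linarith
  qed
qed

text \<open>A greedy construction. The new basis function, minus its interpolant at the points chosen so far, is evaluated at
  a point of \<open>E\<close> where it is almost maximal, so that its normalization is bounded by 2. Subtracting it from the earlier
  functions multiplies their bound by 3.\<close>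

theorem interpolation_basis:
  fixes b :: "'b => 'a => real"
  assumes "finite B" and bdd: "!!i. i \<in> B ==> \<exists>K. \<forall>x\<in>E. \<bar>b i x\<bar> \<le> K"
    and nd: "!!c. (!!x. x \<in> E ==> (\<Sum>i\<in>B. c i * b i x) = 0) ==> (!!x. (\<Sum>i\<in>B. c i * b i x) = 0)"
  shows "\<exists>P p. finite P \<and> P \<subseteq> E \<and> card P \<le> card B \<and>
    (\<forall>e\<in>P. \<exists>c. \<forall>x. p e x = (\<Sum>i\<in>B. c i * b i x)) \<and>
    (\<forall>e\<in>P. \<forall>x\<in>E. \<bar>p e x\<bar> \<le> 2 * 3 ^ card B) \<and>
    (\<forall>e\<in>P. \<forall>e'\<in>P. p e e' = (if e = e' then 1 else 0)) \<and>
    (\<forall>i\<in>B. \<forall>x. b i x = (\<Sum>e\<in>P. b i e * p e x))"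
  using assms
proof (induction B rule: finite_induct)
  case empty
  then show ?case by (intro exI[of _ "{}"]) auto
next
  case (insert k B)
  have ext: "(\<Sum>i\<in>insert k B. (if i = k then a else c i) * b i x) = a * b k x + (\<Sum>i\<in>B. c i * b i x)" for a c x
    using insert.hyps by (simp add: sum.insert) (intro sum.cong, auto)
  have "\<exists>P p. finite P \<and> P \<subseteq> E \<and> card P \<le> card B \<and>
    (\<forall>e\<in>P. \<exists>c. \<forall>x. p e x = (\<Sum>i\<in>B. c i * b i x)) \<and>
    (\<forall>e\<in>P. \<forall>x\<in>E. \<bar>p e x\<bar> \<le> 2 * 3 ^ card B) \<and>
    (\<forall>e\<in>P. \<forall>e'\<in>P. p e e' = (if e = e' then 1 else 0)) \<and>
    (\<forall>i\<in>B. \<forall>x. b i x = (\<Sum>e\<in>P. b i e * p e x))"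
  proof (rule insert.IH)
    show "\<exists>K. \<forall>x\<in>E. \<bar>b i x\<bar> \<le> K" if "i \<in> B" for i using insert.prems(1) that by auto
    show "(\<Sum>i\<in>B. c i * b i x) = 0" if "!!x. x \<in> E ==> (\<Sum>i\<in>B. c i * b i x) = 0" for c x
    proof -
      have "(\<Sum>i\<in>insert k B. (if i = k then 0 else c i) * b i x) = 0"
        by (rule insert.prems(2)) (subst ext, simp add: that)
      then show ?thesis unfolding ext by simp
    qed
  qed
  then obtain P p where P: "finite P" "P \<subseteq> E" "card P \<le> card B"
    and span': "\<forall>e\<in>P. \<exists>c. \<forall>x. p e x = (\<Sum>i\<in>B. c i * b i x)"
    and bound': "\<forall>e\<in>P. \<forall>x\<in>E. \<bar>p e x\<bar> \<le> 2 * 3 ^ card B"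
    and delta': "\<forall>e\<in>P. \<forall>e'\<in>P. p e e' = (if e = e' then 1 else 0)"
    and rep': "\<forall>i\<in>B. \<forall>x. b i x = (\<Sum>e\<in>P. b i e * p e x)"
    by (elim exE conjE) (rule that)
  note span = span'[THEN bspec] and bound = bound'[THEN bspec, THEN bspec]
    and delta = delta'[THEN bspec, THEN bspec] and rep = rep'[THEN bspec, THEN spec]
  define sp where "sp f \<longleftrightarrow> (\<exists>c. \<forall>x. f x = (\<Sum>i\<in>insert k B. c i * b i x))" for f
  have sp_add: "sp (%x. f x + g x)" if fg: "sp f" "sp g" for f g
  proof -
    obtain c d where "\<forall>x. f x = (\<Sum>i\<in>insert k B. c i * b i x)" "\<forall>x. g x = (\<Sum>i\<in>insert k B. d i * b i x)"
      using fg unfolding sp_def by blast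
    then show ?thesis unfolding sp_def
      by (intro exI[of _ "%i. c i + d i"]) (simp add: distrib_right sum.distrib del: sum.insert)
  qed
  have sp_cmult: "sp (%x. a * f x)" if sf: "sp f" for f a
  proof -
    obtain c where "\<forall>x. f x = (\<Sum>i\<in>insert k B. c i * b i x)" using sf unfolding sp_def by blast
    then show ?thesis unfolding sp_def
      by (intro exI[of _ "%i. a * c i"]) (simp add: sum_distrib_left mult.assoc del: sum.insert)
  qed
  have sp_p: "sp (p e)" if eP: "e \<in> P" for e
  proof -
    obtain c where "\<forall>x. p e x = (\<Sum>i\<in>B. c i * b i x)" using span[OF eP] by blast
    then show ?thesis unfolding sp_def
      by (intro exI[of _ "%i. if i = k then 0 else c i"]) (subst ext, simp)
  qed
  have sp_b: "sp (b k)" unfolding sp_def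
    by (intro exI[of _ "%i. if i = k then 1 else 0"]) (subst ext, simp)
  have sp_sum: "sp (%x. \<Sum>e\<in>P'. f e x)" if "finite P'" "!!e. e \<in> P' ==> sp (f e)" for P' f
    using that
  proof (induction P' rule: finite_induct)
    case empty
    then show ?case using sp_cmult[OF sp_b, of 0] by simp
  next
    case (insert e P')
    then have "sp (%x. f e x + (\<Sum>e\<in>P'. f e x))" by (intro sp_add) auto
    then show ?case using insert by simp
  qed
  define g where "g x = b k x + (- 1) * (\<Sum>e\<in>P. b k e * p e x)" for x
  have sp_g: "sp g" unfolding g_def[abs_def] using P
    by (intro sp_add sp_b sp_cmult sp_sum sp_p) auto
  have gP: "g e = 0" if "e \<in> P" for e
  proof -
    have "(\<Sum>e'\<in>P. b k e' * p e' e) = (\<Sum>e'\<in>P. if e' = e then b k e else 0)"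
      using delta that by (intro sum.cong) auto
    then show ?thesis using that P by (simp add: g_def)
  qed
  have card_ins: "card (insert k B) = Suc (card B)" using insert.hyps by simp
  show ?case
  proof (cases "\<forall>x\<in>E. g x = 0")
    case True
    obtain c where c: "!!x. g x = (\<Sum>i\<in>insert k B. c i * b i x)" using sp_g unfolding sp_def by blast
    have g0: "g x = 0" for x unfolding c by (rule insert.prems(2)) (use True in \<open>simp only: c[symmetric]\<close>)
    have k: "b k x = (\<Sum>e\<in>P. b k e * p e x)" for x using g0[of x] unfolding g_def by linarith
    have mono: "\<bar>p e x\<bar> \<le> 2 * 3 ^ card (insert k B)" if "e \<in> P" "x \<in> E" for e x
    proof (rule order_trans[OF bound[OF that]])
      show "2 * 3 ^ card B \<le> (2 * 3 ^ card (insert k B) :: real)" unfolding card_ins by simp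
    qed
    have rep_k: "b i x = (\<Sum>e\<in>P. b i e * p e x)" if "i \<in> insert k B" for i x
      using that
    proof
      assume "i = k" then show ?thesis by (simp only: k[symmetric])
    next
      assume "i \<in> B" then show ?thesis by (rule rep)
    qed
    show ?thesis
    proof (intro exI[of _ P] exI[of _ p] conjI ballI allI)
      show "\<bar>p e x\<bar> \<le> 2 * 3 ^ card (insert k B)" if "e \<in> P" "x \<in> E" for e x
        by (rule mono[OF that])
      show "\<exists>c. \<forall>x. p e x = (\<Sum>i\<in>insert k B. c i * b i x)" if "e \<in> P" for e
        using sp_p[OF that] unfolding sp_def .
      show "b i x = (\<Sum>e\<in>P. b i e * p e x)" if "i \<in> insert k B" for i x
        by (rule rep_k[OF that])
      show "p e e' = (if e = e' then 1 else 0)" if "e \<in> P" "e' \<in> P" for e e' by (rule delta[OF that])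
      show "card P \<le> card (insert k B)" using P card_ins by simp
    qed (rule P)+
  next
    case False
    then obtain x0 where x0: "x0 \<in> E" "g x0 \<noteq> 0" by auto
    obtain Kb where Kb: "!!x. x \<in> E ==> \<bar>b k x\<bar> \<le> Kb" using insert.prems(1)[of k] by auto
    have "\<bar>g x\<bar> \<le> Kb + (\<Sum>e\<in>P. \<bar>b k e\<bar> * (2 * 3 ^ card B))" if "x \<in> E" for x
    proof -
      have "\<bar>\<Sum>e\<in>P. b k e * p e x\<bar> \<le> (\<Sum>e\<in>P. \<bar>b k e\<bar> * (2 * 3 ^ card B))"
        by (rule order_trans[OF sum_abs]) (auto intro!: sum_mono mult_left_mono simp: abs_mult bound that)
      then show ?thesis using Kb[OF that] unfolding g_def by linarith
    qed
    from almost_maximal_point[of E g, OF this x0] obtain e0 where e0: "e0 \<in> E" "g e0 \<noteq> 0" "!!x. x \<in> E ==> \<bar>g x\<bar> \<le> 2 * \<bar>g e0\<bar>"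
      by blast
    have e0P: "e0 \<notin> P" using gP e0(2) by auto
    define p0 where "p0 x = (1 / g e0) * g x" for x
    define p' where "p' e = (if e = e0 then p0 else (%x. p e x + (- p e e0) * p0 x))" for e
    have p0_e0: "p0 e0 = 1" and p0_P: "e \<in> P ==> p0 e = 0" for e
      using e0 gP by (auto simp: p0_def)
    have p0_bound: "\<bar>p0 x\<bar> \<le> 2" if "x \<in> E" for x
      using e0(3)[OF that] e0(2) by (simp add: p0_def abs_mult field_simps)
    have sp_p0: "sp p0" unfolding p0_def[abs_def] by (intro sp_cmult sp_g)
    have sumP': "(\<Sum>e\<in>insert e0 P. b i e * p' e x) = (\<Sum>e\<in>P. b i e * p e x) + p0 x * (b i e0 - (\<Sum>e\<in>P. b i e * p e e0))" for i x
    proof -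
      have "(\<Sum>e\<in>P. b i e * p' e x) = (\<Sum>e\<in>P. b i e * p e x - p0 x * (b i e * p e e0))"
        using e0P by (intro sum.cong) (auto simp: p'_def algebra_simps)
      then show ?thesis using P e0P
        by (simp add: p'_def sum_subtractf sum_distrib_left algebra_simps)
    qed
    show ?thesis
    proof (intro exI[of _ "insert e0 P"] exI[of _ p'] conjI ballI allI)
      show "card (insert e0 P) \<le> card (insert k B)" using P e0P card_ins by simp
      show "\<exists>c. \<forall>x. p' e x = (\<Sum>i\<in>insert k B. c i * b i x)" if "e \<in> insert e0 P" for e
      proof -
        have "sp (p' e)"
        proof (cases "e = e0")
          case False
          then have "sp (%x. p e x + (- p e e0) * p0 x)" using that by (intro sp_add sp_cmult sp_p sp_p0) auto
          then show ?thesis using False by (simp add: p'_def)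
        qed (simp add: p'_def sp_p0)
        then show ?thesis unfolding sp_def .
      qed
      show "\<bar>p' e x\<bar> \<le> 2 * 3 ^ card (insert k B)" if "e \<in> insert e0 P" "x \<in> E" for e x
      proof (cases "e = e0")
        case True
        have "\<bar>p' e x\<bar> \<le> 2 * 1" using p0_bound[OF that(2)] True by (simp add: p'_def)
        also have "\<dots> \<le> 2 * 3 ^ card (insert k B)" by (intro mult_left_mono one_le_power) auto
        finally show ?thesis .
      next
        case False
        let ?K = "2 * 3 ^ card B :: real"
        have "\<bar>p e x\<bar> \<le> ?K" "\<bar>p e e0\<bar> \<le> ?K" using bound that e0(1) False by auto
        moreover have "\<bar>p e e0 * p0 x\<bar> \<le> ?K * 2"
          unfolding abs_mult using \<open>\<bar>p e e0\<bar> \<le> ?K\<close> p0_bound[OF that(2)] by (intro mult_mono) auto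
        ultimately have "\<bar>p e x - p e e0 * p0 x\<bar> \<le> ?K + ?K * 2" by linarith
        then show ?thesis using False unfolding card_ins by (simp add: p'_def)
      qed
      show "p' e e' = (if e = e' then 1 else 0)" if "e \<in> insert e0 P" "e' \<in> insert e0 P" for e e'
        using that delta p0_e0 p0_P e0P by (auto simp: p'_def)
      show "b i x = (\<Sum>e\<in>insert e0 P. b i e * p' e x)" if "i \<in> insert k B" for i x
      proof (cases "i = k")
        case True
        have "b k e0 - (\<Sum>e\<in>P. b k e * p e e0) = g e0" by (simp add: g_def)
        then have "p0 x * (b k e0 - (\<Sum>e\<in>P. b k e * p e e0)) = g x" using e0(2) by (simp add: p0_def)
        then show ?thesis unfolding True sumP' g_def by linarith
      next
        case False
        then have "i \<in> B" using that by simp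
        then show ?thesis unfolding sumP' rep[OF \<open>i \<in> B\<close>, symmetric] by simp
      qed
    qed (use P e0 in auto)
  qed
qed

section \<open>Adapted vector fields\<close>

text \<open>The vector fields dual to the gradients of \<open>\<tau>\<close>, by Cramer's rule.\<close>

definition fld :: "('n => real ^ 'n::finite => real) => 'n => real ^ 'n => real ^ 'n" where
  "fld \<tau> l x = (\<chi> s. det (\<chi> i. if i = l then axis s 1 else jac \<tau> x $ i) / det (jac \<tau> x))"

definition XV :: "(real ^ 'n => real ^ 'n) => (real ^ 'n::finite => real) => real ^ 'n => real" where
  "XV V f y = (\<Sum>s\<in>UNIV. V y $ s * dv (axis s 1) f y)"

lemma XV_dv: "f differentiable (at y) ==> XV V f y = dv (V y) f y"
  unfolding XV_def by (rule dv_axis_expand[symmetric])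

text \<open>The derivative of \<open>f\<close> along a dual field is a quotient of Jacobians, in which \<open>f\<close> replaces one member of the
  tuple. It is therefore bounded by 1 where the Jacobian of \<open>\<tau>\<close> is maximal.\<close>

lemma XV_fld_det:
  "XV (fld \<tau> l) f x = det (\<chi> i. if i = l then (\<chi> s. dv (axis s 1) f x) else jac \<tau> x $ i) / det (jac \<tau> x)"
proof -
  let ?g = "\<chi> s. dv (axis s 1) f x"
  have g: "(\<Sum>s\<in>UNIV. dv (axis s 1) f x *s axis s 1) = ?g"
    by (simp add: vec_eq_iff axis_def if_distrib[of "%x. _ * x"] cong: if_cong)
  have "det (\<chi> i. if i = l then ?g else jac \<tau> x $ i)
    = det (\<chi> i. if i = l then (\<Sum>s\<in>UNIV. dv (axis s 1) f x *s axis s 1) else jac \<tau> x $ i)" by (simp only: g)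
  also have "\<dots> = (\<Sum>s\<in>UNIV. det (\<chi> i. if i = l then dv (axis s 1) f x *s axis s 1 else jac \<tau> x $ i))"
    by (rule det_linear_row_sum[of UNIV l "%_ s. dv (axis s 1) f x *s axis s 1" "%i. jac \<tau> x $ i"]) simp
  also have "\<dots> = (\<Sum>s\<in>UNIV. dv (axis s 1) f x * det (\<chi> i. if i = l then axis s 1 else jac \<tau> x $ i))"
    by (intro sum.cong refl det_row_mul[of l _ "%_. axis _ 1" "%i. jac \<tau> x $ i"])
  finally show ?thesis by (simp add: XV_def fld_def sum_divide_distrib mult.commute)
qed

lemma XV_fld_member: "f = \<tau> i ==> det (jac \<tau> x) \<noteq> 0 ==> XV (fld \<tau> l) f x = (if i = l then 1 else 0)"
proof -
  assume f: "f = \<tau> i" and nz: "det (jac \<tau> x) \<noteq> 0"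
  have row_i: "(\<chi> s. dv (axis s 1) f x) = jac \<tau> x $ i" by (simp add: f jac_def)
  show ?thesis
  proof (cases "i = l")
    case True
    have "(\<chi> i'. if i' = l then jac \<tau> x $ i else jac \<tau> x $ i') = jac \<tau> x"
      using True by (simp add: vec_eq_iff)
    then show ?thesis unfolding XV_fld_det row_i using nz True by simp
  next
    case False
    have "det (\<chi> i'. if i' = l then jac \<tau> x $ i else jac \<tau> x $ i') = 0"
      by (rule det_identical_rows[OF False]) (use False in \<open>simp add: row_def vec_eq_iff\<close>)
    then show ?thesis unfolding XV_fld_det row_i using False by simp
  qed
qed

lemma jac_update: "(\<chi> i. if i = l then (\<chi> s. dv (axis s 1) f x) else jac \<tau> x $ i) = jac (\<tau>(l := f)) x"
  by (simp add: jac_def vec_eq_iff)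

lemma jac_fld_identity:
  assumes "det (jac \<tau> x) \<noteq> 0"
  shows "jac \<tau> x ** (\<chi> s l. fld \<tau> l x $ s) = mat 1"
proof -
  have "(\<Sum>s\<in>UNIV. jac \<tau> x $ i $ s * fld \<tau> l x $ s) = (if i = l then 1 else 0)" for i l
    using XV_fld_member[where \<tau> = \<tau> and i = i and l = l and x = x, OF refl assms] by (simp add: XV_def jac_def mult.commute)
  then show ?thesis by (simp add: matrix_matrix_mult_def mat_def vec_eq_iff)
qed

lemma rat_jac_entry: "open U ==> (!!i. rat U t (\<tau> i)) ==> rat U (2 * t) (%x. jac \<tau> x $ i $ s)"
  unfolding jac_def by (simp add: rat_dv_axis)

definition det_deg :: "'n::finite itself => nat => nat" where
  "det_deg _ t = card {p. p permutes (UNIV :: 'n set)} * (CARD('n) * (2 * t))"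

lemma rat_det_jac:
  fixes \<tau> :: "'n => real ^ 'n::finite => real"
  assumes "open U" "!!i. rat U t (\<tau> i)"
  shows "rat U (det_deg TYPE('n) t) (%x. det (jac \<tau> x))"
proof -
  have "rat U (det_deg TYPE('n) t) (%x. det (\<chi> i s. jac \<tau> x $ i $ s))"
    unfolding det_deg_def by (rule rat_det) (rule rat_jac_entry[OF assms])
  then show ?thesis by simp
qed

lemma rat_fld:
  fixes \<tau> :: "'n => real ^ 'n::finite => real"
  assumes "open U" "!!i. rat U t (\<tau> i)" "!!x. x \<in> U ==> det (jac \<tau> x) \<noteq> 0"
  shows "rat U (2 * det_deg TYPE('n) t) (%x. fld \<tau> l x $ s)"
proof -
  have "rat U (det_deg TYPE('n) t) (%x. det (\<chi> i j. if i = l then axis s 1 $ j else jac \<tau> x $ i $ j))"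
    unfolding det_deg_def
  proof (rule rat_det)
    fix i j show "rat U (2 * t) (%x. if i = l then axis s 1 $ j else jac \<tau> x $ i $ j)"
      using rat_jac_entry[OF assms(1,2)] by (cases "i = l") (simp_all add: rat_const)
  qed
  moreover have "(\<chi> i j. if i = l then axis s 1 $ j else jac \<tau> x $ i $ j) = (\<chi> i. if i = l then axis s 1 else jac \<tau> x $ i)" for x
    by (simp add: vec_eq_iff)
  ultimately have "rat U (det_deg TYPE('n) t) (%x. det (\<chi> i. if i = l then axis s 1 else jac \<tau> x $ i))" by simp
  from rat_divide[OF this rat_det_jac[OF assms(1,2)] assms(3)] show ?thesis
    by (simp add: fld_def mult_2)
qed

definition XV_deg :: "'n::finite itself => nat => nat" where
  "XV_deg n t = CARD('n) * (2 * det_deg n t + 2 * t) + t"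

lemma rat_XV:
  fixes V :: "real ^ 'n::finite => real ^ 'n"
  assumes "open U" "!!s. rat U a (%y. V y $ s)" "rat U t f"
  shows "rat U (CARD('n) * (a + 2 * t)) (XV V f)"
  unfolding XV_def[abs_def] using assms by (auto intro!: rat_sum rat_mult rat_dv_axis)

lemma rat_XV_fld:
  fixes \<tau> :: "'n => real ^ 'n::finite => real"
  assumes "open U" "!!i. rat U t (\<tau> i)" "!!x. x \<in> U ==> det (jac \<tau> x) \<noteq> 0" "rat U t f"
  shows "rat U (XV_deg TYPE('n) t) (XV (fld \<tau> l) f)"
  by (rule rat_mono[OF rat_XV[OF assms(1) rat_fld[OF assms(1-3)] assms(4)]]) (auto simp: XV_deg_def)

section \<open>Stages\<close>

text \<open>All families that can arise in \<open>r\<close> steps, whichever tuple is chosen in each step. The choice depends on the point,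
  but the number of possibilities and the degrees of the functions do not.\<close>

primrec stages :: "(real ^ 'n => real) set => nat => ((real ^ 'n::finite) set \<times> (real ^ 'n => real) set) set" where
  "stages F0 0 = {(UNIV, F0)}"
| "stages F0 (Suc r) = (\<Union>(U, F)\<in>stages F0 r. \<Union>\<tau>\<in>{\<tau>. range \<tau> \<subseteq> F}.
     {({x \<in> U. det (jac \<tau> x) \<noteq> 0}, F \<union> (%(l, f). XV (fld \<tau> l) f) ` (UNIV \<times> F))})"

primrec stage_size :: "'n::finite itself => nat => nat => nat" where
  "stage_size n b 0 = b"
| "stage_size n b (Suc r) = stage_size n b r + CARD('n) * stage_size n b r"

primrec stage_deg :: "'n::finite itself => nat => nat => nat" where
  "stage_deg n t 0 = t"
| "stage_deg n t (Suc r) = XV_deg n (stage_deg n t r)"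

primrec stage_count :: "'n::finite itself => nat => nat => nat" where
  "stage_count n b 0 = 1"
| "stage_count n b (Suc r) = stage_count n b r * stage_size n b r ^ CARD('n)"

lemma tuples_PiE: "{\<tau> :: 'n::finite => 'f. range \<tau> \<subseteq> F} = UNIV \<rightarrow>\<^sub>E F"
  by (auto simp: PiE_def Pi_def)

lemma finite_tuples: "finite F ==> finite {\<tau> :: 'n::finite => 'f. range \<tau> \<subseteq> F}"
  unfolding tuples_PiE by (intro finite_PiE) auto

lemma card_tuples: "card {\<tau> :: 'n::finite => 'f. range \<tau> \<subseteq> F} = card F ^ CARD('n)"
  unfolding tuples_PiE by (simp add: card_PiE)

lemma stages_invariant:
  fixes F0 :: "(real ^ 'n::finite => real) set"
  assumes F0: "finite F0" "card F0 \<le> b" "!!f. f \<in> F0 ==> pol t f"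
  shows "finite (stages F0 r) \<and> card (stages F0 r) \<le> stage_count TYPE('n) b r \<and>
    (\<forall>(U, F)\<in>stages F0 r. open U \<and> finite F \<and> card F \<le> stage_size TYPE('n) b r \<and>
      F0 \<subseteq> F \<and> (\<forall>f\<in>F. rat U (stage_deg TYPE('n) t r) f))"
proof (induction r)
  case 0
  then show ?case using F0 by (auto intro: rat_pol)
next
  case (Suc r)
  let ?S = "stages F0 r" and ?t = "stage_deg TYPE('n) t r"
  let ?new = "%U F \<tau>. ({x \<in> U. det (jac \<tau> x) \<noteq> 0}, F \<union> (%(l, f). XV (fld \<tau> l) f) ` (UNIV \<times> F))"
  let ?T = "%p. (?new (fst p) (snd p)) ` {\<tau> :: 'n => _. range \<tau> \<subseteq> snd p}"
  have St: "stages F0 (Suc r) = (\<Union>p\<in>?S. ?T p)" by (auto simp: case_prod_beta')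
  have inv: "open (fst p)" "finite (snd p)" "card (snd p) \<le> stage_size TYPE('n) b r" "F0 \<subseteq> snd p"
    "!!f. f \<in> snd p ==> rat (fst p) ?t f" if "p \<in> ?S" for p
    using Suc that by (auto simp: case_prod_beta')
  have finS: "finite ?S" and cardS: "card ?S \<le> stage_count TYPE('n) b r" using Suc by auto
  have finT: "finite (?T p)" if "p \<in> ?S" for p using inv(2)[OF that] by (intro finite_imageI finite_tuples)
  have cardT: "card (?T p) \<le> stage_size TYPE('n) b r ^ CARD('n)" if "p \<in> ?S" for p
  proof -
    have "card (?T p) \<le> card {\<tau> :: 'n => _. range \<tau> \<subseteq> snd p}"
      by (rule card_image_le[OF finite_tuples[OF inv(2)[OF that]]])
    also have "\<dots> \<le> stage_size TYPE('n) b r ^ CARD('n)"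
      unfolding card_tuples by (intro power_mono inv that) auto
    finally show ?thesis .
  qed
  have "card (stages F0 (Suc r)) \<le> (\<Sum>p\<in>?S. card (?T p))"
    unfolding St by (rule card_UN_le[OF finS])
  also have "\<dots> \<le> (\<Sum>p\<in>?S. stage_size TYPE('n) b r ^ CARD('n))" by (intro sum_mono cardT)
  also have "\<dots> \<le> stage_count TYPE('n) b (Suc r)" using cardS by simp
  finally have card: "card (stages F0 (Suc r)) \<le> stage_count TYPE('n) b (Suc r)" .
  have "open U' \<and> finite F' \<and> card F' \<le> stage_size TYPE('n) b (Suc r) \<and> F0 \<subseteq> F' \<and>
      (\<forall>f\<in>F'. rat U' (stage_deg TYPE('n) t (Suc r)) f)" if mem: "(U', F') \<in> stages F0 (Suc r)" for U' F'
  proof -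
    obtain U F \<tau> where S: "(U, F) \<in> ?S" and \<tau>: "range \<tau> \<subseteq> F"
      and U': "U' = {x \<in> U. det (jac \<tau> x) \<noteq> 0}" and F': "F' = F \<union> (%(l, f). XV (fld \<tau> l) f) ` (UNIV \<times> F)"
      using mem by auto
    have oU: "open U" and fF: "finite F" and cF: "card F \<le> stage_size TYPE('n) b r" and FF: "F0 \<subseteq> F"
      and rF: "!!f. f \<in> F ==> rat U ?t f" using inv[OF S] by auto
    have r\<tau>: "rat U ?t (\<tau> i)" for i using rF \<tau> by auto
    have "continuous_on U (%x. det (jac \<tau> x))" by (rule rat_continuous_on[OF rat_det_jac[OF oU r\<tau>] oU])
    from continuous_open_preimage[OF this oU, of "- {0}"] have oU': "open U'"
      unfolding U' by (auto simp: vimage_def Int_def)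
    have sub: "U' \<subseteq> U" and nz: "!!x. x \<in> U' ==> det (jac \<tau> x) \<noteq> 0" by (auto simp: U')
    have rU': "rat U' ?t f" if "f \<in> F" for f using rat_mono[OF rF[OF that] sub] by simp
    have "?t \<le> XV_deg TYPE('n) ?t" by (simp add: XV_deg_def)
    then have old: "rat U' (stage_deg TYPE('n) t (Suc r)) f" if "f \<in> F" for f
      using rat_mono[OF rU'[OF that] order_refl] by simp
    have "rat U' ?t (\<tau> i)" for i using rU' \<tau> by auto
    then have new: "rat U' (stage_deg TYPE('n) t (Suc r)) (XV (fld \<tau> l) f)" if "f \<in> F" for f l
      using rat_XV_fld[OF oU' _ nz rU'[OF that]] by simp
    have rats: "rat U' (stage_deg TYPE('n) t (Suc r)) f" if "f \<in> F'" for f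
      using that old new unfolding F' by auto
    have "card F' \<le> card F + card (UNIV \<times> F :: ('n \<times> _) set)"
      unfolding F' by (rule order_trans[OF card_Un_le add_left_mono[OF card_image_le]]) (use fF in auto)
    also have "\<dots> = card F + CARD('n) * card F" by (simp add: card_cartesian_product)
    also have "\<dots> \<le> stage_size TYPE('n) b (Suc r)"
      using cF by (auto intro!: add_mono mult_left_mono)
    finally show ?thesis using oU' fF FF rats unfolding F' by auto
  qed
  note new = this
  have fin: "finite (stages F0 (Suc r))" unfolding St using finS finT by auto
  have all: "\<forall>(U', F')\<in>stages F0 (Suc r). open U' \<and> finite F' \<and> card F' \<le> stage_size TYPE('n) b (Suc r) \<and>
      F0 \<subseteq> F' \<and> (\<forall>f\<in>F'. rat U' (stage_deg TYPE('n) t (Suc r)) f)"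
  proof (rule ballI)
    fix p assume "p \<in> stages F0 (Suc r)"
    then have "(fst p, snd p) \<in> stages F0 (Suc r)" by (simp only: prod.collapse)
    then show "case p of (U', F') => open U' \<and> finite F' \<and> card F' \<le> stage_size TYPE('n) b (Suc r) \<and>
      F0 \<subseteq> F' \<and> (\<forall>f\<in>F'. rat U' (stage_deg TYPE('n) t (Suc r)) f)"
      unfolding case_prod_beta by (rule new)
  qed
  show ?case by (intro conjI fin card all)
qed

section \<open>Operators of low order\<close>

abbreviation dvs :: "(real ^ 'n::finite) list => (real ^ 'n => real) => real ^ 'n => real" where
  "dvs vs f \<equiv> foldr dv vs f"

text \<open>Differential operators with rational coefficients that have order at most \<open>r\<close> and whose coefficients of order \<open>r\<close>
  vanish at \<open>x\<close>. These are the errors made when constant vectors are replaced by the dual fields.\<close>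

inductive low :: "(real ^ 'n::finite) set => real ^ 'n => nat => ((real ^ 'n => real) => real ^ 'n => real) => bool"
  for U x r where
  zero: "low U x r (%p y. 0)"
| step: "low U x r Q ==> rat U t c ==> length w \<le> r ==> (length w = r --> c x = 0)
    ==> low U x r (%p y. c y * dvs w p y + Q p y)"

lemma low_add: "low U x r Q ==> low U x r Q' ==> low U x r (%p y. Q p y + Q' p y)"
proof (induction rule: low.induct)
  case (step Q t c w)
  then have "low U x r (%p y. c y * dvs w p y + (Q p y + Q' p y))" by (intro low.step) auto
  then show ?case by (simp add: add.assoc)
qed simp

lemma low_sum: "(!!i. i \<in> I ==> low U x r (Q i)) ==> low U x r (%p y. \<Sum>i\<in>I. Q i p y)"
  by (induction I rule: infinite_finite_induct) (auto intro: low.zero low_add)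

lemma low_single: "rat U t c ==> length w \<le> r ==> (length w = r --> c x = 0) ==> low U x r (%p y. c y * dvs w p y)"
  using low.step[OF low.zero, of U t c w r x] by simp

lemma low_mono: "low U x r Q ==> V \<subseteq> U ==> low V x r Q"
proof (induction rule: low.induct)
  case (step Q t c w)
  then show ?case by (auto intro!: low.step elim: rat_mono)
qed (rule low.zero)

lemma poly_rat: "real_polynomial_function p ==> \<exists>t. rat U t p"
  using real_polynomial_function_imp_pol rat_pol by blast

lemma low_rat: "low U x r Q ==> real_polynomial_function p ==> \<exists>t. rat U t (Q p)"
proof (induction rule: low.induct)
  case zero
  then show ?case using rat_const by blast
next
  case (step Q t c w)
  obtain s where s: "rat U s (dvs w p)" using poly_rat[OF real_polynomial_function_dvs[OF step.prems]] by blast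
  obtain s' where s': "rat U s' (Q p)" using step by blast
  show ?case using rat_add[OF rat_mult[OF step(2) s] s'] by blast
qed

text \<open>A coefficient that vanishes at \<open>x\<close> may be differentiated once, as this lowers the order of the remaining operator
  below \<open>Suc r\<close>.\<close>

lemma low_field:
  assumes U: "open U" and V: "!!s. rat U a (%y. V y $ s)" and Q: "low U x r Q"
  shows "\<exists>Q'. low U x (Suc r) Q' \<and> (\<forall>p y. real_polynomial_function p --> y \<in> U --> XV V (Q p) y = Q' p y)"
  using Q
proof (induction rule: low.induct)
  case zero
  show ?case by (intro exI[of _ "%p y. 0"] conjI low.zero) (simp add: XV_def)
next
  case (step Q t c w)
  then obtain Q' where Q': "low U x (Suc r) Q'"
    "!!p y. real_polynomial_function p ==> y \<in> U ==> XV V (Q p) y = Q' p y" by blast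
  let ?R = "%p y. \<Sum>s\<in>UNIV. (c y * V y $ s) * dvs (axis s 1 # w) p y"
  let ?Q'' = "%p y. XV V c y * dvs w p y + (?R p y + Q' p y)"
  have "low U x (Suc r) ?R"
  proof (rule low_sum)
    fix s show "low U x (Suc r) (%p y. (c y * V y $ s) * dvs (axis s 1 # w) p y)"
      by (rule low_single[OF rat_mult[OF step(2) V]]) (use step in auto)
  qed
  then have "low U x (Suc r) ?Q''"
    using step(3) by (intro low.step[OF low_add[OF _ Q'(1)] rat_XV[OF U V step(2)]]) auto
  moreover have "XV V (%y. c y * dvs w p y + Q p y) y = ?Q'' p y"
    if p: "real_polynomial_function p" and y: "y \<in> U" for p y
  proof -
    obtain s where s: "rat U s (Q p)" using low_rat[OF step(1) p] by blast
    have d: "c differentiable (at y)" "dvs w p differentiable (at y)" "Q p differentiable (at y)"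
      using rat_differentiable[OF step(2) U y] rat_differentiable[OF s U y]
        differentiable_at_real_polynomial_function[OF real_polynomial_function_dvs[OF p]] by auto
    have "XV V (%y. c y * dvs w p y + Q p y) y
      = (\<Sum>s\<in>UNIV. V y $ s * (c y * dv (axis s 1) (dvs w p) y + dv (axis s 1) c y * dvs w p y + dv (axis s 1) (Q p) y))"
      unfolding XV_def using d by (simp add: dv_add dv_mult differentiable_mult)
    also have "\<dots> = XV V c y * dvs w p y + (?R p y + XV V (Q p) y)"
      by (simp add: XV_def sum_distrib_left sum_distrib_right sum.distrib algebra_simps)
    finally show ?thesis using Q'(2)[OF p y] by simp
  qed
  ultimately show ?case by blast
qed

text \<open>Linear combinations of members of \<open>F\<close> whose coefficients have absolute sum \<open>b\<close>.\<close>

inductive comb :: "(real ^ 'n::finite => real) set => real => (real ^ 'n => real) => bool" for F where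
  zero: "comb F 0 (%y. 0)"
| step: "comb F b h ==> f \<in> F ==> comb F (\<bar>a\<bar> + b) (%y. a * f y + h y)"

lemma comb_add: "comb F b h ==> comb F b' h' ==> comb F (b + b') (%y. h y + h' y)"
proof (induction rule: comb.induct)
  case (step b h f a)
  then have "comb F (\<bar>a\<bar> + (b + b')) (%y. a * f y + (h y + h' y))" by (intro comb.step) auto
  then show ?case by (simp add: add.assoc)
qed simp

lemma comb_single: "f \<in> F ==> comb F \<bar>a\<bar> (%y. a * f y)"
  using comb.step[OF comb.zero, of f F a] by simp

lemma comb_sum: "finite I ==> (!!i. i \<in> I ==> comb F (b i) (h i)) ==> comb F (\<Sum>i\<in>I. b i) (%y. \<Sum>i\<in>I. h i y)"
  by (induction I rule: finite_induct) (auto intro: comb.zero comb_add)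

lemma comb_mono: "comb F b h ==> F \<subseteq> F' ==> comb F' b h"
  by (induction rule: comb.induct) (auto intro: comb.intros)

lemma comb_bound: "comb F b h ==> (!!f. f \<in> F ==> \<bar>f x\<bar> \<le> K) ==> 0 \<le> K ==> \<bar>h x\<bar> \<le> b * K"
proof (induction rule: comb.induct)
  case (step b h f a)
  have "\<bar>a * f x\<bar> \<le> \<bar>a\<bar> * K" using step by (simp add: abs_mult mult_left_mono)
  then show ?case using step by (simp add: distrib_right)
qed simp

lemma comb_rat:
  assumes "comb F b h" "!!f. f \<in> F ==> rat U t f" shows "\<exists>s. rat U s h"
  using assms
proof (induction rule: comb.induct)
  case zero
  then show ?case using rat_const by blast
next
  case (step b h f a)
  then obtain s where "rat U s h" by blast
  then show ?case using rat_add[OF rat_cmult[of U t f a]] step by blast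
qed

lemma comb_field:
  fixes \<tau> :: "'n => real ^ 'n::finite => real" and a :: "'n => real"
  assumes "comb F b h" and U: "open U" and F: "!!f. f \<in> F ==> rat U t f" and a: "!!l. \<bar>a l\<bar> \<le> 1"
    and V: "!!y. V y = (\<Sum>l\<in>UNIV. a l *\<^sub>R fld \<tau> l y)"
  shows "\<exists>b' h'. comb (F \<union> (%(l, f). XV (fld \<tau> l) f) ` (UNIV \<times> F)) b' h' \<and> b' \<le> real CARD('n) * b \<and>
    (\<forall>y\<in>U. XV V h y = h' y)"
  using assms(1)
proof (induction rule: comb.induct)
  case zero
  show ?case by (intro exI[of _ 0] exI[of _ "%y. 0"]) (auto intro: comb.zero simp: XV_def)
next
  case (step b h f \<alpha>)
  let ?F' = "F \<union> (%(l, f). XV (fld \<tau> l) f) ` (UNIV \<times> F)"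
  obtain b' h' where h': "comb ?F' b' h'" "b' \<le> real CARD('n) * b" "!!y. y \<in> U ==> XV V h y = h' y"
    using step by blast
  obtain s where s: "rat U s h" using comb_rat[OF step(1) F] by blast
  have "comb ?F' (\<Sum>l\<in>UNIV. \<bar>\<alpha> * a l\<bar>) (%y. \<Sum>l\<in>UNIV. (\<alpha> * a l) * XV (fld \<tau> l) f y)"
    using step(2) by (intro comb_sum comb_single) auto
  from comb_add[OF this h'(1)]
  have "comb ?F' ((\<Sum>l\<in>UNIV. \<bar>\<alpha> * a l\<bar>) + b') (%y. (\<Sum>l\<in>UNIV. (\<alpha> * a l) * XV (fld \<tau> l) f y) + h' y)" .
  moreover have "(\<Sum>l\<in>(UNIV::'n set). \<bar>\<alpha> * a l\<bar>) + b' \<le> real CARD('n) * (\<bar>\<alpha>\<bar> + b)"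
  proof -
    have "(\<Sum>l\<in>(UNIV::'n set). \<bar>\<alpha> * a l\<bar>) \<le> (\<Sum>l\<in>(UNIV::'n set). \<bar>\<alpha>\<bar>)"
      by (intro sum_mono) (use a in \<open>auto simp: abs_mult intro: mult_left_le\<close>)
    then show ?thesis using h'(2) by (simp add: distrib_left)
  qed
  moreover have "XV V (%y. \<alpha> * f y + h y) y = (\<Sum>l\<in>UNIV. (\<alpha> * a l) * XV (fld \<tau> l) f y) + h' y" if y: "y \<in> U" for y
  proof -
    have d: "f differentiable (at y)" "h differentiable (at y)"
      using rat_differentiable[OF F[OF step(2)] U y] rat_differentiable[OF s U y] .
    have "XV V (%y. \<alpha> * f y + h y) y = \<alpha> * XV V f y + XV V h y"
      unfolding XV_def using d by (simp add: dv_add dv_cmult differentiable_mult sum.distrib sum_distrib_left algebra_simps)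
    also have "XV V f y = (\<Sum>s\<in>UNIV. \<Sum>l\<in>UNIV. a l * (fld \<tau> l y $ s * dv (axis s 1) f y))"
      by (simp add: XV_def V sum_distrib_right mult.assoc)
    also have "\<dots> = (\<Sum>l\<in>UNIV. a l * XV (fld \<tau> l) f y)"
      by (subst sum.swap) (simp add: XV_def sum_distrib_left)
    finally show ?thesis using h'(3)[OF y] by (simp add: sum_distrib_left mult.assoc)
  qed
  ultimately show ?case by blast
qed

text \<open>Up to operators of low order, at most \<open>r\<close> derivatives of functions in \<open>F0\<close> in directions that are short, as
  measured by the gradients of \<open>F\<close> at \<open>x\<close>, are combinations of members of \<open>F\<close> with bounded coefficients.\<close>

definition good :: "(real ^ 'n::finite => real) set => real ^ 'n => nat => (real ^ 'n) set => (real ^ 'n => real) set => bool" where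
  "good F0 x r U F \<longleftrightarrow> (\<forall>vs. length vs \<le> r --> (\<forall>v\<in>set vs. \<forall>f\<in>F. \<bar>dv v f x\<bar> \<le> 1) -->
    (\<exists>Q. low U x (length vs) Q \<and> (\<forall>p\<in>F0. \<exists>b h. comb F b h \<and> b \<le> real CARD('n) ^ length vs \<and>
      (\<forall>y\<in>U. dvs vs p y + Q p y = h y))))"

lemma good_0: "F0 \<subseteq> F ==> good F0 x 0 U F"
  unfolding good_def
proof (intro allI impI)
  fix vs :: "(real ^ 'a) list" assume "F0 \<subseteq> F" and vs: "length vs \<le> 0"
  have "\<exists>b h. comb F b h \<and> b \<le> 1 \<and> (\<forall>y\<in>U. p y = h y)" if "p \<in> F0" for p
    using comb_single[of p F 1] that \<open>F0 \<subseteq> F\<close> by (intro exI[of _ 1] exI[of _ p]) auto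
  then show "\<exists>Q. low U x (length vs) Q \<and> (\<forall>p\<in>F0. \<exists>b h. comb F b h \<and> b \<le> real CARD('a) ^ length vs \<and>
      (\<forall>y\<in>U. dvs vs p y + Q p y = h y))"
    using vs by (intro exI[of _ "%p y. 0"]) (auto intro: low.zero)
qed

text \<open>Let \<open>v\<close> be the outermost direction. The combination \<open>V\<close> of dual fields with \<open>V x = v\<close> has
  coefficients bounded by 1. Differentiating along \<open>V\<close> turns members of \<open>F\<close> into combinations of new
  members, and replacing \<open>v\<close> by \<open>V\<close> costs an operator whose coefficients \<open>V - v\<close> vanish at \<open>x\<close>.\<close>

lemma good_step:
  fixes \<tau> :: "'n => real ^ 'n::finite => real"
  assumes good: "good F0 x r U F" and oU: "open U" and F: "!!f. f \<in> F ==> rat U t f"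
    and F0: "!!p. p \<in> F0 ==> real_polynomial_function p" and \<tau>: "range \<tau> \<subseteq> F"
    and x: "x \<in> U" and J: "det (jac \<tau> x) \<noteq> 0"
  shows "good F0 x (Suc r) {x \<in> U. det (jac \<tau> x) \<noteq> 0} (F \<union> (%(l, f). XV (fld \<tau> l) f) ` (UNIV \<times> F))"
  unfolding good_def
proof (intro allI impI)
  let ?U' = "{x \<in> U. det (jac \<tau> x) \<noteq> 0}" and ?F' = "F \<union> (%(l, f). XV (fld \<tau> l) f) ` (UNIV \<times> F)"
  fix vs :: "(real ^ 'n) list"
  assume len: "length vs \<le> Suc r" and bd: "\<forall>v\<in>set vs. \<forall>f\<in>?F'. \<bar>dv v f x\<bar> \<le> 1"
  have r\<tau>: "rat U t (\<tau> i)" for i using F \<tau> by auto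
  have "continuous_on U (%x. det (jac \<tau> x))" by (rule rat_continuous_on[OF rat_det_jac[OF oU r\<tau>] oU])
  from continuous_open_preimage[OF this oU, of "- {0}"] have oU': "open ?U'"
    by (auto simp: vimage_def Int_def)
  have sub: "?U' \<subseteq> U" by auto
  have xU': "x \<in> ?U'" using x J by simp
  show "\<exists>Q. low ?U' x (length vs) Q \<and> (\<forall>p\<in>F0. \<exists>b h. comb ?F' b h \<and> b \<le> real CARD('n) ^ length vs \<and>
      (\<forall>y\<in>?U'. dvs vs p y + Q p y = h y))"
  proof (cases "length vs \<le> r")
    case True
    then obtain Q where Q: "low U x (length vs) Q" "!!p. p \<in> F0 ==> \<exists>b h. comb F b h \<and> b \<le> real CARD('n) ^ length vs \<and>
      (\<forall>y\<in>U. dvs vs p y + Q p y = h y)"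
      using good bd unfolding good_def by (metis (no_types, lifting) UnI1)
    show ?thesis
    proof (intro exI[of _ Q] conjI ballI)
      show "low ?U' x (length vs) Q" by (rule low_mono[OF Q(1) sub])
      fix p assume "p \<in> F0"
      from Q(2)[OF this] obtain b h where bh: "comb F b h" "b \<le> real CARD('n) ^ length vs" "\<forall>y\<in>U. dvs vs p y + Q p y = h y"
        by blast
      have "comb ?F' b h" by (rule comb_mono[OF bh(1)]) auto
      then show "\<exists>b h. comb ?F' b h \<and> b \<le> real CARD('n) ^ length vs \<and> (\<forall>y\<in>?U'. dvs vs p y + Q p y = h y)"
        using bh by blast
    qed
  next
    case False
    then obtain v ws where vs: "vs = v # ws" "length ws = r" using len by (cases vs) auto
    have "\<forall>v\<in>set ws. \<forall>f\<in>F. \<bar>dv v f x\<bar> \<le> 1" using bd vs by auto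
    then obtain Q where Q: "low U x r Q" "!!p. p \<in> F0 ==> \<exists>b h. comb F b h \<and> b \<le> real CARD('n) ^ r \<and>
      (\<forall>y\<in>U. dvs ws p y + Q p y = h y)"
      using good[unfolded good_def, rule_format, of ws] vs(2) by auto
    define a where "a l = dv v (\<tau> l) x" for l
    have a1: "\<bar>a l\<bar> \<le> 1" for l using bd vs(1) \<tau> unfolding a_def by auto
    define V where "V y = (\<Sum>l\<in>UNIV. a l *\<^sub>R fld \<tau> l y)" for y
    have r\<tau>': "rat ?U' t (\<tau> i)" for i using rat_mono[OF r\<tau> sub] by simp
    have rfld: "rat ?U' (2 * det_deg TYPE('n) t) (%y. fld \<tau> l y $ s)" for l s
      by (rule rat_fld[OF oU' r\<tau>']) simp
    have rV: "rat ?U' (CARD('n) * (2 * det_deg TYPE('n) t)) (%y. V y $ s)" for s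
      unfolding V_def by (simp, intro rat_sum rat_cmult rfld) simp
    have Vx: "V x = v"
    proof -
      have "(jac \<tau> x *v V x) $ i = (jac \<tau> x *v v) $ i" for i
      proof -
        have "(jac \<tau> x *v V x) $ i = (\<Sum>s\<in>UNIV. \<Sum>l\<in>UNIV. a l * (fld \<tau> l x $ s * dv (axis s 1) (\<tau> i) x))"
          by (simp add: matrix_vector_mult_def V_def jac_def sum_distrib_left mult_ac)
        also have "\<dots> = (\<Sum>l\<in>UNIV. a l * XV (fld \<tau> l) (\<tau> i) x)"
          by (subst sum.swap) (simp add: XV_def sum_distrib_left)
        also have "\<dots> = (\<Sum>l\<in>UNIV. if l = i then a l else 0)"
          by (intro sum.cong refl) (simp add: XV_fld_member[OF refl J])
        also have "\<dots> = dv v (\<tau> i) x" by (simp add: a_def)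
        also have "\<dots> = (jac \<tau> x *v v) $ i"
          unfolding dv_axis_expand[OF rat_differentiable[OF r\<tau> oU x], of v]
          by (simp add: matrix_vector_mult_def jac_def mult.commute)
        finally show ?thesis .
      qed
      then have eq: "jac \<tau> x *v V x = jac \<tau> x *v v" by (simp add: vec_eq_iff)
      obtain I where "I ** jac \<tau> x = mat 1" using J by (auto simp: invertible_det_nz[symmetric] invertible_def)
      then show ?thesis using arg_cong[OF eq, of "(*v) I"] by (simp add: matrix_vector_mul_assoc)
    qed
    obtain Q' where Q': "low ?U' x (Suc r) Q'"
      "!!p y. real_polynomial_function p ==> y \<in> ?U' ==> XV V (Q p) y = Q' p y"
      using low_field[OF oU' rV low_mono[OF Q(1) sub]] by blast
    let ?R = "%p y. \<Sum>s\<in>UNIV. (V y $ s + - (v $ s)) * dvs (axis s 1 # ws) p y"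
    have "low ?U' x (Suc r) ?R"
    proof (rule low_sum)
      fix s show "low ?U' x (Suc r) (%p y. (V y $ s + - (v $ s)) * dvs (axis s 1 # ws) p y)"
        by (rule low_single[OF rat_add[OF rV rat_const[of _ 0]]]) (use vs Vx in auto)
    qed
    from low_add[OF this Q'(1)] have lowR: "low ?U' x (Suc r) (%p y. ?R p y + Q' p y)" .
    show ?thesis
    proof (intro exI[of _ "%p y. ?R p y + Q' p y"] conjI ballI)
      show "low ?U' x (length vs) (%p y. ?R p y + Q' p y)" using lowR vs by simp
      fix p assume p: "p \<in> F0"
      obtain b h where h: "comb F b h" "b \<le> real CARD('n) ^ r" "!!y. y \<in> U ==> dvs ws p y + Q p y = h y"
        using Q(2)[OF p] by blast
      obtain b' h' where h': "comb ?F' b' h'" "b' \<le> real CARD('n) * b" "!!y. y \<in> U ==> XV V h y = h' y"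
        using comb_field[OF h(1) oU F a1 V_def] by blast
      have "b' \<le> real CARD('n) ^ length vs"
        using order_trans[OF h'(2) mult_left_mono[OF h(2), of "real CARD('n)"]] vs by simp
      moreover have "dvs vs p y + (?R p y + Q' p y) = h' y" if y: "y \<in> ?U'" for y
      proof -
        have pp: "real_polynomial_function p" by (rule F0[OF p])
        obtain s where s: "rat ?U' s (Q p)" using low_rat[OF low_mono[OF Q(1) sub] pp] by blast
        have d: "dvs ws p differentiable (at y)" "Q p differentiable (at y)"
          using differentiable_at_real_polynomial_function[OF real_polynomial_function_dvs[OF pp]]
            rat_differentiable[OF s oU' y] by auto
        have "dvs vs p y = (\<Sum>s\<in>UNIV. v $ s * dvs (axis s 1 # ws) p y)"
          using dv_axis_expand[OF d(1), of v] vs by simp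
        then have "dvs vs p y + ?R p y = XV V (dvs ws p) y"
          by (simp add: XV_def sum.distrib[symmetric] algebra_simps)
        moreover have "XV V (%y. dvs ws p y + Q p y) y = XV V (dvs ws p) y + XV V (Q p) y"
          unfolding XV_def using d by (simp add: dv_add sum.distrib distrib_left)
        moreover have "XV V (%y. dvs ws p y + Q p y) y = XV V h y"
          unfolding XV_def using y h(3) by (intro sum.cong refl arg_cong2[of _ _ _ _ "(*)"] dv_transform[OF oU]) auto
        ultimately show ?thesis using h'(3)[of y] Q'(2)[OF pp y] y by simp
      qed
      ultimately show "\<exists>b h. comb ?F' b h \<and> b \<le> real CARD('n) ^ length vs \<and>
          (\<forall>y\<in>?U'. dvs vs p y + (?R p y + Q' p y) = h y)"
        using h'(1) by blast
    qed
  qed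
qed

text \<open>Replacing a member of a tuple with maximal Jacobian by any other function does not increase the Jacobian.\<close>

lemma maximal_tuple:
  fixes F :: "(real ^ 'n::finite => real) set"
  assumes "finite F" "range \<tau>0 \<subseteq> F" "det (jac \<tau>0 x) \<noteq> 0"
  obtains \<tau> :: "'n => real ^ 'n => real" where "range \<tau> \<subseteq> F" "det (jac \<tau> x) \<noteq> 0"
    "!!l f. f \<in> F ==> \<bar>XV (fld \<tau> l) f x\<bar> \<le> 1"
proof -
  let ?T = "{\<tau> :: 'n => real ^ 'n => real. range \<tau> \<subseteq> F}" and ?d = "%\<tau>. \<bar>det (jac \<tau> x)\<bar>"
  have fin: "finite ?T" using assms(1) by (rule finite_tuples)
  have "Max (?d ` ?T) \<in> ?d ` ?T" using fin assms(2) by (intro Max_in) auto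
  then obtain \<tau> where \<tau>1: "\<tau> \<in> ?T" "Max (?d ` ?T) = ?d \<tau>" by (rule imageE) (rule that)
  have \<tau>2: "?d \<tau>' \<le> ?d \<tau>" if "\<tau>' \<in> ?T" for \<tau>'
  proof -
    have "?d \<tau>' \<le> Max (?d ` ?T)" by (rule Max_ge[OF finite_imageI[OF fin] imageI[OF that]])
    then show ?thesis by (simp only: \<tau>1(2))
  qed
  have "?d \<tau>0 \<le> ?d \<tau>" by (rule \<tau>2) (rule CollectI, rule assms(2))
  then have nz: "det (jac \<tau> x) \<noteq> 0" using assms(3) by linarith
  from \<tau>1(1) have \<tau>F: "range \<tau> \<subseteq> F" by (rule CollectD)
  show thesis
  proof (rule that[OF \<tau>F nz])
    fix l f assume f: "f \<in> F"
    have "range (\<tau>(l := f)) \<subseteq> F" using \<tau>F f by (simp add: image_subset_iff)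
    then have "?d (\<tau>(l := f)) \<le> ?d \<tau>" by (intro \<tau>2 CollectI)
    then show "\<bar>XV (fld \<tau> l) f x\<bar> \<le> 1" unfolding XV_fld_det jac_update using nz by (simp add: abs_divide)
  qed
qed

text \<open>All adjoined functions are bounded by 1 at \<open>x\<close>, which is where \<open>1 \<le> K\<close> enters.\<close>

lemma good_stage_exists:
  fixes F0 :: "(real ^ 'n::finite => real) set"
  assumes F0: "finite F0" "!!f. f \<in> F0 ==> pol t f" and \<tau>0: "range \<tau>0 \<subseteq> F0" "det (jac \<tau>0 x) \<noteq> 0"
    and K: "1 \<le> K" "!!f. f \<in> F0 ==> \<bar>f x\<bar> \<le> K"
  shows "\<exists>(U, F)\<in>stages F0 r. x \<in> U \<and> good F0 x r U F \<and> (\<forall>f\<in>F. \<bar>f x\<bar> \<le> K)"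
proof (induction r)
  case 0
  then show ?case using K good_0[of F0 F0] by auto
next
  case (Suc r)
  then obtain U F where UF: "(U, F) \<in> stages F0 r" "x \<in> U" "good F0 x r U F" "\<forall>f\<in>F. \<bar>f x\<bar> \<le> K" by auto
  have inv: "open U" "finite F" "F0 \<subseteq> F" "!!f. f \<in> F ==> rat U (stage_deg TYPE('n) t r) f"
    using stages_invariant[of F0 "card F0" t r] F0 UF(1) by auto
  obtain \<tau> :: "'n => real ^ 'n => real" where \<tau>: "range \<tau> \<subseteq> F" "det (jac \<tau> x) \<noteq> 0"
    "!!l f. f \<in> F ==> \<bar>XV (fld \<tau> l) f x\<bar> \<le> 1"
    using maximal_tuple[OF inv(2) order_trans[OF \<tau>0(1) inv(3)] \<tau>0(2)] by blast
  let ?U' = "{x \<in> U. det (jac \<tau> x) \<noteq> 0}" and ?F' = "F \<union> (%(l, f). XV (fld \<tau> l) f) ` (UNIV \<times> F)"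
  have "(?U', ?F') \<in> stages F0 (Suc r)"
    unfolding stages.simps(2)
    by (rule UN_I[OF UF(1)], unfold prod.case) (rule UN_I[of \<tau>], rule CollectI, rule \<tau>(1), rule singletonI)
  moreover have "good F0 x (Suc r) ?U' ?F'"
    by (rule good_step[OF UF(3) inv(1,4) pol_imp_real_polynomial_function[OF F0(2)] \<tau>(1) UF(2) \<tau>(2)])
  moreover have "\<bar>f x\<bar> \<le> K" if "f \<in> ?F'" for f
    using that UF(4) \<tau>(3) K(1) by (auto intro: order_trans)
  ultimately show ?case using UF(2) \<tau>(2) by (intro bexI[of _ "(?U', ?F')"]) auto
qed

section \<open>Multilinear symbols\<close>

text \<open>Derivatives of order less than \<open>r\<close> at the point \<open>x\<close>; at \<open>x\<close> itself an operator that is low of order \<open>r\<close> is of this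
  form.\<close>

inductive lower_symbol :: "real ^ 'n::finite => nat => ((real ^ 'n => real) => real) => bool" for x r where
  zero: "lower_symbol x r (%p. 0)"
| step: "lower_symbol x r L ==> length w < r ==> lower_symbol x r (%p. c * dvs w p x + L p)"

lemma lower_symbol_mono: "lower_symbol x r L ==> r \<le> s ==> lower_symbol x s L"
  by (induction rule: lower_symbol.induct) (auto intro: lower_symbol.intros)

lemma lower_symbol_0: "lower_symbol x 0 L ==> L p = 0"
  by (induction rule: lower_symbol.induct) auto

lemma low_symbol: "low U x r Q ==> \<exists>R. lower_symbol x r R \<and> (\<forall>p. Q p x = R p)"
proof (induction rule: low.induct)
  case zero
  show ?case by (intro exI[of _ "%p. 0"]) (auto intro: lower_symbol.zero)
next
  case (step Q t c w)
  then obtain R where R: "lower_symbol x r R" "\<forall>p. Q p x = R p" by blast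
  show ?case
  proof (cases "length w = r")
    case True
    then show ?thesis using step R by (intro exI[of _ R]) auto
  next
    case False
    then have "lower_symbol x r (%p. c x * dvs w p x + R p)" using step R by (intro lower_symbol.step) auto
    then show ?thesis using R(2) by (intro exI[of _ "%p. c x * dvs w p x + R p"]) simp
  qed
qed

text \<open>A functional is applied to each factor of a sum of products. Derivatives of \<^const>\<open>tens\<close> have this form, with
  one word of directions for each factor.\<close>

definition slots :: "'i set => ('i => real) => ('i => 'k::finite => 'f) => ('k => 'f => real) => real" where
  "slots A a g L = (\<Sum>I\<in>A. a I * (\<Prod>j\<in>UNIV. L j (g I j)))"

lemma slots_linear:
  "slots A a g (L(j := %p. c * M p + K p)) = c * slots A a g (L(j := M)) + slots A a g (L(j := K))"
proof -
  have prod: "(\<Prod>j'\<in>UNIV. (L(j := M)) j' (g I j')) = M (g I j) * (\<Prod>j'\<in>UNIV - {j}. L j' (g I j'))" for I M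
    by (subst prod.remove[of _ j]) auto
  show ?thesis unfolding slots_def prod by (simp add: sum_distrib_left sum.distrib[symmetric] algebra_simps)
qed

lemma filter_enumerated_words:
  "distinct js ==> map snd (filter (%p. fst p = j) (concat (map (%j. map (Pair j) (W j)) js))) = (if j \<in> set js then W j else [])"
proof (induction js)
  case (Cons i js)
  have "filter (%p. fst p = j) (map (Pair i) (W i)) = (if i = j then map (Pair j) (W j) else [])"
    by (auto simp: filter_map comp_def)
  then show ?case using Cons by (auto simp: comp_def)
qed simp

text \<open>This is a derivative on the diagonal of order less than \<open>q\<close>.\<close>

lemma slots_words_vanish:
  fixes g :: "'i => 'k::finite => real ^ 'n::finite => real"
  assumes A: "finite A" and g: "!!I j. I \<in> A ==> real_polynomial_function (g I j)"
    and v: "!!i. vord q (%h. tens A a g ((\<chi> j. x) + h) i)" and len: "(\<Sum>j\<in>UNIV. length (W j)) < q"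
  shows "slots A (%I. a I i) g (%j p. dvs (W j) p x) = 0"
proof -
  obtain js :: "'k list" where js: "distinct js" "set js = UNIV" using finite_distinct_list[of "UNIV :: 'k set"] by auto
  let ?ws = "concat (map (%j. map (Pair j) (W j)) js)"
  have "length ?ws = (\<Sum>j\<leftarrow>js. length (W j))" by (simp add: length_concat comp_def)
  also have "\<dots> = (\<Sum>j\<in>UNIV. length (W j))" using sum_list_distinct_conv_sum_set[OF js(1)] js(2) by simp
  finally have "dargs ?ws (tens A a g) (\<chi> j. x) i = 0" using len by (intro dargs_vanish[of q] v) simp
  moreover have "dargs ?ws (tens A a g) (\<chi> j. x) i = slots A (%I. a I i) g (%j p. dvs (W j) p x)"
  proof -
    have "dargs ?ws (tens A a g) = tens A a (%I j. dvs (map snd (filter (%p. fst p = j) ?ws)) (g I j))"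
      by (rule dargs_tens[OF A]) (rule g)
    then show ?thesis unfolding filter_enumerated_words[OF js(1)] by (simp add: js tens_def slots_def)
  qed
  ultimately show ?thesis by simp
qed

text \<open>By multilinearity, the functionals can be expanded into single derivatives in one slot after another.\<close>

lemma slots_lower_vanish:
  fixes g :: "'i => 'k::finite => real ^ 'n::finite => real"
  assumes A: "finite A" and g: "!!I j. I \<in> A ==> real_polynomial_function (g I j)"
    and v: "!!i. vord q (%h. tens A a g ((\<chi> j. x) + h) i)" and len: "(\<Sum>j\<in>UNIV. l j) < q"
    and L: "!!j. lower_symbol x (Suc (l j)) (L j)"
  shows "slots A (%I. a I i) g L = 0"
proof -
  have main: "slots A (%I. a I i) g (%j. if j \<in> S then L j else (%p. dvs (W j) p x)) = 0"
    if "finite S" "!!j. length (W j) \<le> l j" for S W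
    using that
  proof (induction S arbitrary: W rule: finite_induct)
    case empty
    have "(\<Sum>j\<in>UNIV. length (W j)) \<le> (\<Sum>j\<in>UNIV. l j)" by (intro sum_mono empty)
    then have "(\<Sum>j\<in>UNIV. length (W j)) < q" using len by linarith
    from slots_words_vanish[where A = A and g = g and a = a and x = x and W = W and i = i, OF A g v this]
    show ?case by simp
  next
    case (insert j0 S)
    let ?L = "%j. if j \<in> insert j0 S then L j else (%p. dvs (W j) p x)"
    have "slots A (%I. a I i) g (?L(j0 := K)) = 0" if "lower_symbol x (Suc (l j0)) K" for K
      using that
    proof (induction rule: lower_symbol.induct)
      case zero
      have "(\<Prod>j\<in>UNIV. (?L(j0 := %p. 0)) j (g I j)) = 0" for I
        by (rule prod_zero) auto
      then show ?case unfolding slots_def by (simp only: mult_zero_right sum.neutral_const)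
    next
      case (step K w c)
      let ?W = "W(j0 := w)"
      have "slots A (%I. a I i) g (%j. if j \<in> S then L j else (%p. dvs (?W j) p x)) = 0"
        by (rule insert.IH) (use insert.prems step in auto)
      moreover have "(%j. if j \<in> S then L j else (%p. dvs (?W j) p x)) = ?L(j0 := %p. dvs w p x)"
        using insert.hyps by (auto simp: fun_eq_iff)
      ultimately have "slots A (%I. a I i) g (?L(j0 := %p. dvs w p x)) = 0" by simp
      then show ?case unfolding slots_linear step.IH by simp
    qed
    from this[OF L] show ?case by (simp add: fun_upd_idem)
  qed
  have "slots A (%I. a I i) g (%j. if j \<in> UNIV then L j else (%p. dvs [] p x)) = 0"
    by (rule main[of UNIV "%_. []"]) auto
  then show ?thesis by simp
qed

text \<open>Replacing one factor by a derivative of lower order makes the total order less than \<open>q\<close>, where everything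
  vanishes on the diagonal. So derivatives of order \<open>q\<close> do not see the errors of lower order.\<close>

lemma slots_replace_lower:
  fixes g :: "'i => 'k::finite => real ^ 'n::finite => real"
  assumes A: "finite A" and g: "!!I j. I \<in> A ==> real_polynomial_function (g I j)"
    and v: "!!i. vord q (%h. tens A a g ((\<chi> j. x) + h) i)" and len: "(\<Sum>j\<in>UNIV. length (W j)) = q"
    and R: "!!j. lower_symbol x (length (W j)) (R j)"
  shows "slots A (%I. a I i) g (%j p. dvs (W j) p x) = slots A (%I. a I i) g (%j p. dvs (W j) p x + R j p)"
proof -
  let ?w = "%j p. dvs (W j) p x"
  have main: "slots A (%I. a I i) g (%j. if j \<in> S then (%p. ?w j p + R j p) else ?w j) = slots A (%I. a I i) g ?w"
    if "finite S" for S
    using that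
  proof (induction S rule: finite_induct)
    case (insert j0 S)
    let ?L = "%j. if j \<in> S then (%p. ?w j p + R j p) else ?w j"
    have Lj0: "?L(j0 := ?w j0) = ?L" using insert.hyps by (auto simp: fun_eq_iff)
    have "slots A (%I. a I i) g (?L(j0 := R j0)) = 0"
    proof (cases "length (W j0)")
      case 0
      have "R j0 p = 0" for p using lower_symbol_0[of x "R j0" p] R[of j0] 0 by simp
      then have "(\<Prod>j\<in>UNIV. (?L(j0 := R j0)) j (g I j)) = 0" for I by (intro prod_zero) auto
      then show ?thesis unfolding slots_def by (simp only: mult_zero_right sum.neutral_const)
    next
      case (Suc b)
      let ?l = "(%j. length (W j))(j0 := b)"
      have "(\<Sum>j\<in>UNIV. ?l j) < (\<Sum>j\<in>UNIV. length (W j))"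
        by (rule sum_strict_mono_ex1) (use Suc in auto)
      then have len': "(\<Sum>j\<in>UNIV. ?l j) < q" using len by simp
      have w: "lower_symbol x (Suc (length (W j))) (%p. 1 * ?w j p + K p)" if "lower_symbol x (Suc (length (W j))) K" for K j
        by (rule lower_symbol.step[OF that]) simp
      have "lower_symbol x (Suc (?l j)) ((?L(j0 := R j0)) j)" for j
        using R[of j0] Suc w[OF lower_symbol.zero, of j] w[OF lower_symbol_mono[OF R], of j] by simp
      from slots_lower_vanish[where A = A and g = g and a = a and x = x and l = ?l and L = "?L(j0 := R j0)" and i = i,
          OF A g v len' this] show ?thesis .
    qed
    then have "slots A (%I. a I i) g (?L(j0 := %p. 1 * ?w j0 p + R j0 p)) = slots A (%I. a I i) g ?L"
      unfolding slots_linear Lj0 by simp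
    moreover have "?L(j0 := %p. 1 * ?w j0 p + R j0 p) = (%j. if j \<in> insert j0 S then (%p. ?w j p + R j p) else ?w j)"
      by (auto simp: fun_eq_iff)
    ultimately show ?case using insert.IH by simp
  qed simp
  from main[of UNIV] show ?thesis by simp
qed

section \<open>Interpolating the polynomial map\<close>

lemma map_degree_expansion:
  assumes "polynomial_map m \<Phi>" "i < m"
  shows "\<exists>c. \<forall>x. \<Phi> x i = (\<Sum>\<alpha> | mi_order \<alpha> \<le> map_degree m \<Phi>. c \<alpha> * monomial \<alpha> x)"
proof -
  let ?P = "%d. \<forall>i<m. \<exists>c. \<forall>x. \<Phi> x i = (\<Sum>\<alpha> | mi_order \<alpha> \<le> d. c \<alpha> * monomial \<alpha> x)"
  have all: "\<forall>i. \<exists>d c. \<forall>x. \<Phi> x i = (\<Sum>\<alpha> | mi_order \<alpha> \<le> d. c \<alpha> * monomial \<alpha> x)"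
    by (rule allI) (rule real_polynomial_function_monomials[OF polynomial_map_component[OF assms(1)]])
  from choice[OF all] obtain d
    where d: "!!i. \<exists>c. \<forall>x. \<Phi> x i = (\<Sum>\<alpha> | mi_order \<alpha> \<le> d i. c \<alpha> * monomial \<alpha> x)" by (elim exE) (rule that, erule spec)
  have "?P (\<Sum>i<m. d i)"
  proof (intro allI impI)
    fix i assume i: "i < m"
    obtain c where c: "!!x. \<Phi> x i = (\<Sum>\<alpha> | mi_order \<alpha> \<le> d i. c \<alpha> * monomial \<alpha> x)" using d[of i] by (elim exE) (rule that, erule spec)
    have le: "d i \<le> (\<Sum>i<m. d i)" using i by (intro member_le_sum) auto
    have "\<Phi> x i = (\<Sum>\<alpha> | mi_order \<alpha> \<le> (\<Sum>i<m. d i). (if mi_order \<alpha> \<le> d i then c \<alpha> else 0) * monomial \<alpha> x)" for x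
      unfolding c by (rule sum.mono_neutral_cong_left) (use le in \<open>auto simp: finite_mi_order_le\<close>)
    then show "\<exists>c. \<forall>x. \<Phi> x i = (\<Sum>\<alpha> | mi_order \<alpha> \<le> (\<Sum>i<m. d i). c \<alpha> * monomial \<alpha> x)"
      by (intro exI[of _ "%\<alpha>. if mi_order \<alpha> \<le> d i then c \<alpha> else 0"] allI)
  qed
  then have "?P (map_degree m \<Phi>)" unfolding map_degree_def by (rule LeastI)
  from this[rule_format, OF assms(2)] show ?thesis .
qed

text \<open>Each monomial is a product of monomials in the single arguments, and each of these is reproduced by interpolation.\<close>

lemma interpolated_map:
  fixes \<Phi> :: "real ^ 'n::finite ^ 'k::finite => nat => real" and p :: "real ^ 'n => real ^ 'n => real"
  assumes \<Phi>: "polynomial_map m \<Phi>" and P: "finite P"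
    and rep: "!!\<gamma> x. (\<Sum>l\<in>UNIV. \<gamma> l) \<le> map_degree m \<Phi> ==> mon \<gamma> x = (\<Sum>e\<in>P. mon \<gamma> e * p e x)"
  shows "\<Phi> = tens (UNIV \<rightarrow>\<^sub>E P) (%I. \<Phi> (\<chi> j. I j)) (%I j. p (I j))"
proof (intro ext)
  fix x i
  show "\<Phi> x i = tens (UNIV \<rightarrow>\<^sub>E P) (%I. \<Phi> (\<chi> j. I j)) (%I j. p (I j)) x i"
  proof (cases "i < m")
    case True
    obtain c where c: "!!x. \<Phi> x i = (\<Sum>\<alpha> | mi_order \<alpha> \<le> map_degree m \<Phi>. c \<alpha> * monomial \<alpha> x)"
      using map_degree_expansion[OF \<Phi> True] by (elim exE) (rule that, erule spec)
    have "monomial \<alpha> x = (\<Sum>I\<in>UNIV \<rightarrow>\<^sub>E P. monomial \<alpha> (\<chi> j. I j) * (\<Prod>j\<in>UNIV. p (I j) (x $ j)))"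
      if "mi_order \<alpha> \<le> map_degree m \<Phi>" for \<alpha>
    proof -
      have "(\<Sum>l\<in>UNIV. \<alpha> j l) \<le> map_degree m \<Phi>" for j
      proof (rule order_trans[OF _ that])
        show "(\<Sum>l\<in>UNIV. \<alpha> j l) \<le> mi_order \<alpha>" unfolding mi_order_def by (rule member_le_sum) auto
      qed
      then have "monomial \<alpha> x = (\<Prod>j\<in>UNIV. \<Sum>e\<in>P. mon (\<alpha> j) e * p e (x $ j))"
        unfolding monomial_prod_mon by (intro prod.cong refl rep)
      also have "\<dots> = (\<Sum>I\<in>UNIV \<rightarrow>\<^sub>E P. \<Prod>j\<in>UNIV. mon (\<alpha> j) (I j) * p (I j) (x $ j))"
        by (rule prod_sum_PiE) (use P in auto)
      finally show ?thesis by (simp add: prod.distrib monomial_prod_mon)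
    qed
    then have "\<Phi> x i = (\<Sum>\<alpha> | mi_order \<alpha> \<le> map_degree m \<Phi>. \<Sum>I\<in>UNIV \<rightarrow>\<^sub>E P. c \<alpha> * (monomial \<alpha> (\<chi> j. I j) * (\<Prod>j\<in>UNIV. p (I j) (x $ j))))"
      unfolding c by (intro sum.cong refl) (simp add: sum_distrib_left)
    also have "\<dots> = (\<Sum>I\<in>UNIV \<rightarrow>\<^sub>E P. \<Phi> (\<chi> j. I j) i * (\<Prod>j\<in>UNIV. p (I j) (x $ j)))"
      unfolding c by (subst sum.swap) (simp add: sum_distrib_right mult.assoc)
    finally show ?thesis by (simp add: tens_def)
  next
    case False
    then have "\<Phi> y i = 0" for y using polynomial_map_Euc[OF \<Phi>, of y] by (simp add: Euc_iff)
    then show ?thesis by (simp add: tens_def)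
  qed
qed

text \<open>The gradients of the coordinates are combinations of the gradients of the \<open>p e\<close>. Expanding \<open>det (mat 1) = 1\<close> row by
  row, some tuple of the latter must have a nonzero determinant.\<close>

lemma nondegenerate_tuple:
  fixes p :: "'e => real ^ 'n::finite => real"
  assumes P: "finite P" "!!e. e \<in> P ==> pol t (p e)"
    and rep: "!!s y. y $ s = (\<Sum>e\<in>P. b s e * p e y)"
  shows "\<exists>\<tau> :: 'n => real ^ 'n => real. range \<tau> \<subseteq> p ` P \<and> det (jac \<tau> x) \<noteq> 0"
proof (rule ccontr)
  assume not: "\<not> ?thesis"
  define G where "G e = (\<chi> s. dv (axis s 1) (p e) x)" for e
  have row: "mat 1 $ i = (\<Sum>e\<in>P. b i e *s G e)" for i
  proof -
    have "dv v (%y :: real ^ 'n. y $ i) x = v $ i" for v :: "real ^ 'n"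
    proof -
      have "((%t. (x + t *\<^sub>R v) $ i) has_real_derivative v $ i) (at 0)"
        by (auto intro!: derivative_eq_intros)
      then show ?thesis unfolding dv_def by (rule DERIV_imp_deriv)
    qed
    moreover have "dv v (%y :: real ^ 'n. y $ i) x = (\<Sum>e\<in>P. b i e * dv v (p e) x)" for v
      unfolding rep using pol_differentiable[OF P(2)] by (simp add: dv_sum dv_cmult differentiable_mult)
    ultimately have "(\<Sum>e\<in>P. b i e * dv (axis s 1) (p e) x) = axis s 1 $ i" for s by (simp only:)
    then show ?thesis by (auto simp: vec_eq_iff G_def mat_def axis_def)
  qed
  have "det (\<chi> i. if i \<in> S then mat 1 $ i else G (f i)) = 0" if "finite S" "!!i. i \<notin> S ==> f i \<in> P" for S f
    using that
  proof (induction S arbitrary: f rule: finite_induct)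
    case empty
    then have "range (%i. p (f i)) \<subseteq> p ` P" by auto
    then have "det (jac (%i. p (f i)) x) = 0" using not by blast
    moreover have "jac (%i. p (f i)) x = (\<chi> i. G (f i))" by (simp add: jac_def G_def vec_eq_iff)
    ultimately show ?case by simp
  next
    case (insert s S)
    let ?c = "%i. if i \<in> S then mat 1 $ i else G (f i)"
    have "(\<chi> i. if i \<in> insert s S then mat 1 $ i else G (f i)) = (\<chi> i. if i = s then (\<Sum>e\<in>P. b s e *s G e) else ?c i)"
      by (auto simp: vec_eq_iff row[symmetric])
    then have "det (\<chi> i. if i \<in> insert s S then mat 1 $ i else G (f i)) = det (\<chi> i. if i = s then (\<Sum>e\<in>P. b s e *s G e) else ?c i)"
      by (simp only:)
    also have "\<dots> = (\<Sum>e\<in>P. det (\<chi> i. if i = s then b s e *s G e else ?c i))"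
      by (rule det_linear_row_sum[OF P(1), of s "%_ e. b s e *s G e" ?c])
    also have "\<dots> = (\<Sum>e\<in>P. b s e * det (\<chi> i. if i = s then G e else ?c i))"
      by (intro sum.cong refl det_row_mul[of s _ "%_. G _" ?c])
    also have "\<dots> = 0"
    proof (rule sum.neutral, rule ballI)
      fix e assume e: "e \<in> P"
      have "det (\<chi> i. if i \<in> S then mat 1 $ i else G ((f(s := e)) i)) = 0"
        by (rule insert.IH) (use insert.prems e in auto)
      moreover have "(\<chi> i. if i \<in> S then mat 1 $ i else G ((f(s := e)) i)) = (\<chi> i. if i = s then G e else ?c i)"
        using insert.hyps by (auto simp: vec_eq_iff)
      ultimately show "b s e * det (\<chi> i. if i = s then G e else ?c i) = 0" by (simp only: mult_zero_right)
    qed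
    finally show ?case .
  qed
  from this[of UNIV undefined] have "det ((\<chi> i. mat 1 $ i) :: real ^ 'n ^ 'n) = 0" by simp
  then show False by (simp add: vec_lambda_eta)
qed

section \<open>The density at a point\<close>

lemma mi_order_exists: "\<exists>\<alpha> :: 'k::finite => 'n::finite => nat. mi_order \<alpha> = q"
proof -
  obtain j :: 'k and l :: 'n where True by blast
  have "mi_order (%j' l'. if j' = j then if l' = l then q else 0 else 0) = q"
    by (simp add: mi_order_def if_distrib[of "%f. sum f _"] sum.If_cases)
  then show ?thesis by blast
qed

lemma finite_mi_order: "finite {\<alpha> :: 'k::finite => 'n::finite => nat. mi_order \<alpha> = q}"
  by (rule finite_subset[OF _ finite_mi_order_le[of q]]) auto

text \<open>The expression whose infimum over \<open>T\<close> is the density.\<close>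

definition frame_density ::
  "((nat => real) => real) => (real ^ 'n::finite ^ 'k::finite => nat => real) => nat => real ^ 'n ^ 'n => real ^ 'n => real" where
  "frame_density N \<Phi> q T x = Max ((%\<alpha>. N (mixed_deriv (pullback_pderiv_arg T) \<alpha> \<Phi> (\<chi> j. x)) powr (real CARD('n) / real q)
                 / \<bar>det T\<bar>) ` {\<alpha>. mi_order \<alpha> = q})"

lemma density_bound_frame: "density_bound N \<Phi> q x = (INF T\<in>{T. invertible T}. frame_density N \<Phi> q T x)"
  by (simp add: density_bound_def frame_density_def)

lemma invertible_mat_1: "invertible (mat 1 :: real ^ 'n::finite ^ 'n)"
  by (simp add: invertible_det_nz)

lemma frame_density_nonneg:
  fixes \<Phi> :: "real ^ 'n::finite ^ 'k::finite => nat => real"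
  shows "0 \<le> frame_density N \<Phi> q T x"
proof -
  obtain \<alpha> :: "'k => 'n => nat" where \<alpha>: "mi_order \<alpha> = q" using mi_order_exists by blast
  show ?thesis unfolding frame_density_def
    by (rule order_trans[OF _ Max_ge[OF finite_imageI[OF finite_mi_order] imageI[of \<alpha>]]]) (use \<alpha> in auto)
qed

lemma frame_density_le_iff:
  "frame_density N \<Phi> q T x \<le> M \<longleftrightarrow> (\<forall>\<alpha>. mi_order \<alpha> = q -->
    N (mixed_deriv (pullback_pderiv_arg T) \<alpha> \<Phi> (\<chi> j. x)) powr (real CARD('n) / real q) / \<bar>det T\<bar> \<le> M)"
  for \<Phi> :: "real ^ 'n::finite ^ 'k::finite => nat => real"
  unfolding frame_density_def using mi_order_exists by (subst Max_le_iff) (auto simp: finite_mi_order)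

lemma bdd_below_frame_density: "bdd_below ((%T. frame_density N \<Phi> q T x) ` S)"
  by (rule bdd_belowI2[of _ 0]) (rule frame_density_nonneg)

lemma density_bound_le: "invertible T ==> density_bound N \<Phi> q x \<le> frame_density N \<Phi> q T x"
  unfolding density_bound_frame by (intro cINF_lower bdd_below_frame_density) simp

lemma density_bound_nonneg: "0 \<le> density_bound N \<Phi> q x"
  unfolding density_bound_frame
  by (rule cINF_greatest) (use invertible_mat_1 frame_density_nonneg in auto)

lemma density_bound_less_iff: "density_bound N \<Phi> q x < M \<longleftrightarrow> (\<exists>T. invertible T \<and> frame_density N \<Phi> q T x < M)"
  unfolding density_bound_frame
  by (subst cINF_less_iff) (use invertible_mat_1 bdd_below_frame_density in auto)


text \<open>The frame \<open>T\<close> dual to the gradients of \<open>\<tau>\<close> has determinant \<open>1 / det (jac \<tau> x)\<close>, and its columns are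
  admissible directions for \<^const>\<open>good\<close>. A derivative of order \<open>q\<close> of \<open>\<Phi>\<close> is a sum over interpolation nodes of
  a value of \<open>\<Phi>\<close>, bounded by \<open>S\<close>, times bounded factors.\<close>

lemma density_at_point:
  fixes \<Phi> :: "real ^ 'n::finite ^ 'k::finite => nat => real" and p :: "real ^ 'n => real ^ 'n => real"
    and \<tau> :: "'n => real ^ 'n => real"
  assumes q: "1 \<le> q" and N: "norm_on m N" and \<Phi>: "polynomial_map m \<Phi>"
    and van: "!!\<alpha>. mi_order \<alpha> < q ==> mixed_deriv pderiv_arg \<alpha> \<Phi> (\<chi> j. x) = (%_. 0)"
    and P: "finite P" "!!e. e \<in> P ==> pol t (p e)"
    and interp: "\<Phi> = tens (UNIV \<rightarrow>\<^sub>E P) (%I. \<Phi> (\<chi> j. I j)) (%I j. p (I j))"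
    and S: "!!I. I \<in> (UNIV :: 'k set) \<rightarrow>\<^sub>E P ==> N (\<Phi> (\<chi> j. I j)) \<le> S" "0 \<le> S"
    and good: "good (p ` P) x q U F" and x: "x \<in> U" and K: "0 \<le> K" "!!f. f \<in> F ==> \<bar>f x\<bar> \<le> K"
    and diff: "!!f. f \<in> F ==> f differentiable (at x)"
    and \<tau>: "det (jac \<tau> x) \<noteq> 0" "!!l f. f \<in> F ==> \<bar>XV (fld \<tau> l) f x\<bar> \<le> 1"
  shows "density_bound N \<Phi> q x
    \<le> (real (card P ^ CARD('k)) * (real CARD('n) ^ q * K) ^ CARD('k) * S) powr (real CARD('n) / real q) * \<bar>det (jac \<tau> x)\<bar>"
proof -
  define T where "T = (\<chi> s l. fld \<tau> l x $ s)"
  define a where "a I = \<Phi> (\<chi> j. I j)" for I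
  let ?A = "(UNIV :: 'k set) \<rightarrow>\<^sub>E P" and ?g = "%I j. p (I j)"
  let ?B = "(real CARD('n) ^ q * K) ^ CARD('k)"
  have col: "column l T = fld \<tau> l x" for l by (simp add: T_def column_def vec_eq_iff)
  have one: "jac \<tau> x ** T = mat 1" unfolding T_def by (rule jac_fld_identity[OF \<tau>(1)])
  have detT: "det (jac \<tau> x) * det T = 1" using arg_cong[OF one, of det] by (simp add: det_mul)
  then have Tnz: "det T \<noteq> 0" by auto
  have detT': "1 / \<bar>det T\<bar> = \<bar>det (jac \<tau> x)\<bar>" using arg_cong[OF detT, of abs] Tnz by (simp add: abs_mult field_simps)
  have pc: "poly_comps \<Phi>" unfolding poly_comps_def using polynomial_map_component[OF \<Phi>] by blast
  have Euc0: "!!x i. m \<le> i ==> \<Phi> x i = 0" using polynomial_map_Euc[OF \<Phi>] by (auto simp: Euc_iff)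
  have v: "vord q (%h. \<Phi> ((\<chi> j. x) + h) i)" for i by (rule vanishing_vord[OF pc Euc0 van])
  have fin: "finite ?A" using P(1) by (intro finite_PiE) auto
  have gp: "real_polynomial_function (?g I j)" if "I \<in> ?A" for I j
    using that by (intro pol_imp_real_polynomial_function[OF P(2)]) auto
  have \<Phi>a: "\<Phi> = tens ?A a ?g" unfolding a_def[abs_def] by (rule interp)
  have v': "vord q (%h. tens ?A a ?g ((\<chi> j. x) + h) i)" for i using v[of i] unfolding \<Phi>a[symmetric] .
  have dvcol: "\<bar>dv (column l T) f x\<bar> \<le> 1" if "f \<in> F" for l f
    using \<tau>(2)[OF that, of l] XV_dv[OF diff[OF that], of "fld \<tau> l"] by (simp add: col)
  have words: "\<exists>R. lower_symbol x (length vs) R \<and> (\<forall>f\<in>p ` P. \<bar>dvs vs f x + R f\<bar> \<le> real CARD('n) ^ q * K)"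
    if vs: "length vs \<le> q" "set vs \<subseteq> range (%l. column l T)" for vs
  proof -
    have "\<forall>v\<in>set vs. \<forall>f\<in>F. \<bar>dv v f x\<bar> \<le> 1" using vs(2) dvcol by auto
    from good[unfolded good_def, THEN spec, THEN mp, OF vs(1), THEN mp, OF this]
    obtain Q where Q: "low U x (length vs) Q" and
      Qb: "\<forall>f\<in>p ` P. \<exists>b h. comb F b h \<and> b \<le> real CARD('n) ^ length vs \<and> (\<forall>y\<in>U. dvs vs f y + Q f y = h y)"
      by (elim exE conjE) (rule that)
    obtain R where R: "lower_symbol x (length vs) R" "\<forall>f. Q f x = R f" using low_symbol[OF Q] by blast
    have "\<bar>dvs vs f x + R f\<bar> \<le> real CARD('n) ^ q * K" if f: "f \<in> p ` P" for f
    proof -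
      obtain b h where bh: "comb F b h" "b \<le> real CARD('n) ^ length vs" "\<forall>y\<in>U. dvs vs f y + Q f y = h y"
        using Qb[rule_format, OF f] by (elim exE conjE) (rule that)
      have eq: "dvs vs f x + R f = h x" using bspec[OF bh(3) x] R(2)[THEN spec, of f] by (simp only:)
      have "\<bar>h x\<bar> \<le> b * K" by (rule comb_bound[OF bh(1) K(2,1)])
      also have "\<dots> \<le> real CARD('n) ^ q * K"
        using bh(2) vs(1) K(1) by (intro mult_right_mono order_trans[OF bh(2) power_increasing]) auto
      finally show ?thesis unfolding eq .
    qed
    then show ?thesis using R(1) by blast
  qed
  have der: "N (mixed_deriv (pullback_pderiv_arg T) \<alpha> \<Phi> (\<chi> j. x)) \<le> real (card P ^ CARD('k)) * ?B * S"
    if \<alpha>: "mi_order \<alpha> = q" for \<alpha>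
  proof -
    let ?ws = "mi_word (%l. column l T) \<alpha>"
    define W where "W j = map snd (filter (%p. fst p = j) ?ws)" for j
    have lenW: "(\<Sum>j\<in>UNIV. length (W j)) = q"
    proof -
      have "(\<Sum>j\<in>UNIV. length (filter (%p. fst p = j) ws)) = length ws" for ws :: "('k \<times> (real ^ 'n)) list"
      proof (induction ws)
        case (Cons p ws)
        have "(\<Sum>j\<in>UNIV. length (filter (%p. fst p = j) (p # ws)))
          = (\<Sum>j\<in>UNIV. (if j = fst p then 1 else 0) + length (filter (%p. fst p = j) ws))" by (intro sum.cong) auto
        then show ?case using Cons by (simp add: sum.distrib)
      qed simp
      then show ?thesis by (simp add: W_def length_mi_word \<alpha>)
    qed
    have "length (W j) \<le> q" "set (W j) \<subseteq> range (%l. column l T)" for j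
    proof -
      show "length (W j) \<le> q" unfolding W_def using length_filter_le[of _ ?ws] by (simp add: length_mi_word \<alpha>)
      show "set (W j) \<subseteq> range (%l. column l T)" unfolding W_def using set_mi_word[of "%l. column l T" \<alpha>] by auto
    qed
    then have allR: "\<forall>j. \<exists>R. lower_symbol x (length (W j)) R \<and> (\<forall>f\<in>p ` P. \<bar>dvs (W j) f x + R f\<bar> \<le> real CARD('n) ^ q * K)"
      using words by blast
    from choice[OF allR] obtain R where R: "!!j. lower_symbol x (length (W j)) (R j)"
      "!!j f. f \<in> p ` P ==> \<bar>dvs (W j) f x + R j f\<bar> \<le> real CARD('n) ^ q * K" by blast
    have "mixed_deriv (pullback_pderiv_arg T) \<alpha> \<Phi> = dargs ?ws \<Phi>"
      by (rule mixed_deriv_dargs[OF pullback_pderiv_arg_darg pc])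
    also have "\<dots> = dargs ?ws (tens ?A a ?g)" by (simp only: \<Phi>a[symmetric])
    also have "\<dots> = tens ?A a (%I j. dvs (W j) (?g I j))"
      unfolding W_def by (rule dargs_tens[OF fin]) (rule gp)
    finally have "mixed_deriv (pullback_pderiv_arg T) \<alpha> \<Phi> (\<chi> j. x) i = slots ?A (%I. a I i) ?g (%j f. dvs (W j) f x)" for i
      by (simp add: tens_def slots_def)
    also have "\<dots> i = slots ?A (%I. a I i) ?g (%j f. dvs (W j) f x + R j f)" for i
      by (rule slots_replace_lower[where q = q and A = ?A and g = ?g and a = a and x = x and W = W and R = R and i = i])
        (rule fin, simp add: gp, rule v', rule lenW, rule R(1))
    finally have eq: "mixed_deriv (pullback_pderiv_arg T) \<alpha> \<Phi> (\<chi> j. x)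
        = (%i. \<Sum>I\<in>?A. (\<Prod>j\<in>UNIV. dvs (W j) (?g I j) x + R j (?g I j)) * a I i)"
      by (simp add: slots_def fun_eq_iff mult.commute)
    have aE: "a I \<in> Euc m" for I unfolding a_def by (rule polynomial_map_Euc[OF \<Phi>])
    have "N (mixed_deriv (pullback_pderiv_arg T) \<alpha> \<Phi> (\<chi> j. x))
        \<le> (\<Sum>I\<in>?A. \<bar>\<Prod>j\<in>UNIV. dvs (W j) (?g I j) x + R j (?g I j)\<bar> * N (a I))"
      unfolding eq by (rule norm_on_sum[OF N fin aE])
    also have "\<dots> \<le> (\<Sum>I\<in>?A. ?B * S)"
    proof (rule sum_mono)
      fix I assume I: "I \<in> ?A"
      have "\<bar>\<Prod>j\<in>UNIV. dvs (W j) (?g I j) x + R j (?g I j)\<bar> \<le> (\<Prod>j\<in>(UNIV :: 'k set). real CARD('n) ^ q * K)"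
        unfolding abs_prod using I by (intro prod_mono conjI R(2) imageI) auto
      then show "\<bar>\<Prod>j\<in>UNIV. dvs (W j) (?g I j) x + R j (?g I j)\<bar> * N (a I) \<le> ?B * S"
        using S(1)[OF I] norm_on_nonneg[OF N aE] K(1) by (intro mult_mono) (auto simp: a_def)
    qed
    also have "\<dots> = real (card P ^ CARD('k)) * ?B * S" by (simp add: card_PiE)
    finally show ?thesis .
  qed
  have "density_bound N \<Phi> q x \<le> frame_density N \<Phi> q T x"
    by (rule density_bound_le) (simp add: invertible_det_nz Tnz)
  also have "\<dots> \<le> (real (card P ^ CARD('k)) * ?B * S) powr (real CARD('n) / real q) * \<bar>det (jac \<tau> x)\<bar>"
    unfolding frame_density_le_iff detT'[symmetric]
  proof (intro allI impI)
    fix \<alpha> :: "'k => 'n => nat" assume \<alpha>: "mi_order \<alpha> = q"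
    let ?M = "mixed_deriv (pullback_pderiv_arg T) \<alpha> \<Phi> (\<chi> j. x)"
    have "?M \<in> Euc m"
    proof -
      have md: "mixed_deriv (pullback_pderiv_arg T) \<alpha> \<Phi> = dargs (mi_word (%l. column l T) \<alpha>) \<Phi>"
        by (rule mixed_deriv_dargs[OF pullback_pderiv_arg_darg pc])
      show ?thesis unfolding md Euc_iff
      proof (intro allI impI)
        fix i assume "m \<le> i"
        then have "dargs ws \<Phi> y i = 0" for ws :: "('k \<times> (real ^ 'n)) list" and y
          by (induction ws arbitrary: y) (auto simp: Euc0 darg_def)
        then show "dargs (mi_word (%l. column l T) \<alpha>) \<Phi> (\<chi> j. x) i = 0" .
      qed
    qed
    then have "0 \<le> N ?M" by (rule norm_on_nonneg[OF N])
    then have "N ?M powr (real CARD('n) / real q) \<le> (real (card P ^ CARD('k)) * ?B * S) powr (real CARD('n) / real q)"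
      using der[OF \<alpha>] by (intro powr_mono2) auto
    from divide_right_mono[OF this, of "\<bar>det T\<bar>"]
    show "N ?M powr (real CARD('n) / real q) / \<bar>det T\<bar>
      \<le> (real (card P ^ CARD('k)) * ?B * S) powr (real CARD('n) / real q) * (1 / \<bar>det T\<bar>)" by simp
  qed
  finally show ?thesis .
qed


section \<open>Integrating the density\<close>

text \<open>At each point of \<open>E\<close> the density is bounded by the Jacobian of one of the finitely many tuples, all of whose
  members are bounded by \<open>K\<close> there; the integrals of all of these are added.\<close>

lemma density_integral_interpolated:
  fixes \<Phi> :: "real ^ 'n::finite ^ 'k::finite => nat => real" and p :: "real ^ 'n => real ^ 'n => real"
  assumes q: "1 \<le> q" and N: "norm_on m N" and \<Phi>: "polynomial_map m \<Phi>" and E: "E \<in> sets borel"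
    and van: "!!x \<alpha>. x \<in> E ==> mi_order \<alpha> < q ==> mixed_deriv pderiv_arg \<alpha> \<Phi> (\<chi> j. x) = (%_. 0)"
    and P: "finite P" "!!e. e \<in> P ==> pol t (p e)" "card P \<le> n0"
    and rep: "!!s y. y $ s = (\<Sum>e\<in>P. b s e * p e y)"
    and interp: "\<Phi> = tens (UNIV \<rightarrow>\<^sub>E P) (%I. \<Phi> (\<chi> j. I j)) (%I j. p (I j))"
    and S: "!!I. I \<in> (UNIV :: 'k set) \<rightarrow>\<^sub>E P ==> N (\<Phi> (\<chi> j. I j)) \<le> S" "0 \<le> S"
    and K: "1 \<le> K" "!!e x. e \<in> P ==> x \<in> E ==> \<bar>p e x\<bar> \<le> K"
  defines "sd \<equiv> stage_deg TYPE('n) t q"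
  shows "(\<integral>\<^sup>+x. ennreal (density_bound N \<Phi> q x) * indicator E x \<partial>lborel)
    \<le> ennreal (real (stage_count TYPE('n) n0 q * stage_size TYPE('n) n0 q ^ CARD('n)) *
        ((real (n0 ^ CARD('k)) * (real CARD('n) ^ q * K) ^ CARD('k) * S) powr (real CARD('n) / real q)
          * (real (((CARD('n) * sd + 1) ^ CARD('n)) ^ CARD('n)) * (2 * K) ^ CARD('n))))"
proof -
  let ?F0 = "p ` P"
  let ?H = "(real (n0 ^ CARD('k)) * (real CARD('n) ^ q * K) ^ CARD('k) * S) powr (real CARD('n) / real q)"
  let ?B = "real (((CARD('n) * sd + 1) ^ CARD('n)) ^ CARD('n)) * (2 * K) ^ CARD('n)"
  have F0: "finite ?F0" "card ?F0 \<le> n0" "!!f. f \<in> ?F0 ==> pol t f"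
    using P card_image_le[OF P(1), of p] by auto
  note inv = stages_invariant[where b = n0 and t = t and r = q, OF F0]
  have st: "open U" "finite F" "card F \<le> stage_size TYPE('n) n0 q" "?F0 \<subseteq> F" "!!f. f \<in> F ==> rat U sd f"
    if "(U, F) \<in> stages ?F0 q" for U F
    using bspec[OF conjunct2[OF conjunct2[OF inv]] that] unfolding sd_def prod.case by blast+
  define J where "J = (SIGMA UF : stages ?F0 q. {\<tau> :: 'n => real ^ 'n => real. range \<tau> \<subseteq> snd UF})"
  have finJ: "finite J" unfolding J_def
    using inv st(2) by (intro finite_SigmaI finite_tuples) auto
  have cardJ: "card J \<le> stage_count TYPE('n) n0 q * stage_size TYPE('n) n0 q ^ CARD('n)"
  proof -
    have "card J = (\<Sum>UF\<in>stages ?F0 q. card {\<tau> :: 'n => real ^ 'n => real. range \<tau> \<subseteq> snd UF})"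
      unfolding J_def using inv st(2) by (intro card_SigmaI ballI finite_tuples) auto
    also have "\<dots> \<le> (\<Sum>UF\<in>stages ?F0 q. stage_size TYPE('n) n0 q ^ CARD('n))"
      unfolding card_tuples using st(3) by (intro sum_mono power_mono) auto
    also have "\<dots> \<le> stage_count TYPE('n) n0 q * stage_size TYPE('n) n0 q ^ CARD('n)" using inv by simp
    finally show ?thesis .
  qed
  define R where "R z = E \<inter> {y \<in> fst (fst z). \<forall>i. snd z i y \<in> {- K .. K}}"
    for z :: "((real ^ 'n) set \<times> (real ^ 'n => real) set) \<times> ('n => real ^ 'n => real)"
  define h where "h z x = ennreal \<bar>det (jac (snd z) x)\<bar> * indicator (R z) x"
    for z :: "((real ^ 'n) set \<times> (real ^ 'n => real) set) \<times> ('n => real ^ 'n => real)" and x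
  have J: "open (fst (fst z))" "!!i. rat (fst (fst z)) sd (snd z i)" if "z \<in> J" for z
    using that st(1,5) unfolding J_def by force+
  have R: "R z \<in> sets borel" if z: "z \<in> J" for z
  proof -
    let ?U = "fst (fst z)"
    have "open (?U \<inter> snd z i -` (- {- K .. K}))" for i
      by (intro continuous_open_preimage rat_continuous_on[OF J(2)[OF z] J(1)[OF z]] J(1)[OF z]) auto
    then have "open (\<Union>i. ?U \<inter> snd z i -` (- {- K .. K}))" by (intro open_UN ballI)
    then have "E \<inter> ?U - (\<Union>i. ?U \<inter> snd z i -` (- {- K .. K})) \<in> sets borel"
      by (rule sets.Diff[OF sets.Int[OF E borel_open[OF J(1)[OF z]]] borel_open])
    moreover have "R z = E \<inter> ?U - (\<Union>i. ?U \<inter> snd z i -` (- {- K .. K}))" unfolding R_def by auto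
    ultimately show ?thesis by simp
  qed
  have hm: "h z \<in> borel_measurable lborel" if z: "z \<in> J" for z
  proof -
    have "continuous_on (fst (fst z)) (%x. det (jac (snd z) x))"
      by (rule rat_continuous_on[OF rat_det_jac[OF J(1)[OF z] J(2)[OF z]] J(1)[OF z]])
    then have "continuous_on (R z) (%x. \<bar>det (jac (snd z) x)\<bar>)"
      by (intro continuous_intros) (rule continuous_on_subset, auto simp: R_def)
    from borel_measurable_continuous_on_indicator[OF R[OF z] this]
    have "(%x. ennreal (indicator (R z) x *\<^sub>R \<bar>det (jac (snd z) x)\<bar>)) \<in> borel_measurable lborel" by simp
    moreover have "(%x. ennreal (indicator (R z) x *\<^sub>R \<bar>det (jac (snd z) x)\<bar>)) = h z"
      by (auto simp: h_def fun_eq_iff indicator_def)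
    ultimately show ?thesis by (simp only:)
  qed
  have hint: "(\<integral>\<^sup>+x. h z x \<partial>lborel) \<le> ennreal ?B" if z: "z \<in> J" for z
    unfolding h_def
  proof (rule rational_Jacobian_integral[OF J(2)[OF z] J(1)[OF z] R[OF z]])
    show "\<bar>snd z i x\<bar> \<le> K" if "x \<in> R z" for i x
    proof -
      have "- K \<le> snd z i x" "snd z i x \<le> K" using that unfolding R_def by auto
      then show ?thesis by linarith
    qed
  qed (use K(1) in \<open>auto simp: R_def\<close>)
  have point: "ennreal (density_bound N \<Phi> q x) * indicator E x \<le> (\<Sum>z\<in>J. ennreal ?H * h z x)" for x
  proof (cases "x \<in> E")
    case True
    obtain \<tau>0 :: "'n => real ^ 'n => real" where \<tau>0: "range \<tau>0 \<subseteq> ?F0" "det (jac \<tau>0 x) \<noteq> 0"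
    proof -
      have "\<exists>\<tau> :: 'n => real ^ 'n => real. range \<tau> \<subseteq> p ` P \<and> det (jac \<tau> x) \<noteq> 0"
      proof (rule nondegenerate_tuple[where b = b and t = t])
        show "pol t (p e)" if "e \<in> P" for e by (rule P(2)[OF that])
      qed (rule P(1) rep)+
      then show ?thesis by (elim exE conjE) (rule that)
    qed
    have "\<exists>(U, F)\<in>stages ?F0 q. x \<in> U \<and> good ?F0 x q U F \<and> (\<forall>f\<in>F. \<bar>f x\<bar> \<le> K)"
      by (rule good_stage_exists[OF F0(1,3) \<tau>0 K(1)]) (use K(2) True in auto)
    then obtain U F where UF: "(U, F) \<in> stages ?F0 q" "x \<in> U" "good ?F0 x q U F" "\<forall>f\<in>F. \<bar>f x\<bar> \<le> K" by auto
    obtain \<tau> :: "'n => real ^ 'n => real" where \<tau>: "range \<tau> \<subseteq> F" "det (jac \<tau> x) \<noteq> 0"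
      "!!l f. f \<in> F ==> \<bar>XV (fld \<tau> l) f x\<bar> \<le> 1"
      by (rule maximal_tuple[OF st(2)[OF UF(1)] order_trans[OF \<tau>0(1) st(4)[OF UF(1)]] \<tau>0(2)]) (rule that)
    let ?z = "((U, F), \<tau>)"
    have z: "?z \<in> J" using UF(1) \<tau>(1) by (simp add: J_def)
    have "\<bar>\<tau> i x\<bar> \<le> K" for i using UF(4) \<tau>(1) by auto
    then have xR: "x \<in> R ?z" using True UF(2) by (auto simp: R_def abs_le_iff) (metis minus_le_iff)
    have K0: "0 \<le> K" using K(1) by simp
    have "density_bound N \<Phi> q x \<le> (real (card P ^ CARD('k)) * (real CARD('n) ^ q * K) ^ CARD('k) * S) powr (real CARD('n) / real q) * \<bar>det (jac \<tau> x)\<bar>"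
    proof (rule density_at_point[where F = F and U = U and P = P and p = p and m = m and t = t, OF q N \<Phi>])
      show "mixed_deriv pderiv_arg \<alpha> \<Phi> (\<chi> j. x) = (%_. 0)" if "mi_order \<alpha> < q" for \<alpha> :: "'k => 'n => nat"
        by (rule van[OF True that])
      show "pol t (p e)" if "e \<in> P" for e by (rule P(2)[OF that])
      show "N (\<Phi> (\<chi> j. I j)) \<le> S" if "I \<in> (UNIV :: 'k set) \<rightarrow>\<^sub>E P" for I by (rule S(1)[OF that])
      show "\<bar>f x\<bar> \<le> K" if "f \<in> F" for f by (rule bspec[OF UF(4) that])
      show "f differentiable (at x)" if "f \<in> F" for f
        by (rule rat_differentiable[OF st(5)[OF UF(1) that] st(1)[OF UF(1)] UF(2)])
      show "\<bar>XV (fld \<tau> l) f x\<bar> \<le> 1" if "f \<in> F" for f l by (rule \<tau>(3)[OF that])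
    qed (rule P(1) interp S(2) UF(3) UF(2) K0 \<tau>(2))+
    also have "\<dots> \<le> ?H * \<bar>det (jac \<tau> x)\<bar>"
    proof (rule mult_right_mono, rule powr_mono2)
      have "real (card P ^ CARD('k)) \<le> real (n0 ^ CARD('k))" using P(3) by (simp add: power_mono)
      then show "real (card P ^ CARD('k)) * (real CARD('n) ^ q * K) ^ CARD('k) * S \<le> real (n0 ^ CARD('k)) * (real CARD('n) ^ q * K) ^ CARD('k) * S"
        using K0 S(2) by (intro mult_right_mono) auto
      show "0 \<le> real (card P ^ CARD('k)) * (real CARD('n) ^ q * K) ^ CARD('k) * S"
        using K0 S(2) by (intro mult_nonneg_nonneg zero_le_power) auto
    qed auto
    finally have "ennreal (density_bound N \<Phi> q x) \<le> ennreal ?H * h ?z x"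
      using xR by (simp add: h_def ennreal_mult'[symmetric] ennreal_leI)
    also have "\<dots> \<le> (\<Sum>z\<in>J. ennreal ?H * h z x)"
      by (rule member_le_sum[OF z _ finJ]) simp
    finally show ?thesis using True by simp
  qed simp
  have "(\<integral>\<^sup>+x. ennreal (density_bound N \<Phi> q x) * indicator E x \<partial>lborel) \<le> (\<integral>\<^sup>+x. (\<Sum>z\<in>J. ennreal ?H * h z x) \<partial>lborel)"
    by (intro nn_integral_mono point)
  also have "\<dots> = (\<Sum>z\<in>J. ennreal ?H * (\<integral>\<^sup>+x. h z x \<partial>lborel))"
  proof -
    have "(\<integral>\<^sup>+x. (\<Sum>z\<in>J. ennreal ?H * h z x) \<partial>lborel) = (\<Sum>z\<in>J. \<integral>\<^sup>+x. ennreal ?H * h z x \<partial>lborel)"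
      by (rule nn_integral_sum) (rule borel_measurable_times_ennreal[OF borel_measurable_const hm])
    also have "\<dots> = (\<Sum>z\<in>J. ennreal ?H * (\<integral>\<^sup>+x. h z x \<partial>lborel))"
      by (rule sum.cong[OF refl]) (rule nn_integral_cmult[OF hm])
    finally show ?thesis .
  qed
  also have "\<dots> \<le> (\<Sum>z\<in>J. ennreal ?H * ennreal ?B)" by (intro sum_mono mult_left_mono hint) auto
  also have "\<dots> = ennreal (real (card J) * (?H * ?B))"
  proof -
    have "0 \<le> ?B" using K(1) by (intro mult_nonneg_nonneg zero_le_power) auto
    then have "ennreal ?H * ennreal ?B = ennreal (?H * ?B)" by (intro ennreal_mult[symmetric]) auto
    then show ?thesis unfolding sum_constant ennreal_of_nat_eq_real_of_nat
      by (simp only:) (rule ennreal_mult[symmetric], use \<open>0 \<le> ?B\<close> in \<open>auto intro: mult_nonneg_nonneg\<close>)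
  qed
  also have "\<dots> \<le> ennreal (real (stage_count TYPE('n) n0 q * stage_size TYPE('n) n0 q ^ CARD('n)) * (?H * ?B))"
  proof (rule ennreal_leI, rule mult_right_mono)
    show "real (card J) \<le> real (stage_count TYPE('n) n0 q * stage_size TYPE('n) n0 q ^ CARD('n))"
      using cardJ by (rule of_nat_mono)
    show "0 \<le> ?H * ?B" using K(1) by (intro mult_nonneg_nonneg zero_le_power) auto
  qed
  finally show ?thesis .
qed

text \<open>Interpolation requires that no nonzero polynomial of the given degree vanishes on \<open>E\<close>. Otherwise \<open>E\<close> is a null
  set and the integral is zero.\<close>

theorem density_integral:
  fixes q d :: nat
  assumes q: "1 \<le> q"
  shows "\<exists>C>0. \<forall>m N (\<Phi> :: real ^ 'n::finite ^ 'k::finite => nat => real) E S.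
    norm_on m N --> polynomial_map m \<Phi> --> map_degree m \<Phi> = d --> E \<in> sets borel --> bounded E -->
    (\<forall>x\<in>E. \<forall>\<alpha>. mi_order \<alpha> < q --> mixed_deriv pderiv_arg \<alpha> \<Phi> (\<chi> j. x) = (%_. 0)) -->
    0 \<le> S --> sup_on N \<Phi> E = ennreal S -->
    (\<integral>\<^sup>+x. ennreal (density_bound N \<Phi> q x) * indicator E x \<partial>lborel) \<le> ennreal (C * S powr (real CARD('n) / real q))"
proof -
  \<comment> \<open>Degree \<open>d\<close> is needed to reproduce \<open>\<Phi>\<close>; the increment makes room for the coordinates when \<open>d = 0\<close>.\<close>
  define t where "t = d + 1"
  define Bs where "Bs = {\<gamma> :: 'n => nat. (\<Sum>l\<in>UNIV. \<gamma> l) \<le> t}"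
  define n0 where "n0 = card Bs"
  define K where "K = (2 * 3 ^ n0 :: real)"
  have finBs: "finite Bs" unfolding Bs_def by (rule finite_deg_le)
  have K1: "1 \<le> (K :: real)"
  proof -
    have "(1 :: real) \<le> 3 ^ n0" by (rule one_le_power) simp
    then show ?thesis unfolding K_def by linarith
  qed
  define X where "X = real (n0 ^ CARD('k)) * (real CARD('n) ^ q * K) ^ CARD('k)"
  define B where "B = real (((CARD('n) * stage_deg TYPE('n) t q + 1) ^ CARD('n)) ^ CARD('n)) * (2 * K) ^ CARD('n)"
  define C1 where "C1 = real (stage_count TYPE('n) n0 q * stage_size TYPE('n) n0 q ^ CARD('n)) * (X powr (real CARD('n) / real q) * B)"
  have X0: "0 \<le> X" unfolding X_def using K1 by (intro mult_nonneg_nonneg zero_le_power) auto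
  have C10: "0 \<le> C1" unfolding C1_def B_def using K1 by (intro mult_nonneg_nonneg zero_le_power) auto
  show ?thesis
  proof (intro exI[of _ "C1 + 1"] conjI allI impI)
    show "0 < C1 + 1" using C10 by simp
    fix m N and \<Phi> :: "real ^ 'n ^ 'k => nat => real" and E S
    assume N: "norm_on m N" and \<Phi>: "polynomial_map m \<Phi>" and deg: "map_degree m \<Phi> = d" and E: "E \<in> sets borel" "bounded E"
      and van: "\<forall>x\<in>E. \<forall>\<alpha>. mi_order \<alpha> < q --> mixed_deriv pderiv_arg \<alpha> \<Phi> (\<chi> j. x) = (%_. 0)"
      and S: "0 \<le> S" "sup_on N \<Phi> E = ennreal S"
    show "(\<integral>\<^sup>+x. ennreal (density_bound N \<Phi> q x) * indicator E x \<partial>lborel) \<le> ennreal ((C1 + 1) * S powr (real CARD('n) / real q))"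
    proof (cases "\<exists>c (x :: real ^ 'n). (\<forall>x\<in>E. (\<Sum>\<gamma>\<in>Bs. c \<gamma> * mon \<gamma> x) = 0) \<and> (\<Sum>\<gamma>\<in>Bs. c \<gamma> * mon \<gamma> x) \<noteq> 0")
      case True
      then obtain c x0 where c: "\<forall>x\<in>E. (\<Sum>\<gamma>\<in>Bs. c \<gamma> * mon \<gamma> x) = 0" "(\<Sum>\<gamma>\<in>Bs. c \<gamma> * mon \<gamma> x0) \<noteq> 0"
        by (elim exE conjE) (rule that)
      have "pol t (%x. \<Sum>\<gamma>\<in>Bs. c \<gamma> * mon \<gamma> x)" unfolding gpol_def Bs_def by blast
      from null_zero_set_pol[OF this c(2)] have "{x. (\<Sum>\<gamma>\<in>Bs. c \<gamma> * mon \<gamma> x) = 0} \<in> null_sets lborel" .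
      then have "E \<in> null_sets lborel" by (rule null_sets_subset) (use E(1) c(1) in auto)
      then have "(\<integral>\<^sup>+x. ennreal (density_bound N \<Phi> q x) * indicator E x \<partial>lborel) = 0"
        by (rule nn_integral_null_set)
      then show ?thesis by simp
    next
      case False
      have bdd: "\<exists>k. \<forall>x\<in>E. \<bar>mon \<gamma> x\<bar> \<le> k" for \<gamma> :: "'n => nat"
      proof -
        have "compact (closure E)" using E(2) by (simp add: compact_closure)
        then have "compact (mon \<gamma> ` closure E)"
          by (intro compact_continuous_image continuous_at_imp_continuous_on ballI continuous_real_polymonial_function real_polynomial_function_mon)
        then have "bounded (mon \<gamma> ` closure E)" by (rule compact_imp_bounded)
        then obtain k where k: "\<forall>y\<in>mon \<gamma> ` closure E. norm y \<le> k" by (auto simp: bounded_iff)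
        then show ?thesis using closure_subset[of E] by (intro exI[of _ k]) auto
      qed
      have nd: "(\<Sum>\<gamma>\<in>Bs. c \<gamma> * mon \<gamma> x) = 0" if "!!x. x \<in> E ==> (\<Sum>\<gamma>\<in>Bs. c \<gamma> * mon \<gamma> x) = 0" for c and x :: "real ^ 'n"
        using False that by (simp only: not_ex de_Morgan_conj not_not) (drule spec[of _ c], drule spec[of _ x], auto)
      have "\<exists>P p. finite P \<and> P \<subseteq> E \<and> card P \<le> card Bs \<and>
        (\<forall>e\<in>P. \<exists>c. \<forall>x. p e x = (\<Sum>i\<in>Bs. c i * mon i x)) \<and>
        (\<forall>e\<in>P. \<forall>x\<in>E. \<bar>p e x\<bar> \<le> 2 * 3 ^ card Bs) \<and>
        (\<forall>e\<in>P. \<forall>e'\<in>P. p e e' = (if e = e' then 1 else 0)) \<and>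
        (\<forall>i\<in>Bs. \<forall>x. mon i x = (\<Sum>e\<in>P. mon i e * p e x))"
      proof (rule interpolation_basis[OF finBs bdd])
        fix c and x :: "real ^ 'n"
        assume z: "!!x. x \<in> E ==> (\<Sum>\<gamma>\<in>Bs. c \<gamma> * mon \<gamma> x) = 0"
        show "(\<Sum>\<gamma>\<in>Bs. c \<gamma> * mon \<gamma> x) = 0" by (rule nd) (rule z)
      qed
      then
      obtain P and p :: "real ^ 'n => real ^ 'n => real" where P: "finite P" "P \<subseteq> E" "card P \<le> card Bs"
        and pspan: "\<forall>e\<in>P. \<exists>c. \<forall>x. p e x = (\<Sum>i\<in>Bs. c i * mon i x)"
        and pb: "\<forall>e\<in>P. \<forall>x\<in>E. \<bar>p e x\<bar> \<le> 2 * 3 ^ card Bs"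
        and prep: "\<forall>i\<in>Bs. \<forall>x. mon i x = (\<Sum>e\<in>P. mon i e * p e x)"
        by (elim exE conjE) (rule that)
      have rep: "mon \<gamma> x = (\<Sum>e\<in>P. mon \<gamma> e * p e x)" if "(\<Sum>l\<in>UNIV. \<gamma> l) \<le> map_degree m \<Phi>" for \<gamma> x
        using prep[rule_format, of \<gamma> x] that deg unfolding Bs_def t_def by simp
      have coord: "y $ s = (\<Sum>e\<in>P. e $ s * p e y)" for s and y :: "real ^ 'n"
      proof -
        let ?\<gamma> = "%j. if j = s then 1 else 0 :: nat"
        have 1: "mon ?\<gamma> z = z $ s" for z :: "real ^ 'n" by (simp add: gmon_single)
        have "?\<gamma> \<in> Bs" by (simp add: Bs_def t_def)
        from prep[rule_format, OF this, of y] show ?thesis unfolding 1 .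
      qed
      have Nle: "N (\<Phi> (\<chi> j. I j)) \<le> S" if I: "I \<in> (UNIV :: 'k set) \<rightarrow>\<^sub>E P" for I
      proof -
        have "ennreal (N (\<Phi> (\<chi> j. I j))) \<le> sup_on N \<Phi> E"
          unfolding sup_on_def by (rule SUP_upper) (use I P(2) in auto)
        then show ?thesis unfolding S(2) using S(1) by simp
      qed
      have "(\<integral>\<^sup>+x. ennreal (density_bound N \<Phi> q x) * indicator E x \<partial>lborel)
        \<le> ennreal (real (stage_count TYPE('n) n0 q * stage_size TYPE('n) n0 q ^ CARD('n)) *
        ((real (n0 ^ CARD('k)) * (real CARD('n) ^ q * K) ^ CARD('k) * S) powr (real CARD('n) / real q)
          * (real (((CARD('n) * stage_deg TYPE('n) t q + 1) ^ CARD('n)) ^ CARD('n)) * (2 * K) ^ CARD('n))))"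
      proof (rule density_integral_interpolated[where P = P and p = p and b = "%s e. e $ s", OF q N \<Phi> E(1)])
        show "pol t (p e)" if "e \<in> P" for e using pspan that unfolding gpol_def Bs_def by blast
        show "\<Phi> = tens (UNIV \<rightarrow>\<^sub>E P) (%I. \<Phi> (\<chi> j. I j)) (%I j. p (I j))"
          by (rule interpolated_map[OF \<Phi> P(1) rep])
        show "\<bar>p e x\<bar> \<le> K" if "e \<in> P" "x \<in> E" for e x using pb that unfolding K_def n0_def by blast
        show "mixed_deriv pderiv_arg \<alpha> \<Phi> (\<chi> j. x) = (%_. 0)" if "x \<in> E" "mi_order \<alpha> < q" for x and \<alpha> :: "'k => 'n => nat"
          using van[THEN bspec, OF that(1), THEN spec, THEN mp, OF that(2)] .
        show "card P \<le> n0" unfolding n0_def by (rule P(3))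
        show "y $ s = (\<Sum>e\<in>P. e $ s * p e y)" for s and y :: "real ^ 'n" by (rule coord)
        show "N (\<Phi> (\<chi> j. I j)) \<le> S" if "I \<in> (UNIV :: 'k set) \<rightarrow>\<^sub>E P" for I by (rule Nle[OF that])
      qed (rule P(1) S(1) K1)+
      also have "\<dots> = ennreal (C1 * S powr (real CARD('n) / real q))"
        unfolding C1_def X_def[symmetric] B_def[symmetric] using X0 S(1) by (simp add: powr_mult mult_ac)
      also have "\<dots> \<le> ennreal ((C1 + 1) * S powr (real CARD('n) / real q))"
        by (intro ennreal_leI mult_right_mono) auto
      finally show ?thesis .
    qed
  qed
qed

section \<open>Coverings by cubes\<close>

text \<open>Estimates that hold locally, with the same constant, hold globally.\<close>

lemma countable_piece_bound:
  fixes f :: "'a set => ennreal" and B :: "nat => 'a set"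
  assumes sub: "!!A :: nat => 'a set. f (\<Union>i. A i) \<le> (\<Sum>i. f (A i))" and A: "A \<in> sets M"
    and B: "!!i. B i \<in> sets M" "A \<subseteq> (\<Union>i. B i)"
    and le: "!!i A'. A' \<in> sets M ==> A' \<subseteq> A ==> A' \<subseteq> B i ==> f A' \<le> c * emeasure M A'"
  shows "f A \<le> c * emeasure M A"
proof -
  let ?D = "%i. A \<inter> disjointed B i"
  have "range B \<subseteq> sets M" using B(1) by (simp add: image_subset_iff)
  then have "range (disjointed B) \<subseteq> sets M" by (rule sets.range_disjointed_sets)
  then have meas: "?D i \<in> sets M" for i by (intro sets.Int A) (simp add: image_subset_iff)
  have un: "(\<Union>i. ?D i) = A" using B(2) UN_disjointed_eq[of B] by blast
  have disj: "disjoint_family ?D"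
    using disjoint_family_disjointed[of B] unfolding disjoint_family_on_def by blast
  have "f A \<le> (\<Sum>i. f (?D i))" using sub[of ?D] unfolding un .
  also have "\<dots> \<le> (\<Sum>i. c * emeasure M (?D i))"
  proof (intro suminf_le summableI)
    fix i show "f (?D i) \<le> c * emeasure M (?D i)"
      by (rule le[OF meas, of i i]) (use disjointed_subset[of B i] in auto)
  qed
  also have "\<dots> = c * emeasure M (\<Union>i. ?D i)"
    using meas by (subst suminf_emeasure[OF _ disj, symmetric]) auto
  finally show ?thesis unfolding un .
qed

lemma cube_inside_ball:
  fixes u x :: "real ^ 'n::finite"
  assumes "cbox u (u + (\<chi> i. s)) \<subseteq> ball x (r / 2)" "0 < s" shows "s \<le> r"
proof -
  have "u \<in> ball x (r / 2)" "u + (\<chi> i. s) \<in> ball x (r / 2)"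
    using assms by (auto simp: subset_iff mem_box_cart)
  then have "dist u (u + (\<chi> i. s)) < r"
    using dist_triangle3[of u "u + (\<chi> i. s)" x] by auto
  moreover have "\<bar>(\<chi> i :: 'n. s) $ l\<bar> \<le> norm (\<chi> i :: 'n. s)" for l by (rule component_le_norm_cart)
  ultimately show ?thesis by (simp add: dist_norm)
qed

lemma emeasure_cube: "0 \<le> s ==> emeasure lborel (box u (u + (\<chi> i. s)) :: (real ^ 'n::finite) set) = ennreal (s ^ CARD('n))"
proof -
  assume s: "0 \<le> s"
  have nonneg: "0 \<le> (\<chi> i. s) \<bullet> b" if "b \<in> Basis" for b :: "real ^ 'n"
    using that s by (auto simp: Basis_vec_def inner_axis)
  then have "emeasure lborel (box u (u + (\<chi> i. s))) = ennreal (\<Prod>b\<in>Basis. (\<chi> i. s) \<bullet> (b :: real ^ 'n))"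
    by (subst emeasure_lborel_box_eq) (simp add: inner_add_left)
  also have "(\<Prod>b\<in>Basis. (\<chi> i. s) \<bullet> (b :: real ^ 'n)) = s ^ CARD('n)"
    unfolding prod_Basis_cart by (simp add: inner_axis)
  finally show ?thesis .
qed

text \<open>The preimage of \<open>A\<close> under \<open>T\<close> is covered by cubes with disjoint interiors inside an open set of almost the same
  measure; the gauge makes each cube small enough for the estimate at one of its points, and its image small
  in diameter.\<close>

theorem Hausdorff_le_of_cubes:
  fixes T :: "real ^ 'n::finite ^ 'n" and \<Phi> :: "real ^ 'n ^ 'k::finite => nat => real"
  assumes T: "invertible T" and A: "A \<in> sets borel" "A \<subseteq> \<Omega>" "bounded A" and L: "0 \<le> L" and \<sigma>: "0 \<le> \<sigma>"
    and cubes: "!!x. x \<in> A ==> \<exists>r>0. \<forall>a s. 0 < s --> s \<le> r --> x \<in> (*v) T ` cbox a (a + (\<chi> i. s)) -->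
      epowr (sup_on N \<Phi> ((*v) T ` cbox a (a + (\<chi> i. s)))) \<sigma> \<le> ennreal (L * \<bar>det T\<bar> * s ^ CARD('n))"
  shows "weighted_Hausdorff N \<Phi> \<Omega> \<sigma> A \<le> ennreal L * emeasure lborel A"
proof (rule weighted_Hausdorff_leI)
  fix \<delta> :: real assume \<delta>: "0 < \<delta>"
  obtain T' where TT: "T ** T' = mat 1" "T' ** T = mat 1" using T by (auto simp: invertible_def)
  have TT': "T *v (T' *v x) = x" "T' *v (T *v x) = x" for x using TT by (simp_all add: matrix_vector_mul_assoc)
  have T': "invertible T'" using TT by (auto simp: invertible_def)
  define S where "S = (*v) T' ` A"
  have TS: "(*v) T ` S = A" unfolding S_def by (auto simp: image_image TT')
  have Sb: "S \<in> sets borel" unfolding S_def by (rule emeasure_linear_image(1)[OF A(1,3) T'])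
  have Sbd: "bounded S" unfolding S_def by (rule bounded_linear_image[OF A(3)]) simp
  have emA: "emeasure lborel A = ennreal \<bar>det T\<bar> * emeasure lborel S"
    using emeasure_linear_image(2)[OF Sb Sbd T] unfolding TS .
  obtain b where b: "0 < b" "!!x. x \<in> S ==> norm x \<le> b" using Sbd by (auto simp: bounded_pos)
  define c where "c = L * \<bar>det T\<bar>"
  have c0: "0 \<le> c" using L by (simp add: c_def)
  obtain r where r: "!!x. x \<in> A ==> 0 < r x \<and> (\<forall>a s. 0 < s --> s \<le> r x --> x \<in> (*v) T ` cbox a (a + (\<chi> i. s)) -->
      epowr (sup_on N \<Phi> ((*v) T ` cbox a (a + (\<chi> i. s)))) \<sigma> \<le> ennreal (c * s ^ CARD('n)))"
  proof -
    have "\<forall>x\<in>A. \<exists>r. 0 < r \<and> (\<forall>a s. 0 < s --> s \<le> r --> x \<in> (*v) T ` cbox a (a + (\<chi> i. s)) -->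
      epowr (sup_on N \<Phi> ((*v) T ` cbox a (a + (\<chi> i. s)))) \<sigma> \<le> ennreal (c * s ^ CARD('n)))"
      using cubes unfolding c_def by blast
    from bchoice[OF this] show ?thesis by (elim exE) (rule that, erule bspec)
  qed
  show "weighted_content N \<Phi> \<Omega> \<sigma> \<delta> A \<le> ennreal L * emeasure lborel A"
  proof (rule ennreal_le_epsilon)
    fix e :: real assume e: "0 < e"
    have e': "0 < e / (c + 1)" using e c0 by simp
    \<comment> \<open>The excess is chosen so that multiplication by \<open>c\<close> leaves an error of at most \<open>e\<close>.\<close>
    obtain V where V: "open V" "S \<subseteq> V" "emeasure lborel (V - S) < ennreal (e / (c + 1))"
      using outer_regular_lborel[of S "e / (c + 1)"] Sb e' by auto
    define g where "g y = (if y \<in> S then V \<inter> ball y (r (T *v y) / 2) \<inter> (*v) T -` ball (T *v y) (\<delta> / 2) else ball y 1)" for y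
    have oT: "open ((*v) T -` ball (T *v y) (\<delta> / 2))" for y
      by (intro open_vimage open_ball linear_continuous_on) simp
    have SA: "y \<in> S ==> T *v y \<in> A" for y using TS by blast
    have ga: "gauge g" unfolding gauge_def
      using V(1,2) r \<delta> oT SA by (auto simp: g_def intro!: open_Int)
    have Sc: "S \<subseteq> cbox (\<chi> i. - b) (\<chi> i. b)"
    proof
      fix x assume "x \<in> S"
      then have "\<bar>x $ i\<bar> \<le> b" for i using b(2) component_le_norm_cart[of x i] by (meson order_trans)
      then show "x \<in> cbox (\<chi> i. - b) (\<chi> i. b)" by (simp add: mem_box_cart abs_le_iff) (metis minus_le_iff)
    qed
    have bx: "box (\<chi> i. - b) (\<chi> i. b :: real ^ 'n) \<noteq> {}"
    proof -
      have "(0 :: real ^ 'n) \<in> box (\<chi> i. - b) (\<chi> i. b)" using b(1) by (simp add: mem_box_cart)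
      then show ?thesis by blast
    qed
    obtain \<D> where \<D>: "countable \<D>"
      "!!K. K \<in> \<D> ==> interior K \<noteq> {} \<and> (\<exists>c d. K = cbox c d)"
      "pairwise (%A B. interior A \<inter> interior B = {}) \<D>"
      "!!K. K \<in> \<D> ==> \<exists>x \<in> S \<inter> K. K \<subseteq> g x"
      "!!u v. cbox u v \<in> \<D> ==> \<exists>n. \<forall>i \<in> Basis. v \<bullet> i - u \<bullet> i = ((\<chi> i. b) \<bullet> i - (\<chi> i. - b) \<bullet> i) / 2^n"
      "S \<subseteq> \<Union>\<D>"
      by (rule covering_lemma[OF Sc bx ga]) (rule that)
    have cube: "interior K \<subseteq> V \<and> diameter ((*v) T ` K \<inter> A) \<le> \<delta> \<and>
      epowr (sup_on N \<Phi> ((*v) T ` K \<inter> A)) \<sigma> \<le> ennreal c * emeasure lborel (interior K)" if K: "K \<in> \<D>" for K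
    proof -
      obtain u v where uv: "K = cbox u v" using \<D>(2)[OF K] by blast
      obtain n where n: "\<forall>i \<in> Basis. v \<bullet> i - u \<bullet> i = ((\<chi> i. b) \<bullet> i - (\<chi> i. - b) \<bullet> i) / 2^n"
        using \<D>(5)[of u v] K uv by blast
      define s where "s = 2 * b / 2 ^ n"
      have s0: "0 < s" using b(1) by (simp add: s_def)
      have "v $ l - u $ l = s" for l
        using n[rule_format, of "axis l 1"] by (simp add: inner_axis s_def)
      then have v: "v = u + (\<chi> i. s)" by (simp add: vec_eq_iff algebra_simps)
      obtain x where x: "x \<in> S" "x \<in> K" "K \<subseteq> g x" using \<D>(4)[OF K] by blast
      have gx: "g x \<subseteq> V" "g x \<subseteq> ball x (r (T *v x) / 2)" "g x \<subseteq> (*v) T -` ball (T *v x) (\<delta> / 2)"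
        using x(1) by (auto simp: g_def)
      have "s \<le> r (T *v x)" using x(3) gx(2) uv v s0 by (intro cube_inside_ball[of u s x]) auto
      then have "epowr (sup_on N \<Phi> ((*v) T ` K)) \<sigma> \<le> ennreal (c * s ^ CARD('n))"
        using r[OF SA[OF x(1)]] s0 x(2) unfolding uv v by blast
      also have "\<dots> = ennreal c * emeasure lborel (interior K)"
        unfolding uv v interior_cbox using s0 c0 by (simp add: emeasure_cube ennreal_mult)
      finally have "epowr (sup_on N \<Phi> ((*v) T ` K)) \<sigma> \<le> ennreal c * emeasure lborel (interior K)" .
      moreover have "epowr (sup_on N \<Phi> ((*v) T ` K \<inter> A)) \<sigma> \<le> epowr (sup_on N \<Phi> ((*v) T ` K)) \<sigma>"
        by (intro epowr_mono sup_on_mono \<sigma>) auto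
      moreover have "diameter ((*v) T ` K \<inter> A) \<le> \<delta>"
      proof (rule diameter_le)
        fix y z assume "y \<in> (*v) T ` K \<inter> A" "z \<in> (*v) T ` K \<inter> A"
        then have "dist (T *v x) y < \<delta> / 2" "dist (T *v x) z < \<delta> / 2" using x(3) gx(3) by auto
        then show "norm (y - z) \<le> \<delta>" using dist_triangle3[of y z "T *v x"] by (simp add: dist_norm)
      qed (use \<delta> in simp)
      moreover have "interior K \<subseteq> V" using interior_subset[of K] x(3) gx(1) by blast
      ultimately show ?thesis by (blast intro: order_trans)
    qed
    define k where "k i = (if i \<in> to_nat_on \<D> ` \<D> then from_nat_into \<D> i else {})" for i
    have kD: "k i \<in> \<D>" if "i \<in> to_nat_on \<D> ` \<D>" for i using that \<D>(1) by (auto simp: k_def)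
    have kcube: "interior (k i) \<subseteq> V \<and> diameter ((*v) T ` (k i) \<inter> A) \<le> \<delta> \<and>
      epowr (sup_on N \<Phi> ((*v) T ` (k i) \<inter> A)) \<sigma> \<le> ennreal c * emeasure lborel (interior (k i))" for i
    proof (cases "i \<in> to_nat_on \<D> ` \<D>")
      case True
      show ?thesis by (rule cube[OF kD[OF True]])
    next
      case False
      then show ?thesis using \<delta> by (simp add: k_def)
    qed
    have disj: "disjoint_family (%i. interior (k i))" unfolding disjoint_family_on_def
    proof (intro ballI impI)
      fix i j :: nat assume ij: "i \<noteq> j"
      show "interior (k i) \<inter> interior (k j) = {}"
      proof (cases "i \<in> to_nat_on \<D> ` \<D> \<and> j \<in> to_nat_on \<D> ` \<D>")
        case True
        then have "k i \<noteq> k j" using ij to_nat_on_from_nat_into[of i \<D>] to_nat_on_from_nat_into[of j \<D>] by (metis k_def)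
        then show ?thesis using \<D>(3) kD True unfolding pairwise_def by blast
      qed (auto simp: k_def)
    qed
    have "(%_. 1, %i. (*v) T ` (k i) \<inter> A) \<in> weighted_covers \<Omega> \<delta> A"
      unfolding weighted_covers_def mem_Collect_eq prod.case
    proof (intro conjI allI ballI)
      fix i
      show "(*v) T ` (k i) \<inter> A \<subseteq> \<Omega>" using A(2) by blast
      show "bounded ((*v) T ` (k i) \<inter> A)" by (rule bounded_subset[OF A(3)]) blast
      show "diameter ((*v) T ` (k i) \<inter> A) \<le> \<delta>" using kcube by blast
    next
      fix x assume "x \<in> \<Omega>"
      show "indicator A x \<le> (\<Sum>i. ennreal 1 * indicator ((*v) T ` (k i) \<inter> A) x)"
      proof (cases "x \<in> A")
        case True
        then have "T' *v x \<in> S" by (simp add: S_def)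
        then obtain K where K: "K \<in> \<D>" "T' *v x \<in> K" using \<D>(6) by blast
        define i where "i = to_nat_on \<D> K"
        have "k i = K" using K(1) \<D>(1) by (simp add: k_def i_def)
        then have "x \<in> (*v) T ` (k i)" using K(2) TT'(1)[of x] by (intro image_eqI[of _ _ "T' *v x"]) auto
        then have "indicator A x \<le> (\<Sum>i\<in>{i}. ennreal 1 * indicator ((*v) T ` (k i) \<inter> A) x)" using True by simp
        also have "\<dots> \<le> (\<Sum>i. ennreal 1 * indicator ((*v) T ` (k i) \<inter> A) x)"
          by (rule sum_le_suminf) auto
        finally show ?thesis .
      qed simp
    qed simp
    from weighted_content_le[OF this]
    have "weighted_content N \<Phi> \<Omega> \<sigma> \<delta> A \<le> (\<Sum>i. epowr (sup_on N \<Phi> ((*v) T ` (k i) \<inter> A)) \<sigma>)" by simp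
    also have "\<dots> \<le> (\<Sum>i. ennreal c * emeasure lborel (interior (k i)))"
      using kcube by (intro suminf_le summableI) blast
    also have "\<dots> = ennreal c * emeasure lborel (\<Union>i. interior (k i))"
      by (subst suminf_emeasure[OF _ disj, symmetric]) auto
    also have "\<dots> \<le> ennreal c * emeasure lborel V"
    proof (intro mult_left_mono emeasure_mono)
      show "(\<Union>i. interior (k i)) \<subseteq> V" using kcube by blast
    qed (use V(1) in auto)
    also have "\<dots> \<le> ennreal c * (emeasure lborel S + ennreal (e / (c + 1)))"
    proof (intro mult_left_mono)
      have "emeasure lborel V \<le> emeasure lborel (S \<union> (V - S))" using Sb V(1) by (intro emeasure_mono) auto
      also have "\<dots> \<le> emeasure lborel S + emeasure lborel (V - S)" using Sb V(1) by (intro emeasure_subadditive) auto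
      also have "\<dots> \<le> emeasure lborel S + ennreal (e / (c + 1))" using V(3) by (intro add_left_mono) simp
      finally show "emeasure lborel V \<le> emeasure lborel S + ennreal (e / (c + 1))" .
    qed simp
    also have "\<dots> = ennreal L * emeasure lborel A + ennreal (c * (e / (c + 1)))"
    proof -
      have "ennreal c * ennreal (e / (c + 1)) = ennreal (c * (e / (c + 1)))"
        using c0 e' by (intro ennreal_mult[symmetric]) auto
      moreover have "ennreal c * emeasure lborel S = ennreal L * emeasure lborel A"
        unfolding emA c_def using ennreal_mult[OF L abs_ge_zero[of "det T"]] by (simp only: mult.assoc)
      ultimately show ?thesis by (simp only: distrib_left)
    qed
    also have "\<dots> \<le> ennreal L * emeasure lborel A + ennreal e"
      using c0 e by (intro add_left_mono ennreal_leI) (simp add: field_simps)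
    finally show "weighted_content N \<Phi> \<Omega> \<sigma> \<delta> A \<le> ennreal L * emeasure lborel A + ennreal e" .
  qed
qed

section \<open>The density bounds the Hausdorff measure from above\<close>

lemma poly_comps_dargs: "poly_comps F ==> poly_comps (dargs ws F)"
  by (induction ws) (auto intro: poly_comps_darg)

lemma frame_derivative:
  fixes \<Phi> :: "real ^ 'n::finite ^ 'k::finite => nat => real"
  assumes \<Phi>: "polynomial_map m \<Phi>"
  shows "poly_comps (mixed_deriv (pullback_pderiv_arg T) \<alpha> \<Phi>)"
    and "mixed_deriv (pullback_pderiv_arg T) \<alpha> \<Phi> y \<in> Euc m"
proof -
  have pc: "poly_comps \<Phi>" unfolding poly_comps_def using polynomial_map_component[OF \<Phi>] by blast
  have md: "mixed_deriv (pullback_pderiv_arg T) \<alpha> \<Phi> = dargs (mi_word (%l. column l T) \<alpha>) \<Phi>"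
    by (rule mixed_deriv_dargs[OF pullback_pderiv_arg_darg pc])
  show "poly_comps (mixed_deriv (pullback_pderiv_arg T) \<alpha> \<Phi>)" unfolding md by (rule poly_comps_dargs[OF pc])
  have Euc0: "!!x i. m \<le> i ==> \<Phi> x i = 0" using polynomial_map_Euc[OF \<Phi>] by (auto simp: Euc_iff)
  show "mixed_deriv (pullback_pderiv_arg T) \<alpha> \<Phi> y \<in> Euc m" unfolding md Euc_iff
  proof (intro allI impI)
    fix i assume "m \<le> i"
    then have "dargs ws \<Phi> y i = 0" for ws :: "('k \<times> (real ^ 'n)) list" and y
      by (induction ws arbitrary: y) (auto simp: Euc0 darg_def)
    then show "dargs (mi_word (%l. column l T) \<alpha>) \<Phi> y i = 0" .
  qed
qed

lemma continuous_on_frame_derivative: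
  fixes \<Phi> :: "real ^ 'n::finite ^ 'k::finite => nat => real"
  assumes N: "norm_on m N" and \<Phi>: "polynomial_map m \<Phi>"
  shows "continuous_on UNIV (%x. N (mixed_deriv (pullback_pderiv_arg T) \<alpha> \<Phi> (\<chi> j. x)))"
proof (rule continuous_on_norm_on[OF N])
  fix i
  have "continuous_on UNIV (%y. mixed_deriv (pullback_pderiv_arg T) \<alpha> \<Phi> y i)"
    using frame_derivative(1)[OF \<Phi>, of T \<alpha>] unfolding poly_comps_def
    by (intro continuous_at_imp_continuous_on ballI continuous_real_polymonial_function) blast
  moreover have "continuous_on UNIV (%x :: real ^ 'n. (\<chi> j. x) :: real ^ 'n ^ 'k)"
    by (intro continuous_on_vec_lambda continuous_on_id)
  ultimately show "continuous_on UNIV (%x. mixed_deriv (pullback_pderiv_arg T) \<alpha> \<Phi> (\<chi> j. x) i)"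
    by (rule continuous_on_compose2) simp
qed (rule frame_derivative(2)[OF \<Phi>])

lemma open_frame_density_less:
  fixes \<Phi> :: "real ^ 'n::finite ^ 'k::finite => nat => real"
  assumes q: "1 \<le> q" and N: "norm_on m N" and \<Phi>: "polynomial_map m \<Phi>"
  shows "open {x. frame_density N \<Phi> q T x < M}"
proof -
  let ?f = "%\<alpha> x. N (mixed_deriv (pullback_pderiv_arg T) \<alpha> \<Phi> (\<chi> j. x)) powr (real CARD('n) / real q) / \<bar>det T\<bar>"
  have ne: "{\<alpha> :: 'k => 'n => nat. mi_order \<alpha> = q} \<noteq> {}" using mi_order_exists by blast
  have eq: "{x. frame_density N \<Phi> q T x < M} = (\<Inter>\<alpha>\<in>{\<alpha>. mi_order \<alpha> = q}. {x. ?f \<alpha> x < M})"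
    unfolding frame_density_def using ne by (subst Max_less_iff) (auto simp: finite_mi_order)
  show ?thesis unfolding eq
  proof (rule open_INT[OF finite_mi_order], rule ballI)
    fix \<alpha> :: "'k => 'n => nat"
    have "continuous_on UNIV (%x. N (mixed_deriv (pullback_pderiv_arg T) \<alpha> \<Phi> (\<chi> j. x)) powr (real CARD('n) / real q))"
      using q norm_on_nonneg[OF N frame_derivative(2)[OF \<Phi>]]
      by (intro continuous_on_powr' continuous_on_frame_derivative[OF N \<Phi>] continuous_on_const) auto
    then have "continuous_on UNIV (?f \<alpha>)"
      unfolding divide_inverse by (intro continuous_on_mult continuous_on_const)
    then show "open {x. ?f \<alpha> x < M}" by (intro open_Collect_less continuous_on_const)
  qed
qed

text \<open>The terms of order greater than \<open>q\<close> in Taylor's formula are negligible for small \<open>s\<close>, since the value \<open>M\<close> leaves room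
  for them in the summand \<open>+ 1\<close>.\<close>

lemma cube_sup_bound:
  fixes \<Phi> :: "real ^ 'n::finite ^ 'k::finite => nat => real" and T :: "real ^ 'n ^ 'n"
  assumes q: "1 \<le> q" and N: "norm_on m N" and \<Phi>: "polynomial_map m \<Phi>"
    and van: "\<forall>\<alpha>. mi_order \<alpha> < q --> mixed_deriv pderiv_arg \<alpha> \<Phi> (\<chi> j. x) = (%_. 0)"
    and T: "invertible T" and M: "frame_density N \<Phi> q T x < M"
  shows "\<exists>r>0. \<forall>a s. 0 < s --> s \<le> r --> x \<in> (*v) T ` cbox a (a + (\<chi> i. s)) -->
    sup_on N \<Phi> ((*v) T ` cbox a (a + (\<chi> i. s)))
      \<le> ennreal (s ^ q * ((real (card {\<alpha> :: 'k => 'n => nat. mi_order \<alpha> = q}) + 1) * (M * \<bar>det T\<bar>) powr (real q / real CARD('n))))"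
proof -
  let ?c = "real (card {\<alpha> :: 'k => 'n => nat. mi_order \<alpha> = q})"
  define B where "B = (M * \<bar>det T\<bar>) powr (real q / real CARD('n))"
  have Tnz: "det T \<noteq> 0" using T by (simp add: invertible_det_nz)
  have M0: "0 < M" using frame_density_nonneg[of N \<Phi> q T x] M by linarith
  have B0: "0 < B" unfolding B_def using M0 Tnz by simp
  have der: "N (mixed_deriv (pullback_pderiv_arg T) \<alpha> \<Phi> (\<chi> j. x)) \<le> B" if "mi_order \<alpha> = q" for \<alpha>
  proof -
    let ?v = "N (mixed_deriv (pullback_pderiv_arg T) \<alpha> \<Phi> (\<chi> j. x))"
    have v0: "0 \<le> ?v" by (rule norm_on_nonneg[OF N frame_derivative(2)[OF \<Phi>]])
    have "?v powr (real CARD('n) / real q) / \<bar>det T\<bar> \<le> M"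
      using less_imp_le[OF M] that unfolding frame_density_le_iff by blast
    then have "?v powr (real CARD('n) / real q) \<le> M * \<bar>det T\<bar>" using Tnz by (simp add: divide_le_eq)
    then have "(?v powr (real CARD('n) / real q)) powr (real q / real CARD('n)) \<le> B"
      unfolding B_def by (intro powr_mono2) auto
    then show ?thesis using v0 q by (simp add: powr_powr)
  qed
  obtain C where C: "0 \<le> C" "\<forall>u s. 0 \<le> s \<and> s \<le> 1 \<and> (\<forall>j l. \<bar>u $ j $ l\<bar> \<le> s) -->
    N (\<Phi> ((\<chi> j. x) + (\<chi> j. T *v (u $ j)))) \<le> s ^ q * (?c * B) + C * s ^ (q + 1)"
  proof -
    have "\<exists>C\<ge>0. \<forall>u s. 0 \<le> s \<and> s \<le> 1 \<and> (\<forall>j l. \<bar>u $ j $ l\<bar> \<le> s) -->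
      N (\<Phi> ((\<chi> j. x) + (\<chi> j. T *v (u $ j)))) \<le> s ^ q * (?c * B) + C * s ^ (q + 1)"
      by (rule taylor_bound[OF N \<Phi>]) (use van der in auto)
    then show ?thesis by (elim exE conjE) (rule that)
  qed
  define r where "r = min 1 (B / (C + 1))"
  have r0: "0 < r" using B0 C(1) by (simp add: r_def)
  show ?thesis unfolding B_def[symmetric]
  proof (intro exI[of _ r] conjI r0 allI impI)
    fix a :: "real ^ 'n" and s :: real
    assume s: "0 < s" "s \<le> r" and x: "x \<in> (*v) T ` cbox a (a + (\<chi> i. s))"
    have s1: "s \<le> 1" "s \<le> B / (C + 1)" using s(2) by (auto simp: r_def)
    have "s * (C + 1) \<le> B" using s1(2) C(1) by (simp add: pos_le_divide_eq)
    then have Cs: "C * s \<le> B" using s(1) by (simp add: algebra_simps)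
    have bound: "s ^ q * (?c * B) + C * s ^ (q + 1) \<le> s ^ q * ((?c + 1) * B)"
    proof -
      have "C * s ^ (q + 1) = s ^ q * (C * s)" by simp
      also have "\<dots> \<le> s ^ q * B" using s(1) Cs by (intro mult_left_mono) auto
      finally show ?thesis by (simp add: algebra_simps)
    qed
    obtain u0 where u0: "u0 \<in> cbox a (a + (\<chi> i. s))" "x = T *v u0" using x by blast
    show "sup_on N \<Phi> ((*v) T ` cbox a (a + (\<chi> i. s))) \<le> ennreal (s ^ q * ((?c + 1) * B))"
      unfolding sup_on_def
    proof (rule SUP_least)
      fix y :: "real ^ 'n ^ 'k" assume "y \<in> {y. \<forall>j. y $ j \<in> (*v) T ` cbox a (a + (\<chi> i. s))}"
      then have "\<forall>j. \<exists>u. u \<in> cbox a (a + (\<chi> i. s)) \<and> y $ j = T *v u" by blast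
      from choice[OF this] obtain u where u: "!!j. u j \<in> cbox a (a + (\<chi> i. s))" "!!j. y $ j = T *v u j" by blast
      define w where "w = (\<chi> j. u j - u0)"
      have yw: "y = (\<chi> j. x) + (\<chi> j. T *v (w $ j))"
        by (simp add: vec_eq_iff[of y] u(2) w_def u0(2) matrix_vector_mult_diff_distrib)
      have "\<bar>w $ j $ l\<bar> \<le> s" for j l
      proof -
        have "a $ l \<le> u j $ l" "u j $ l \<le> a $ l + s" "a $ l \<le> u0 $ l" "u0 $ l \<le> a $ l + s"
          using u(1)[of j] u0(1) by (auto simp: mem_box_cart)
        then show ?thesis by (simp add: w_def abs_le_iff)
      qed
      then have "N (\<Phi> y) \<le> s ^ q * (?c * B) + C * s ^ (q + 1)"
        unfolding yw using C(2) s(1) s1(1) by simp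
      then show "ennreal (N (\<Phi> y)) \<le> ennreal (s ^ q * ((?c + 1) * B))" using bound by (intro ennreal_leI) linarith
    qed
  qed
qed

definition density_const :: "'n::finite itself => 'k::finite itself => nat => real" where
  "density_const _ _ q = (real (card {\<alpha> :: 'k => 'n => nat. mi_order \<alpha> = q}) + 1) powr (real CARD('n) / real q)"

lemma density_const_pos: "0 < density_const TYPE('n::finite) TYPE('k::finite) q"
  unfolding density_const_def by simp

lemma Hausdorff_le_frame:
  fixes \<Phi> :: "real ^ 'n::finite ^ 'k::finite => nat => real"
  assumes q: "1 \<le> q" and N: "norm_on m N" and \<Phi>: "polynomial_map m \<Phi>"
    and van: "!!x \<alpha>. x \<in> \<Omega> ==> mi_order \<alpha> < q ==> mixed_deriv pderiv_arg \<alpha> \<Phi> (\<chi> j. x) = (%_. 0)"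
    and T: "invertible T" and M: "0 \<le> M" "!!x. x \<in> A ==> frame_density N \<Phi> q T x < M"
    and A: "A \<in> sets borel" "A \<subseteq> \<Omega>" "bounded A"
  shows "weighted_Hausdorff N \<Phi> \<Omega> (real CARD('n) / real q) A
    \<le> ennreal (density_const TYPE('n) TYPE('k) q * M) * emeasure lborel A"
proof (rule Hausdorff_le_of_cubes[OF T A])
  let ?\<sigma> = "real CARD('n) / real q" and ?c = "real (card {\<alpha> :: 'k => 'n => nat. mi_order \<alpha> = q}) + 1"
  show "0 \<le> density_const TYPE('n) TYPE('k) q * M" using density_const_pos[where 'n = 'n and 'k = 'k, of q] M(1) by simp
  show "0 \<le> ?\<sigma>" by simp
  fix x assume x: "x \<in> A"
  then have "x \<in> \<Omega>" using A(2) by blast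
  then have vx: "\<forall>\<alpha>. mi_order \<alpha> < q --> mixed_deriv pderiv_arg \<alpha> \<Phi> (\<chi> j. x) = (%_. 0)" using van by blast
  let ?B = "(M * \<bar>det T\<bar>) powr (real q / real CARD('n))"
  obtain r where r: "0 < r" "\<forall>a s. 0 < s --> s \<le> r --> x \<in> (*v) T ` cbox a (a + (\<chi> i. s)) -->
    sup_on N \<Phi> ((*v) T ` cbox a (a + (\<chi> i. s))) \<le> ennreal (s ^ q * (?c * ?B))"
    using cube_sup_bound[OF q N \<Phi> vx T M(2)[OF x]] by (elim exE conjE) (rule that)
  show "\<exists>r>0. \<forall>a s. 0 < s --> s \<le> r --> x \<in> (*v) T ` cbox a (a + (\<chi> i. s)) -->
      epowr (sup_on N \<Phi> ((*v) T ` cbox a (a + (\<chi> i. s)))) ?\<sigma> \<le> ennreal (density_const TYPE('n) TYPE('k) q * M * \<bar>det T\<bar> * s ^ CARD('n))"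
  proof (intro exI[of _ r] conjI r(1) allI impI)
    fix a s assume s: "0 < s" "s \<le> r" and xc: "x \<in> (*v) T ` cbox a (a + (\<chi> i. s))"
    have le: "sup_on N \<Phi> ((*v) T ` cbox a (a + (\<chi> i. s))) \<le> ennreal (s ^ q * (?c * ?B))"
      using r(2) s xc by blast
    have "epowr (sup_on N \<Phi> ((*v) T ` cbox a (a + (\<chi> i. s)))) ?\<sigma> \<le> epowr (ennreal (s ^ q * (?c * ?B))) ?\<sigma>"
      by (rule epowr_mono[OF le]) simp
    also have "\<dots> = ennreal ((s ^ q * (?c * ?B)) powr ?\<sigma>)" using s(1) by (intro epowr_ennreal) auto
    also have "(s ^ q * (?c * ?B)) powr ?\<sigma> = (s ^ q) powr ?\<sigma> * (?c powr ?\<sigma> * ?B powr ?\<sigma>)"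
      using s(1) by (simp add: powr_mult)
    also have "(s ^ q) powr ?\<sigma> = s ^ CARD('n)"
      using s(1) q by (simp add: powr_realpow[symmetric] powr_powr)
    also have "?B powr ?\<sigma> = M * \<bar>det T\<bar>" using q M(1) by (simp add: powr_powr)
    also have "s ^ CARD('n) * (?c powr ?\<sigma> * (M * \<bar>det T\<bar>)) = density_const TYPE('n) TYPE('k) q * M * \<bar>det T\<bar> * s ^ CARD('n)"
      by (simp add: density_const_def mult_ac)
    finally show "epowr (sup_on N \<Phi> ((*v) T ` cbox a (a + (\<chi> i. s)))) ?\<sigma> \<le> ennreal (density_const TYPE('n) TYPE('k) q * M * \<bar>det T\<bar> * s ^ CARD('n))" .
  qed
qed

lemma ennreal_zero_of_small:
  fixes x y :: ennreal
  assumes "y < top" "!!e. 0 < e ==> x \<le> ennreal e * y" shows "x = 0"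
proof -
  obtain b where b: "0 \<le> b" "y = ennreal b" using assms(1) by (cases y) auto
  have small: "x \<le> 0 + ennreal e" if e: "0 < e" for e :: real
  proof -
    have "x \<le> ennreal (e / (b + 1)) * y" using e b(1) by (intro assms(2)) simp
    also have "\<dots> = ennreal (e / (b + 1) * b)" unfolding b(2) by (rule ennreal_mult[symmetric]) (use b(1) e in auto)
    also have "\<dots> \<le> ennreal e" using b(1) e by (intro ennreal_leI) (simp add: field_simps)
    finally show ?thesis by simp
  qed
  have "x \<le> 0" by (rule ennreal_le_epsilon) (rule small)
  then show ?thesis by simp
qed

lemma balls_cover: "(\<Union>i::nat. ball (0 :: 'a::real_normed_vector) (real i)) = UNIV"
proof -
  have "x \<in> (\<Union>i::nat. ball 0 (real i))" for x :: 'a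
  proof -
    obtain i :: nat where "norm x < real i" using reals_Archimedean2 by blast
    then have "x \<in> ball 0 (real i)" by simp
    then show ?thesis by (rule UN_I[OF UNIV_I])
  qed
  then show ?thesis by (intro set_eqI iffI UNIV_I)
qed

text \<open>For \<open>\<sigma> > n / q\<close> the power \<open>s powr (q * \<sigma>)\<close> is much smaller than the volume \<open>s ^ n\<close>, so that the constant in the
  covering estimate can be taken arbitrarily small.\<close>

theorem Hausdorff_zero_above_critical:
  fixes \<Phi> :: "real ^ 'n::finite ^ 'k::finite => nat => real"
  assumes q: "1 \<le> q" and N: "norm_on m N" and \<Phi>: "polynomial_map m \<Phi>" and \<Omega>: "open \<Omega>"
    and van: "!!x \<alpha>. x \<in> \<Omega> ==> mi_order \<alpha> < q ==> mixed_deriv pderiv_arg \<alpha> \<Phi> (\<chi> j. x) = (%_. 0)"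
    and \<sigma>: "real CARD('n) / real q < \<sigma>"
  shows "weighted_Hausdorff N \<Phi> \<Omega> \<sigma> \<Omega> = 0"
proof -
  have \<sigma>0: "0 \<le> \<sigma>" using \<sigma> by (meson divide_nonneg_nonneg less_imp_le of_nat_0_le_iff order_trans)
  define \<rho> where "\<rho> = real q * \<sigma> - real CARD('n)"
  have \<rho>: "0 < \<rho>" using \<sigma> q by (simp add: \<rho>_def field_simps)
  have small: "weighted_Hausdorff N \<Phi> \<Omega> \<sigma> A \<le> ennreal e * emeasure lborel A"
    if A: "A \<in> sets borel" "A \<subseteq> \<Omega>" "bounded A" and e: "0 < e" for A and e :: real
  proof (rule Hausdorff_le_of_cubes[OF invertible_mat_1 A _ \<sigma>0])
    show "0 \<le> e" using e by simp
    fix x assume x: "x \<in> A"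
    then have "x \<in> \<Omega>" using A(2) by blast
    then have vx: "\<forall>\<alpha>. mi_order \<alpha> < q --> mixed_deriv pderiv_arg \<alpha> \<Phi> (\<chi> j. x) = (%_. 0)" using van by blast
    let ?T = "mat 1 :: real ^ 'n ^ 'n"
    obtain r B where r: "0 < r" and B: "0 \<le> B" "!!a s. 0 < s ==> s \<le> r ==> x \<in> (*v) ?T ` cbox a (a + (\<chi> i. s)) ==>
      sup_on N \<Phi> ((*v) ?T ` cbox a (a + (\<chi> i. s))) \<le> ennreal (s ^ q * B)"
    proof -
      let ?B = "(real (card {\<alpha> :: 'k => 'n => nat. mi_order \<alpha> = q}) + 1) * ((frame_density N \<Phi> q ?T x + 1) * \<bar>det ?T\<bar>) powr (real q / real CARD('n))"
      have lt: "frame_density N \<Phi> q ?T x < frame_density N \<Phi> q ?T x + 1" by simp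
      from cube_sup_bound[OF q N \<Phi> vx invertible_mat_1 lt]
      obtain r where "0 < r" "\<forall>a s. 0 < s --> s \<le> r --> x \<in> (*v) ?T ` cbox a (a + (\<chi> i. s)) -->
        sup_on N \<Phi> ((*v) ?T ` cbox a (a + (\<chi> i. s))) \<le> ennreal (s ^ q * ?B)" by (elim exE conjE) (rule that)
      then show ?thesis by (intro that[of r ?B]) (blast, simp, blast)
    qed
    define r' where "r' = min r ((e / (B powr \<sigma> + 1)) powr (1 / \<rho>))"
    have Bp: "0 < B powr \<sigma> + 1" by (simp add: add_nonneg_pos)
    then have r': "0 < r'" using r e by (simp add: r'_def)
    show "\<exists>r>0. \<forall>a s. 0 < s --> s \<le> r --> x \<in> (*v) ?T ` cbox a (a + (\<chi> i. s)) -->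
      epowr (sup_on N \<Phi> ((*v) ?T ` cbox a (a + (\<chi> i. s)))) \<sigma> \<le> ennreal (e * \<bar>det ?T\<bar> * s ^ CARD('n))"
    proof (intro exI[of _ r'] conjI r' allI impI)
      fix a s assume s: "0 < s" "s \<le> r'" and xc: "x \<in> (*v) ?T ` cbox a (a + (\<chi> i. s))"
      have le: "sup_on N \<Phi> ((*v) ?T ` cbox a (a + (\<chi> i. s))) \<le> ennreal (s ^ q * B)"
        using B(2)[OF s(1) _ xc] s(2) by (simp add: r'_def)
      have "s powr \<rho> \<le> ((e / (B powr \<sigma> + 1)) powr (1 / \<rho>)) powr \<rho>"
        using s \<rho> by (intro powr_mono2) (auto simp: r'_def)
      also have "\<dots> = e / (B powr \<sigma> + 1)" using \<rho> e Bp by (simp add: powr_powr)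
      finally have "s powr \<rho> * (B powr \<sigma> + 1) \<le> e" using Bp by (simp add: pos_le_divide_eq)
      moreover have "s powr \<rho> * B powr \<sigma> \<le> s powr \<rho> * (B powr \<sigma> + 1)" by (intro mult_left_mono) auto
      ultimately have sB: "s powr \<rho> * B powr \<sigma> \<le> e" by linarith
      have "epowr (sup_on N \<Phi> ((*v) ?T ` cbox a (a + (\<chi> i. s)))) \<sigma> \<le> epowr (ennreal (s ^ q * B)) \<sigma>"
        by (rule epowr_mono[OF le \<sigma>0])
      also have "\<dots> = ennreal ((s ^ q * B) powr \<sigma>)" using s(1) B(1) by (intro epowr_ennreal) auto
      also have "(s ^ q * B) powr \<sigma> = (s powr \<rho> * B powr \<sigma>) * s ^ CARD('n)"
      proof -
        have "(s ^ q) powr \<sigma> = s powr (\<rho> + real CARD('n))"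
          using s(1) by (simp add: powr_realpow[symmetric] powr_powr \<rho>_def)
        also have "\<dots> = s powr \<rho> * s ^ CARD('n)" using s(1) by (simp add: powr_add powr_realpow)
        finally show ?thesis using s(1) B(1) by (simp add: powr_mult mult_ac)
      qed
      also have "ennreal ((s powr \<rho> * B powr \<sigma>) * s ^ CARD('n)) \<le> ennreal (e * \<bar>det ?T\<bar> * s ^ CARD('n))"
        using sB s(1) by (intro ennreal_leI mult_right_mono) auto
      finally show "epowr (sup_on N \<Phi> ((*v) ?T ` cbox a (a + (\<chi> i. s)))) \<sigma> \<le> ennreal (e * \<bar>det ?T\<bar> * s ^ CARD('n))" .
    qed
  qed
  have "weighted_Hausdorff N \<Phi> \<Omega> \<sigma> \<Omega> \<le> 0 * emeasure lborel \<Omega>"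
  proof (rule countable_piece_bound[where B = "%i. ball 0 (real i)", OF weighted_Hausdorff_countably_subadditive])
    fix i and A' :: "(real ^ 'n) set" assume A': "A' \<in> sets lborel" "A' \<subseteq> \<Omega>" "A' \<subseteq> ball 0 (real i)"
    have bd: "bounded A'" by (rule bounded_subset[OF bounded_ball A'(3)])
    have "weighted_Hausdorff N \<Phi> \<Omega> \<sigma> A' = 0"
    proof (rule ennreal_zero_of_small)
      show "emeasure lborel A' < top" using emeasure_bounded_finite[OF bd] by simp
      show "weighted_Hausdorff N \<Phi> \<Omega> \<sigma> A' \<le> ennreal e * emeasure lborel A'" if "0 < e" for e
        using small[OF _ A'(2) bd that] A'(1) by simp
    qed
    then show "weighted_Hausdorff N \<Phi> \<Omega> \<sigma> A' \<le> 0 * emeasure lborel A'" by simp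
  qed (use \<Omega> balls_cover in auto)
  then show ?thesis by simp
qed

text \<open>The best frame varies with the point, but each single frame is good on an open set, and countably many of these sets
  suffice by Lindelof's theorem.\<close>

lemma Hausdorff_le_level:
  fixes \<Phi> :: "real ^ 'n::finite ^ 'k::finite => nat => real"
  assumes q: "1 \<le> q" and N: "norm_on m N" and \<Phi>: "polynomial_map m \<Phi>"
    and van: "!!x \<alpha>. x \<in> \<Omega> ==> mi_order \<alpha> < q ==> mixed_deriv pderiv_arg \<alpha> \<Phi> (\<chi> j. x) = (%_. 0)"
    and A: "A \<in> sets borel" "A \<subseteq> \<Omega>" and M: "0 \<le> M" "!!x. x \<in> A ==> density_bound N \<Phi> q x < M"
  shows "weighted_Hausdorff N \<Phi> \<Omega> (real CARD('n) / real q) A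
    \<le> ennreal (density_const TYPE('n) TYPE('k) q * M) * emeasure lborel A"
proof -
  let ?W = "%T i. {x. frame_density N \<Phi> q T x < M} \<inter> ball 0 (real i)"
  define \<F> where "\<F> = {W. \<exists>T i. invertible T \<and> W = ?W T i}"
  have op: "open S" if "S \<in> \<F>" for S
    using that open_frame_density_less[OF q N \<Phi>] unfolding \<F>_def by auto
  obtain \<F>' where \<F>': "\<F>' \<subseteq> \<F>" "countable \<F>'" "\<Union>\<F>' = \<Union>\<F>"
    using Lindelof[of \<F>] op by blast
  define B where "B = from_nat_into (insert {} \<F>')"
  have rng: "range B = insert {} \<F>'" unfolding B_def by (rule range_from_nat_into) (use \<F>'(2) in auto)
  show ?thesis
  proof (rule countable_piece_bound[where B = B, OF weighted_Hausdorff_countably_subadditive])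
    show "A \<in> sets lborel" using A(1) by simp
    show "B i \<in> sets lborel" for i
    proof -
      have "B i \<in> insert {} \<F>'" using rng by blast
      then have "open (B i)" using op \<F>'(1) by auto
      then show ?thesis by simp
    qed
    show "A \<subseteq> (\<Union>i. B i)"
    proof
      fix x assume "x \<in> A"
      then obtain T where T: "invertible T" "frame_density N \<Phi> q T x < M"
        using M(2) unfolding density_bound_less_iff by blast
      obtain i :: nat where "norm x < real i" using reals_Archimedean2 by blast
      then have "x \<in> ?W T i" using T(2) by simp
      then have "x \<in> \<Union>\<F>" using T(1) unfolding \<F>_def by blast
      then have "x \<in> \<Union>(range B)" unfolding rng \<F>'(3)[symmetric] by simp
      then show "x \<in> (\<Union>i. B i)" .
    qed
    fix i and A' :: "(real ^ 'n) set" assume A': "A' \<in> sets lborel" "A' \<subseteq> A" "A' \<subseteq> B i"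
    have "B i \<in> insert {} \<F>'" using rng by blast
    then consider "B i = {}" | "B i \<in> \<F>" using \<F>'(1) by blast
    then show "weighted_Hausdorff N \<Phi> \<Omega> (real CARD('n) / real q) A'
      \<le> ennreal (density_const TYPE('n) TYPE('k) q * M) * emeasure lborel A'"
    proof cases
      case 1
      then have "A' = {}" using A'(3) by blast
      then show ?thesis by (simp add: weighted_Hausdorff_empty)
    next
      case 2
      then obtain T j where T: "invertible T" "B i = ?W T j" unfolding \<F>_def by blast
      show ?thesis
      proof (rule Hausdorff_le_frame[OF q N \<Phi> _ T(1) M(1)])
        show "frame_density N \<Phi> q T x < M" if "x \<in> A'" for x using that A'(3) T(2) by auto
        show "A' \<in> sets borel" using A'(1) by simp
        show "A' \<subseteq> \<Omega>" using A'(2) A(2) by blast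
        show "bounded A'" by (rule bounded_subset[OF bounded_ball[of 0 "real j"]]) (use A'(3) T(2) in auto)
      qed (rule van)
    qed
  qed
qed

text \<open>An infimum of continuous functions is upper semicontinuous.\<close>

lemma density_bound_measurable:
  fixes \<Phi> :: "real ^ 'n::finite ^ 'k::finite => nat => real"
  assumes q: "1 \<le> q" and N: "norm_on m N" and \<Phi>: "polynomial_map m \<Phi>"
  shows "density_bound N \<Phi> q \<in> borel_measurable borel"
  unfolding borel_measurable_iff_less
proof
  fix a
  have "{w \<in> space borel. density_bound N \<Phi> q w < a} = (\<Union>T\<in>{T. invertible T}. {x. frame_density N \<Phi> q T x < a})"
    by (auto simp: density_bound_less_iff)
  moreover have "open (\<Union>T\<in>{T. invertible T}. {x. frame_density N \<Phi> q T x < a})"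
    by (intro open_UN ballI open_frame_density_less[OF q N \<Phi>])
  ultimately show "{w \<in> space borel. density_bound N \<Phi> q w < a} \<in> sets borel" by simp
qed

abbreviation density_measure :: "((nat => real) => real) => (real ^ 'n::finite ^ 'k::finite => nat => real) => nat => (real ^ 'n) measure" where
  "density_measure N \<Phi> q \<equiv> density lborel (%x. ennreal (density_bound N \<Phi> q x))"

text \<open>On the dyadic level sets of the density the level estimate loses at most a factor of 2.\<close>

theorem Hausdorff_le_density:
  fixes \<Phi> :: "real ^ 'n::finite ^ 'k::finite => nat => real"
  assumes q: "1 \<le> q" and N: "norm_on m N" and \<Phi>: "polynomial_map m \<Phi>"
    and van: "!!x \<alpha>. x \<in> \<Omega> ==> mi_order \<alpha> < q ==> mixed_deriv pderiv_arg \<alpha> \<Phi> (\<chi> j. x) = (%_. 0)"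
    and A: "A \<in> sets borel" "A \<subseteq> \<Omega>"
  shows "weighted_Hausdorff N \<Phi> \<Omega> (real CARD('n) / real q) A
    \<le> ennreal (2 * density_const TYPE('n) TYPE('k) q) * emeasure (density_measure N \<Phi> q) A"
proof -
  let ?D = "density_bound N \<Phi> q" and ?c = "density_const TYPE('n) TYPE('k) q"
  let ?wH = "weighted_Hausdorff N \<Phi> \<Omega> (real CARD('n) / real q)"
  have c0: "0 < ?c" by (rule density_const_pos)
  have Dm[measurable]: "?D \<in> borel_measurable borel" by (rule density_bound_measurable[OF q N \<Phi>])
  have zero: "?wH A' = 0" if A': "A' \<in> sets borel" "A' \<subseteq> \<Omega>" "!!x. x \<in> A' ==> ?D x = 0" for A'
  proof -
    have "?wH A' \<le> 0 * emeasure lborel A'"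
    proof (rule countable_piece_bound[where B = "%i. ball 0 (real i)", OF weighted_Hausdorff_countably_subadditive])
      fix i and A'' :: "(real ^ 'n) set" assume A'': "A'' \<in> sets lborel" "A'' \<subseteq> A'" "A'' \<subseteq> ball 0 (real i)"
      have bd: "bounded A''" by (rule bounded_subset[OF bounded_ball A''(3)])
      have "?wH A'' = 0"
      proof (rule ennreal_zero_of_small)
        show "emeasure lborel A'' < top" using emeasure_bounded_finite[OF bd] by simp
        fix e :: real assume e: "0 < e"
        have "?wH A'' \<le> ennreal (?c * (e / ?c)) * emeasure lborel A''"
        proof (rule Hausdorff_le_level[OF q N \<Phi>])
          show "?D x < e / ?c" if "x \<in> A''" for x using A'(3)[of x] that A''(2) e c0 by auto
        qed (use van A'' A'(2) e c0 in auto)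
        then show "?wH A'' \<le> ennreal e * emeasure lborel A''" using c0 by simp
      qed
      then show "?wH A'' \<le> 0 * emeasure lborel A''" by simp
    qed (use A'(1) balls_cover in auto)
    then show ?thesis by simp
  qed
  define lev where "lev k = {x. 2 powr real_of_int k \<le> ?D x \<and> ?D x < 2 powr (real_of_int k + 1)}" for k
  \<comment> \<open>The zero set of the density has index 0, the dyadic levels have the other indices.\<close>
  define B where "B i = (if i = 0 then {x. ?D x = 0} else lev (from_nat (i - 1)))" for i :: nat
  show ?thesis
  proof (rule countable_piece_bound[where B = B, OF weighted_Hausdorff_countably_subadditive])
    show "A \<in> sets (density_measure N \<Phi> q)" using A(1) by simp
    show "B i \<in> sets (density_measure N \<Phi> q)" for i unfolding B_def lev_def by simp
    show "A \<subseteq> (\<Union>i. B i)"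
    proof
      fix x
      show "x \<in> (\<Union>i. B i)"
      proof (cases "?D x = 0")
        case True
        then have "x \<in> B 0" by (simp add: B_def)
        then show ?thesis by blast
      next
        case False
        then have D0: "0 < ?D x" using density_bound_nonneg[of N \<Phi> q x] by linarith
        define k where "k = \<lfloor>log 2 (?D x)\<rfloor>"
        have "real_of_int k \<le> log 2 (?D x)" "log 2 (?D x) < real_of_int k + 1" unfolding k_def by linarith+
        then have "x \<in> lev k" unfolding lev_def using D0 by (simp add: le_log_iff log_less_iff)
        then have "x \<in> B (Suc (to_nat k))" by (simp add: B_def)
        then show ?thesis by blast
      qed
    qed
    fix i and A' :: "(real ^ 'n) set"
    assume A': "A' \<in> sets (density_measure N \<Phi> q)" "A' \<subseteq> A" "A' \<subseteq> B i"
    have A'b: "A' \<in> sets borel" "A' \<subseteq> \<Omega>" using A' A(2) by auto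
    show "?wH A' \<le> ennreal (2 * ?c) * emeasure (density_measure N \<Phi> q) A'"
    proof (cases "i = 0")
      case True
      then have "?wH A' = 0" using A'(3) by (intro zero A'b) (auto simp: B_def)
      then show ?thesis by simp
    next
      case False
      define k where "k = real_of_int (from_nat (i - 1))"
      have kA: "2 powr k \<le> ?D x" "?D x < 2 powr (k + 1)" if "x \<in> A'" for x
        using that A'(3) False by (auto simp: B_def lev_def k_def)
      have "?wH A' \<le> ennreal (?c * 2 powr (k + 1)) * emeasure lborel A'"
      proof (rule Hausdorff_le_level[OF q N \<Phi>])
        show "?D x < 2 powr (k + 1)" if "x \<in> A'" for x by (rule kA(2)[OF that])
      qed (use van A'b in auto)
      also have "\<dots> = ennreal (2 * ?c) * (ennreal (2 powr k) * emeasure lborel A')"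
      proof -
        have "?c * 2 powr (k + 1) = (2 * ?c) * 2 powr k" by (simp add: powr_add)
        then have "ennreal (?c * 2 powr (k + 1)) = ennreal (2 * ?c) * ennreal (2 powr k)"
          using c0 by (simp only:) (rule ennreal_mult, auto)
        then show ?thesis by (simp only: mult.assoc)
      qed
      also have "\<dots> \<le> ennreal (2 * ?c) * emeasure (density_measure N \<Phi> q) A'"
      proof (rule mult_left_mono)
        have "ennreal (2 powr k) * emeasure lborel A' = (\<integral>\<^sup>+x. ennreal (2 powr k) * indicator A' x \<partial>lborel)"
          using A'b(1) by (simp add: nn_integral_cmult_indicator)
        also have "\<dots> \<le> (\<integral>\<^sup>+x. ennreal (?D x) * indicator A' x \<partial>lborel)"
          using kA(1) by (intro nn_integral_mono) (auto simp: indicator_def intro!: ennreal_leI)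
        also have "\<dots> = emeasure (density_measure N \<Phi> q) A'"
          using A'b(1) by (subst emeasure_density) auto
        finally show "ennreal (2 powr k) * emeasure lborel A' \<le> emeasure (density_measure N \<Phi> q) A'" .
      qed simp
      finally show ?thesis .
    qed
  qed
qed

section \<open>The density bounds the Hausdorff measure from below\<close>

text \<open>The bound for bounded sets passes to the limit along an exhaustion by balls.\<close>

lemma density_measure_le_sup:
  fixes \<Phi> :: "real ^ 'n::finite ^ 'k::finite => nat => real"
  assumes q: "1 \<le> q" and N: "norm_on m N" and \<Phi>: "polynomial_map m \<Phi>" and C: "0 < C"
    and int: "!!E S. E \<in> sets borel ==> bounded E ==> E \<subseteq> \<Omega> ==> 0 \<le> S ==> sup_on N \<Phi> E = ennreal S ==>
      (\<integral>\<^sup>+x. ennreal (density_bound N \<Phi> q x) * indicator E x \<partial>lborel) \<le> ennreal (C * S powr (real CARD('n) / real q))"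
    and E: "E \<in> sets borel" "E \<subseteq> \<Omega>"
  shows "emeasure (density_measure N \<Phi> q) E \<le> ennreal C * epowr (sup_on N \<Phi> E) (real CARD('n) / real q)"
proof -
  let ?E = "%i. E \<inter> ball 0 (real i)"
  have Dm[measurable]: "density_bound N \<Phi> q \<in> borel_measurable borel" by (rule density_bound_measurable[OF q N \<Phi>])
  have "(SUP i. emeasure (density_measure N \<Phi> q) (?E i)) = emeasure (density_measure N \<Phi> q) (\<Union>i. ?E i)"
  proof (rule SUP_emeasure_incseq)
    show "range ?E \<subseteq> sets (density_measure N \<Phi> q)" using E(1) by auto
    show "incseq ?E" unfolding incseq_def by auto
  qed
  moreover have "(\<Union>i. ?E i) = E" using balls_cover by blast
  moreover have "emeasure (density_measure N \<Phi> q) (?E i) \<le> ennreal C * epowr (sup_on N \<Phi> E) (real CARD('n) / real q)" for i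
  proof -
    have bd: "bounded (?E i)" by (rule bounded_subset[OF bounded_ball[of 0 "real i"]]) auto
    have "sup_on N \<Phi> (?E i) < top"
      by (rule sup_on_finite_compact[where N = N and \<Phi> = \<Phi>, OF continuous_on_norm_polynomial_map[OF N \<Phi>] bd]) simp
    then obtain S where S: "0 \<le> S" "sup_on N \<Phi> (?E i) = ennreal S" by (cases "sup_on N \<Phi> (?E i)") auto
    have "emeasure (density_measure N \<Phi> q) (?E i) = (\<integral>\<^sup>+x. ennreal (density_bound N \<Phi> q x) * indicator (?E i) x \<partial>lborel)"
      using E(1) by (subst emeasure_density) auto
    also have "\<dots> \<le> ennreal (C * S powr (real CARD('n) / real q))"
      by (rule int[OF _ bd _ S]) (use E in auto)
    also have "\<dots> = ennreal C * epowr (sup_on N \<Phi> (?E i)) (real CARD('n) / real q)"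
      unfolding S(2) epowr_ennreal[OF S(1)] using C by (intro ennreal_mult) auto
    also have "\<dots> \<le> ennreal C * epowr (sup_on N \<Phi> E) (real CARD('n) / real q)"
      by (intro mult_left_mono epowr_mono sup_on_mono) auto
    finally show ?thesis .
  qed
  ultimately show ?thesis by (metis SUP_least)
qed

text \<open>The exceptional set is tested where \<open>f\<close> is bounded and the measure is finite, so that no infinite integrals are
  compared.\<close>

lemma AE_le_of_integrals:
  assumes "sigma_finite_measure M" and f: "f \<in> borel_measurable M" and g: "g \<in> borel_measurable M"
    and le: "!!A. A \<in> sets M ==> (\<integral>\<^sup>+x. g x * indicator A x \<partial>M) \<le> (\<integral>\<^sup>+x. f x * indicator A x \<partial>M)"
  shows "AE x in M. g x \<le> (f x :: ennreal)"
proof -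
  interpret sigma_finite_measure M by fact
  note f[measurable] g[measurable]
  obtain A :: "nat => _" where A: "range A \<subseteq> sets M" "(\<Union>i. A i) = space M" "!!i. emeasure M (A i) \<noteq> \<infinity>"
    using sigma_finite by metis
  have Am[measurable]: "A i \<in> sets M" for i using A(1) by blast
  define B where "B n i = {x \<in> space M. f x < g x \<and> f x \<le> of_nat n} \<inter> A i" for n i :: nat
  have Bm[measurable]: "B n i \<in> sets M" for n i unfolding B_def by measurable
  have "AE x in M. x \<notin> B n i" for n i
  proof -
    have "(\<integral>\<^sup>+x. f x * indicator (B n i) x \<partial>M) \<le> (\<integral>\<^sup>+x. of_nat n * indicator (A i) x \<partial>M)"
      by (intro nn_integral_mono) (auto simp: indicator_def B_def)
    also have "\<dots> = of_nat n * emeasure M (A i)" by (simp add: nn_integral_cmult_indicator)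
    also have "\<dots> < \<infinity>" using A(3)[of i] by (simp add: ennreal_mult_less_top less_top ennreal_of_nat_eq_real_of_nat)
    finally have fin: "(\<integral>\<^sup>+x. f x * indicator (B n i) x \<partial>M) \<noteq> \<infinity>" by simp
    have "AE x in M. g x * indicator (B n i) x \<le> f x * indicator (B n i) x"
    proof (rule ccontr)
      assume not: "\<not> ?thesis"
      have "(\<integral>\<^sup>+x. f x * indicator (B n i) x \<partial>M) < (\<integral>\<^sup>+x. g x * indicator (B n i) x \<partial>M)"
        by (rule nn_integral_less[OF _ _ fin _ not]) (auto simp: indicator_def B_def)
      then show False using le[OF Bm, of n i] by simp
    qed
    then show ?thesis by eventually_elim (auto simp: B_def indicator_def split: if_splits)
  qed
  then have "AE x in M. \<forall>n i. x \<notin> B n i" by (simp add: AE_all_countable)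
  then show ?thesis
  proof (rule AE_mp)
    show "AE x in M. (\<forall>n i. x \<notin> B n i) --> g x \<le> f x"
    proof (rule AE_I2, rule impI, rule ccontr)
      fix x assume x: "x \<in> space M" and nB: "\<forall>n i. x \<notin> B n i" and "\<not> g x \<le> f x"
      then have lt: "f x < g x" by simp
      then have "f x < top" using top_greatest[of "g x"] by (rule less_le_trans)
      then obtain r where r: "0 \<le> r" "f x = ennreal r" by (cases "f x") auto
      obtain n :: nat where "r \<le> real n" using real_arch_simple by blast
      then have "f x \<le> of_nat n" unfolding r(2) ennreal_of_nat_eq_real_of_nat by (rule ennreal_leI)
      moreover obtain i where "x \<in> A i" using A(2) x by blast
      ultimately have "x \<in> B n i" using x lt by (simp add: B_def)
      then show False using nB by blast
    qed
  qed
qed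

section \<open>The critical exponent\<close>

text \<open>The hypothesis on \<open>E\<close> says that the density measure is dominated by the set function; the mass distribution principle
  applies.\<close>

lemma critical_lower_bound:
  fixes \<Phi> :: "real ^ 'n::finite ^ 'k::finite => nat => real"
  assumes q: "1 \<le> q" and N: "norm_on m N" and \<Phi>: "polynomial_map m \<Phi>" and \<Omega>: "open \<Omega>" and C: "0 < C"
    and sup: "!!E. E \<in> sets borel ==> E \<subseteq> \<Omega> ==>
      emeasure (density_measure N \<Phi> q) E \<le> ennreal C * epowr (sup_on N \<Phi> E) (real CARD('n) / real q)"
    and A: "A \<in> sets borel" "A \<subseteq> \<Omega>"
  shows "ennreal (inverse C) * emeasure (density_measure N \<Phi> q) A \<le> weighted_Hausdorff N \<Phi> \<Omega> (real CARD('n) / real q) A"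
proof -
  let ?\<sigma> = "real CARD('n) / real q" and ?s = "real q / real CARD('n)"
  let ?\<nu> = "density_measure N \<Phi> q"
  define \<mu> where "\<mu> = restrict_space ?\<nu> \<Omega>"
  have sets: "sets \<mu> = sets (restrict_space borel \<Omega>)" unfolding \<mu>_def by (rule sets_restrict_space_cong) simp
  have Ob: "\<Omega> \<in> sets borel" using \<Omega> by simp
  have borel: "E \<in> sets borel \<and> E \<subseteq> \<Omega>" if "E \<in> sets (restrict_space borel \<Omega>)" for E
    using that Ob by (auto simp: sets_restrict_space_iff)
  have em: "emeasure \<mu> E = emeasure ?\<nu> E" if "E \<in> sets (restrict_space borel \<Omega>)" for E
    unfolding \<mu>_def by (rule emeasure_restrict_space) (use borel[OF that] Ob in auto)
  have dom: "dominates (sup_on N \<Phi>) \<Omega> \<mu> (1 / ?\<sigma>) (C powr (- ?s))"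
    unfolding dominates_def
  proof
    fix E assume E: "E \<in> sets (restrict_space borel \<Omega>)"
    have s0: "0 < ?s" using q by simp
    have s1: "1 / ?\<sigma> = ?s" by simp
    have "ennreal (C powr (- ?s)) * epowr (emeasure \<mu> E) ?s
      \<le> ennreal (C powr (- ?s)) * epowr (ennreal C * epowr (sup_on N \<Phi> E) ?\<sigma>) ?s"
      unfolding em[OF E] by (intro mult_left_mono epowr_mono sup) (use borel[OF E] in auto)
    also have "\<dots> = ennreal (C powr (- ?s)) * (ennreal (C powr ?s) * epowr (epowr (sup_on N \<Phi> E) ?\<sigma>) ?s)"
      by (subst epowr_mult) (use C s0 in auto)
    also have "epowr (epowr (sup_on N \<Phi> E) ?\<sigma>) ?s = sup_on N \<Phi> E"
      by (subst epowr_epowr) (use q in auto)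
    also have "ennreal (C powr (- ?s)) * (ennreal (C powr ?s) * sup_on N \<Phi> E) = ennreal (C powr (- ?s) * C powr ?s) * sup_on N \<Phi> E"
      by (simp add: ennreal_mult' mult.assoc)
    also have "C powr (- ?s) * C powr ?s = 1" using C by (simp add: powr_add[symmetric])
    finally show "ennreal (C powr (- ?s)) * epowr (emeasure \<mu> E) (1 / ?\<sigma>) \<le> sup_on N \<Phi> E"
      unfolding s1 by simp
  qed
  have AS: "A \<in> sets (restrict_space borel \<Omega>)" using A Ob by (simp add: sets_restrict_space_iff)
  have "ennreal ((C powr (- ?s)) powr ?\<sigma>) * emeasure \<mu> A \<le> weighted_Hausdorff N \<Phi> \<Omega> ?\<sigma> A"
    by (rule dominates_le_Hausdorff[where N = N and \<Phi> = \<Phi>, OF continuous_on_norm_polynomial_map[OF N \<Phi>] _ _ _ dom AS])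
      (use sets q in \<open>auto simp: borel_measure_on_def\<close>)
  moreover have "(C powr (- ?s)) powr ?\<sigma> = inverse C"
  proof -
    have "- ?s * ?\<sigma> = - 1" using q by simp
    then have "(C powr (- ?s)) powr ?\<sigma> = C powr (- 1)" by (simp only: powr_powr)
    then show ?thesis using C by (simp only: powr_minus) simp
  qed
  ultimately show ?thesis unfolding em[OF AS] by simp
qed

lemma Hausdorff_RN_deriv:
  fixes \<Phi> :: "real ^ 'n::finite ^ 'k::finite => nat => real"
  assumes \<Omega>: "open \<Omega>" and D: "D \<in> borel_measurable borel" "!!x. 0 \<le> D x" and c: "0 \<le> c" "0 \<le> c'"
    and lower: "!!A. A \<in> sets borel ==> A \<subseteq> \<Omega> ==> ennreal c * emeasure (density lborel (%x. ennreal (D x))) A \<le> weighted_Hausdorff N \<Phi> \<Omega> \<sigma> A"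
    and upper: "!!A. A \<in> sets borel ==> A \<subseteq> \<Omega> ==> weighted_Hausdorff N \<Phi> \<Omega> \<sigma> A \<le> ennreal c' * emeasure (density lborel (%x. ennreal (D x))) A"
  shows "absolutely_continuous (restrict_space lborel \<Omega>) (weighted_Hausdorff_measure N \<Phi> \<Omega> \<sigma>)"
    and "AE x in restrict_space lborel \<Omega>. ennreal (c * D x) \<le> RN_deriv (restrict_space lborel \<Omega>) (weighted_Hausdorff_measure N \<Phi> \<Omega> \<sigma>) x \<and>
      RN_deriv (restrict_space lborel \<Omega>) (weighted_Hausdorff_measure N \<Phi> \<Omega> \<sigma>) x \<le> ennreal (c' * D x)"
proof -
  let ?M = "restrict_space lborel \<Omega>" and ?\<Lambda> = "weighted_Hausdorff_measure N \<Phi> \<Omega> \<sigma>"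
  let ?\<nu> = "density lborel (%x. ennreal (D x))"
  note D(1)[measurable]
  have Ob: "\<Omega> \<in> sets lborel" using \<Omega> by simp
  have sets: "sets ?M = sets (restrict_space borel \<Omega>)" by (rule sets_restrict_space_cong) simp
  have sf: "sigma_finite_measure ?M"
    by (rule sigma_finite_measure_restrict_space[OF lborel.sigma_finite_measure_axioms Ob])
  have borel: "A \<in> sets borel" "A \<subseteq> \<Omega>" if "A \<in> sets ?M" for A
    using that Ob by (auto simp: sets_restrict_space_iff)
  have em\<Lambda>: "emeasure ?\<Lambda> A = weighted_Hausdorff N \<Phi> \<Omega> \<sigma> A" if "A \<in> sets ?M" for A
    using that unfolding sets by (rule emeasure_weighted_Hausdorff_measure)
  have em\<nu>: "(\<integral>\<^sup>+x. ennreal (D x) * indicator A x \<partial>?M) = emeasure ?\<nu> A" if A: "A \<in> sets ?M" for A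
  proof -
    have "(\<integral>\<^sup>+x. ennreal (D x) * indicator A x \<partial>?M) = (\<integral>\<^sup>+x. (ennreal (D x) * indicator A x) * indicator \<Omega> x \<partial>lborel)"
      by (rule nn_integral_restrict_space) (use Ob in simp)
    also have "\<dots> = (\<integral>\<^sup>+x. ennreal (D x) * indicator A x \<partial>lborel)"
      using borel(2)[OF A] by (intro nn_integral_cong) (auto simp: indicator_def)
    also have "\<dots> = emeasure ?\<nu> A" using borel(1)[OF A] by (subst emeasure_density) auto
    finally show ?thesis .
  qed
  have DM: "(%x. ennreal (D x)) \<in> borel_measurable ?M"
    by (rule measurable_restrict_space1) measurable
  show ac: "absolutely_continuous ?M ?\<Lambda>"
    unfolding absolutely_continuous_def
  proof
    fix A assume A: "A \<in> null_sets ?M"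
    then have AM: "A \<in> sets ?M" by auto
    have "emeasure ?\<nu> A = 0" unfolding em\<nu>[OF AM, symmetric] by (rule nn_integral_null_set[OF A])
    then have "weighted_Hausdorff N \<Phi> \<Omega> \<sigma> A = 0" using upper[OF borel[OF AM]] by simp
    then show "A \<in> null_sets ?\<Lambda>" using AM em\<Lambda>[OF AM] sets by (intro null_setsI) auto
  qed
  let ?f = "RN_deriv ?M ?\<Lambda>"
  have dens: "density ?M ?f = ?\<Lambda>"
    by (rule sigma_finite_measure.density_RN_deriv[OF sf ac]) (simp add: sets)
  have fM: "?f \<in> borel_measurable ?M" by (rule borel_measurable_RN_deriv)
  have intf: "(\<integral>\<^sup>+x. ?f x * indicator A x \<partial>?M) = weighted_Hausdorff N \<Phi> \<Omega> \<sigma> A" if A: "A \<in> sets ?M" for A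
    using emeasure_density[OF fM A] unfolding dens em\<Lambda>[OF A] by simp
  have intD: "(\<integral>\<^sup>+x. ennreal (b * D x) * indicator A x \<partial>?M) = ennreal b * emeasure ?\<nu> A"
    if A: "A \<in> sets ?M" and b: "0 \<le> b" for A b
  proof -
    have "(\<integral>\<^sup>+x. ennreal (b * D x) * indicator A x \<partial>?M) = (\<integral>\<^sup>+x. ennreal b * (ennreal (D x) * indicator A x) \<partial>?M)"
      using b D(2) by (simp add: ennreal_mult mult.assoc)
    also have "\<dots> = ennreal b * (\<integral>\<^sup>+x. ennreal (D x) * indicator A x \<partial>?M)"
      by (rule nn_integral_cmult) (rule borel_measurable_times_ennreal[OF DM borel_measurable_indicator[OF A]])
    finally show ?thesis unfolding em\<nu>[OF A] .
  qed
  have bM: "(%x. ennreal (b * D x)) \<in> borel_measurable ?M" for b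
    by (rule measurable_restrict_space1) measurable
  have "AE x in ?M. ennreal (c * D x) \<le> ?f x"
    by (rule AE_le_of_integrals[OF sf fM bM]) (use lower borel intf intD c in auto)
  moreover have "AE x in ?M. ?f x \<le> ennreal (c' * D x)"
    by (rule AE_le_of_integrals[OF sf bM fM]) (use upper borel intf intD c in auto)
  ultimately show "AE x in ?M. ennreal (c * D x) \<le> ?f x \<and> ?f x \<le> ennreal (c' * D x)" by eventually_elim simp
qed

lemma best_constant_le_Hausdorff:
  fixes \<Phi> :: "real ^ 'n::finite ^ 'k::finite => nat => real"
  assumes cont: "continuous_on UNIV (%x. N (\<Phi> x))" and \<mu>: "borel_measure_on \<Omega> \<mu>" and s: "0 < s"
    and E: "E \<in> sets (restrict_space borel \<Omega>)"
  shows "best_constant (sup_on N \<Phi>) \<Omega> \<mu> s * epowr (emeasure \<mu> E) s \<le> epowr (weighted_Hausdorff N \<Phi> \<Omega> (1 / s) E) s"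
  unfolding best_constant_def SUP_mult_right_ennreal
proof (rule SUP_least)
  fix c assume c: "c \<in> {c. 0 \<le> c \<and> dominates (sup_on N \<Phi>) \<Omega> \<mu> s c}"
  have c0: "0 \<le> c" and dom: "dominates (sup_on N \<Phi>) \<Omega> \<mu> (1 / (1 / s)) c" using c by auto
  have "ennreal (c powr (1 / s)) * emeasure \<mu> E \<le> weighted_Hausdorff N \<Phi> \<Omega> (1 / s) E"
    by (rule dominates_le_Hausdorff[where N = N and \<Phi> = \<Phi>, OF cont \<mu> _ c0 dom E]) (use s in simp)
  then have "epowr (ennreal (c powr (1 / s)) * emeasure \<mu> E) s \<le> epowr (weighted_Hausdorff N \<Phi> \<Omega> (1 / s) E) s"
    by (rule epowr_mono) (use s in simp)
  moreover have "epowr (ennreal (c powr (1 / s)) * emeasure \<mu> E) s = ennreal c * epowr (emeasure \<mu> E) s"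
    using s c0 by (subst epowr_mult) (auto simp: powr_powr)
  ultimately show "ennreal c * epowr (emeasure \<mu> E) s \<le> epowr (weighted_Hausdorff N \<Phi> \<Omega> (1 / s) E) s" by simp
qed

lemma dominated_imp_Hausdorff_pos:
  fixes \<Phi> :: "real ^ 'n::finite ^ 'k::finite => nat => real"
  assumes cont: "continuous_on UNIV (%x. N (\<Phi> x))" and \<mu>: "borel_measure_on \<Omega> \<mu>" and \<sigma>: "0 < \<sigma>"
    and dom: "dominates_nontrivially (sup_on N \<Phi>) \<Omega> \<mu> (1 / \<sigma>)" and \<Omega>: "open \<Omega>"
  shows "0 < weighted_Hausdorff N \<Phi> \<Omega> \<sigma> \<Omega>"
proof -
  obtain c where c: "0 < c" "dominates (sup_on N \<Phi>) \<Omega> \<mu> (1 / \<sigma>) c" and nz: "emeasure \<mu> \<Omega> \<noteq> 0"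
    using dom unfolding dominates_nontrivially_def by blast
  have O: "\<Omega> \<in> sets (restrict_space borel \<Omega>)" using \<Omega> by (simp add: sets_restrict_space_iff)
  have "ennreal (c powr \<sigma>) * emeasure \<mu> \<Omega> \<le> weighted_Hausdorff N \<Phi> \<Omega> \<sigma> \<Omega>"
    by (rule dominates_le_Hausdorff[where N = N and \<Phi> = \<Phi>, OF cont \<mu> \<sigma> less_imp_le[OF c(1)] c(2) O])
  moreover have "0 < ennreal (c powr \<sigma>) * emeasure \<mu> \<Omega>"
    using c(1) nz by (simp add: ennreal_zero_less_mult_iff zero_less_iff_neq_zero)
  ultimately show ?thesis by (rule less_le_trans[rotated])
qed

lemma ennreal_inverse_mult_le:
  assumes "0 < (b :: real)" "b \<le> C" "x \<le> ennreal b * y" shows "ennreal (inverse C) * x \<le> y"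
proof -
  have "ennreal (inverse C) * x \<le> ennreal (inverse C) * (ennreal b * y)" by (intro mult_left_mono assms) simp
  also have "\<dots> = ennreal (inverse C * b) * y" using assms by (simp add: ennreal_mult' mult.assoc)
  also have "\<dots> \<le> ennreal 1 * y" using assms by (intro mult_right_mono ennreal_leI) (auto simp: field_simps)
  finally show ?thesis by simp
qed

theorem theorem3:
  fixes q d :: nat
  assumes "1 \<le> q"
  shows "\<exists>C::real. 0 < C \<and>
    (\<forall>(m::nat) (N :: (nat \<Rightarrow> real) \<Rightarrow> real) (\<Omega> :: (real ^ 'n::finite) set)
      (\<Phi> :: real ^ 'n ^ 'k::finite \<Rightarrow> nat \<Rightarrow> real) (\<sigma>::real).
      1 \<le> m \<and> norm_on m N \<and> open \<Omega> \<and> connected \<Omega> \<and> \<Omega> \<noteq> {} \<and>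
      polynomial_map m \<Phi> \<and> map_degree m \<Phi> = d \<and> vanishes_to_order q \<Phi> \<Omega> \<and> 0 < \<sigma> \<longrightarrow>
      (\<sigma> > real CARD('n) / real q \<longrightarrow>
        weighted_Hausdorff N \<Phi> \<Omega> \<sigma> \<Omega> = 0 \<and>
        \<not> (\<exists>\<mu>. borel_measure_on \<Omega> \<mu> \<and> dominates_nontrivially (sup_on N \<Phi>) \<Omega> \<mu> (1 / \<sigma>))) \<and>
      (\<sigma> \<le> real CARD('n) / real q \<longrightarrow>
        ((\<exists>\<mu>. borel_measure_on \<Omega> \<mu> \<and> dominates_nontrivially (sup_on N \<Phi>) \<Omega> \<mu> (1 / \<sigma>))
          \<longleftrightarrow> weighted_Hausdorff N \<Phi> \<Omega> \<sigma> \<Omega> > 0)) \<and>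
      (\<sigma> = real CARD('n) / real q \<longrightarrow>
        measure_space \<Omega> (sets (restrict_space borel \<Omega>)) (weighted_Hausdorff N \<Phi> \<Omega> \<sigma>) \<and>
        absolutely_continuous (restrict_space lborel \<Omega>) (weighted_Hausdorff_measure N \<Phi> \<Omega> \<sigma>) \<and>
        (AE x in restrict_space lborel \<Omega>.
          ennreal (inverse C * density_bound N \<Phi> q x)
            \<le> RN_deriv (restrict_space lborel \<Omega>) (weighted_Hausdorff_measure N \<Phi> \<Omega> \<sigma>) x \<and>
          RN_deriv (restrict_space lborel \<Omega>) (weighted_Hausdorff_measure N \<Phi> \<Omega> \<sigma>) x
            \<le> ennreal (C * density_bound N \<Phi> q x)) \<and>
        (\<forall>E\<in>sets (restrict_space borel \<Omega>).
          ennreal (inverse C) * epowr (weighted_Hausdorff N \<Phi> \<Omega> \<sigma> E) (real q / real CARD('n))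
            \<le> sup_on N \<Phi> E) \<and>
        (\<forall>\<mu>. borel_measure_on \<Omega> \<mu> \<and>
              (\<exists>c>0. dominates (sup_on N \<Phi>) \<Omega> \<mu> (real q / real CARD('n)) c) \<longrightarrow>
          (\<forall>E\<in>sets (restrict_space borel \<Omega>).
            ennreal (inverse C) * best_constant (sup_on N \<Phi>) \<Omega> \<mu> (real q / real CARD('n))
                * epowr (emeasure \<mu> E) (real q / real CARD('n))
              \<le> epowr (weighted_Hausdorff N \<Phi> \<Omega> \<sigma> E) (real q / real CARD('n))))))"
proof -
  note q = assms
  let ?cr = "real CARD('n) / real q" and ?s = "real q / real CARD('n)"
  have s0: "0 < ?s" and s1: "1 / ?s = ?cr" and cr0: "?cr * ?s = 1" using q by auto
  have "\<exists>C>0. \<forall>m N (\<Phi> :: real ^ 'n ^ 'k => nat => real) E S.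
    norm_on m N --> polynomial_map m \<Phi> --> map_degree m \<Phi> = d --> E \<in> sets borel --> bounded E -->
    (\<forall>x\<in>E. \<forall>\<alpha>. mi_order \<alpha> < q --> mixed_deriv pderiv_arg \<alpha> \<Phi> (\<chi> j. x) = (%_. 0)) -->
    0 \<le> S --> sup_on N \<Phi> E = ennreal S -->
    (\<integral>\<^sup>+x. ennreal (density_bound N \<Phi> q x) * indicator E x \<partial>lborel) \<le> ennreal (C * S powr ?cr)"
    by (rule density_integral[OF q])
  then obtain C1 where C1: "0 < C1" and int: "\<forall>m N (\<Phi> :: real ^ 'n ^ 'k => nat => real) E S.
    norm_on m N --> polynomial_map m \<Phi> --> map_degree m \<Phi> = d --> E \<in> sets borel --> bounded E -->
    (\<forall>x\<in>E. \<forall>\<alpha>. mi_order \<alpha> < q --> mixed_deriv pderiv_arg \<alpha> \<Phi> (\<chi> j. x) = (%_. 0)) -->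
    0 \<le> S --> sup_on N \<Phi> E = ennreal S -->
    (\<integral>\<^sup>+x. ennreal (density_bound N \<Phi> q x) * indicator E x \<partial>lborel) \<le> ennreal (C1 * S powr ?cr)"
    by (elim exE conjE) (rule that)
  define c2 where "c2 = 2 * density_const TYPE('n) TYPE('k) q"
  have c2: "0 < c2" unfolding c2_def using density_const_pos[where 'n = 'n and 'k = 'k, of q] by simp
  \<comment> \<open>The four summands serve, in this order, the maximality of the measure, the lower and the upper bound of the derivative, and the lower bound of the set function.\<close>
  define C where "C = 1 + C1 + c2 + (c2 * C1) powr ?s"
  have pw: "0 < (c2 * C1) powr ?s" using c2 C1 by simp
  have C: "0 < C" "1 \<le> C" "C1 \<le> C" "c2 \<le> C" "(c2 * C1) powr ?s \<le> C" unfolding C_def using C1 c2 pw by linarith+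
  show ?thesis
  proof (rule exI[of _ C], rule conjI[OF C(1)], (rule allI)+, rule impI)
    fix m N \<Omega> and \<Phi> :: "real ^ 'n ^ 'k => nat => real" and \<sigma> :: real
    assume hyps: "1 \<le> m \<and> norm_on m N \<and> open \<Omega> \<and> connected \<Omega> \<and> \<Omega> \<noteq> {} \<and>
      polynomial_map m \<Phi> \<and> map_degree m \<Phi> = d \<and> vanishes_to_order q \<Phi> \<Omega> \<and> 0 < \<sigma>"
    then have N: "norm_on m N" and \<Omega>: "open \<Omega>" and \<Phi>: "polynomial_map m \<Phi>" and deg: "map_degree m \<Phi> = d"
      and vo: "vanishes_to_order q \<Phi> \<Omega>" and \<sigma>: "0 < \<sigma>" by blast+
    have van: "!!x \<alpha>. x \<in> \<Omega> ==> mi_order \<alpha> < q ==> mixed_deriv pderiv_arg \<alpha> \<Phi> (\<chi> j. x) = (%_. 0)"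
      using vo unfolding vanishes_to_order_def by blast
    have cont: "continuous_on UNIV (%x. N (\<Phi> x))" by (rule continuous_on_norm_polynomial_map[OF N \<Phi>])
    have pos: "0 < weighted_Hausdorff N \<Phi> \<Omega> \<sigma> \<Omega>" if "borel_measure_on \<Omega> \<mu>" "dominates_nontrivially (sup_on N \<Phi>) \<Omega> \<mu> (1 / \<sigma>)" for \<mu>
      by (rule dominated_imp_Hausdorff_pos[where N = N and \<Phi> = \<Phi>, OF cont that(1) \<sigma> that(2) \<Omega>])
    have part1: "weighted_Hausdorff N \<Phi> \<Omega> \<sigma> \<Omega> = 0" if "?cr < \<sigma>"
      by (rule Hausdorff_zero_above_critical[OF q N \<Phi> \<Omega> van that])
    have part2: "(\<exists>\<mu>. borel_measure_on \<Omega> \<mu> \<and> dominates_nontrivially (sup_on N \<Phi>) \<Omega> \<mu> (1 / \<sigma>))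
          \<longleftrightarrow> 0 < weighted_Hausdorff N \<Phi> \<Omega> \<sigma> \<Omega>"
      using pos Frostman_measure[where N = N and \<Phi> = \<Phi>, OF cont \<Omega> \<sigma>] by blast
    have supb: "emeasure (density_measure N \<Phi> q) E \<le> ennreal C1 * epowr (sup_on N \<Phi> E) ?cr"
      if E: "E \<in> sets borel" "E \<subseteq> \<Omega>" for E
    proof (rule density_measure_le_sup[OF q N \<Phi> C1 _ E])
      fix E S assume E: "E \<in> sets borel" "bounded E" "E \<subseteq> \<Omega>" and S: "0 \<le> S" "sup_on N \<Phi> E = ennreal S"
      have "\<forall>x\<in>E. \<forall>\<alpha>. mi_order \<alpha> < q --> mixed_deriv pderiv_arg \<alpha> \<Phi> (\<chi> j. x) = (%_. 0)" using van E(3) by blast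
      from int[rule_format, OF N \<Phi> deg E(1,2) this[rule_format] S]
      show "(\<integral>\<^sup>+x. ennreal (density_bound N \<Phi> q x) * indicator E x \<partial>lborel) \<le> ennreal (C1 * S powr ?cr)" by blast
    qed
    have lower: "ennreal (inverse C1) * emeasure (density_measure N \<Phi> q) A \<le> weighted_Hausdorff N \<Phi> \<Omega> ?cr A"
      if "A \<in> sets borel" "A \<subseteq> \<Omega>" for A
      by (rule critical_lower_bound[OF q N \<Phi> \<Omega> C1 supb that])
    have upper: "weighted_Hausdorff N \<Phi> \<Omega> ?cr A \<le> ennreal c2 * emeasure (density_measure N \<Phi> q) A"
      if "A \<in> sets borel" "A \<subseteq> \<Omega>" for A
      unfolding c2_def by (rule Hausdorff_le_density[OF q N \<Phi> van that])
    have i0: "0 \<le> inverse C1" using C1 by simp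
    note RN = Hausdorff_RN_deriv[where N = N and \<Phi> = \<Phi> and \<sigma> = ?cr and D = "density_bound N \<Phi> q", OF \<Omega>
        density_bound_measurable[OF q N \<Phi>] density_bound_nonneg i0 less_imp_le[OF c2] lower upper]
    have part3: "absolutely_continuous (restrict_space lborel \<Omega>) (weighted_Hausdorff_measure N \<Phi> \<Omega> ?cr)" by (rule RN(1))
    have RN2: "AE x in restrict_space lborel \<Omega>.
          ennreal (inverse C1 * density_bound N \<Phi> q x)
            \<le> RN_deriv (restrict_space lborel \<Omega>) (weighted_Hausdorff_measure N \<Phi> \<Omega> ?cr) x \<and>
          RN_deriv (restrict_space lborel \<Omega>) (weighted_Hausdorff_measure N \<Phi> \<Omega> ?cr) x
            \<le> ennreal (c2 * density_bound N \<Phi> q x)" by (rule RN(2))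
    have le1: "ennreal (inverse C * density_bound N \<Phi> q x) \<le> ennreal (inverse C1 * density_bound N \<Phi> q x)" for x
      using C C1 density_bound_nonneg by (intro ennreal_leI mult_right_mono le_imp_inverse_le) auto
    have le2: "ennreal (c2 * density_bound N \<Phi> q x) \<le> ennreal (C * density_bound N \<Phi> q x)" for x
      using C density_bound_nonneg by (intro ennreal_leI mult_right_mono) auto
    have part4: "AE x in restrict_space lborel \<Omega>.
          ennreal (inverse C * density_bound N \<Phi> q x)
            \<le> RN_deriv (restrict_space lborel \<Omega>) (weighted_Hausdorff_measure N \<Phi> \<Omega> ?cr) x \<and>
          RN_deriv (restrict_space lborel \<Omega>) (weighted_Hausdorff_measure N \<Phi> \<Omega> ?cr) x
            \<le> ennreal (C * density_bound N \<Phi> q x)"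
      using RN2
      by eventually_elim (elim conjE, intro conjI, (erule order_trans[OF le1] | erule order_trans[OF _ le2])+)
    have part5: "ennreal (inverse C) * epowr (weighted_Hausdorff N \<Phi> \<Omega> ?cr E) ?s \<le> sup_on N \<Phi> E"
      if E: "E \<in> sets (restrict_space borel \<Omega>)" for E
    proof (rule ennreal_inverse_mult_le[OF pw C(5)])
      have Eb: "E \<in> sets borel" "E \<subseteq> \<Omega>" using E \<Omega> by (auto simp: sets_restrict_space_iff)
      have "weighted_Hausdorff N \<Phi> \<Omega> ?cr E \<le> ennreal c2 * (ennreal C1 * epowr (sup_on N \<Phi> E) ?cr)"
        by (rule order_trans[OF upper[OF Eb] mult_left_mono[OF supb[OF Eb]]]) simp
      also have "\<dots> = ennreal (c2 * C1) * epowr (sup_on N \<Phi> E) ?cr"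
        using c2 C1 by (simp add: ennreal_mult mult.assoc)
      finally have "epowr (weighted_Hausdorff N \<Phi> \<Omega> ?cr E) ?s \<le> epowr (ennreal (c2 * C1) * epowr (sup_on N \<Phi> E) ?cr) ?s"
        by (rule epowr_mono) simp
      also have "\<dots> = ennreal ((c2 * C1) powr ?s) * epowr (epowr (sup_on N \<Phi> E) ?cr) ?s"
        using c2 C1 s0 by (intro epowr_mult) auto
      also have "epowr (epowr (sup_on N \<Phi> E) ?cr) ?s = sup_on N \<Phi> E"
        using q by (subst epowr_epowr) auto
      finally show "epowr (weighted_Hausdorff N \<Phi> \<Omega> ?cr E) ?s \<le> ennreal ((c2 * C1) powr ?s) * sup_on N \<Phi> E" .
    qed
    have part6: "ennreal (inverse C) * best_constant (sup_on N \<Phi>) \<Omega> \<mu> ?s * epowr (emeasure \<mu> E) ?s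
        \<le> epowr (weighted_Hausdorff N \<Phi> \<Omega> ?cr E) ?s"
      if \<mu>: "borel_measure_on \<Omega> \<mu>" and E: "E \<in> sets (restrict_space borel \<Omega>)" for \<mu> E
    proof -
      have "best_constant (sup_on N \<Phi>) \<Omega> \<mu> ?s * epowr (emeasure \<mu> E) ?s \<le> ennreal 1 * epowr (weighted_Hausdorff N \<Phi> \<Omega> ?cr E) ?s"
        using best_constant_le_Hausdorff[where N = N and \<Phi> = \<Phi>, OF cont \<mu> s0 E] unfolding s1 by simp
      from ennreal_inverse_mult_le[OF zero_less_one C(2) this] show ?thesis by (simp only: mult.assoc)
    qed
    have no_measure: "\<not> (\<exists>\<mu>. borel_measure_on \<Omega> \<mu> \<and> dominates_nontrivially (sup_on N \<Phi>) \<Omega> \<mu> (1 / \<sigma>))" if "?cr < \<sigma>"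
      unfolding part2 part1[OF that] by simp
    show "(\<sigma> > real CARD('n) / real q -->
        weighted_Hausdorff N \<Phi> \<Omega> \<sigma> \<Omega> = 0 \<and>
        \<not> (\<exists>\<mu>. borel_measure_on \<Omega> \<mu> \<and> dominates_nontrivially (sup_on N \<Phi>) \<Omega> \<mu> (1 / \<sigma>))) \<and>
      (\<sigma> \<le> real CARD('n) / real q -->
        ((\<exists>\<mu>. borel_measure_on \<Omega> \<mu> \<and> dominates_nontrivially (sup_on N \<Phi>) \<Omega> \<mu> (1 / \<sigma>))
          \<longleftrightarrow> weighted_Hausdorff N \<Phi> \<Omega> \<sigma> \<Omega> > 0)) \<and>
      (\<sigma> = real CARD('n) / real q -->
        measure_space \<Omega> (sets (restrict_space borel \<Omega>)) (weighted_Hausdorff N \<Phi> \<Omega> \<sigma>) \<and>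
        absolutely_continuous (restrict_space lborel \<Omega>) (weighted_Hausdorff_measure N \<Phi> \<Omega> \<sigma>) \<and>
        (AE x in restrict_space lborel \<Omega>.
          ennreal (inverse C * density_bound N \<Phi> q x)
            \<le> RN_deriv (restrict_space lborel \<Omega>) (weighted_Hausdorff_measure N \<Phi> \<Omega> \<sigma>) x \<and>
          RN_deriv (restrict_space lborel \<Omega>) (weighted_Hausdorff_measure N \<Phi> \<Omega> \<sigma>) x
            \<le> ennreal (C * density_bound N \<Phi> q x)) \<and>
        (\<forall>E\<in>sets (restrict_space borel \<Omega>).
          ennreal (inverse C) * epowr (weighted_Hausdorff N \<Phi> \<Omega> \<sigma> E) (real q / real CARD('n))
            \<le> sup_on N \<Phi> E) \<and>
        (\<forall>\<mu>. borel_measure_on \<Omega> \<mu> \<and>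
              (\<exists>c>0. dominates (sup_on N \<Phi>) \<Omega> \<mu> (real q / real CARD('n)) c) -->
          (\<forall>E\<in>sets (restrict_space borel \<Omega>).
            ennreal (inverse C) * best_constant (sup_on N \<Phi>) \<Omega> \<mu> (real q / real CARD('n))
                * epowr (emeasure \<mu> E) (real q / real CARD('n))
              \<le> epowr (weighted_Hausdorff N \<Phi> \<Omega> \<sigma> E) (real q / real CARD('n)))))"
    proof (rule conjI, rule impI, rule conjI[OF part1 no_measure], assumption, assumption,
        rule conjI, rule impI, rule part2, rule impI)
      assume \<sigma>cr: "\<sigma> = ?cr"
      show "measure_space \<Omega> (sets (restrict_space borel \<Omega>)) (weighted_Hausdorff N \<Phi> \<Omega> \<sigma>) \<and>
        absolutely_continuous (restrict_space lborel \<Omega>) (weighted_Hausdorff_measure N \<Phi> \<Omega> \<sigma>) \<and>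
        (AE x in restrict_space lborel \<Omega>.
          ennreal (inverse C * density_bound N \<Phi> q x)
            \<le> RN_deriv (restrict_space lborel \<Omega>) (weighted_Hausdorff_measure N \<Phi> \<Omega> \<sigma>) x \<and>
          RN_deriv (restrict_space lborel \<Omega>) (weighted_Hausdorff_measure N \<Phi> \<Omega> \<sigma>) x
            \<le> ennreal (C * density_bound N \<Phi> q x)) \<and>
        (\<forall>E\<in>sets (restrict_space borel \<Omega>).
          ennreal (inverse C) * epowr (weighted_Hausdorff N \<Phi> \<Omega> \<sigma> E) (real q / real CARD('n))
            \<le> sup_on N \<Phi> E) \<and>
        (\<forall>\<mu>. borel_measure_on \<Omega> \<mu> \<and>
              (\<exists>c>0. dominates (sup_on N \<Phi>) \<Omega> \<mu> (real q / real CARD('n)) c) -->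
          (\<forall>E\<in>sets (restrict_space borel \<Omega>).
            ennreal (inverse C) * best_constant (sup_on N \<Phi>) \<Omega> \<mu> (real q / real CARD('n))
                * epowr (emeasure \<mu> E) (real q / real CARD('n))
              \<le> epowr (weighted_Hausdorff N \<Phi> \<Omega> \<sigma> E) (real q / real CARD('n))))"
        unfolding \<sigma>cr
        by (intro conjI ballI allI impI weighted_Hausdorff_measure_space part3 part4 part5 part6) (assumption | erule conjunct1)+
    qed
  qed
qed

end
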